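(* Let $p$ be a rational prime and let $R$ be a complete discrete valuation ring with maximal ideal generated by $p$ and algebraically closed residue field $R/pR$. Let $G$ be an affine smooth group scheme over $R$. Assume there exists an open subset $G^0\subset G$ with $\widehat{G^0}\neq\emptyset$ such that the $p$-adic completion $\widehat{G^0}$ admits a Frobenius lift that is Lie invariant mod $p$. Then $G(R)$ contains no non-trivial unipotent elements of index $\leq p$.
   Context: The ring $R$ has a unique Frobenius lift $\phi:R\to R$, i.e. a ring endomorphism inducing the $p$-power Frobenius on $R/pR$. For a scheme $X$ over $R$, $\widehat{X}$ denotes its $p$-adic completion (a $p$-adic formal scheme). A Frobenius lift on a $p$-adic formal scheme $X$ over $R$ is an endomorphism $\phi:X\to X$ whose reduction mod $p$ is the $p$-power Frobenius on the reduction of $X$ mod $p$; it is always assumed compatible with the Frobenius lift on $R$. Differentials are $\Omega_{\widehat{X}/R}:=\varprojlim_n \Omega_{X_n/R_n}$, where $R_n=R/p^nR$, $X_n=X\otimes_R R_n$ (for $X$ affine; in general one glues). If $X$ is smooth over $R$ and $\phi$ is a Frobenius lift on $\widehat{X}$, then $\phi^*\omega$ is uniquely divisible by $p$ for every $1$-form $\omega$, giving an additive map $\frac{\phi^*}{p}:\Omega_{\widehat{X}/R}\to\Omega_{\widehat{X}/R}$, $\omega\mapsto \frac{\phi^*\omega}{p}$. Lie invariance: let $G$ be a smooth group scheme over $R$ of relative dimension $d$, let $G^0\subset G$ be a Zariski open set with non-empty reduction mod $p$, and let $\omega$ be a column vector of size $D\geq d$ whose entries generate the $R$-module of left invariant $1$-forms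 on $G$ (also viewed, by restriction, as forms on $\widehat{G^0}$). A Frobenius lift $\phi$ on $\widehat{G^0}$ is Lie invariant mod $p$ if there exists a $D\times D$ matrix $\lambda$ with coefficients in $R$ such that $\frac{\phi^*}{p}\omega\equiv\lambda\,\omega \bmod p$, where $\frac{\phi^*}{p}$ is applied entrywise. This condition does not depend on the choice of $\omega$. Unipotent elements and index: let $G$ be an affine group scheme of finite type over a ring $A$. "Embedding $G\subset GL_N$" means a closed embedding of group schemes over $A$; $\mathfrak{gl}_N(A)$ is the ring of $N\times N$ matrices over $A$. An element $u\in G(A)$ is unipotent if there is an embedding $G\subset GL_N$ (for some $N$) such that $u-1$ is nilpotent in $\mathfrak{gl}_N(A)$. The index of a unipotent $u\in G(A)$ is the minimum of all integers $n\geq 1$ for which there exists an embedding $G\subset GL_N$ (for some $N$) such that $(u-1)^n=0$ in $\mathfrak{gl}_N(A)$. *)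

theory Defs
  imports "HOL-Algebra.Algebra" "HOL-Computational_Algebra.Primes"
begin

section \<open>Base ring\<close>

definition discrete_valuation_ring :: "'r ring \<Rightarrow> bool" where
  "discrete_valuation_ring R \<longleftrightarrow>
     principal_domain R \<and> \<not> field R \<and> (\<exists>!m. maximalideal m R)"

text \<open>Bijectivity of the canonical map from \<open>R\<close> to the inverse limit of the \<open>R/(a\<^sup>n)\<close>.\<close>

definition adically_complete :: "'r ring \<Rightarrow> 'r \<Rightarrow> bool" where
  "adically_complete R a \<longleftrightarrow>
     (\<forall>x :: nat \<Rightarrow> 'r.
        (\<forall>n. x n \<in> carrier R) \<and>
        (\<forall>n. x (Suc n) \<ominus>\<^bsub>R\<^esub> x n \<in> PIdl\<^bsub>R\<^esub> (a [^]\<^bsub>R\<^esub> n))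
        \<longrightarrow> (\<exists>!y. y \<in> carrier R \<and> (\<forall>n. y \<ominus>\<^bsub>R\<^esub> x n \<in> PIdl\<^bsub>R\<^esub> (a [^]\<^bsub>R\<^esub> n))))"

definition frobenius_lift_ring :: "'r ring \<Rightarrow> nat \<Rightarrow> ('r \<Rightarrow> 'r) \<Rightarrow> bool" where
  "frobenius_lift_ring R p \<phi> \<longleftrightarrow>
     \<phi> \<in> ring_hom R R \<and>
     (\<forall>x\<in>carrier R. \<phi> x \<ominus>\<^bsub>R\<^esub> x [^]\<^bsub>R\<^esub> p \<in> PIdl\<^bsub>R\<^esub> ([p] \<cdot>\<^bsub>R\<^esub> \<one>\<^bsub>R\<^esub>))"


section \<open>Algebras\<close>

record ('r, 'a) algebra = "'a ring" +
  algmap :: "'r \<Rightarrow> 'a"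

definition with_algmap :: "'a ring \<Rightarrow> ('r \<Rightarrow> 'a) \<Rightarrow> ('r, 'a) algebra" where
  "with_algmap S k = ring.extend S (algebra.fields k)"

definition is_algebra :: "'r ring \<Rightarrow> ('r, 'a, 'm) algebra_scheme \<Rightarrow> bool" where
  "is_algebra R A \<longleftrightarrow> cring R \<and> cring A \<and> algmap A \<in> ring_hom R A"

definition alg_hom ::
  "'r ring \<Rightarrow> ('r, 'a, 'm) algebra_scheme \<Rightarrow> ('r, 'b, 'n) algebra_scheme \<Rightarrow> ('a \<Rightarrow> 'b) set" where
  "alg_hom R A B =
     {h \<in> ring_hom A B. \<forall>r\<in>carrier R. h (algmap A r) = algmap B r}"

abbreviation base_algebra :: "'r ring \<Rightarrow> ('r, 'r) algebra" where
  "base_algebra R \<equiv> with_algmap R (\<lambda>r. r)"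

definition quot_algebra ::
  "('r, 'a, 'm) algebra_scheme \<Rightarrow> 'a set \<Rightarrow> ('r, 'a set) algebra" where
  "quot_algebra A I = with_algmap (A Quot I) (\<lambda>r. I +>\<^bsub>A\<^esub> algmap A r)"

definition reduction ::
  "('r, 'a, 'm) algebra_scheme \<Rightarrow> nat \<Rightarrow> nat \<Rightarrow> ('r, 'a set) algebra" where
  "reduction A p n = quot_algebra A (PIdl\<^bsub>A\<^esub> ([(p ^ n)] \<cdot>\<^bsub>A\<^esub> \<one>\<^bsub>A\<^esub>))"

definition finite_type :: "'r ring \<Rightarrow> ('r, 'a, 'm) algebra_scheme \<Rightarrow> bool" where
  "finite_type R A \<longleftrightarrow>
     (\<exists>E. finite E \<and> E \<subseteq> carrier A \<and>
          carrier A = generate_ring A (algmap A ` carrier R \<union> E))"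

text \<open>
  The infinitesimal lifting property. The test algebras \<open>B\<close> have their carrier in \<open>'r list\<close>.
  For \<open>A\<close> of finite type, written as a quotient \<open>P/J\<close> of a polynomial ring in finitely many
  variables, this is no restriction: all lifting problems can be solved as soon as the identity
  of \<open>A = (P/J\<^sup>2)/(J/J\<^sup>2)\<close> lifts to \<open>P/J\<^sup>2\<close>, and the cardinality of \<open>P/J\<^sup>2\<close> is at most that of
  \<open>'r list\<close>.
\<close>

definition formally_smooth :: "'r ring \<Rightarrow> ('r, 'a, 'm) algebra_scheme \<Rightarrow> bool" where
  "formally_smooth R A \<longleftrightarrow>
     (\<forall>(B :: ('r, 'r list) algebra) I.
        is_algebra R B \<and> ideal I B \<and>
        (\<forall>x\<in>I. \<forall>y\<in>I. x \<otimes>\<^bsub>B\<^esub> y = \<zero>\<^bsub>B\<^esub>) \<longrightarrow>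
        (\<forall>g\<in>alg_hom R A (quot_algebra B I). \<exists>h\<in>alg_hom R A B.
           \<forall>a\<in>carrier A. I +>\<^bsub>B\<^esub> h a = g a))"

text \<open>
  Smooth means formally smooth and of finite presentation; over a noetherian base \<open>R\<close>, the only
  case considered here, finite type and finite presentation agree.
\<close>

definition smooth_algebra :: "'r ring \<Rightarrow> ('r, 'a, 'm) algebra_scheme \<Rightarrow> bool" where
  "smooth_algebra R A \<longleftrightarrow> is_algebra R A \<and> finite_type R A \<and> formally_smooth R A"


section \<open>Tensor products\<close>

definition monoid_ring :: "('m, 'x) monoid_scheme \<Rightarrow> ('m \<Rightarrow>\<^sub>0 int) ring" where
  "monoid_ring M =
     \<lparr>carrier = {c. Poly_Mapping.keys c \<subseteq> carrier M},
      monoid.mult = (\<lambda>x y. frag_extend (\<lambda>a. frag_extend (\<lambda>b. frag_of (a \<otimes>\<^bsub>M\<^esub> b)) y) x),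
      one = frag_of \<one>\<^bsub>M\<^esub>, ring.zero = 0, add = (+)\<rparr>"

text \<open>
  \<open>A \<otimes>\<^sub>R B\<close> is the quotient of the integral monoid ring of the multiplicative monoid
  \<open>A \<times> B\<close> by the relations making \<open>(a, b)\<close> biadditive and \<open>R\<close>-balanced.
\<close>

definition tensor_relations ::
  "'r ring \<Rightarrow> ('r, 'a, 'm) algebra_scheme \<Rightarrow> ('r, 'b, 'n) algebra_scheme \<Rightarrow> ('a \<times> 'b \<Rightarrow>\<^sub>0 int) set" where
  "tensor_relations R A B =
     {frag_of (a \<oplus>\<^bsub>A\<^esub> a', b) - frag_of (a, b) - frag_of (a', b) | a a' b.
        a \<in> carrier A \<and> a' \<in> carrier A \<and> b \<in> carrier B} \<union>
     {frag_of (a, b \<oplus>\<^bsub>B\<^esub> b') - frag_of (a, b) - frag_of (a, b') | a b b'.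
        a \<in> carrier A \<and> b \<in> carrier B \<and> b' \<in> carrier B} \<union>
     {frag_of (algmap A r \<otimes>\<^bsub>A\<^esub> a, b) - frag_of (a, algmap B r \<otimes>\<^bsub>B\<^esub> b) | r a b.
        r \<in> carrier R \<and> a \<in> carrier A \<and> b \<in> carrier B}"

definition tensor_ideal ::
  "'r ring \<Rightarrow> ('r, 'a, 'm) algebra_scheme \<Rightarrow> ('r, 'b, 'n) algebra_scheme \<Rightarrow> ('a \<times> 'b \<Rightarrow>\<^sub>0 int) set" where
  "tensor_ideal R A B = Idl\<^bsub>monoid_ring (A \<times>\<times> B)\<^esub> (tensor_relations R A B)"

definition pure_tensor ::
  "'r ring \<Rightarrow> ('r, 'a, 'm) algebra_scheme \<Rightarrow> ('r, 'b, 'n) algebra_scheme \<Rightarrow>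
   'a \<Rightarrow> 'b \<Rightarrow> ('a \<times> 'b \<Rightarrow>\<^sub>0 int) set" where
  "pure_tensor R A B a b = tensor_ideal R A B +>\<^bsub>monoid_ring (A \<times>\<times> B)\<^esub> frag_of (a, b)"

definition tensor ::
  "'r ring \<Rightarrow> ('r, 'a, 'm) algebra_scheme \<Rightarrow> ('r, 'b, 'n) algebra_scheme \<Rightarrow>
   ('r, ('a \<times> 'b \<Rightarrow>\<^sub>0 int) set) algebra" where
  "tensor R A B =
     with_algmap (monoid_ring (A \<times>\<times> B) Quot tensor_ideal R A B)
       (\<lambda>r. pure_tensor R A B (algmap A r) \<one>\<^bsub>B\<^esub>)"

definition tensor_in1 ::
  "'r ring \<Rightarrow> ('r, 'a, 'm) algebra_scheme \<Rightarrow> ('r, 'b, 'n) algebra_scheme \<Rightarrow>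
   'a \<Rightarrow> ('a \<times> 'b \<Rightarrow>\<^sub>0 int) set" where
  "tensor_in1 R A B a = pure_tensor R A B a \<one>\<^bsub>B\<^esub>"

definition tensor_in2 ::
  "'r ring \<Rightarrow> ('r, 'a, 'm) algebra_scheme \<Rightarrow> ('r, 'b, 'n) algebra_scheme \<Rightarrow>
   'b \<Rightarrow> ('a \<times> 'b \<Rightarrow>\<^sub>0 int) set" where
  "tensor_in2 R A B b = pure_tensor R A B \<one>\<^bsub>A\<^esub> b"

text \<open>
  For algebra homomorphisms \<open>x : A \<rightarrow> C\<close> and \<open>y : B \<rightarrow> C\<close>, \<open>copair C x y\<close> is the homomorphism
  \<open>A \<otimes>\<^sub>R B \<rightarrow> C\<close> sending \<open>a \<otimes> b\<close> to \<open>x a \<cdot> y b\<close>: every representative of a class is sent to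
  the same element of \<open>C\<close>.
\<close>

definition copair ::
  "('c, 'm) ring_scheme \<Rightarrow> ('a \<Rightarrow> 'c) \<Rightarrow> ('b \<Rightarrow> 'c) \<Rightarrow> ('a \<times> 'b \<Rightarrow>\<^sub>0 int) set \<Rightarrow> 'c" where
  "copair C x y t =
     the_elem ((\<lambda>c. finsum C
       (\<lambda>(a, b). [(Poly_Mapping.lookup c (a, b))] \<cdot>\<^bsub>C\<^esub> (x a \<otimes>\<^bsub>C\<^esub> y b))
       (Poly_Mapping.keys c)) ` t)"


section \<open>Affine group schemes\<close>

text \<open>
  An affine group scheme \<open>G\<close> over \<open>R\<close> is represented by its coordinate ring, a commutative Hopf
  algebra over \<open>R\<close>. In what follows \<open>G\<close> denotes this Hopf algebra.
\<close>

record ('r, 'a) hopf = "('r, 'a) algebra" +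
  comult :: "'a \<Rightarrow> ('a \<times> 'a \<Rightarrow>\<^sub>0 int) set"
  counit :: "'a \<Rightarrow> 'r"
  antipode :: "'a \<Rightarrow> 'a"

text \<open>The product of the \<open>C\<close>-valued points \<open>x\<close> and \<open>y\<close> of \<open>G\<close>.\<close>

definition conv ::
  "('r, 'a, 'm) hopf_scheme \<Rightarrow> ('c, 'n) ring_scheme \<Rightarrow> ('a \<Rightarrow> 'c) \<Rightarrow> ('a \<Rightarrow> 'c) \<Rightarrow> 'a \<Rightarrow> 'c" where
  "conv G C x y a = copair C x y (comult G a)"

text \<open>
  Coassociativity is stated for the three canonical homomorphisms \<open>j1\<close>, \<open>j2\<close>, \<open>j3\<close> from \<open>G\<close> to
  \<open>(G \<otimes> G) \<otimes> G\<close>: since \<open>conv j1 j2\<close> is \<open>\<Delta> a \<otimes> 1\<close>, the two sides are \<open>(\<Delta> \<otimes> id) \<circ> \<Delta>\<close> and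
  \<open>(id \<otimes> \<Delta>) \<circ> \<Delta>\<close>, both with values in \<open>(G \<otimes> G) \<otimes> G\<close>.
\<close>

definition affine_group_scheme :: "'r ring \<Rightarrow> ('r, 'a, 'm) hopf_scheme \<Rightarrow> bool" where
  "affine_group_scheme R G \<longleftrightarrow>
     is_algebra R G \<and>
     comult G \<in> alg_hom R G (tensor R G G) \<and>
     counit G \<in> alg_hom R G (base_algebra R) \<and>
     antipode G \<in> alg_hom R G G \<and>
     (let T2 = tensor R G G;
          T3 = tensor R T2 G;
          j1 = (\<lambda>a. tensor_in1 R T2 G (tensor_in1 R G G a));
          j2 = (\<lambda>a. tensor_in1 R T2 G (tensor_in2 R G G a));
          j3 = tensor_in2 R T2 G
      in \<forall>a\<in>carrier G.
           conv G T3 (conv G T3 j1 j2) j3 a = conv G T3 j1 (conv G T3 j2 j3) a) \<and>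
     (let e = (\<lambda>a. algmap G (counit G a))
      in \<forall>a\<in>carrier G.
           conv G G e (\<lambda>a. a) a = a \<and>
           conv G G (\<lambda>a. a) e a = a \<and>
           conv G G (antipode G) (\<lambda>a. a) a = e a \<and>
           conv G G (\<lambda>a. a) (antipode G) a = e a)"

definition rational_points ::
  "'r ring \<Rightarrow> ('r, 'a, 'm) hopf_scheme \<Rightarrow> ('a \<Rightarrow> 'r) set" where
  "rational_points R G = alg_hom R G (base_algebra R)"


section \<open>Kaehler differentials\<close>

text \<open>
  \<open>kaehler S K\<close> is the module of differentials of \<open>S\<close> relative to a base ring with image \<open>K\<close> in
  \<open>S\<close>. It is the free abelian group on symbols \<open>(a, b)\<close>, standing for \<open>a db\<close>, modulo the usual
  relations. The ring multiplication and unit inherited by the type of modules are not used.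
\<close>

definition kaehler_free :: "('s, 'm) ring_scheme \<Rightarrow> ('s \<times> 's \<Rightarrow>\<^sub>0 int) monoid" where
  "kaehler_free S = free_Abelian_group (carrier S \<times> carrier S)"

definition kaehler_relations :: "('s, 'm) ring_scheme \<Rightarrow> 's set \<Rightarrow> ('s \<times> 's \<Rightarrow>\<^sub>0 int) set" where
  "kaehler_relations S K = generate (kaehler_free S)
     ({frag_of (a \<oplus>\<^bsub>S\<^esub> a', b) - frag_of (a, b) - frag_of (a', b) | a a' b.
         a \<in> carrier S \<and> a' \<in> carrier S \<and> b \<in> carrier S} \<union>
      {frag_of (a, b \<oplus>\<^bsub>S\<^esub> c) - frag_of (a, b) - frag_of (a, c) | a b c.
         a \<in> carrier S \<and> b \<in> carrier S \<and> c \<in> carrier S} \<union>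
      {frag_of (a, b \<otimes>\<^bsub>S\<^esub> c) - frag_of (a \<otimes>\<^bsub>S\<^esub> b, c) - frag_of (a \<otimes>\<^bsub>S\<^esub> c, b) | a b c.
         a \<in> carrier S \<and> b \<in> carrier S \<and> c \<in> carrier S} \<union>
      {frag_of (a, k) | a k. a \<in> carrier S \<and> k \<in> K})"

definition frag_map :: "('x \<Rightarrow> 'y) \<Rightarrow> ('x \<Rightarrow>\<^sub>0 int) \<Rightarrow> ('y \<Rightarrow>\<^sub>0 int)" where
  "frag_map h = frag_extend (\<lambda>x. frag_of (h x))"

definition kaehler ::
  "('s, 'm) ring_scheme \<Rightarrow> 's set \<Rightarrow> ('s, ('s \<times> 's \<Rightarrow>\<^sub>0 int) set) module" where
  "kaehler S K =
     \<lparr>carrier = rcosets\<^bsub>kaehler_free S\<^esub> (kaehler_relations S K),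
      monoid.mult = undefined, one = undefined,
      ring.zero = kaehler_relations S K,
      add = set_mult (kaehler_free S),
      smult = (\<lambda>s \<omega>. kaehler_relations S K <#>\<^bsub>kaehler_free S\<^esub>
                       (frag_map (\<lambda>(a, b). (s \<otimes>\<^bsub>S\<^esub> a, b)) ` \<omega>))\<rparr>"

text \<open>
  Pullback of forms along a ring homomorphism \<open>h\<close> from \<open>S\<close> to \<open>T\<close> that maps the constants of
  \<open>S\<close> into the set \<open>L\<close> of constants of \<open>T\<close>: \<open>a db\<close> is sent to \<open>h a d(h b)\<close>.
\<close>

definition pullback ::
  "('t, 'm) ring_scheme \<Rightarrow> 't set \<Rightarrow> ('s \<Rightarrow> 't) \<Rightarrow>
   ('s \<times> 's \<Rightarrow>\<^sub>0 int) set \<Rightarrow> ('t \<times> 't \<Rightarrow>\<^sub>0 int) set" where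
  "pullback T L h \<omega> =
     kaehler_relations T L <#>\<^bsub>kaehler_free T\<^esub> (frag_map (\<lambda>(a, b). (h a, h b)) ` \<omega>)"

abbreviation constants :: "'r ring \<Rightarrow> ('r, 'a, 'm) algebra_scheme \<Rightarrow> 'a set" where
  "constants R A \<equiv> algmap A ` carrier R"

abbreviation differentials ::
  "'r ring \<Rightarrow> ('r, 'a, 'm) algebra_scheme \<Rightarrow> ('a, ('a \<times> 'a \<Rightarrow>\<^sub>0 int) set) module" where
  "differentials R A \<equiv> kaehler A (constants R A)"

text \<open>
  Invariance under left translation by the universal point of \<open>G\<close>: on \<open>G \<times> G\<close>, regarded as a
  scheme over \<open>G\<close> by the first projection, the translation \<open>(g, x) \<mapsto> (g, g x)\<close> has to preserve
  the relative form induced by \<open>\<omega>\<close>. All other points of \<open>G\<close> are obtained from this one by base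
  change.
\<close>

definition left_invariant_forms ::
  "'r ring \<Rightarrow> ('r, 'a, 'm) hopf_scheme \<Rightarrow> ('a \<times> 'a \<Rightarrow>\<^sub>0 int) set set" where
  "left_invariant_forms R G =
     {\<omega> \<in> carrier (differentials R G).
        pullback (tensor R G G) (tensor_in1 R G G ` carrier G) (comult G) \<omega> =
        pullback (tensor R G G) (tensor_in1 R G G ` carrier G) (tensor_in2 R G G) \<omega>}"

definition generates_invariant_forms ::
  "'r ring \<Rightarrow> ('r, 'a, 'm) hopf_scheme \<Rightarrow> nat \<Rightarrow> (nat \<Rightarrow> ('a \<times> 'a \<Rightarrow>\<^sub>0 int) set) \<Rightarrow> bool" where
  "generates_invariant_forms R G D \<omega> \<longleftrightarrow>
     (\<forall>i<D. \<omega> i \<in> left_invariant_forms R G) \<and>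
     (\<forall>\<eta>\<in>left_invariant_forms R G. \<exists>c. (\<forall>i<D. c i \<in> carrier R) \<and>
        \<eta> = finsum (differentials R G)
              (\<lambda>i. algmap G (c i) \<odot>\<^bsub>differentials R G\<^esub> \<omega> i) {..<D})"


section \<open>Open subschemes and their \<open>p\<close>-adic completions\<close>

definition spec :: "('a, 'm) ring_scheme \<Rightarrow> 'a set set" where
  "spec A = {q. primeideal q A}"

definition zariski_open :: "('a, 'm) ring_scheme \<Rightarrow> 'a set set \<Rightarrow> bool" where
  "zariski_open A U \<longleftrightarrow>
     (\<exists>E. E \<subseteq> carrier A \<and> U = {q \<in> spec A. \<not> E \<subseteq> q})"

definition basic_open :: "('a, 'm) ring_scheme \<Rightarrow> 'a \<Rightarrow> 'a set set" where
  "basic_open A f = {q \<in> spec A. f \<notin> q}"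

definition powers :: "('a, 'm) ring_scheme \<Rightarrow> 'a \<Rightarrow> 'a set" where
  "powers A f = range (\<lambda>n::nat. f [^]\<^bsub>A\<^esub> n)"

definition fraction_rel :: "('a, 'm) ring_scheme \<Rightarrow> 'a \<Rightarrow> (('a \<times> 'a) \<times> ('a \<times> 'a)) set" where
  "fraction_rel A f =
     {((a, s), (b, t)) | a s b t.
        a \<in> carrier A \<and> b \<in> carrier A \<and> s \<in> powers A f \<and> t \<in> powers A f \<and>
        (\<exists>u\<in>powers A f. u \<otimes>\<^bsub>A\<^esub> (a \<otimes>\<^bsub>A\<^esub> t) = u \<otimes>\<^bsub>A\<^esub> (b \<otimes>\<^bsub>A\<^esub> s))}"

definition fraction :: "('a, 'm) ring_scheme \<Rightarrow> 'a \<Rightarrow> 'a \<Rightarrow> 'a \<Rightarrow> ('a \<times> 'a) set" where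
  "fraction A f a s = fraction_rel A f `` {(a, s)}"

text \<open>The localization \<open>A\<^sub>f\<close>, the coordinate ring of \<open>basic_open A f\<close>.\<close>

definition localization ::
  "('r, 'a, 'm) algebra_scheme \<Rightarrow> 'a \<Rightarrow> ('r, ('a \<times> 'a) set) algebra" where
  "localization A f =
     \<lparr>carrier = (carrier A \<times> powers A f) // fraction_rel A f,
      monoid.mult = (\<lambda>x y. \<Union>(a, s)\<in>x. \<Union>(b, t)\<in>y. fraction A f (a \<otimes>\<^bsub>A\<^esub> b) (s \<otimes>\<^bsub>A\<^esub> t)),
      one = fraction A f \<one>\<^bsub>A\<^esub> \<one>\<^bsub>A\<^esub>,
      ring.zero = fraction A f \<zero>\<^bsub>A\<^esub> \<one>\<^bsub>A\<^esub>,
      add = (\<lambda>x y. \<Union>(a, s)\<in>x. \<Union>(b, t)\<in>y.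
               fraction A f (a \<otimes>\<^bsub>A\<^esub> t \<oplus>\<^bsub>A\<^esub> b \<otimes>\<^bsub>A\<^esub> s) (s \<otimes>\<^bsub>A\<^esub> t)),
      algmap = (\<lambda>r. fraction A f (algmap A r) \<one>\<^bsub>A\<^esub>)\<rparr>"

text \<open>
  Let \<open>U\<close> be open in \<open>spec A\<close>, and let \<open>X\<close> be its \<open>p\<close>-adic completion, the colimit of the
  schemes \<open>X\<^sub>n = U \<otimes> R/p\<^sup>n\<close>. The schemes \<open>X\<^sub>n\<close> all have the same underlying space, on which the
  \<open>basic_open A f\<close> contained in \<open>U\<close> induce a basis of affine opens; the section ring of \<open>X\<^sub>n\<close> over
  such an open is \<open>piece A p f n = A\<^sub>f/p\<^sup>n\<close>. Sheaves on \<open>X\<close>, and morphisms between them, are given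
  by their values on this basis and on all levels \<open>n\<close>.
\<close>

definition affine_pieces :: "('a, 'm) ring_scheme \<Rightarrow> 'a set set \<Rightarrow> 'a set" where
  "affine_pieces A U = {f \<in> carrier A. basic_open A f \<subseteq> U}"

definition piece ::
  "('r, 'a, 'm) algebra_scheme \<Rightarrow> nat \<Rightarrow> 'a \<Rightarrow> nat \<Rightarrow> ('r, ('a \<times> 'a) set set) algebra" where
  "piece A p f n = reduction (localization A f) p n"

definition to_piece ::
  "('r, 'a, 'm) algebra_scheme \<Rightarrow> nat \<Rightarrow> 'a \<Rightarrow> nat \<Rightarrow> 'a \<Rightarrow> ('a \<times> 'a) set set" where
  "to_piece A p f n a =
     (PIdl\<^bsub>localization A f\<^esub> ([(p ^ n)] \<cdot>\<^bsub>localization A f\<^esub> \<one>\<^bsub>localization A f\<^esub>))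
       +>\<^bsub>localization A f\<^esub> fraction A f a \<one>\<^bsub>A\<^esub>"

text \<open>
  The \<open>A\<close>-algebra homomorphisms between two pieces. There is at most one, and it exists exactly
  when the piece \<open>(g, n)\<close> is contained in the piece \<open>(f, m)\<close> as a locally closed subscheme of
  \<open>spec A\<close>; it is then restriction of functions. So these are the restriction maps of the
  structure sheaves as well as the transition maps between the levels.
\<close>

definition restrictions ::
  "('r, 'a, 'm) algebra_scheme \<Rightarrow> nat \<Rightarrow> 'a \<Rightarrow> nat \<Rightarrow> 'a \<Rightarrow> nat \<Rightarrow>
   (('a \<times> 'a) set set \<Rightarrow> ('a \<times> 'a) set set) set" where
  "restrictions A p f m g n =
     {\<rho> \<in> ring_hom (piece A p f m) (piece A p g n).
        \<forall>a\<in>carrier A. \<rho> (to_piece A p f m a) = to_piece A p g n a}"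

text \<open>
  A Frobenius lift \<open>\<Phi>\<close> on the completion of \<open>U\<close>, compatible with \<open>\<phi>\<close> on \<open>R\<close>. The absolute
  Frobenius of \<open>X\<^sub>1\<close> is the identity on the underlying space and the \<open>p\<close>-th power map on
  functions. As \<open>X\<close> and \<open>X\<^sub>1\<close> have the same underlying space, the former forces any Frobenius lift
  to be the identity on that space; it is therefore given by endomorphisms \<open>\<Phi> f n\<close> of all rings
  \<open>A\<^sub>f/p\<^sup>n\<close>, compatible with all restriction and transition maps.
\<close>

definition frobenius_lift ::
  "'r ring \<Rightarrow> nat \<Rightarrow> ('r \<Rightarrow> 'r) \<Rightarrow> ('r, 'a, 'm) algebra_scheme \<Rightarrow> 'a set set \<Rightarrow>
   ('a \<Rightarrow> nat \<Rightarrow> ('a \<times> 'a) set set \<Rightarrow> ('a \<times> 'a) set set) \<Rightarrow> bool" where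
  "frobenius_lift R p \<phi> A U \<Phi> \<longleftrightarrow>
     (\<forall>f\<in>affine_pieces A U. \<forall>n.
        \<Phi> f n \<in> ring_hom (piece A p f n) (piece A p f n) \<and>
        (\<forall>r\<in>carrier R. \<Phi> f n (algmap (piece A p f n) r) = algmap (piece A p f n) (\<phi> r))) \<and>
     (\<forall>f\<in>affine_pieces A U. \<forall>g\<in>affine_pieces A U. \<forall>m n.
        \<forall>\<rho>\<in>restrictions A p f m g n. \<forall>x\<in>carrier (piece A p f m).
          \<rho> (\<Phi> f m x) = \<Phi> g n (\<rho> x)) \<and>
     (\<forall>f\<in>affine_pieces A U. \<forall>x\<in>carrier (piece A p f 1).
        \<Phi> f 1 x = x [^]\<^bsub>piece A p f 1\<^esub> p)"

text \<open>Global sections over the completion of \<open>U\<close> of the inverse limit of the differentials of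
  \<open>X\<^sub>n\<close> over \<open>R/p\<^sup>n\<close>.\<close>

definition formal_forms ::
  "'r ring \<Rightarrow> nat \<Rightarrow> ('r, 'a, 'm) algebra_scheme \<Rightarrow> 'a set set \<Rightarrow>
   ('a \<Rightarrow> nat \<Rightarrow> (('a \<times> 'a) set set \<times> ('a \<times> 'a) set set \<Rightarrow>\<^sub>0 int) set) set" where
  "formal_forms R p A U =
     {\<theta>. (\<forall>f\<in>affine_pieces A U. \<forall>n.
            \<theta> f n \<in> carrier (differentials R (piece A p f n))) \<and>
         (\<forall>f\<in>affine_pieces A U. \<forall>g\<in>affine_pieces A U. \<forall>m n.
            \<forall>\<rho>\<in>restrictions A p f m g n.
              pullback (piece A p g n) (constants R (piece A p g n)) \<rho> (\<theta> f m) = \<theta> g n)}"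

definition restrict_form ::
  "'r ring \<Rightarrow> nat \<Rightarrow> ('r, 'a, 'm) algebra_scheme \<Rightarrow> ('a \<times> 'a \<Rightarrow>\<^sub>0 int) set \<Rightarrow>
   'a \<Rightarrow> nat \<Rightarrow> (('a \<times> 'a) set set \<times> ('a \<times> 'a) set set \<Rightarrow>\<^sub>0 int) set" where
  "restrict_form R p A \<omega> f n =
     pullback (piece A p f n) (constants R (piece A p f n)) (to_piece A p f n) \<omega>"

text \<open>
  \<open>frobenius_pullback_over_p R p A U \<Phi> \<theta> \<eta>\<close> says that \<open>\<eta>\<close> is the form obtained by dividing the
  pullback of \<open>\<theta>\<close> along \<open>\<Phi>\<close> by \<open>p\<close>; for smooth \<open>A\<close> there is exactly one such \<open>\<eta>\<close>.
\<close>

definition frobenius_pullback_over_p ::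
  "'r ring \<Rightarrow> nat \<Rightarrow> ('r, 'a, 'm) algebra_scheme \<Rightarrow> 'a set set \<Rightarrow>
   ('a \<Rightarrow> nat \<Rightarrow> ('a \<times> 'a) set set \<Rightarrow> ('a \<times> 'a) set set) \<Rightarrow>
   ('a \<Rightarrow> nat \<Rightarrow> (('a \<times> 'a) set set \<times> ('a \<times> 'a) set set \<Rightarrow>\<^sub>0 int) set) \<Rightarrow>
   ('a \<Rightarrow> nat \<Rightarrow> (('a \<times> 'a) set set \<times> ('a \<times> 'a) set set \<Rightarrow>\<^sub>0 int) set) \<Rightarrow> bool" where
  "frobenius_pullback_over_p R p A U \<Phi> \<theta> \<eta> \<longleftrightarrow>
     \<eta> \<in> formal_forms R p A U \<and>
     (\<forall>f\<in>affine_pieces A U. \<forall>n.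
        [p] \<cdot>\<^bsub>differentials R (piece A p f n)\<^esub> \<eta> f n =
        pullback (piece A p f n) (constants R (piece A p f n)) (\<Phi> f n) (\<theta> f n))"

definition lie_invariant_mod_p ::
  "'r ring \<Rightarrow> nat \<Rightarrow> ('r, 'a, 'm) hopf_scheme \<Rightarrow> 'a set set \<Rightarrow>
   ('a \<Rightarrow> nat \<Rightarrow> ('a \<times> 'a) set set \<Rightarrow> ('a \<times> 'a) set set) \<Rightarrow> bool" where
  "lie_invariant_mod_p R p G U \<Phi> \<longleftrightarrow>
     (\<exists>D \<omega> \<Lambda>.
        generates_invariant_forms R G D \<omega> \<and>
        (\<forall>i<D. \<forall>j<D. \<Lambda> i j \<in> carrier R) \<and>
        (\<forall>i<D. \<exists>\<eta> \<theta>.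
           frobenius_pullback_over_p R p G U \<Phi> (restrict_form R p G (\<omega> i)) \<eta> \<and>
           \<theta> \<in> formal_forms R p G U \<and>
           (\<forall>f\<in>affine_pieces G U. \<forall>n.
              let \<Omega> = differentials R (piece G p f n) in
              \<eta> f n =
                finsum \<Omega>
                  (\<lambda>j. algmap (piece G p f n) (\<Lambda> i j) \<odot>\<^bsub>\<Omega>\<^esub> restrict_form R p G (\<omega> j) f n)
                  {..<D}
                \<oplus>\<^bsub>\<Omega>\<^esub> [p] \<cdot>\<^bsub>\<Omega>\<^esub> \<theta> f n)))"


section \<open>Unipotent elements\<close>

text \<open>\<open>N \<times> N\<close> matrices, extended by zero outside the index range.\<close>

definition matrix_ring :: "('a, 'm) ring_scheme \<Rightarrow> nat \<Rightarrow> (nat \<Rightarrow> nat \<Rightarrow> 'a) ring" where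
  "matrix_ring A N =
     \<lparr>carrier = {M. \<forall>i j. (i < N \<and> j < N \<longrightarrow> M i j \<in> carrier A) \<and>
                          (\<not> (i < N \<and> j < N) \<longrightarrow> M i j = \<zero>\<^bsub>A\<^esub>)},
      monoid.mult = (\<lambda>M M' i j. if i < N \<and> j < N
                then finsum A (\<lambda>k. M i k \<otimes>\<^bsub>A\<^esub> M' k j) {..<N} else \<zero>\<^bsub>A\<^esub>),
      one = (\<lambda>i j. if i < N \<and> i = j then \<one>\<^bsub>A\<^esub> else \<zero>\<^bsub>A\<^esub>),
      ring.zero = (\<lambda>i j. \<zero>\<^bsub>A\<^esub>),
      add = (\<lambda>M M' i j. M i j \<oplus>\<^bsub>A\<^esub> M' i j)\<rparr>"

text \<open>
  A morphism from \<open>G\<close> to \<open>GL\<^sub>N\<close> is an element \<open>M\<close> of \<open>GL\<^sub>N\<close> over the coordinate ring of \<open>G\<close>, the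
  image of the generic matrix. It is a homomorphism of groups when \<open>\<Delta> M\<^sub>i\<^sub>j\<close> is the sum of the
  \<open>M\<^sub>i\<^sub>k \<otimes> M\<^sub>k\<^sub>j\<close>. It is a closed immersion when the comorphism is surjective; the coordinate ring
  of \<open>GL\<^sub>N\<close> is generated as an \<open>R\<close>-algebra by the entries of the generic matrix and of its inverse.
\<close>

definition gl_embedding ::
  "'r ring \<Rightarrow> ('r, 'a, 'm) hopf_scheme \<Rightarrow> nat \<Rightarrow> (nat \<Rightarrow> nat \<Rightarrow> 'a) \<Rightarrow> bool" where
  "gl_embedding R G N M \<longleftrightarrow>
     M \<in> Units (matrix_ring G N) \<and>
     (\<forall>i<N. \<forall>j<N. comult G (M i j) =
        finsum (tensor R G G) (\<lambda>k. pure_tensor R G G (M i k) (M k j)) {..<N}) \<and>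
     carrier G = generate_ring G
       (constants R G \<union>
        {M i j | i j. i < N \<and> j < N} \<union>
        {(inv\<^bsub>matrix_ring G N\<^esub> M) i j | i j. i < N \<and> j < N})"

definition point_matrix ::
  "'r ring \<Rightarrow> nat \<Rightarrow> (nat \<Rightarrow> nat \<Rightarrow> 'a) \<Rightarrow> ('a \<Rightarrow> 'r) \<Rightarrow> nat \<Rightarrow> nat \<Rightarrow> 'r" where
  "point_matrix R N M u = (\<lambda>i j. if i < N \<and> j < N then u (M i j) else \<zero>\<^bsub>R\<^esub>)"

definition unipotent_order ::
  "'r ring \<Rightarrow> ('r, 'a, 'm) hopf_scheme \<Rightarrow> ('a \<Rightarrow> 'r) \<Rightarrow> nat \<Rightarrow> bool" where
  "unipotent_order R G u n \<longleftrightarrow>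
     (\<exists>N M. gl_embedding R G N M \<and>
        (point_matrix R N M u \<ominus>\<^bsub>matrix_ring R N\<^esub> \<one>\<^bsub>matrix_ring R N\<^esub>) [^]\<^bsub>matrix_ring R N\<^esub> n
          = \<zero>\<^bsub>matrix_ring R N\<^esub>)"

definition unipotent :: "'r ring \<Rightarrow> ('r, 'a, 'm) hopf_scheme \<Rightarrow> ('a \<Rightarrow> 'r) \<Rightarrow> bool" where
  "unipotent R G u \<longleftrightarrow> (\<exists>n\<ge>1. unipotent_order R G u n)"

definition unipotent_index :: "'r ring \<Rightarrow> ('r, 'a, 'm) hopf_scheme \<Rightarrow> ('a \<Rightarrow> 'r) \<Rightarrow> nat" where
  "unipotent_index R G u = (LEAST n. n \<ge> 1 \<and> unipotent_order R G u n)"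

end

theory Submission
  imports Defs
begin

text \<open>
  A non-trivial unipotent \<open>u\<close> of index at most \<open>p\<close> lies on a one-parameter group: the coordinates
  of \<open>u\<^sup>n\<close> are polynomials in \<open>n\<close>. After division by a power of \<open>p\<close>, the derivative of this group
  at \<open>0\<close> is a tangent vector at the unit which is non-zero modulo \<open>p\<close> and whose matrix has
  vanishing \<open>p\<close>-th power; let \<open>D\<close> be the corresponding left invariant derivation. Then \<open>D\<^sup>p\<close>
  vanishes modulo \<open>p\<close>, and the invariant forms take constant values on \<open>D\<close>, at least one of which
  is a unit \<open>c\<close>.

  On an affine piece modulo \<open>p\<^sup>2\<close>, pair \<open>D\<close> with the pullback of an invariant form \<open>\<omega>\<close> along a
  Frobenius lift, and apply \<open>D\<close> to the result another \<open>p - 1\<close> times. Lie invariance modulo \<open>p\<close>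
  makes the pairing constant modulo \<open>p\<^sup>2\<close>, so this gives \<open>0\<close>. On the other hand, for a form \<open>a db\<close>
  the derivative of \<open>b\<^sup>p\<close> of order \<open>p\<close> is \<open>p! (D b)\<^sup>p\<close>, so that the result is \<open>p! c\<^sup>p\<close>. Hence \<open>p\<close>
  vanishes on the piece, which is impossible because \<open>G\<close> is flat: instead of flatness we use the
  weaker statement that \<open>p\<close>-torsion elements are nilpotent modulo \<open>p\<close>, which follows from formal
  smoothness by lifting to Witt vectors of length two.
\<close>

text \<open>The computation is Katz's identity for the Cartier operator C in characteristic p,
  \<open><C w, D>^p = <w, D^p> - D^(p-1) <w, D>\<close>: modulo p, the pullback divided by p lifts
  the inverse of C, and (p - 1)! = -1. Division by p is avoided by keeping all quantities p times as
  large and comparing them modulo p^2. There p! need not vanish, while p * p! does, so that the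
  error terms disappear. The bound on the index enters through binomial coefficients: for k < p the
  function n -> binomial(n, k) is a polynomial over R, because k! is a unit. The coefficient of n in
  u^n is then a truncated logarithm of u, which is non-zero for non-trivial u and inherits the
  vanishing p-th power. That D^p is divisible by p on all functions follows from the entries of the
  generic matrix and of its inverse, since the p-th power of a derivation is a derivation modulo p.
  Group theory is done on points: a derivation is a point with values in dual numbers, and left
  invariance is the identity (xy)^-1 (xz) = y^-1 z.\<close>

section \<open>Evaluation of formal sums\<close>

text \<open>The additive extension of \<open>g\<close> to the free abelian group. The sum runs over
  the keys exactly as in \<open>copair\<close>, so that \<open>copair\<close> is this map followed
  by \<open>the_elem\<close> on a class.\<close>

definition frag_eval :: "('c, 'm) ring_scheme \<Rightarrow> ('x \<Rightarrow> 'c) \<Rightarrow> ('x \<Rightarrow>\<^sub>0 int) \<Rightarrow> 'c" where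
  "frag_eval T g c = finsum T (\<lambda>x. [(Poly_Mapping.lookup c x)] \<cdot>\<^bsub>T\<^esub> g x) (Poly_Mapping.keys c)"

lemmas frag_ind = free_Abelian_group_induct [consumes 1, case_names zero diff gen]

context abelian_group
begin

text \<open>Keys can cancel in a sum, so additivity is proved over a common finite superset of the
  supports, where the extra terms have coefficient zero.\<close>

lemma frag_eval_superset:
  assumes "finite S" "Poly_Mapping.keys c \<subseteq> S" "g \<in> S \<rightarrow> carrier G"
  shows "frag_eval G g c = finsum G (\<lambda>x. [(Poly_Mapping.lookup c x)] \<cdot> g x) S"
proof -
  have g: "g x \<in> carrier G" if "x \<in> S" for x using assms(3) that by auto
  have z: "[(0::int)] \<cdot> g x = \<zero>" if "x \<in> S" for x
    by (simp add: add_pow_def)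
  show ?thesis
    unfolding frag_eval_def
  proof (rule add.finprod_mono_neutral_cong_left[OF assms(1,2)])
    fix x assume "x \<in> S - Poly_Mapping.keys c"
    then show "[(Poly_Mapping.lookup c x)] \<cdot> g x = \<zero>" using z by (simp add: Poly_Mapping.in_keys_iff)
  next
    show "(\<lambda>x. [(Poly_Mapping.lookup c x)] \<cdot> g x) \<in> S \<rightarrow> carrier G" using g by simp
  qed (rule refl)
qed

lemma frag_eval_closed [simp, intro]:
  assumes "g \<in> Y \<rightarrow> carrier G" "Poly_Mapping.keys c \<subseteq> Y"
  shows "frag_eval G g c \<in> carrier G"
  unfolding frag_eval_def using assms by (intro finsum_closed) (auto intro!: add.int_pow_closed)

lemma frag_eval_0 [simp]: "frag_eval G g 0 = \<zero>"
  by (simp add: frag_eval_def)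

lemma frag_eval_of [simp]:
  assumes "g x \<in> carrier G"
  shows "frag_eval G g (frag_of x) = g x"
  using assms by (simp add: frag_eval_def)

lemma frag_eval_add:
  assumes "g \<in> Y \<rightarrow> carrier G" "Poly_Mapping.keys c \<subseteq> Y" "Poly_Mapping.keys d \<subseteq> Y"
  shows "frag_eval G g (c + d) = frag_eval G g c \<oplus> frag_eval G g d"
proof -
  let ?S = "Poly_Mapping.keys c \<union> Poly_Mapping.keys d"
  have S: "finite ?S" "g \<in> ?S \<rightarrow> carrier G" using assms by auto
  have gS: "g x \<in> carrier G" if "x \<in> ?S" for x using S that by auto
  have "frag_eval G g (c + d) = finsum G (\<lambda>x. [(Poly_Mapping.lookup (c+d) x)] \<cdot> g x) ?S"
    using S Poly_Mapping.keys_add[of c d] by (intro frag_eval_superset) (simp_all add: Pi_iff)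
  also have "\<dots> = finsum G (\<lambda>x. [(Poly_Mapping.lookup c x)] \<cdot> g x \<oplus> [(Poly_Mapping.lookup d x)] \<cdot> g x) ?S"
    using S gS by (intro finsum_cong') (simp_all add: lookup_add add.int_pow_mult Pi_iff)
  also have "\<dots> = finsum G (\<lambda>x. [(Poly_Mapping.lookup c x)] \<cdot> g x) ?S \<oplus> finsum G (\<lambda>x. [(Poly_Mapping.lookup d x)] \<cdot> g x) ?S"
    using S by (intro finsum_addf) (auto intro!: add.int_pow_closed)
  also have "\<dots> = frag_eval G g c \<oplus> frag_eval G g d"
    using S frag_eval_superset[of ?S c g] frag_eval_superset[of ?S d g] by simp
  finally show ?thesis .
qed

lemma frag_eval_uminus:
  assumes "g \<in> Y \<rightarrow> carrier G" "Poly_Mapping.keys c \<subseteq> Y"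
  shows "frag_eval G g (- c) = \<ominus> frag_eval G g c"
proof -
  have "frag_eval G g (- c) \<oplus> frag_eval G g c = \<zero>"
    using frag_eval_add[OF assms(1), of "- c" c] assms(2) by simp
  then show ?thesis
    using minus_equality frag_eval_closed[OF assms] frag_eval_closed[OF assms(1), of "- c"] assms(2)
    by (metis keys_minus)
qed

lemma frag_eval_diff:
  assumes "g \<in> Y \<rightarrow> carrier G" "Poly_Mapping.keys c \<subseteq> Y" "Poly_Mapping.keys d \<subseteq> Y"
  shows "frag_eval G g (c - d) = frag_eval G g c \<ominus> frag_eval G g d"
  using frag_eval_add[OF assms(1,2), of "- d"] frag_eval_uminus[OF assms(1,3)] assms
  by (simp add: a_minus_def)

lemma frag_eval_cong:
  assumes "\<And>x. x \<in> Poly_Mapping.keys c \<Longrightarrow> g x = h x" "h \<in> Poly_Mapping.keys c \<rightarrow> carrier G"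
  shows "frag_eval G g c = frag_eval G h c"
  unfolding frag_eval_def using assms by (intro finsum_cong') (auto intro!: add.int_pow_closed)

end

text \<open>Only additivity of \<open>k\<close> is asked for: it is later applied to second
  projections of idealizations, to iterated derivations and to x -> p! x^p, none of which is a ring
  homomorphism.\<close>

lemma abelian_group_hom_frag_eval:
  assumes T: "abelian_group T" and T': "abelian_group T'"
    and k: "k \<in> carrier T \<rightarrow> carrier T'"
    and kadd: "\<And>x y. x \<in> carrier T \<Longrightarrow> y \<in> carrier T \<Longrightarrow> k (x \<oplus>\<^bsub>T\<^esub> y) = k x \<oplus>\<^bsub>T'\<^esub> k y"
    and g: "g \<in> Y \<rightarrow> carrier T" and c: "Poly_Mapping.keys c \<subseteq> Y"
  shows "k (frag_eval T g c) = frag_eval T' (\<lambda>x. k (g x)) c"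
proof -
  interpret T: abelian_group T by fact
  interpret T': abelian_group T' by fact
  interpret abelian_group_hom T T' k
    using k kadd by unfold_locales (auto simp: hom_def)
  show ?thesis using c
  proof (induction c rule: frag_ind)
    case diff
    then show ?case
      using g k by (simp add: T.frag_eval_diff[of g Y] T'.frag_eval_diff[of "\<lambda>x. k (g x)" Y] Pi_iff T.frag_eval_closed
        T.minus_eq T'.minus_eq T.frag_eval_closed[of g Y])
  next
    case (gen a)
    have "g a \<in> carrier T" using g gen by auto
    then have "g a \<in> carrier T" "k (g a) \<in> carrier T'" using k by auto
    then show ?case by simp
  qed auto
qed

section \<open>Monoid rings\<close>

lemma monoid_ring_simps [simp]:
  "carrier (monoid_ring M) = {c. Poly_Mapping.keys c \<subseteq> carrier M}"
  "\<one>\<^bsub>monoid_ring M\<^esub> = frag_of \<one>\<^bsub>M\<^esub>"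
  "\<zero>\<^bsub>monoid_ring M\<^esub> = 0"
  "x \<oplus>\<^bsub>monoid_ring M\<^esub> y = x + y"
  by (simp_all add: monoid_ring_def)

abbreviation mrmult where "mrmult M \<equiv> monoid.mult (monoid_ring M)"

lemma monoid_ring_mult:
  "x \<otimes>\<^bsub>monoid_ring M\<^esub> y = frag_extend (\<lambda>a. frag_extend (\<lambda>b. frag_of (a \<otimes>\<^bsub>M\<^esub> b)) y) x"
  by (simp add: monoid_ring_def)

lemma monoid_ring_mult_of [simp]:
  "frag_of a \<otimes>\<^bsub>monoid_ring M\<^esub> frag_of b = frag_of (a \<otimes>\<^bsub>M\<^esub> b)"
  by (simp add: monoid_ring_mult)

lemma frag_cmul_diff: "frag_cmul c (a - b) = frag_cmul c a - frag_cmul c b"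
  by (rule poly_mapping_eqI) (simp add: lookup_minus right_diff_distrib)

lemma frag_extend_fun_diff: "frag_extend (\<lambda>a. f a - g a) x = frag_extend f x - frag_extend g x"
  by (simp add: frag_extend_def sum_subtractf frag_cmul_diff)

lemma monoid_ring_mult_distrib:
  "mrmult M (x - y) z = mrmult M x z - mrmult M y z"
  "mrmult M x (y - z) = mrmult M x y - mrmult M x z"
  "mrmult M 0 z = 0"
  "mrmult M x 0 = 0"
  by (simp_all add: monoid_ring_mult frag_extend_diff frag_extend_fun_diff)
     (simp add: frag_extend_def)

lemma monoid_ring_mult_closed:
  assumes "monoid M" "Poly_Mapping.keys x \<subseteq> carrier M" "Poly_Mapping.keys y \<subseteq> carrier M"
  shows "Poly_Mapping.keys (mrmult M x y) \<subseteq> carrier M"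
  using assms(2)
proof (induction x rule: frag_ind)
  case (diff x z)
  then show ?case by (simp add: monoid_ring_mult_distrib order_trans[OF keys_diff])
next
  case (gen a)
  show ?case using assms(3)
  proof (induction y rule: frag_ind)
    case (diff x z)
    then show ?case by (simp add: monoid_ring_mult_distrib order_trans[OF keys_diff])
  next
    case (gen b)
    then show ?case using \<open>a \<in> carrier M\<close> assms(1) by (simp add: monoid.m_closed keys_frag_of)
  qed (simp add: monoid_ring_mult_distrib)
qed (simp add: monoid_ring_mult_distrib)

lemma keys_add_subset:
  "Poly_Mapping.keys x \<subseteq> S \<Longrightarrow> Poly_Mapping.keys y \<subseteq> S \<Longrightarrow> Poly_Mapping.keys (x + y) \<subseteq> S"
  using Poly_Mapping.keys_add[of x y] by blast

lemma cring_monoid_ring: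
  assumes "comm_monoid M"
  shows "cring (monoid_ring M)"
proof -
  interpret M: comm_monoid M by fact
  note cl = monoid_ring_mult_closed[OF M.monoid_axioms]
  have comm: "mrmult M x y = mrmult M y x"
    if "Poly_Mapping.keys x \<subseteq> carrier M" "Poly_Mapping.keys y \<subseteq> carrier M" for x y
    using that(1)
  proof (induction x rule: frag_ind)
    case (gen a)
    show ?case using that(2)
      by (induction y rule: frag_ind) (auto simp: monoid_ring_mult_distrib M.m_comm gen)
  qed (auto simp: monoid_ring_mult_distrib)
  have assoc: "mrmult M (mrmult M x y) z = mrmult M x (mrmult M y z)"
    if "Poly_Mapping.keys x \<subseteq> carrier M" "Poly_Mapping.keys y \<subseteq> carrier M" "Poly_Mapping.keys z \<subseteq> carrier M" for x y z
    using that(1)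
  proof (induction x rule: frag_ind)
    case (gen a)
    show ?case using that(2)
    proof (induction y rule: frag_ind)
      case b: (gen b)
      show ?case using that(3)
        by (induction z rule: frag_ind) (auto simp: monoid_ring_mult_distrib M.m_assoc gen b)
    qed (auto simp: monoid_ring_mult_distrib)
  qed (auto simp: monoid_ring_mult_distrib)
  have one: "mrmult M (frag_of \<one>\<^bsub>M\<^esub>) x = x" if "Poly_Mapping.keys x \<subseteq> carrier M" for x
    using that
    by (induction x rule: frag_ind) (auto simp: monoid_ring_mult_distrib)
  have distr: "mrmult M (x + y) z = mrmult M x z + mrmult M y z" for x y z
    using monoid_ring_mult_distrib(1)[of M x "-y" z] monoid_ring_mult_distrib(1)[of M 0 y z]
    by (simp add: monoid_ring_mult_distrib)
  show ?thesis
  proof (rule cringI)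
    show "abelian_group (monoid_ring M)"
    proof (rule abelian_groupI)
      fix x assume "x \<in> carrier (monoid_ring M)"
      then show "\<exists>y\<in>carrier (monoid_ring M). y \<oplus>\<^bsub>monoid_ring M\<^esub> x = \<zero>\<^bsub>monoid_ring M\<^esub>"
        by (intro bexI[of _ "- x"]) auto
    qed (use keys_add_subset in \<open>simp_all add: add.assoc add.commute add.left_commute\<close>)
    show "comm_monoid (monoid_ring M)"
    proof (rule comm_monoidI)
      fix x y assume "x \<in> carrier (monoid_ring M)" "y \<in> carrier (monoid_ring M)"
      then have xy: "Poly_Mapping.keys x \<subseteq> carrier M" "Poly_Mapping.keys y \<subseteq> carrier M" by auto
      show "mrmult M x y \<in> carrier (monoid_ring M)" using cl[OF xy] by simp
      show "mrmult M x y = mrmult M y x" by (rule comm[OF xy])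
      fix z assume "z \<in> carrier (monoid_ring M)"
      then show "mrmult M (mrmult M x y) z = mrmult M x (mrmult M y z)" using assoc[OF xy] by simp
    next
      fix x assume "x \<in> carrier (monoid_ring M)"
      then show "mrmult M \<one>\<^bsub>monoid_ring M\<^esub> x = x" using one by simp
    qed simp
    show "mrmult M (x \<oplus>\<^bsub>monoid_ring M\<^esub> y) z = mrmult M x z \<oplus>\<^bsub>monoid_ring M\<^esub> mrmult M y z" for x y z
      using distr by simp
  qed
qed

lemma monoid_ring_minus [simp]:
  assumes "comm_monoid M" "Poly_Mapping.keys x \<subseteq> carrier M" "Poly_Mapping.keys y \<subseteq> carrier M"
  shows "x \<ominus>\<^bsub>monoid_ring M\<^esub> y = x - y"
proof -
  interpret cring "monoid_ring M" using assms(1) by (rule cring_monoid_ring)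
  have "\<ominus>\<^bsub>monoid_ring M\<^esub> y = - y" using assms(3) by (intro minus_equality) auto
  then show ?thesis by (simp add: a_minus_def)
qed

lemma monoid_ring_nat_pow:
  assumes "comm_monoid M" "Poly_Mapping.keys x \<subseteq> carrier M"
  shows "[(n::nat)] \<cdot>\<^bsub>monoid_ring M\<^esub> x = frag_cmul (int n) x"
proof -
  interpret cring "monoid_ring M" using assms(1) by (rule cring_monoid_ring)
  show ?thesis
  proof (induction n)
    case (Suc n)
    have "frag_cmul (int (Suc n)) x = frag_cmul (int n) x + x"
      using frag_cmul_distrib[of "int n" 1 x] by (simp add: add.commute)
    then show ?case using Suc assms(2) by simp
  qed simp
qed

text \<open>The universal property of the integral monoid ring. It serves both the tensor product
  and, for the multiplicative monoid of a ring, the transfer of integral identities to that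
  ring.\<close>

lemma frag_eval_ring_hom:
  assumes M: "comm_monoid M" and T: "cring T"
    and g: "g \<in> carrier M \<rightarrow> carrier T" "g \<one>\<^bsub>M\<^esub> = \<one>\<^bsub>T\<^esub>"
    and gm: "\<And>a b. a \<in> carrier M \<Longrightarrow> b \<in> carrier M \<Longrightarrow> g (a \<otimes>\<^bsub>M\<^esub> b) = g a \<otimes>\<^bsub>T\<^esub> g b"
  shows "frag_eval T g \<in> ring_hom (monoid_ring M) T"
proof -
  interpret M: comm_monoid M by fact
  interpret T: cring T by fact
  note cl = monoid_ring_mult_closed[OF M.monoid_axioms]
  have gc: "g a \<in> carrier T" if "a \<in> carrier M" for a using g that by auto
  note e = T.frag_eval_closed[OF g(1)] T.frag_eval_diff[OF g(1)]
  show ?thesis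
  proof (rule ring_hom_memI)
    fix x y assume "x \<in> carrier (monoid_ring M)" "y \<in> carrier (monoid_ring M)"
    then have x: "Poly_Mapping.keys x \<subseteq> carrier M" and y: "Poly_Mapping.keys y \<subseteq> carrier M" by auto
    show "frag_eval T g (x \<oplus>\<^bsub>monoid_ring M\<^esub> y) = frag_eval T g x \<oplus>\<^bsub>T\<^esub> frag_eval T g y"
      using T.frag_eval_add[OF g(1) x y] by simp
    show "frag_eval T g (mrmult M x y) = frag_eval T g x \<otimes>\<^bsub>T\<^esub> frag_eval T g y"
      using x
    proof (induction x rule: frag_ind)
      case (diff a b)
      have "frag_eval T g (mrmult M (a - b) y) = frag_eval T g (mrmult M a y) \<ominus>\<^bsub>T\<^esub> frag_eval T g (mrmult M b y)"
        unfolding monoid_ring_mult_distrib by (intro e cl diff y)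
      also have "\<dots> = (frag_eval T g a \<ominus>\<^bsub>T\<^esub> frag_eval T g b) \<otimes>\<^bsub>T\<^esub> frag_eval T g y"
        unfolding diff.IH using e(1)[OF diff(1)] e(1)[OF diff(2)] e(1)[OF y]
        by (simp add: T.minus_eq T.l_distr T.l_minus)
      finally show ?case using e(2)[OF diff(1,2)] by simp
    next
      case (gen a)
      have a: "Poly_Mapping.keys (frag_of a) \<subseteq> carrier M" using gen by simp
      show ?case using y
      proof (induction y rule: frag_ind)
        case (diff u v)
        have "frag_eval T g (mrmult M (frag_of a) (u - v)) = frag_eval T g (mrmult M (frag_of a) u) \<ominus>\<^bsub>T\<^esub> frag_eval T g (mrmult M (frag_of a) v)"
          unfolding monoid_ring_mult_distrib by (intro e cl diff a)
        also have "\<dots> = frag_eval T g (frag_of a) \<otimes>\<^bsub>T\<^esub> (frag_eval T g u \<ominus>\<^bsub>T\<^esub> frag_eval T g v)"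
          unfolding diff.IH using e(1)[OF diff(1)] e(1)[OF diff(2)] e(1)[OF a]
          by (simp add: T.minus_eq T.r_distr T.r_minus)
        finally show ?case using e(2)[OF diff(1,2)] by simp
      next
        case (gen b)
        then show ?case using \<open>a \<in> carrier M\<close> by (simp add: gc gm)
      qed (simp add: monoid_ring_mult_distrib e(1)[OF a])
    qed (simp add: monoid_ring_mult_distrib e(1)[OF y])
  next
    fix x assume "x \<in> carrier (monoid_ring M)"
    then show "frag_eval T g x \<in> carrier T" by (simp add: e(1))
  next
    show "frag_eval T g \<one>\<^bsub>monoid_ring M\<^esub> = \<one>\<^bsub>T\<^esub>" using g gc[OF M.one_closed] by simp
  qed
qed

section \<open>Ring homomorphisms and quotients\<close>

lemma ring_hom_diff:
  assumes "h \<in> ring_hom S C" "ring S" "ring C" "x \<in> carrier S" "y \<in> carrier S"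
  shows "h (x \<ominus>\<^bsub>S\<^esub> y) = h x \<ominus>\<^bsub>C\<^esub> h y"
proof -
  interpret ring_hom_ring S C h by (intro ring_hom_ringI2 assms)
  show ?thesis using assms by (simp add: a_minus_def)
qed

lemma ring_hom_nat_mult:
  assumes "h \<in> ring_hom S C" "ring S" "ring C" "x \<in> carrier S"
  shows "h ([(n::nat)] \<cdot>\<^bsub>S\<^esub> x) = [n] \<cdot>\<^bsub>C\<^esub> h x"
proof -
  interpret ring_hom_ring S C h by (intro ring_hom_ringI2 assms)
  show ?thesis by (induction n) (use assms in auto)
qed

lemma ring_hom_nat_pow:
  assumes "h \<in> ring_hom S C" "ring S" "ring C" "x \<in> carrier S"
  shows "h (x [^]\<^bsub>S\<^esub> (n::nat)) = h x [^]\<^bsub>C\<^esub> n"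
proof -
  interpret ring_hom_ring S C h by (intro ring_hom_ringI2 assms)
  show ?thesis by (induction n) (use assms in auto)
qed

lemma abelian_group_hom_finsum:
  assumes T: "abelian_group T" and T': "abelian_group T'"
    and k: "k \<in> carrier T \<rightarrow> carrier T'"
    and kadd: "\<And>x y. x \<in> carrier T \<Longrightarrow> y \<in> carrier T \<Longrightarrow> k (x \<oplus>\<^bsub>T\<^esub> y) = k x \<oplus>\<^bsub>T'\<^esub> k y"
    and g: "g \<in> I \<rightarrow> carrier T"
  shows "k (finsum T g I) = finsum T' (\<lambda>x. k (g x)) I"
proof -
  interpret T: abelian_group T by fact
  interpret T': abelian_group T' by fact
  interpret abelian_group_hom T T' k
    using k kadd by unfold_locales (auto simp: hom_def)
  show ?thesis using g
  proof (induction I rule: infinite_finite_induct)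
    case (insert x F)
    then have g: "g \<in> F \<rightarrow> carrier T" "g x \<in> carrier T" by auto
    have "(\<lambda>x. k (g x)) \<in> F \<rightarrow> carrier T'" "k (g x) \<in> carrier T'"
      using k g by (auto intro!: funcset_mem[OF k] elim: funcset_mem)
    then show ?case using insert g by simp
  qed (simp_all)
qed

lemma ring_hom_finsum:
  assumes "h \<in> ring_hom S C" "ring S" "ring C" "g \<in> I \<rightarrow> carrier S"
  shows "h (finsum S g I) = finsum C (\<lambda>x. h (g x)) I"
proof -
  interpret S: ring S by fact
  interpret C: ring C by fact
  show ?thesis
    using S.abelian_group_axioms C.abelian_group_axioms assms(4)
    by (intro abelian_group_hom_finsum) (use assms(1) in \<open>auto simp: ring_hom_def\<close>)
qed

lemma ring_hom_frag_eval:
  assumes "h \<in> ring_hom S C" "ring S" "ring C" "g \<in> Y \<rightarrow> carrier S" "Poly_Mapping.keys c \<subseteq> Y"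
  shows "h (frag_eval S g c) = frag_eval C (\<lambda>x. h (g x)) c"
proof -
  interpret S: ring S by fact
  interpret C: ring C by fact
  show ?thesis
    using S.abelian_group_axioms C.abelian_group_axioms assms(4,5)
    by (intro abelian_group_hom_frag_eval) (use assms(1) in \<open>auto simp: ring_hom_def\<close>)
qed

lemma carrier_quotE:
  assumes "t \<in> carrier (S Quot I)"
  obtains x where "x \<in> carrier S" "t = I +>\<^bsub>S\<^esub> x"
  using assms by (auto simp: FactRing_def A_RCOSETS_def')

text \<open>A homomorphism that kills the ideal is constant on each coset, so the image of a coset
  is a singleton. This gives meaning to \<open>the_elem\<close> in \<open>copair\<close> and in all
  later factorizations through a quotient.\<close>

lemma the_elem_image_coset:
  assumes I: "ideal I S" and C: "ring C" and h: "h \<in> ring_hom S C"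
    and hI: "\<forall>x\<in>I. h x = \<zero>\<^bsub>C\<^esub>" and x: "x \<in> carrier S"
  shows "the_elem (h ` (I +>\<^bsub>S\<^esub> x)) = h x"
proof -
  interpret I: ideal I S by fact
  interpret C: ring C by fact
  have hx: "h x \<in> carrier C" using h x by (rule ring_hom_closed)
  have "h y = h x" if yI: "y \<in> I +>\<^bsub>S\<^esub> x" for y
  proof -
    obtain i where i: "i \<in> I" "y = i \<oplus>\<^bsub>S\<^esub> x"
      using yI unfolding a_r_coset_def' by blast
    have "h y = h i \<oplus>\<^bsub>C\<^esub> h x" unfolding i(2) by (rule ring_hom_add[OF h I.Icarr[OF i(1)] x])
    then show ?thesis using bspec[OF hI i(1)] C.l_zero[OF hx] by metis
  qed
  moreover have "x \<in> I +>\<^bsub>S\<^esub> x" using I.a_rcos_self[OF x] .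
  ultimately have "h ` (I +>\<^bsub>S\<^esub> x) = {h x}" by blast
  then show ?thesis by simp
qed

lemma quot_lift_hom:
  assumes I: "ideal I S" and C: "ring C" and h: "h \<in> ring_hom S C"
    and hI: "\<forall>x\<in>I. h x = \<zero>\<^bsub>C\<^esub>"
  shows "(\<lambda>t. the_elem (h ` t)) \<in> ring_hom (S Quot I) C"
proof -
  interpret I: ideal I S by fact
  have \<pi>: "(+>\<^bsub>S\<^esub>) I \<in> ring_hom S (S Quot I)" by (rule I.rcos_ring_hom)
  note e = the_elem_image_coset[OF I C h hI]
  show ?thesis
  proof (rule ring_hom_memI)
    fix t assume "t \<in> carrier (S Quot I)"
    then obtain x where x: "x \<in> carrier S" "t = I +>\<^bsub>S\<^esub> x" by (rule carrier_quotE)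
    show "the_elem (h ` t) \<in> carrier C" using x ring_hom_closed[OF h] by (simp add: e)
    fix t' assume "t' \<in> carrier (S Quot I)"
    then obtain y where y: "y \<in> carrier S" "t' = I +>\<^bsub>S\<^esub> y" by (rule carrier_quotE)
    show "the_elem (h ` (t \<otimes>\<^bsub>S Quot I\<^esub> t')) = the_elem (h ` t) \<otimes>\<^bsub>C\<^esub> the_elem (h ` t')"
      unfolding x(2) y(2) ring_hom_mult[OF \<pi> x(1) y(1), symmetric]
      using x y by (simp add: e ring_hom_mult[OF h])
    show "the_elem (h ` (t \<oplus>\<^bsub>S Quot I\<^esub> t')) = the_elem (h ` t) \<oplus>\<^bsub>C\<^esub> the_elem (h ` t')"
      unfolding x(2) y(2) ring_hom_add[OF \<pi> x(1) y(1), symmetric]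
      using x y by (simp add: e ring_hom_add[OF h])
  next
    show "the_elem (h ` \<one>\<^bsub>S Quot I\<^esub>) = \<one>\<^bsub>C\<^esub>"
      unfolding ring_hom_one[OF \<pi>, symmetric] using e[OF I.one_closed] ring_hom_one[OF h] by simp
  qed
qed

section \<open>Algebras\<close>

lemma with_algmap_simps [simp]:
  "carrier (with_algmap S k) = carrier S"
  "monoid.mult (with_algmap S k) = monoid.mult S"
  "\<one>\<^bsub>with_algmap S k\<^esub> = \<one>\<^bsub>S\<^esub>"
  "\<zero>\<^bsub>with_algmap S k\<^esub> = \<zero>\<^bsub>S\<^esub>"
  "add (with_algmap S k) = add S"
  "algmap (with_algmap S k) = k"
  by (simp_all add: with_algmap_def ring.extend_def algebra.fields_def)

lemma ring_hom_with_algmap [simp]: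
  "ring_hom (with_algmap S k) C = ring_hom S C"
  "ring_hom C (with_algmap S k) = ring_hom C S"
  by (simp_all add: ring_hom_def)

lemma cring_with_algmap [simp]:
  assumes "cring S" shows "cring (with_algmap S k)"
proof -
  interpret cring S by fact
  show ?thesis
  proof (rule cringI)
    show "abelian_group (with_algmap S k)"
    proof (rule abelian_groupI)
      fix x assume "x \<in> carrier (with_algmap S k)"
      then show "\<exists>y\<in>carrier (with_algmap S k). y \<oplus>\<^bsub>with_algmap S k\<^esub> x = \<zero>\<^bsub>with_algmap S k\<^esub>"
        by (intro bexI[of _ "\<ominus>\<^bsub>S\<^esub> x"]) (simp_all add: l_neg)
    qed (auto simp: a_ac)
    show "comm_monoid (with_algmap S k)"
      by (rule comm_monoidI) (auto simp: m_ac)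
  qed (simp add: l_distr)
qed

lemma ideal_with_algmap [simp]:
  "a_r_coset (with_algmap S k) = a_r_coset S"
  by (simp add: a_r_coset_def r_coset_def fun_eq_iff)

section \<open>Tensor products\<close>

locale algebra_pair =
  fixes R :: "'r ring" and A :: "('r, 'a, 'm) algebra_scheme" and B :: "('r, 'b, 'n) algebra_scheme"
  assumes A: "is_algebra R A" and B: "is_algebra R B"
begin

lemma AB: "cring R" "cring A" "cring B" "algmap A \<in> ring_hom R A" "algmap B \<in> ring_hom R B"
  using A B by (auto simp: is_algebra_def)

sublocale R: cring R by (rule AB)
sublocale A: cring A by (rule AB)
sublocale B: cring B by (rule AB)

abbreviation "S \<equiv> monoid_ring (A \<times>\<times> B)"
abbreviation "J \<equiv> tensor_ideal R A B"
abbreviation "T \<equiv> tensor R A B"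

lemma comm_monoid_prod: "comm_monoid (A \<times>\<times> B)"
  by (rule comm_monoidI) (auto simp: A.m_ac B.m_ac)

sublocale S: cring S by (rule cring_monoid_ring[OF comm_monoid_prod])

lemma algmap_closed [simp]: "r \<in> carrier R \<Longrightarrow> algmap A r \<in> carrier A" "r \<in> carrier R \<Longrightarrow> algmap B r \<in> carrier B"
  using AB by (auto simp: ring_hom_def)

lemma keys_sub_Diff: "Poly_Mapping.keys x \<subseteq> Z \<Longrightarrow> Poly_Mapping.keys y \<subseteq> Z \<Longrightarrow> Poly_Mapping.keys (x - y) \<subseteq> Z"
  using keys_diff[of x y] by blast

lemma relations_carrier: "tensor_relations R A B \<subseteq> carrier S"
  unfolding tensor_relations_def
  by (auto intro!: keys_sub_Diff simp del: subset_iff dest!: subsetD[OF keys_diff])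

sublocale J: ideal J S
  unfolding tensor_ideal_def by (rule S.genideal_ideal[OF relations_carrier])

lemma quot_hom: "(+>\<^bsub>S\<^esub>) J \<in> ring_hom S T"
  using J.rcos_ring_hom by (simp add: tensor_def)

lemma cring_T: "cring T"
  unfolding tensor_def by (intro cring_with_algmap J.quotient_is_cring S.cring_axioms)

sublocale T: cring T by (rule cring_T)

lemma frag_in_S [simp]: "a \<in> carrier A \<Longrightarrow> b \<in> carrier B \<Longrightarrow> frag_of (a, b) \<in> carrier S"
  by simp

lemma pure_closed [simp]: "a \<in> carrier A \<Longrightarrow> b \<in> carrier B \<Longrightarrow> pure_tensor R A B a b \<in> carrier T"
  unfolding pure_tensor_def by (rule ring_hom_closed[OF quot_hom]) simp

lemma pure_mult:
  assumes "a \<in> carrier A" "b \<in> carrier B" "a' \<in> carrier A" "b' \<in> carrier B"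
  shows "pure_tensor R A B a b \<otimes>\<^bsub>T\<^esub> pure_tensor R A B a' b' = pure_tensor R A B (a \<otimes>\<^bsub>A\<^esub> a') (b \<otimes>\<^bsub>B\<^esub> b')"
  unfolding pure_tensor_def using assms
  by (subst ring_hom_mult[OF quot_hom, symmetric]) auto

lemma pure_one: "pure_tensor R A B \<one>\<^bsub>A\<^esub> \<one>\<^bsub>B\<^esub> = \<one>\<^bsub>T\<^esub>"
  unfolding pure_tensor_def using ring_hom_one[OF quot_hom] by simp

lemma coset_eqI:
  assumes "x \<in> carrier S" "y \<in> carrier S" "x - y \<in> tensor_relations R A B"
  shows "J +>\<^bsub>S\<^esub> x = J +>\<^bsub>S\<^esub> y"
proof -
  have "x - y \<in> J" using assms(3) S.genideal_self[OF relations_carrier] by (auto simp: tensor_ideal_def)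
  moreover have "x \<ominus>\<^bsub>S\<^esub> y = x - y" using assms comm_monoid_prod by (intro monoid_ring_minus) auto
  ultimately show ?thesis
    using S.quotient_eq_iff_same_a_r_cos[OF J.ideal_axioms assms(1,2)] by simp
qed

lemma coset_add:
  assumes "x \<in> carrier S" "y \<in> carrier S"
  shows "J +>\<^bsub>S\<^esub> (x + y) = (J +>\<^bsub>S\<^esub> x) \<oplus>\<^bsub>T\<^esub> (J +>\<^bsub>S\<^esub> y)"
  using ring_hom_add[OF quot_hom assms] by simp

lemma pure_add_left:
  assumes "a \<in> carrier A" "a' \<in> carrier A" "b \<in> carrier B"
  shows "pure_tensor R A B (a \<oplus>\<^bsub>A\<^esub> a') b = pure_tensor R A B a b \<oplus>\<^bsub>T\<^esub> pure_tensor R A B a' b"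
proof -
  have "J +>\<^bsub>S\<^esub> frag_of (a \<oplus>\<^bsub>A\<^esub> a', b) = J +>\<^bsub>S\<^esub> (frag_of (a, b) + frag_of (a', b))"
    using assms keys_add_subset[of "frag_of (a, b)" "carrier A \<times> carrier B" "frag_of (a', b)"]
    by (intro coset_eqI) (force simp: tensor_relations_def algebra_simps)+
  then show ?thesis unfolding pure_tensor_def using assms by (simp only: coset_add frag_in_S)
qed

lemma pure_add_right:
  assumes "a \<in> carrier A" "b \<in> carrier B" "b' \<in> carrier B"
  shows "pure_tensor R A B a (b \<oplus>\<^bsub>B\<^esub> b') = pure_tensor R A B a b \<oplus>\<^bsub>T\<^esub> pure_tensor R A B a b'"
proof -
  have "J +>\<^bsub>S\<^esub> frag_of (a, b \<oplus>\<^bsub>B\<^esub> b') = J +>\<^bsub>S\<^esub> (frag_of (a, b) + frag_of (a, b'))"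
    using assms keys_add_subset[of "frag_of (a, b)" "carrier A \<times> carrier B" "frag_of (a, b')"]
    by (intro coset_eqI) (force simp: tensor_relations_def algebra_simps)+
  then show ?thesis unfolding pure_tensor_def using assms by (simp only: coset_add frag_in_S)
qed

lemma pure_balanced:
  assumes "r \<in> carrier R"
  shows "pure_tensor R A B (algmap A r) \<one>\<^bsub>B\<^esub> = pure_tensor R A B \<one>\<^bsub>A\<^esub> (algmap B r)"
proof -
  have "frag_of (algmap A r, \<one>\<^bsub>B\<^esub>) - frag_of (\<one>\<^bsub>A\<^esub>, algmap B r) \<in> tensor_relations R A B"
    unfolding tensor_relations_def
    by (rule UnI2, rule CollectI, intro exI[of _ r] exI[of _ "\<one>\<^bsub>A\<^esub>"] exI[of _ "\<one>\<^bsub>B\<^esub>"])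
       (use assms in simp)
  then show ?thesis unfolding pure_tensor_def using assms by (intro coset_eqI) auto
qed

lemma tensor_in1_hom: "tensor_in1 R A B \<in> ring_hom A T"
  by (rule ring_hom_memI) (simp_all add: tensor_in1_def pure_add_left pure_mult pure_one)

lemma tensor_in2_hom: "tensor_in2 R A B \<in> ring_hom B T"
  by (rule ring_hom_memI) (simp_all add: tensor_in2_def pure_add_right pure_mult pure_one)

lemma algmap_T: "algmap T r = tensor_in1 R A B (algmap A r)"
  by (simp add: tensor_def tensor_in1_def)

lemma algmap_T2: "r \<in> carrier R \<Longrightarrow> algmap T r = tensor_in2 R A B (algmap B r)"
  by (simp add: algmap_T tensor_in1_def tensor_in2_def pure_balanced)

lemma is_algebra_T: "is_algebra R T"
  unfolding is_algebra_def
proof (intro conjI)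
  have "tensor_in1 R A B \<circ> algmap A \<in> ring_hom R T"
    by (rule ring_hom_trans[OF AB(4) tensor_in1_hom])
  then show "algmap T \<in> ring_hom R T" by (simp add: algmap_T[abs_def] comp_def)
qed (rule R.cring_axioms cring_T)+

lemma pure_eq: 
  assumes "a \<in> carrier A" "b \<in> carrier B"
  shows "pure_tensor R A B a b = tensor_in1 R A B a \<otimes>\<^bsub>T\<^esub> tensor_in2 R A B b"
  using assms by (simp add: tensor_in1_def tensor_in2_def pure_mult)

text \<open>Classes of formal sums of pairs exhaust the tensor product, and a pure tensor is the
  product of its two factors. Agreement on the factors therefore spreads by additivity; the
  uniqueness of \<open>copair\<close> reduces to this.\<close>

lemma tensor_hom_eq:
  assumes C: "ring C" and h: "h \<in> ring_hom T C" "h' \<in> ring_hom T C"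
    and 1: "\<And>a. a \<in> carrier A \<Longrightarrow> h (tensor_in1 R A B a) = h' (tensor_in1 R A B a)"
    and 2: "\<And>b. b \<in> carrier B \<Longrightarrow> h (tensor_in2 R A B b) = h' (tensor_in2 R A B b)"
    and t: "t \<in> carrier T"
  shows "h t = h' t"
proof -
  obtain x where x: "x \<in> carrier S" "t = J +>\<^bsub>S\<^esub> x"
    using t by (auto simp: tensor_def elim: carrier_quotE)
  note c1 = ring_hom_closed[OF tensor_in1_hom] and c2 = ring_hom_closed[OF tensor_in2_hom]
  have "Poly_Mapping.keys x \<subseteq> carrier A \<times> carrier B" using x by simp
  then have "h (J +>\<^bsub>S\<^esub> x) = h' (J +>\<^bsub>S\<^esub> x)"
  proof (induction x rule: frag_ind)
    case zero
    have "J +>\<^bsub>S\<^esub> 0 = \<zero>\<^bsub>T\<^esub>" using ring_hom_zero[OF quot_hom S.ring_axioms T.ring_axioms] by simp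
    then show ?case using ring_hom_zero[OF h(1) T.ring_axioms C] ring_hom_zero[OF h(2) T.ring_axioms C] by simp
  next
    case (diff x y)
    have xy: "x \<in> carrier S" "y \<in> carrier S" using diff by auto
    have "J +>\<^bsub>S\<^esub> (x - y) = (J +>\<^bsub>S\<^esub> x) \<ominus>\<^bsub>T\<^esub> (J +>\<^bsub>S\<^esub> y)"
      using ring_hom_diff[OF quot_hom S.ring_axioms T.ring_axioms xy] diff comm_monoid_prod by simp
    moreover have "J +>\<^bsub>S\<^esub> x \<in> carrier T" "J +>\<^bsub>S\<^esub> y \<in> carrier T"
      using xy by (auto intro: ring_hom_closed[OF quot_hom])
    ultimately show ?case
      using diff.IH ring_hom_diff[OF h(1) T.ring_axioms C] ring_hom_diff[OF h(2) T.ring_axioms C] by metis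
  next
    case (gen z)
    then obtain a b where z: "z = (a, b)" "a \<in> carrier A" "b \<in> carrier B" by auto
    then have "J +>\<^bsub>S\<^esub> frag_of z = tensor_in1 R A B a \<otimes>\<^bsub>T\<^esub> tensor_in2 R A B b"
      using pure_eq by (simp add: pure_tensor_def)
    then show ?case
      using z 1 2 ring_hom_mult[OF h(1) c1 c2] ring_hom_mult[OF h(2) c1 c2] by simp
  qed
  then show ?thesis by (simp add: x)
qed

context
  fixes C :: "('c, 'k) ring_scheme" and x :: "'a \<Rightarrow> 'c" and y :: "'b \<Rightarrow> 'c"
  assumes C: "cring C" and x: "x \<in> ring_hom A C" and y: "y \<in> ring_hom B C"
    and xy: "\<forall>r\<in>carrier R. x (algmap A r) = y (algmap B r)"
begin

lemma copair_frag_eval: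
  "copair C x y t = the_elem (frag_eval C (\<lambda>(a, b). x a \<otimes>\<^bsub>C\<^esub> y b) ` t)"
proof -
  have "frag_eval C (\<lambda>(a, b). x a \<otimes>\<^bsub>C\<^esub> y b) = (\<lambda>c. finsum C
     (\<lambda>(a, b). [(Poly_Mapping.lookup c (a, b))] \<cdot>\<^bsub>C\<^esub> (x a \<otimes>\<^bsub>C\<^esub> y b)) (Poly_Mapping.keys c))"
    unfolding frag_eval_def by (intro ext arg_cong2[where f = "finsum C"]) auto
  then show ?thesis by (simp only: copair_def)
qed

interpretation C: cring C by (rule C)

lemma xy_closed: "a \<in> carrier A \<Longrightarrow> x a \<in> carrier C" "b \<in> carrier B \<Longrightarrow> y b \<in> carrier C"
  using x y by (auto intro: ring_hom_closed)

abbreviation "ev \<equiv> frag_eval C (\<lambda>(a, b). x a \<otimes>\<^bsub>C\<^esub> y b)"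

lemma ev_fun: "(\<lambda>(a, b). x a \<otimes>\<^bsub>C\<^esub> y b) \<in> carrier A \<times> carrier B \<rightarrow> carrier C"
  using xy_closed by auto

lemma ev_hom: "ev \<in> ring_hom S C"
proof (rule frag_eval_ring_hom[OF comm_monoid_prod C])
  fix u v assume "u \<in> carrier (A \<times>\<times> B)" "v \<in> carrier (A \<times>\<times> B)"
  then obtain a b a' b' where u: "u = (a, b)" "v = (a', b')" "a \<in> carrier A" "a' \<in> carrier A" "b \<in> carrier B" "b' \<in> carrier B"
    by auto
  then show "(case u \<otimes>\<^bsub>A \<times>\<times> B\<^esub> v of (a, b) \<Rightarrow> x a \<otimes>\<^bsub>C\<^esub> y b) = (case u of (a, b) \<Rightarrow> x a \<otimes>\<^bsub>C\<^esub> y b) \<otimes>\<^bsub>C\<^esub> (case v of (a, b) \<Rightarrow> x a \<otimes>\<^bsub>C\<^esub> y b)"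
    using xy_closed by (simp add: ring_hom_mult[OF x] ring_hom_mult[OF y] C.m_ac)
qed (use ev_fun ring_hom_one[OF x] ring_hom_one[OF y] in simp_all)

text \<open>The kernel of \<open>ev\<close> is an ideal, so it is enough to check the three families
  of generating relations; the balanced ones are where \<open>xy\<close> enters.\<close>

lemma ev_J: "\<forall>z\<in>J. ev z = \<zero>\<^bsub>C\<^esub>"
proof -
  interpret h: ring_hom_ring S C ev by (intro ring_hom_ringI2 S.ring_axioms C.ring_axioms ev_hom)
  have d: "ev (u - v) = ev u \<ominus>\<^bsub>C\<^esub> ev v" if "Poly_Mapping.keys u \<subseteq> carrier A \<times> carrier B" "Poly_Mapping.keys v \<subseteq> carrier A \<times> carrier B" for u v
    using that by (rule C.frag_eval_diff[OF ev_fun])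
  have f: "ev (frag_of (a, b)) = x a \<otimes>\<^bsub>C\<^esub> y b" if "a \<in> carrier A" "b \<in> carrier B" for a b
    using that xy_closed by simp
  have fk: "Poly_Mapping.keys (frag_of (a, b)) \<subseteq> carrier A \<times> carrier B" if "a \<in> carrier A" "b \<in> carrier B" for a b
    using that by simp
  have c: "(u \<oplus>\<^bsub>C\<^esub> v) \<ominus>\<^bsub>C\<^esub> u \<ominus>\<^bsub>C\<^esub> v = \<zero>\<^bsub>C\<^esub>" if "u \<in> carrier C" "v \<in> carrier C" for u v
    using that by (simp add: C.minus_eq C.a_comm[of u v] C.a_assoc C.r_neg)
  have "J \<subseteq> a_kernel S C ev"
    unfolding tensor_ideal_def
  proof (rule S.genideal_minimal[OF h.kernel_is_ideal], rule subsetI)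
    fix z assume z: "z \<in> tensor_relations R A B"
    then consider a a' b where "z = frag_of (a \<oplus>\<^bsub>A\<^esub> a', b) - frag_of (a, b) - frag_of (a', b)" "a \<in> carrier A" "a' \<in> carrier A" "b \<in> carrier B"
      | a b b' where "z = frag_of (a, b \<oplus>\<^bsub>B\<^esub> b') - frag_of (a, b) - frag_of (a, b')" "a \<in> carrier A" "b \<in> carrier B" "b' \<in> carrier B"
      | r a b where "z = frag_of (algmap A r \<otimes>\<^bsub>A\<^esub> a, b) - frag_of (a, algmap B r \<otimes>\<^bsub>B\<^esub> b)" "r \<in> carrier R" "a \<in> carrier A" "b \<in> carrier B"
      unfolding tensor_relations_def by blast
    then have "ev z = \<zero>\<^bsub>C\<^esub>"
    proof cases
      case 1
      have "ev z = (ev (frag_of (a \<oplus>\<^bsub>A\<^esub> a', b)) \<ominus>\<^bsub>C\<^esub> ev (frag_of (a, b))) \<ominus>\<^bsub>C\<^esub> ev (frag_of (a', b))"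
        unfolding 1(1) using 1(2-4) by (simp only: d keys_sub_Diff fk A.a_closed)
      also have "\<dots> = \<zero>\<^bsub>C\<^esub>"
        using 1(2-4) xy_closed by (simp only: f A.a_closed ring_hom_add[OF x] C.l_distr c C.m_closed)
      finally show ?thesis .
    next
      case 2
      have "ev z = (ev (frag_of (a, b \<oplus>\<^bsub>B\<^esub> b')) \<ominus>\<^bsub>C\<^esub> ev (frag_of (a, b))) \<ominus>\<^bsub>C\<^esub> ev (frag_of (a, b'))"
        unfolding 2(1) using 2(2-4) by (simp only: d keys_sub_Diff fk B.a_closed)
      also have "\<dots> = \<zero>\<^bsub>C\<^esub>"
        using 2(2-4) xy_closed by (simp only: f B.a_closed ring_hom_add[OF y] C.r_distr c C.m_closed)
      finally show ?thesis .
    next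
      case 3
      have "ev z = ev (frag_of (algmap A r \<otimes>\<^bsub>A\<^esub> a, b)) \<ominus>\<^bsub>C\<^esub> ev (frag_of (a, algmap B r \<otimes>\<^bsub>B\<^esub> b))"
        unfolding 3(1) using 3(2-4) by (simp only: d fk A.m_closed B.m_closed algmap_closed)
      also have "ev (frag_of (algmap A r \<otimes>\<^bsub>A\<^esub> a, b)) = ev (frag_of (a, algmap B r \<otimes>\<^bsub>B\<^esub> b))"
        using 3(2-4) xy_closed xy algmap_closed[OF 3(2)]
        by (simp only: f A.m_closed B.m_closed ring_hom_mult[OF x] ring_hom_mult[OF y])
           (simp add: C.m_ac)
      finally show ?thesis
        using 3(2-4) xy_closed algmap_closed[OF 3(2)]
        by (simp only: f B.m_closed C.m_closed C.minus_eq C.r_neg)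
    qed
    then show "z \<in> a_kernel S C ev"
      using subsetD[OF relations_carrier z] unfolding a_kernel_def' by blast
  qed
  then show ?thesis unfolding a_kernel_def' by blast
qed

lemma copair_hom: "copair C x y \<in> ring_hom T C"
  using quot_lift_hom[OF J.ideal_axioms C.ring_axioms ev_hom ev_J]
  by (simp add: copair_frag_eval[abs_def] tensor_def)

lemma copair_coset:
  assumes "c \<in> carrier S"
  shows "copair C x y (J +>\<^bsub>S\<^esub> c) = ev c"
  using the_elem_image_coset[OF J.ideal_axioms C.ring_axioms ev_hom ev_J assms]
  by (simp add: copair_frag_eval)

lemma copair_pure:
  assumes "a \<in> carrier A" "b \<in> carrier B"
  shows "copair C x y (pure_tensor R A B a b) = x a \<otimes>\<^bsub>C\<^esub> y b"
  unfolding pure_tensor_def using assms xy_closed by (subst copair_coset) auto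

lemma copair_in1: "a \<in> carrier A \<Longrightarrow> copair C x y (tensor_in1 R A B a) = x a"
  using xy_closed ring_hom_one[OF y] by (simp add: tensor_in1_def copair_pure)

lemma copair_in2: "b \<in> carrier B \<Longrightarrow> copair C x y (tensor_in2 R A B b) = y b"
  using xy_closed ring_hom_one[OF x] by (simp add: tensor_in2_def copair_pure)

lemma copair_unique:
  assumes h: "h \<in> ring_hom T C"
    and 1: "\<And>a. a \<in> carrier A \<Longrightarrow> h (tensor_in1 R A B a) = x a"
    and 2: "\<And>b. b \<in> carrier B \<Longrightarrow> h (tensor_in2 R A B b) = y b"
    and t: "t \<in> carrier T"
  shows "h t = copair C x y t"
  by (rule tensor_hom_eq[OF C.ring_axioms h copair_hom]) (simp_all add: 1 2 t copair_in1 copair_in2)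

text \<open>Both sides are homomorphisms out of the tensor product with the same restrictions to the
  two factors.\<close>

lemma hom_copair:
  assumes C': "cring C'" and k: "k \<in> ring_hom C C'" and t: "t \<in> carrier T"
  shows "k (copair C x y t) = copair C' (\<lambda>a. k (x a)) (\<lambda>b. k (y b)) t"
proof -
  interpret C': cring C' by fact
  have kx: "(\<lambda>a. k (x a)) \<in> ring_hom A C'" using ring_hom_trans[OF x k] by (simp add: comp_def)
  have ky: "(\<lambda>a. k (y a)) \<in> ring_hom B C'" using ring_hom_trans[OF y k] by (simp add: comp_def)
  have h: "(\<lambda>t. k (copair C x y t)) \<in> ring_hom T C'" using ring_hom_trans[OF copair_hom k] by (simp add: comp_def)
  show ?thesis
    by (rule algebra_pair.copair_unique[OF algebra_pair_axioms C' kx ky _ h])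
      (simp_all add: xy t copair_in1 copair_in2)
qed

end

end

section \<open>Points of group schemes\<close>

locale group_scheme =
  fixes R :: "'r ring" and G :: "('r, 'a, 'm) hopf_scheme"
  assumes group_scheme: "affine_group_scheme R G"
begin

lemma is_algebra_G: "is_algebra R G"
  using group_scheme by (simp add: affine_group_scheme_def)

lemma comult_hom: "comult G \<in> ring_hom G (tensor R G G)"
  and comult_algmap: "r \<in> carrier R \<Longrightarrow> comult G (algmap G r) = algmap (tensor R G G) r"
  using group_scheme by (auto simp: affine_group_scheme_def alg_hom_def)

lemma counit_hom: "counit G \<in> ring_hom G R"
  and counit_algmap: "r \<in> carrier R \<Longrightarrow> counit G (algmap G r) = r"
  using group_scheme by (auto simp: affine_group_scheme_def alg_hom_def)

lemma antipode_hom: "antipode G \<in> ring_hom G G"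
  and antipode_algmap: "r \<in> carrier R \<Longrightarrow> antipode G (algmap G r) = algmap G r"
  using group_scheme by (auto simp: affine_group_scheme_def alg_hom_def)

sublocale G2: algebra_pair R G G
  using is_algebra_G by unfold_locales

abbreviation "T2 \<equiv> tensor R G G"
abbreviation "T3 \<equiv> tensor R T2 G"

sublocale G3: algebra_pair R T2 G
  using is_algebra_G G2.is_algebra_T by unfold_locales

lemma comult_closed: "a \<in> carrier G \<Longrightarrow> comult G a \<in> carrier T2"
  by (rule ring_hom_closed[OF comult_hom])

lemma counit_closed [simp]: "a \<in> carrier G \<Longrightarrow> counit G a \<in> carrier R"
  by (rule ring_hom_closed[OF counit_hom])

lemma antipode_closed [simp]: "a \<in> carrier G \<Longrightarrow> antipode G a \<in> carrier G"
  by (rule ring_hom_closed[OF antipode_hom])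

text \<open>A \<open>C\<close>-valued point of \<open>G\<close>. The structure map
  \<open>\<kappa>\<close> is a separate argument because \<open>C\<close> is often a ring without
  \<open>algmap\<close>, such as an idealization.\<close>

definition is_point :: "('c, 'k) ring_scheme \<Rightarrow> ('r \<Rightarrow> 'c) \<Rightarrow> ('a \<Rightarrow> 'c) \<Rightarrow> bool" where
  "is_point C \<kappa> x \<longleftrightarrow> x \<in> ring_hom G C \<and> (\<forall>r\<in>carrier R. x (algmap G r) = \<kappa> r)"

lemma is_pointD: "is_point C \<kappa> x \<Longrightarrow> x \<in> ring_hom G C" "is_point C \<kappa> x \<Longrightarrow> r \<in> carrier R \<Longrightarrow> x (algmap G r) = \<kappa> r"
  by (auto simp: is_point_def)

lemma is_point_agree: "is_point C \<kappa> x \<Longrightarrow> is_point C \<kappa> y \<Longrightarrow> \<forall>r\<in>carrier R. x (algmap G r) = y (algmap G r)"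
  by (auto simp: is_point_def)

lemma is_point_hom:
  assumes "is_point C \<kappa> x" "k \<in> ring_hom C C'"
  shows "is_point C' (\<lambda>r. k (\<kappa> r)) (\<lambda>a. k (x a))"
  using assms ring_hom_trans[of x G C k C'] by (auto simp: is_point_def comp_def)

lemma is_point_antipode:
  assumes "is_point C \<kappa> x"
  shows "is_point C \<kappa> (\<lambda>a. x (antipode G a))"
  using assms ring_hom_trans[OF antipode_hom, of x C] antipode_algmap by (auto simp: is_point_def comp_def)

lemma is_point_counit:
  assumes "\<kappa> \<in> ring_hom R C"
  shows "is_point C \<kappa> (\<lambda>a. \<kappa> (counit G a))"
  using assms ring_hom_trans[OF counit_hom, of \<kappa> C] counit_algmap by (auto simp: is_point_def comp_def)

lemma conv_point:
  assumes C: "cring C" and x: "is_point C \<kappa> x" and y: "is_point C \<kappa> y"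
  shows "is_point C \<kappa> (conv G C x y)"
proof -
  have h: "copair C x y \<in> ring_hom T2 C"
    by (rule G2.copair_hom[OF C is_pointD(1)[OF x] is_pointD(1)[OF y] is_point_agree[OF x y]])
  have "conv G C x y (algmap G r) = \<kappa> r" if "r \<in> carrier R" for r
    using that by (simp add: conv_def comult_algmap G2.algmap_T
        G2.copair_in1[OF C is_pointD(1)[OF x] is_pointD(1)[OF y] is_point_agree[OF x y]] is_pointD(2)[OF x])
  then show ?thesis
    using ring_hom_trans[OF comult_hom h] by (simp add: is_point_def comp_def conv_def[abs_def])
qed

text \<open>The functions \<open>x\<close> and \<open>x'\<close> may differ outside the carrier of
  \<open>G\<close>, and \<open>copair\<close> takes them apart elementwise; equality on the carrier
  is transported through the uniqueness of \<open>copair\<close>.\<close>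

lemma conv_cong:
  assumes C: "cring C" and x: "is_point C \<kappa> x" and y: "is_point C \<kappa> y"
    and x': "is_point C \<kappa> x'" and y': "is_point C \<kappa> y'"
    and "\<And>a. a \<in> carrier G \<Longrightarrow> x a = x' a" "\<And>a. a \<in> carrier G \<Longrightarrow> y a = y' a" and a: "a \<in> carrier G"
  shows "conv G C x y a = conv G C x' y' a"
  unfolding conv_def
proof (rule G2.copair_unique[OF C is_pointD(1)[OF x'] is_pointD(1)[OF y'] is_point_agree[OF x' y']])
  show "copair C x y \<in> ring_hom T2 C"
    by (rule G2.copair_hom[OF C is_pointD(1)[OF x] is_pointD(1)[OF y] is_point_agree[OF x y]])
qed (simp_all add: assms comult_closed
  G2.copair_in1[OF C is_pointD(1)[OF x] is_pointD(1)[OF y] is_point_agree[OF x y]]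
  G2.copair_in2[OF C is_pointD(1)[OF x] is_pointD(1)[OF y] is_point_agree[OF x y]])

lemma hom_conv:
  assumes C: "cring C" and C': "cring C'" and x: "is_point C \<kappa> x" and y: "is_point C \<kappa> y"
    and k: "k \<in> ring_hom C C'" and a: "a \<in> carrier G"
  shows "k (conv G C x y a) = conv G C' (\<lambda>a. k (x a)) (\<lambda>a. k (y a)) a"
  unfolding conv_def
  by (rule G2.hom_copair[OF C is_pointD(1)[OF x] is_pointD(1)[OF y] is_point_agree[OF x y] C' k comult_closed[OF a]])

lemma hom_comult:
  assumes C: "cring C" and k: "k \<in> ring_hom T2 C" and a: "a \<in> carrier G"
    and x: "is_point C \<kappa> x" and y: "is_point C \<kappa> y"
    and 1: "\<And>a. a \<in> carrier G \<Longrightarrow> k (tensor_in1 R G G a) = x a"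
    and 2: "\<And>a. a \<in> carrier G \<Longrightarrow> k (tensor_in2 R G G a) = y a"
  shows "k (comult G a) = conv G C x y a"
  unfolding conv_def
  by (rule G2.copair_unique[OF C is_pointD(1)[OF x] is_pointD(1)[OF y] is_point_agree[OF x y] k 1 2 comult_closed[OF a]])

text \<open>Three points are one homomorphism \<open>k\<close> from the triple tensor product, and
  coassociativity is postulated for the three universal points there. Applying \<open>k\<close>
  carries it over to \<open>x\<close>, \<open>y\<close>, \<open>z\<close>.\<close>

lemma conv_assoc:
  assumes C: "cring C" and x: "is_point C \<kappa> x" and y: "is_point C \<kappa> y" and z: "is_point C \<kappa> z"
    and a: "a \<in> carrier G"
  shows "conv G C (conv G C x y) z a = conv G C x (conv G C y z) a"
proof -
  define j1 where "j1 = (\<lambda>a. tensor_in1 R T2 G (tensor_in1 R G G a))"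
  define j2 where "j2 = (\<lambda>a. tensor_in1 R T2 G (tensor_in2 R G G a))"
  define j3 where "j3 = tensor_in2 R T2 G"
  define k where "k = copair C (copair C x y) z"
  have ax: "conv G T3 (conv G T3 j1 j2) j3 a = conv G T3 j1 (conv G T3 j2 j3) a"
    using group_scheme a by (simp add: affine_group_scheme_def Let_def j1_def j2_def j3_def)
  note T3 = G3.cring_T
  have p1: "is_point T3 (algmap T3) j1"
    using ring_hom_trans[OF G2.tensor_in1_hom G3.tensor_in1_hom]
    by (auto simp: is_point_def j1_def comp_def G3.algmap_T G2.algmap_T)
  have p2: "is_point T3 (algmap T3) j2"
    using ring_hom_trans[OF G2.tensor_in2_hom G3.tensor_in1_hom]
    by (auto simp: is_point_def j2_def comp_def G3.algmap_T G2.algmap_T2)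
  have p3: "is_point T3 (algmap T3) j3"
    using G3.tensor_in2_hom by (auto simp: is_point_def j3_def G3.algmap_T2)
  note xy = C is_pointD(1)[OF x] is_pointD(1)[OF y] is_point_agree[OF x y]
  note hxy = G2.copair_hom[OF xy]
  have ag: "\<forall>r\<in>carrier R. copair C x y (algmap T2 r) = z (algmap G r)"
    by (auto simp: G2.algmap_T G2.copair_in1[OF xy] is_pointD(2)[OF x] is_pointD(2)[OF z])
  note kk = C hxy is_pointD(1)[OF z] ag
  have k: "k \<in> ring_hom T3 C" unfolding k_def by (rule G3.copair_hom[OF kk])
  have k1: "k (j1 b) = x b" if "b \<in> carrier G" for b
    using that ring_hom_closed[OF G2.tensor_in1_hom that]
    by (simp add: k_def j1_def G3.copair_in1[OF kk] G2.copair_in1[OF xy])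
  have k2: "k (j2 b) = y b" if "b \<in> carrier G" for b
    using that ring_hom_closed[OF G2.tensor_in2_hom that]
    by (simp add: k_def j2_def G3.copair_in1[OF kk] G2.copair_in2[OF xy])
  have k3: "k (j3 b) = z b" if "b \<in> carrier G" for b
    using that by (simp add: k_def j3_def G3.copair_in2[OF kk])
  have k\<kappa>: "\<forall>r\<in>carrier R. k (algmap T3 r) = \<kappa> r"
    using k1 by (auto simp: is_pointD(2)[OF p1, symmetric] is_pointD(2)[OF x])
  have P: "is_point C \<kappa> (\<lambda>a. k (j a))" if "is_point T3 (algmap T3) j" for j
    using is_point_hom[OF that k] k\<kappa> by (auto simp: is_point_def)
  have n: "k (conv G T3 j j' b) = conv G C (\<lambda>a. k (j a)) (\<lambda>a. k (j' a)) b"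
    if "is_point T3 (algmap T3) j" "is_point T3 (algmap T3) j'" "b \<in> carrier G" for j j' b
    by (rule hom_conv[OF T3 C that(1,2) k that(3)])
  note c = conv_point[OF T3] and cC = conv_point[OF C]
  have n12: "k (conv G T3 j1 j2 b) = conv G C x y b" if "b \<in> carrier G" for b
    unfolding n[OF p1 p2 that] by (rule conv_cong[OF C P[OF p1] P[OF p2] x y k1 k2 that])
  have n23: "k (conv G T3 j2 j3 b) = conv G C y z b" if "b \<in> carrier G" for b
    unfolding n[OF p2 p3 that] by (rule conv_cong[OF C P[OF p2] P[OF p3] y z k2 k3 that])
  have "k (conv G T3 (conv G T3 j1 j2) j3 a) = conv G C (conv G C x y) z a"
    unfolding n[OF c[OF p1 p2] p3 a]
    by (rule conv_cong[OF C P[OF c[OF p1 p2]] P[OF p3] cC[OF x y] z n12 k3 a])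
  moreover have "k (conv G T3 j1 (conv G T3 j2 j3) a) = conv G C x (conv G C y z) a"
    unfolding n[OF p1 c[OF p2 p3] a]
    by (rule conv_cong[OF C P[OF p1] P[OF c[OF p2 p3]] x cC[OF y z] k1 n23 a])
  ultimately show ?thesis using ax by simp
qed

lemma point_id: "is_point G (algmap G) (\<lambda>a. a)"
  using G2.AB by (auto simp: is_point_def ring_hom_def)

lemma point_const: "is_point G (algmap G) (\<lambda>a. algmap G (counit G a))"
  by (rule is_point_counit[OF G2.AB(4)])

lemma hopf_axioms:
  assumes "a \<in> carrier G"
  shows "conv G G (\<lambda>a. algmap G (counit G a)) (\<lambda>a. a) a = a"
    "conv G G (\<lambda>a. a) (\<lambda>a. algmap G (counit G a)) a = a"
    "conv G G (antipode G) (\<lambda>a. a) a = algmap G (counit G a)"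
    "conv G G (\<lambda>a. a) (antipode G) a = algmap G (counit G a)"
  using group_scheme assms by (simp_all add: affine_group_scheme_def Let_def)

context
  fixes C :: "('c, 'k) ring_scheme" and \<kappa> :: "'r \<Rightarrow> 'c" and x :: "'a \<Rightarrow> 'c"
  assumes C: "cring C" and x: "is_point C \<kappa> x"
begin

lemma hom_conv_point:
  assumes "is_point G (algmap G) u" "is_point G (algmap G) v" "a \<in> carrier G"
  shows "x (conv G G u v a) = conv G C (\<lambda>a. x (u a)) (\<lambda>a. x (v a)) a"
  by (rule hom_conv[OF G2.A.cring_axioms C assms(1,2) is_pointD(1)[OF x] assms(3)])

lemma point_algmap: "a \<in> carrier G \<Longrightarrow> x (algmap G (counit G a)) = \<kappa> (counit G a)"
  by (rule is_pointD(2)[OF x counit_closed])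

text \<open>The homomorphism property comes from \<open>x\<close>: on the carrier of
  \<open>R\<close> the map \<open>\<kappa>\<close> is \<open>x\<close> after
  \<open>algmap G\<close>.\<close>

lemma kappa_counit_point: "is_point C \<kappa> (\<lambda>a. \<kappa> (counit G a))"
proof -
  have "is_point C \<kappa> (\<lambda>a. x (algmap G (counit G a)))"
    using is_point_hom[OF point_const is_pointD(1)[OF x]] is_pointD(2)[OF x] by (auto simp: is_point_def)
  moreover have "is_point C \<kappa> f" if "is_point C \<kappa> g" "\<And>a. a \<in> carrier G \<Longrightarrow> f a = g a" for f g
    using that G2.algmap_closed unfolding is_point_def ring_hom_def by (auto simp: Pi_iff)
  ultimately show ?thesis using point_algmap by metis
qed

lemma conv_unit_left: "a \<in> carrier G \<Longrightarrow> conv G C (\<lambda>a. \<kappa> (counit G a)) x a = x a"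
  using hom_conv_point[OF point_const point_id, of a]
    conv_cong[OF C kappa_counit_point x _ x point_algmap[symmetric] refl, of a] 
    is_point_hom[OF point_const is_pointD(1)[OF x]] is_pointD(2)[OF x]
  by (simp add: hopf_axioms is_point_def)

lemma conv_antipode_left: "a \<in> carrier G \<Longrightarrow> conv G C (\<lambda>a. x (antipode G a)) x a = \<kappa> (counit G a)"
  using hom_conv_point[OF is_point_antipode[OF point_id] point_id, of a] by (simp add: hopf_axioms point_algmap)

lemma conv_antipode_right: "a \<in> carrier G \<Longrightarrow> conv G C x (\<lambda>a. x (antipode G a)) a = \<kappa> (counit G a)"
  using hom_conv_point[OF point_id is_point_antipode[OF point_id], of a] by (simp add: hopf_axioms point_algmap)

end

lemma conv_cancel_left:
  assumes C: "cring C" and x: "is_point C \<kappa> x" and y: "is_point C \<kappa> y" and a: "a \<in> carrier G"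
  shows "conv G C (\<lambda>a. x (antipode G a)) (conv G C x y) a = y a"
    "conv G C x (conv G C (\<lambda>a. x (antipode G a)) y) a = y a"
proof -
  note x' = is_point_antipode[OF x]
  show "conv G C (\<lambda>a. x (antipode G a)) (conv G C x y) a = y a"
    unfolding conv_assoc[OF C x' x y a, symmetric] conv_unit_left[OF C y a, symmetric]
    by (rule conv_cong[OF C conv_point[OF C x' x] y kappa_counit_point[OF C x] y conv_antipode_left[OF C x] refl a])
  show "conv G C x (conv G C (\<lambda>a. x (antipode G a)) y) a = y a"
    unfolding conv_assoc[OF C x x' y a, symmetric] conv_unit_left[OF C y a, symmetric]
    by (rule conv_cong[OF C conv_point[OF C x x'] y kappa_counit_point[OF C x] y conv_antipode_right[OF C x] refl a])
qed

text \<open>In group notation, (xy)^-1 (xz) = y^-1 z: write z = y (y^-1 z), reassociate, and cancel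
  xy. This is the computation behind the left invariance of the Maurer-Cartan forms.\<close>

lemma conv_left_quotient:
  assumes C: "cring C" and x: "is_point C \<kappa> x" and y: "is_point C \<kappa> y" and z: "is_point C \<kappa> z"
    and a: "a \<in> carrier G"
  shows "conv G C (\<lambda>a. conv G C x y (antipode G a)) (conv G C x z) a = conv G C (\<lambda>a. y (antipode G a)) z a"
proof -
  note y' = is_point_antipode[OF y]
  note xy = conv_point[OF C x y] and y'z = conv_point[OF C y' z]
  have "conv G C x z b = conv G C (conv G C x y) (conv G C (\<lambda>a. y (antipode G a)) z) b" if "b \<in> carrier G" for b
    unfolding conv_assoc[OF C x y y'z that]
    by (rule conv_cong[OF C x z x conv_point[OF C y y'z] refl conv_cancel_left(2)[OF C y z, symmetric] that])
  then have "conv G C (\<lambda>a. conv G C x y (antipode G a)) (conv G C x z) a =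
    conv G C (\<lambda>a. conv G C x y (antipode G a)) (conv G C (conv G C x y) (conv G C (\<lambda>a. y (antipode G a)) z)) a"
    by (intro conv_cong[OF C is_point_antipode[OF xy] conv_point[OF C x z] is_point_antipode[OF xy]
          conv_point[OF C xy y'z] refl _ a])
  also have "\<dots> = conv G C (\<lambda>a. y (antipode G a)) z a"
    by (rule conv_cancel_left(1)[OF C xy y'z a])
  finally show ?thesis .
qed

lemma comult_repE:
  assumes "a \<in> carrier G"
  obtains c where "Poly_Mapping.keys c \<subseteq> carrier G \<times> carrier G"
    "comult G a = G2.J +>\<^bsub>G2.S\<^esub> c"
proof -
  from comult_closed[OF assms] have "comult G a \<in> carrier (G2.S Quot G2.J)" by (simp add: tensor_def)
  then obtain c where "c \<in> carrier G2.S" "comult G a = G2.J +>\<^bsub>G2.S\<^esub> c" by (rule carrier_quotE)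
  then show ?thesis using that by simp
qed

text \<open>Passage from points to explicit sums: with a representative of the coproduct, a product
  of points becomes a finite sum that can be compared with a differential form.\<close>

lemma conv_rep:
  assumes C: "cring C" and x: "is_point C \<kappa> x" and y: "is_point C \<kappa> y"
    and "Poly_Mapping.keys c \<subseteq> carrier G \<times> carrier G" "comult G a = G2.J +>\<^bsub>G2.S\<^esub> c"
  shows "conv G C x y a = frag_eval C (\<lambda>(a, b). x a \<otimes>\<^bsub>C\<^esub> y b) c"
  unfolding conv_def assms(5) using assms(4)
  by (intro G2.copair_coset[OF C is_pointD(1)[OF x] is_pointD(1)[OF y] is_point_agree[OF x y]]) simp

end

section \<open>Kaehler differentials\<close>

lemma frag_map_of [simp]: "frag_map h (frag_of x) = frag_of (h x)"
  by (simp add: frag_map_def)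

lemma frag_map_diff: "frag_map h (c - d) = frag_map h c - frag_map h d"
  by (simp add: frag_map_def frag_extend_diff)

lemma frag_map_add: "frag_map h (c + d) = frag_map h c + frag_map h d"
  by (simp add: frag_map_def frag_extend_add)

lemma frag_map_0 [simp]: "frag_map h 0 = 0"
  by (simp add: frag_map_def)

lemma keys_frag_map: "Poly_Mapping.keys c \<subseteq> Y \<Longrightarrow> h ` Y \<subseteq> Z \<Longrightarrow> Poly_Mapping.keys (frag_map h c) \<subseteq> Z"
  unfolding frag_map_def by (rule order_trans[OF keys_frag_extend]) (auto simp: keys_frag_of)

text \<open>The generating set inside \<open>kaehler_relations\<close>, named so that inductions
  over the subgroup can distinguish the four kinds of relations.\<close>

definition kaehler_gens :: "('s, 'm) ring_scheme \<Rightarrow> 's set \<Rightarrow> ('s \<times> 's \<Rightarrow>\<^sub>0 int) set" where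
  "kaehler_gens S K =
     {frag_of (a \<oplus>\<^bsub>S\<^esub> a', b) - frag_of (a, b) - frag_of (a', b) | a a' b.
         a \<in> carrier S \<and> a' \<in> carrier S \<and> b \<in> carrier S} \<union>
      {frag_of (a, b \<oplus>\<^bsub>S\<^esub> c) - frag_of (a, b) - frag_of (a, c) | a b c.
         a \<in> carrier S \<and> b \<in> carrier S \<and> c \<in> carrier S} \<union>
      {frag_of (a, b \<otimes>\<^bsub>S\<^esub> c) - frag_of (a \<otimes>\<^bsub>S\<^esub> b, c) - frag_of (a \<otimes>\<^bsub>S\<^esub> c, b) | a b c.
         a \<in> carrier S \<and> b \<in> carrier S \<and> c \<in> carrier S} \<union>
      {frag_of (a, k) | a k. a \<in> carrier S \<and> k \<in> K}"

lemma kaehler_gensE [consumes 1, case_names add_left add_right leibniz const]: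
  assumes "x \<in> kaehler_gens S K"
  obtains a a' b where "x = frag_of (a \<oplus>\<^bsub>S\<^esub> a', b) - frag_of (a, b) - frag_of (a', b)"
      "a \<in> carrier S" "a' \<in> carrier S" "b \<in> carrier S"
    | a b c where "x = frag_of (a, b \<oplus>\<^bsub>S\<^esub> c) - frag_of (a, b) - frag_of (a, c)"
      "a \<in> carrier S" "b \<in> carrier S" "c \<in> carrier S"
    | a b c where "x = frag_of (a, b \<otimes>\<^bsub>S\<^esub> c) - frag_of (a \<otimes>\<^bsub>S\<^esub> b, c) - frag_of (a \<otimes>\<^bsub>S\<^esub> c, b)"
      "a \<in> carrier S" "b \<in> carrier S" "c \<in> carrier S"
    | a k where "x = frag_of (a, k)" "a \<in> carrier S" "k \<in> K"
  using assms unfolding kaehler_gens_def by blast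

lemma kaehler_gensI:
  "a \<in> carrier S \<Longrightarrow> a' \<in> carrier S \<Longrightarrow> b \<in> carrier S \<Longrightarrow>
    frag_of (a \<oplus>\<^bsub>S\<^esub> a', b) - frag_of (a, b) - frag_of (a', b) \<in> kaehler_gens S K"
  "a \<in> carrier S \<Longrightarrow> b \<in> carrier S \<Longrightarrow> c \<in> carrier S \<Longrightarrow>
    frag_of (a, b \<oplus>\<^bsub>S\<^esub> c) - frag_of (a, b) - frag_of (a, c) \<in> kaehler_gens S K"
  "a \<in> carrier S \<Longrightarrow> b \<in> carrier S \<Longrightarrow> c \<in> carrier S \<Longrightarrow>
    frag_of (a, b \<otimes>\<^bsub>S\<^esub> c) - frag_of (a \<otimes>\<^bsub>S\<^esub> b, c) - frag_of (a \<otimes>\<^bsub>S\<^esub> c, b) \<in> kaehler_gens S K"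
  "a \<in> carrier S \<Longrightarrow> k \<in> K \<Longrightarrow> frag_of (a, k) \<in> kaehler_gens S K"
  unfolding kaehler_gens_def by blast+

lemma kaehler_relations_gens: "kaehler_relations S K = generate (kaehler_free S) (kaehler_gens S K)"
  by (simp add: kaehler_relations_def kaehler_gens_def)

definition kcls :: "('s, 'm) ring_scheme \<Rightarrow> 's set \<Rightarrow> ('s \<times> 's \<Rightarrow>\<^sub>0 int) \<Rightarrow> ('s \<times> 's \<Rightarrow>\<^sub>0 int) set" where
  "kcls S K c = kaehler_relations S K #>\<^bsub>kaehler_free S\<^esub> c"

abbreviation form :: "('s, 'm) ring_scheme \<Rightarrow> 's set \<Rightarrow> 's \<Rightarrow> 's \<Rightarrow> ('s \<times> 's \<Rightarrow>\<^sub>0 int) set" where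
  "form S K a b \<equiv> kcls S K (frag_of (a, b))"

locale kaehler_base = cring S for S (structure) +
  fixes K assumes K: "K \<subseteq> carrier S"
begin

abbreviation "F \<equiv> kaehler_free S"
abbreviation "N \<equiv> kaehler_relations S K"
abbreviation "\<Omega> \<equiv> kaehler S K"

lemma F_simps [simp]: "carrier F = {c. Poly_Mapping.keys c \<subseteq> carrier S \<times> carrier S}"
  "x \<otimes>\<^bsub>F\<^esub> y = x + y" "\<one>\<^bsub>F\<^esub> = 0"
  by (auto simp: kaehler_free_def)

sublocale F: comm_group F
  unfolding kaehler_free_def by (rule abelian_free_Abelian_group)

lemma F_inv: "c \<in> carrier F \<Longrightarrow> inv\<^bsub>F\<^esub> c = - c"
  by (simp add: kaehler_free_def)

lemma keys_diff_subset: "Poly_Mapping.keys x \<subseteq> Z \<Longrightarrow> Poly_Mapping.keys y \<subseteq> Z \<Longrightarrow> Poly_Mapping.keys (x - y) \<subseteq> Z"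
  using keys_diff[of x y] by blast

lemma gens_carrier: "kaehler_gens S K \<subseteq> carrier F"
proof
  fix x assume "x \<in> kaehler_gens S K"
  then show "x \<in> carrier F"
    by (cases rule: kaehler_gensE)
      (simp only: F_simps mem_Collect_eq, (intro keys_diff_subset)?; use K in \<open>auto simp: keys_frag_of\<close>)+
qed

lemma N_subgroup: "subgroup N F"
  unfolding kaehler_relations_gens by (rule F.generate_is_subgroup[OF gens_carrier])

sublocale N: normal N F
  by (rule F.subgroup_imp_normal[OF N_subgroup])

lemma gens_N: "x \<in> kaehler_gens S K \<Longrightarrow> x \<in> N"
  unfolding kaehler_relations_gens by (rule generate.incl)

lemma N_keys: "c \<in> N \<Longrightarrow> Poly_Mapping.keys c \<subseteq> carrier S \<times> carrier S"
  using N.subset by auto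

text \<open>Closure under differences, together with 0, already gives inverses and sums, so the
  elements with \<open>P\<close> form a subgroup.\<close>

lemma N_induct [consumes 1, case_names zero diff gens]:
  assumes "c \<in> N" and "P 0"
    and "\<And>c d. Poly_Mapping.keys c \<subseteq> carrier S \<times> carrier S \<Longrightarrow> Poly_Mapping.keys d \<subseteq> carrier S \<times> carrier S \<Longrightarrow> P c \<Longrightarrow> P d \<Longrightarrow> P (c - d)"
    and "\<And>c. c \<in> kaehler_gens S K \<Longrightarrow> P c"
  shows "P c"
proof -
  let ?H = "{c. Poly_Mapping.keys c \<subseteq> carrier S \<times> carrier S \<and> P c}"
  have neg: "P (- c)" if "Poly_Mapping.keys c \<subseteq> carrier S \<times> carrier S" "P c" for c
    using assms(3)[of 0 c] that assms(2) by simp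
  have "subgroup ?H F"
  proof (rule F.subgroupI)
    show "?H \<noteq> {}" using assms(2) by (auto intro!: exI[of _ 0])
    fix a assume a: "a \<in> ?H"
    then have "a \<in> carrier F" by simp
    then show "inv\<^bsub>F\<^esub> a \<in> ?H" using a neg by (simp only: F_inv) simp
    fix b assume b: "b \<in> ?H"
    then show "a \<otimes>\<^bsub>F\<^esub> b \<in> ?H"
      using a assms(3)[of a "- b"] neg[of b] keys_add_subset[of a _ b] by simp
  qed auto
  moreover have "kaehler_gens S K \<subseteq> ?H" using assms(4) gens_carrier by auto
  ultimately have "N \<subseteq> ?H"
    unfolding kaehler_relations_gens by (rule F.generate_subgroup_incl[rotated])
  then show ?thesis using assms(1) by blast
qed

lemma kcls_add:
  assumes "Poly_Mapping.keys c \<subseteq> carrier S \<times> carrier S" "Poly_Mapping.keys d \<subseteq> carrier S \<times> carrier S"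
  shows "kcls S K c \<oplus>\<^bsub>\<Omega>\<^esub> kcls S K d = kcls S K (c + d)"
  using N.rcos_sum[of c d] assms by (simp add: kcls_def kaehler_def)

lemma kcls_zero: "\<zero>\<^bsub>\<Omega>\<^esub> = kcls S K 0"
  using F.coset_mult_one[OF N.subset] by (simp add: kcls_def kaehler_def)

lemma kcls_closed: "Poly_Mapping.keys c \<subseteq> carrier S \<times> carrier S \<Longrightarrow> kcls S K c \<in> carrier \<Omega>"
  by (auto simp: kcls_def kaehler_def RCOSETS_def)

lemma kclsE:
  assumes "\<omega> \<in> carrier \<Omega>"
  obtains c where "Poly_Mapping.keys c \<subseteq> carrier S \<times> carrier S" "\<omega> = kcls S K c"
  using assms by (auto simp: kcls_def kaehler_def RCOSETS_def)

lemma kcls_eqI: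
  assumes c: "Poly_Mapping.keys c \<subseteq> carrier S \<times> carrier S" and d: "Poly_Mapping.keys d \<subseteq> carrier S \<times> carrier S"
    and "c - d \<in> N"
  shows "kcls S K c = kcls S K d"
proof -
  have "c \<in> N #>\<^bsub>F\<^esub> d"
    unfolding r_coset_def using assms(3) by (auto intro!: bexI[of _ "c - d"])
  then show ?thesis
    using F.repr_independence[of c N d] d N_subgroup by (simp add: kcls_def)
qed

lemma abelian_group_kaehler: "abelian_group \<Omega>"
proof (rule abelian_groupI)
  show "\<zero>\<^bsub>\<Omega>\<^esub> \<in> carrier \<Omega>" by (simp add: kcls_zero kcls_closed)
next
  fix x y assume "x \<in> carrier \<Omega>" "y \<in> carrier \<Omega>"
  then obtain c d where c: "Poly_Mapping.keys c \<subseteq> carrier S \<times> carrier S" "x = kcls S K c"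
    and d: "Poly_Mapping.keys d \<subseteq> carrier S \<times> carrier S" "y = kcls S K d" by (metis kclsE)
  show "x \<oplus>\<^bsub>\<Omega>\<^esub> y \<in> carrier \<Omega>" using c d by (simp add: kcls_add kcls_closed keys_add_subset)
  show "x \<oplus>\<^bsub>\<Omega>\<^esub> y = y \<oplus>\<^bsub>\<Omega>\<^esub> x" using c d by (simp add: kcls_add add.commute)
  fix z assume "z \<in> carrier \<Omega>"
  then obtain e where e: "Poly_Mapping.keys e \<subseteq> carrier S \<times> carrier S" "z = kcls S K e" by (metis kclsE)
  show "(x \<oplus>\<^bsub>\<Omega>\<^esub> y) \<oplus>\<^bsub>\<Omega>\<^esub> z = x \<oplus>\<^bsub>\<Omega>\<^esub> (y \<oplus>\<^bsub>\<Omega>\<^esub> z)"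
    using c d e by (simp add: kcls_add keys_add_subset add.assoc)
next
  fix x assume "x \<in> carrier \<Omega>"
  then obtain c where c: "Poly_Mapping.keys c \<subseteq> carrier S \<times> carrier S" "x = kcls S K c" by (metis kclsE)
  show "\<zero>\<^bsub>\<Omega>\<^esub> \<oplus>\<^bsub>\<Omega>\<^esub> x = x" using c by (simp add: kcls_zero kcls_add)
  show "\<exists>y\<in>carrier \<Omega>. y \<oplus>\<^bsub>\<Omega>\<^esub> x = \<zero>\<^bsub>\<Omega>\<^esub>"
    using c kcls_closed[of "- c"] kcls_add[of "- c" c] by (auto simp: kcls_zero)
qed

sublocale \<Omega>: abelian_group \<Omega> by (rule abelian_group_kaehler)

lemma kcls_diff:
  assumes c: "Poly_Mapping.keys c \<subseteq> carrier S \<times> carrier S" and d: "Poly_Mapping.keys d \<subseteq> carrier S \<times> carrier S"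
  shows "kcls S K (c - d) = kcls S K c \<ominus>\<^bsub>\<Omega>\<^esub> kcls S K d"
proof -
  have "kcls S K (- d) \<oplus>\<^bsub>\<Omega>\<^esub> kcls S K d = \<zero>\<^bsub>\<Omega>\<^esub>"
    using d by (simp add: kcls_add kcls_zero)
  then have "kcls S K (- d) = \<ominus>\<^bsub>\<Omega>\<^esub> kcls S K d"
    using d kcls_closed[of d] kcls_closed[of "- d"] \<Omega>.minus_equality by simp
  then show ?thesis using kcls_add[of c "- d"] c d by (simp add: \<Omega>.minus_eq)
qed

lemma kaehler_induct [consumes 1, case_names zero diff form]:
  assumes "\<omega> \<in> carrier \<Omega>" and 0: "P \<zero>\<^bsub>\<Omega>\<^esub>"
    and d: "\<And>\<omega> \<eta>. \<omega> \<in> carrier \<Omega> \<Longrightarrow> \<eta> \<in> carrier \<Omega> \<Longrightarrow> P \<omega> \<Longrightarrow> P \<eta> \<Longrightarrow> P (\<omega> \<ominus>\<^bsub>\<Omega>\<^esub> \<eta>)"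
    and f: "\<And>a b. a \<in> carrier S \<Longrightarrow> b \<in> carrier S \<Longrightarrow> P (form S K a b)"
  shows "P \<omega>"
proof -
  obtain c where c: "Poly_Mapping.keys c \<subseteq> carrier S \<times> carrier S" "\<omega> = kcls S K c"
    using assms(1) by (rule kclsE)
  from c(1) have "P (kcls S K c)"
  proof (induction c rule: frag_ind)
    case zero
    then show ?case using 0 by (simp add: kcls_zero)
  next
    case (diff x y)
    then show ?case unfolding kcls_diff[OF diff(1,2)] by (intro d kcls_closed)
  next
    case (gen z)
    then show ?case using f by auto
  qed
  then show ?thesis using c by simp
qed

lemma form_closed: "a \<in> carrier S \<Longrightarrow> b \<in> carrier S \<Longrightarrow> form S K a b \<in> carrier \<Omega>"
  by (rule kcls_closed) simp

lemma keys_pair: "a \<in> carrier S \<Longrightarrow> b \<in> carrier S \<Longrightarrow> Poly_Mapping.keys (frag_of (a, b)) \<subseteq> carrier S \<times> carrier S"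
  by simp

lemma form_add_left:
  assumes "a \<in> carrier S" "a' \<in> carrier S" "b \<in> carrier S"
  shows "form S K (a \<oplus> a') b = form S K a b \<oplus>\<^bsub>\<Omega>\<^esub> form S K a' b"
proof -
  have "kcls S K (frag_of (a \<oplus> a', b)) = kcls S K (frag_of (a, b) + frag_of (a', b))"
    using assms gens_N[OF kaehler_gensI(1)[OF assms]]
    by (intro kcls_eqI keys_add_subset keys_pair) (simp_all add: diff_diff_eq)
  then show ?thesis using assms by (simp only: kcls_add keys_pair)
qed

lemma form_add_right:
  assumes "a \<in> carrier S" "b \<in> carrier S" "c \<in> carrier S"
  shows "form S K a (b \<oplus> c) = form S K a b \<oplus>\<^bsub>\<Omega>\<^esub> form S K a c"
proof -
  have "kcls S K (frag_of (a, b \<oplus> c)) = kcls S K (frag_of (a, b) + frag_of (a, c))"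
    using assms gens_N[OF kaehler_gensI(2)[OF assms]]
    by (intro kcls_eqI keys_add_subset keys_pair) (simp_all add: diff_diff_eq)
  then show ?thesis using assms by (simp only: kcls_add keys_pair)
qed

lemma form_leibniz:
  assumes "a \<in> carrier S" "b \<in> carrier S" "c \<in> carrier S"
  shows "form S K a (b \<otimes> c) = form S K (a \<otimes> b) c \<oplus>\<^bsub>\<Omega>\<^esub> form S K (a \<otimes> c) b"
proof -
  have "kcls S K (frag_of (a, b \<otimes> c)) = kcls S K (frag_of (a \<otimes> b, c) + frag_of (a \<otimes> c, b))"
    using assms gens_N[OF kaehler_gensI(3)[OF assms]]
    by (intro kcls_eqI keys_add_subset keys_pair) (simp_all add: diff_diff_eq)
  then show ?thesis using assms by (simp only: kcls_add keys_pair m_closed)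
qed

lemma form_const:
  assumes "a \<in> carrier S" "k \<in> K"
  shows "form S K a k = \<zero>\<^bsub>\<Omega>\<^esub>"
  unfolding kcls_zero using assms K gens_N[OF kaehler_gensI(4)[OF assms]] by (intro kcls_eqI) auto

end

text \<open>The image of a coset under \<open>frag_map h\<close> is in general only part of a coset,
  hence the product with the relations in the definitions of \<open>pullback\<close> and of
  \<open>smult\<close>. Here \<open>h\<close> acts on pairs and only has to respect the generating
  relations, because scalar multiplication (a, b) -> (sa, b) is not induced by a ring
  homomorphism.\<close>

lemma frag_map_coset:
  assumes S: "kaehler_base S K" and T: "kaehler_base T L"
    and h: "h ` (carrier S \<times> carrier S) \<subseteq> carrier T \<times> carrier T"
    and g: "\<And>x. x \<in> kaehler_gens S K \<Longrightarrow> frag_map h x \<in> kaehler_gens T L"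
    and c: "Poly_Mapping.keys c \<subseteq> carrier S \<times> carrier S"
  shows "kaehler_relations T L <#>\<^bsub>kaehler_free T\<^esub> (frag_map h ` kcls S K c) = kcls T L (frag_map h c)"
proof -
  interpret S: kaehler_base S K by fact
  interpret T: kaehler_base T L by fact
  have N: "frag_map h n \<in> T.N" if "n \<in> S.N" for n
    using that
  proof (induction rule: S.N_induct)
    case zero
    then show ?case using T.N.one_closed by simp
  next
    case (diff c d)
    have "- frag_map h d \<in> T.N"
      using T.N.m_inv_closed[OF diff(4)] T.F_inv[of "frag_map h d"] T.N_keys[OF diff(4)] by simp
    from T.N.m_closed[OF diff(3) this] show ?case by (simp add: frag_map_diff)
  next
    case (gens c)
    then show ?case using g T.gens_N by blast
  qed
  have add: "n + m \<in> T.N" if "n \<in> T.N" "m \<in> T.N" for n m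
    using T.N.m_closed[OF that] by simp
  have 0: "0 \<in> S.N" using S.N.one_closed by simp
  show ?thesis
    unfolding kcls_def set_mult_def r_coset_def T.F_simps S.F_simps
  proof (rule equalityI; rule subsetI)
    fix z assume "z \<in> (\<Union>ha\<in>T.N. \<Union>k\<in>frag_map h ` (\<Union>h\<in>S.N. {h + c}). {ha + k})"
    then obtain m n where "m \<in> T.N" "n \<in> S.N" "z = m + frag_map h (n + c)" by auto
    then show "z \<in> (\<Union>ha\<in>T.N. {ha + frag_map h c})"
      using add[OF _ N] by (auto simp: frag_map_add add.assoc[symmetric])
  next
    fix z assume "z \<in> (\<Union>ha\<in>T.N. {ha + frag_map h c})"
    then show "z \<in> (\<Union>ha\<in>T.N. \<Union>k\<in>frag_map h ` (\<Union>h\<in>S.N. {h + c}). {ha + k})"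
      using 0 by force
  qed
qed

lemma pullback_kcls:
  assumes S: "kaehler_base S K" and T: "kaehler_base T L"
    and h: "h \<in> ring_hom S T" and hK: "h ` K \<subseteq> L"
    and c: "Poly_Mapping.keys c \<subseteq> carrier S \<times> carrier S"
  shows "pullback T L h (kcls S K c) = kcls T L (frag_map (\<lambda>(a, b). (h a, h b)) c)"
  unfolding pullback_def
proof (rule frag_map_coset[OF S T _ _ c])
  show "(\<lambda>(a, b). (h a, h b)) ` (carrier S \<times> carrier S) \<subseteq> carrier T \<times> carrier T"
    using ring_hom_closed[OF h] by auto
  interpret S: kaehler_base S K by fact
  fix x assume "x \<in> kaehler_gens S K"
  then show "frag_map (\<lambda>(a, b). (h a, h b)) x \<in> kaehler_gens T L"
  proof (cases rule: kaehler_gensE)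
    case (add_left a a' b)
    then show ?thesis using kaehler_gensI(1)[of "h a" T "h a'" "h b" L]
      by (simp add: frag_map_diff ring_hom_add[OF h] ring_hom_closed[OF h])
  next
    case (add_right a b c)
    then show ?thesis using kaehler_gensI(2)[of "h a" T "h b" "h c" L]
      by (simp add: frag_map_diff ring_hom_add[OF h] ring_hom_closed[OF h])
  next
    case (leibniz a b c)
    then show ?thesis using kaehler_gensI(3)[of "h a" T "h b" "h c" L]
      by (simp add: frag_map_diff ring_hom_mult[OF h] ring_hom_closed[OF h])
  next
    case (const a k)
    then show ?thesis using kaehler_gensI(4)[of "h a" T "h k" L] hK
      by (simp add: ring_hom_closed[OF h] image_subset_iff)
  qed
qed

context kaehler_base
begin

lemma smult_kcls:
  assumes s: "s \<in> carrier S" and c: "Poly_Mapping.keys c \<subseteq> carrier S \<times> carrier S"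
  shows "s \<odot>\<^bsub>\<Omega>\<^esub> kcls S K c = kcls S K (frag_map (\<lambda>(a, b). (s \<otimes> a, b)) c)"
proof -
  have "N <#>\<^bsub>F\<^esub> (frag_map (\<lambda>(a, b). (s \<otimes> a, b)) ` kcls S K c) = kcls S K (frag_map (\<lambda>(a, b). (s \<otimes> a, b)) c)"
  proof (rule frag_map_coset[OF kaehler_base_axioms kaehler_base_axioms _ _ c])
    fix x assume "x \<in> kaehler_gens S K"
    then show "frag_map (\<lambda>(a, b). (s \<otimes> a, b)) x \<in> kaehler_gens S K"
    proof (cases rule: kaehler_gensE)
      case (add_left a a' b)
      then show ?thesis using s kaehler_gensI(1)[of "s \<otimes> a" S "s \<otimes> a'" b K]
        by (simp add: frag_map_diff r_distr)
    next
      case (add_right a b c)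
      then show ?thesis using s kaehler_gensI(2)[of "s \<otimes> a" S b c K]
        by (simp add: frag_map_diff)
    next
      case (leibniz a b c)
      then show ?thesis using s kaehler_gensI(3)[of "s \<otimes> a" S b c K]
        by (simp add: frag_map_diff m_assoc)
    next
      case (const a k)
      then show ?thesis using s kaehler_gensI(4)[of "s \<otimes> a" S k K] by simp
    qed
  qed (use s in auto)
  then show ?thesis by (simp add: kaehler_def)
qed

lemma smult_form: "s \<in> carrier S \<Longrightarrow> a \<in> carrier S \<Longrightarrow> b \<in> carrier S \<Longrightarrow> s \<odot>\<^bsub>\<Omega>\<^esub> form S K a b = form S K (s \<otimes> a) b"
  by (simp add: smult_kcls)

lemma smult_closed: "s \<in> carrier S \<Longrightarrow> \<omega> \<in> carrier \<Omega> \<Longrightarrow> s \<odot>\<^bsub>\<Omega>\<^esub> \<omega> \<in> carrier \<Omega>"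
  by (erule kclsE) (simp add: smult_kcls, rule kcls_closed, rule keys_frag_map, auto)

lemma smult_add:
  assumes "s \<in> carrier S" "\<omega> \<in> carrier \<Omega>" "\<eta> \<in> carrier \<Omega>"
  shows "s \<odot>\<^bsub>\<Omega>\<^esub> (\<omega> \<oplus>\<^bsub>\<Omega>\<^esub> \<eta>) = s \<odot>\<^bsub>\<Omega>\<^esub> \<omega> \<oplus>\<^bsub>\<Omega>\<^esub> s \<odot>\<^bsub>\<Omega>\<^esub> \<eta>"
proof -
  have m: "(\<lambda>(a, b). (s \<otimes> a, b)) ` (carrier S \<times> carrier S) \<subseteq> carrier S \<times> carrier S" using assms by auto
  obtain c d where "Poly_Mapping.keys c \<subseteq> carrier S \<times> carrier S" "\<omega> = kcls S K c"
    and "Poly_Mapping.keys d \<subseteq> carrier S \<times> carrier S" "\<eta> = kcls S K d" using assms by (metis kclsE)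
  then show ?thesis
    using assms(1) by (simp add: kcls_add smult_kcls keys_add_subset frag_map_add keys_frag_map[OF _ m])
qed

lemma smult_diff:
  assumes "s \<in> carrier S" "\<omega> \<in> carrier \<Omega>" "\<eta> \<in> carrier \<Omega>"
  shows "s \<odot>\<^bsub>\<Omega>\<^esub> (\<omega> \<ominus>\<^bsub>\<Omega>\<^esub> \<eta>) = s \<odot>\<^bsub>\<Omega>\<^esub> \<omega> \<ominus>\<^bsub>\<Omega>\<^esub> s \<odot>\<^bsub>\<Omega>\<^esub> \<eta>"
proof -
  have m: "(\<lambda>(a, b). (s \<otimes> a, b)) ` (carrier S \<times> carrier S) \<subseteq> carrier S \<times> carrier S" using assms by auto
  obtain c d where "Poly_Mapping.keys c \<subseteq> carrier S \<times> carrier S" "\<omega> = kcls S K c"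
    and "Poly_Mapping.keys d \<subseteq> carrier S \<times> carrier S" "\<eta> = kcls S K d" using assms by (metis kclsE)
  then show ?thesis
    using assms(1) by (simp add: kcls_diff[symmetric] smult_kcls keys_diff_subset frag_map_diff keys_frag_map[OF _ m])
qed

lemma smult_zero: "s \<in> carrier S \<Longrightarrow> s \<odot>\<^bsub>\<Omega>\<^esub> \<zero>\<^bsub>\<Omega>\<^esub> = \<zero>\<^bsub>\<Omega>\<^esub>"
  by (simp add: kcls_zero smult_kcls)

lemma diff_add_diff:
  assumes "u \<in> carrier \<Omega>" "v \<in> carrier \<Omega>" "u' \<in> carrier \<Omega>" "v' \<in> carrier \<Omega>"
  shows "(u \<oplus>\<^bsub>\<Omega>\<^esub> v) \<ominus>\<^bsub>\<Omega>\<^esub> (u' \<oplus>\<^bsub>\<Omega>\<^esub> v') = (u \<ominus>\<^bsub>\<Omega>\<^esub> u') \<oplus>\<^bsub>\<Omega>\<^esub> (v \<ominus>\<^bsub>\<Omega>\<^esub> v')"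
  using assms by (simp add: \<Omega>.minus_eq \<Omega>.minus_add \<Omega>.a_ac)

lemma module_kaehler: "module S \<Omega>"
proof (rule moduleI)
  fix a b x assume a: "a \<in> carrier S" and b: "b \<in> carrier S" and x: "x \<in> carrier \<Omega>"
  show "(a \<oplus> b) \<odot>\<^bsub>\<Omega>\<^esub> x = a \<odot>\<^bsub>\<Omega>\<^esub> x \<oplus>\<^bsub>\<Omega>\<^esub> b \<odot>\<^bsub>\<Omega>\<^esub> x"
    using x
  proof (induction rule: kaehler_induct)
    case (diff \<omega> \<eta>)
    then show ?case using a b by (simp add: smult_diff smult_closed diff_add_diff)
  qed (use a b in \<open>simp_all add: smult_zero smult_form form_add_left l_distr\<close>)
  show "(a \<otimes> b) \<odot>\<^bsub>\<Omega>\<^esub> x = a \<odot>\<^bsub>\<Omega>\<^esub> (b \<odot>\<^bsub>\<Omega>\<^esub> x)"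
    using x
  proof (induction rule: kaehler_induct)
    case (diff \<omega> \<eta>)
    then show ?case using a b by (simp add: smult_diff smult_closed)
  qed (use a b in \<open>simp_all add: smult_zero smult_form m_assoc\<close>)
next
  fix x assume "x \<in> carrier \<Omega>"
  then show "\<one> \<odot>\<^bsub>\<Omega>\<^esub> x = x"
    by (induction rule: kaehler_induct) (simp_all add: smult_zero smult_diff smult_form)
qed (use cring_axioms abelian_group_kaehler smult_closed smult_add in auto)

text \<open>Expands the class of a transformed formal sum into forms a db, so that Maurer-Cartan
  forms can be compared term by term.\<close>

lemma kcls_frag_map:
  assumes "h ` Y \<subseteq> carrier S \<times> carrier S" "Poly_Mapping.keys c \<subseteq> Y"
  shows "kcls S K (frag_map h c) = frag_eval \<Omega> (\<lambda>z. kcls S K (frag_of (h z))) c"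
proof -
  have hc: "Poly_Mapping.keys (frag_of (h z)) \<subseteq> carrier S \<times> carrier S" if "z \<in> Y" for z
    using assms(1) that by auto
  have g: "(\<lambda>z. kcls S K (frag_of (h z))) \<in> Y \<rightarrow> carrier \<Omega>" using hc kcls_closed by blast
  show ?thesis using assms(2)
  proof (induction c rule: frag_ind)
    case (diff x y)
    then show ?case
      using \<Omega>.frag_eval_diff[OF g diff(1,2)]
      by (simp add: frag_map_diff kcls_diff keys_frag_map[OF _ assms(1)])
  next
    case (gen z)
    then show ?case using g by (simp add: Pi_iff)
  qed (simp add: kcls_zero)
qed

end

section \<open>Derivations\<close>

text \<open>A derivation into \<open>T\<close>, regarded as an \<open>S\<close>-module through
  \<open>h\<close>. Vanishing on constants is a separate condition, imposed where forms are
  paired.\<close>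

definition derivation_along :: "('s, 'm) ring_scheme \<Rightarrow> ('t, 'n) ring_scheme \<Rightarrow> ('s \<Rightarrow> 't) \<Rightarrow> ('s \<Rightarrow> 't) \<Rightarrow> bool" where
  "derivation_along S T h d \<longleftrightarrow> d \<in> carrier S \<rightarrow> carrier T \<and>
     (\<forall>x\<in>carrier S. \<forall>y\<in>carrier S. d (x \<oplus>\<^bsub>S\<^esub> y) = d x \<oplus>\<^bsub>T\<^esub> d y) \<and>
     (\<forall>x\<in>carrier S. \<forall>y\<in>carrier S. d (x \<otimes>\<^bsub>S\<^esub> y) = h x \<otimes>\<^bsub>T\<^esub> d y \<oplus>\<^bsub>T\<^esub> h y \<otimes>\<^bsub>T\<^esub> d x)"

lemma derivation_alongD:
  assumes "derivation_along S T h d"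
  shows "x \<in> carrier S \<Longrightarrow> d x \<in> carrier T"
    "x \<in> carrier S \<Longrightarrow> y \<in> carrier S \<Longrightarrow> d (x \<oplus>\<^bsub>S\<^esub> y) = d x \<oplus>\<^bsub>T\<^esub> d y"
    "x \<in> carrier S \<Longrightarrow> y \<in> carrier S \<Longrightarrow> d (x \<otimes>\<^bsub>S\<^esub> y) = h x \<otimes>\<^bsub>T\<^esub> d y \<oplus>\<^bsub>T\<^esub> h y \<otimes>\<^bsub>T\<^esub> d x"
  using assms by (auto simp: derivation_along_def)

lemma derivation_along_comp:
  assumes "derivation_along S T h d" "k \<in> ring_hom S' S"
  shows "derivation_along S' T (\<lambda>x. h (k x)) (\<lambda>x. d (k x))"
  using assms by (auto simp: derivation_along_def ring_hom_def Pi_iff)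

text \<open>Contraction of a form with a derivation, a db -> h a * d b. The value is read off from
  the image of the whole coset, which is a singleton in \<open>kaehler_pairing\<close>.\<close>

definition pairing :: "('t, 'm) ring_scheme \<Rightarrow> ('s \<Rightarrow> 't) \<Rightarrow> ('s \<Rightarrow> 't) \<Rightarrow> ('s \<times> 's \<Rightarrow>\<^sub>0 int) set \<Rightarrow> 't" where
  "pairing T h d \<omega> = the_elem (frag_eval T (\<lambda>(a, b). h a \<otimes>\<^bsub>T\<^esub> d b) ` \<omega>)"

locale kaehler_pairing = kaehler_base S K + T: cring T for S (structure) and K and T +
  fixes h d
  assumes h: "h \<in> ring_hom S T" and d: "derivation_along S T h d"
    and dK: "\<forall>k\<in>K. d k = \<zero>\<^bsub>T\<^esub>"
begin

abbreviation "ev \<equiv> frag_eval T (\<lambda>(a, b). h a \<otimes>\<^bsub>T\<^esub> d b)"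

lemmas dD = derivation_alongD[OF d]
lemma hc [simp]: "x \<in> carrier S \<Longrightarrow> h x \<in> carrier T"
  by (rule ring_hom_closed[OF h])
lemma dc [simp]: "x \<in> carrier S \<Longrightarrow> d x \<in> carrier T"
  by (rule dD)

lemma ev_fun: "(\<lambda>(a, b). h a \<otimes>\<^bsub>T\<^esub> d b) \<in> carrier S \<times> carrier S \<rightarrow> carrier T"
  by auto

lemma ev_diff:
  assumes "Poly_Mapping.keys x \<subseteq> carrier S \<times> carrier S" "Poly_Mapping.keys y \<subseteq> carrier S \<times> carrier S"
  shows "ev (x - y) = ev x \<ominus>\<^bsub>T\<^esub> ev y"
  using assms by (rule T.frag_eval_diff[OF ev_fun])

lemma ev_of: "a \<in> carrier S \<Longrightarrow> b \<in> carrier S \<Longrightarrow> ev (frag_of (a, b)) = h a \<otimes>\<^bsub>T\<^esub> d b"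
  by simp

lemma T_cancel: "u \<in> carrier T \<Longrightarrow> v \<in> carrier T \<Longrightarrow> ((u \<oplus>\<^bsub>T\<^esub> v) \<ominus>\<^bsub>T\<^esub> u) \<ominus>\<^bsub>T\<^esub> v = \<zero>\<^bsub>T\<^esub>"
  by (simp add: T.minus_eq T.a_comm[of u v] T.a_assoc T.r_neg)

lemma ev_3:
  assumes "a \<in> carrier S" "b \<in> carrier S" "a' \<in> carrier S" "b' \<in> carrier S" "a'' \<in> carrier S" "b'' \<in> carrier S"
  shows "ev (frag_of (a, b) - frag_of (a', b') - frag_of (a'', b'')) =
    h a \<otimes>\<^bsub>T\<^esub> d b \<ominus>\<^bsub>T\<^esub> h a' \<otimes>\<^bsub>T\<^esub> d b' \<ominus>\<^bsub>T\<^esub> h a'' \<otimes>\<^bsub>T\<^esub> d b''"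
  using assms by (simp only: ev_diff ev_of keys_diff_subset keys_pair)

lemma ev_N:
  assumes "n \<in> N" shows "ev n = \<zero>\<^bsub>T\<^esub>"
  using assms
proof (induction rule: N_induct)
  case (diff c d)
  then show ?case by (simp add: ev_diff T.minus_eq)
next
  case (gens c)
  then show ?case
  proof (cases rule: kaehler_gensE)
    case (add_left a a' b)
    show ?thesis unfolding add_left(1) using add_left(2-)
      by (subst ev_3) (simp_all add: ring_hom_add[OF h] T.l_distr T_cancel)
  next
    case (add_right a b c)
    show ?thesis unfolding add_right(1) using add_right(2-)
      by (subst ev_3) (simp_all add: dD T.r_distr T_cancel)
  next
    case (leibniz a b c)
    show ?thesis unfolding leibniz(1) using leibniz(2-)
      by (subst ev_3) (simp_all add: dD ring_hom_mult[OF h] T.r_distr T.m_assoc T_cancel)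
  next
    case (const a k)
    then show ?thesis using dK K by auto
  qed
qed simp

lemma pairing_kcls:
  assumes "Poly_Mapping.keys c \<subseteq> carrier S \<times> carrier S"
  shows "pairing T h d (kcls S K c) = ev c"
proof -
  have evc: "ev c \<in> carrier T" using assms by (rule T.frag_eval_closed[OF ev_fun])
  have "ev (n + c) = ev c" if "n \<in> N" for n
    using T.frag_eval_add[OF ev_fun N_keys[OF that] assms] ev_N[OF that] evc by simp
  moreover have "0 \<in> N" using N.one_closed by simp
  moreover have "kcls S K c = (\<lambda>n. n + c) ` N" by (auto simp: kcls_def r_coset_def)
  ultimately have "ev ` kcls S K c = {ev c}" by (auto simp: image_image)
  then show ?thesis by (simp add: pairing_def)
qed

lemma pairing_closed: "\<omega> \<in> carrier \<Omega> \<Longrightarrow> pairing T h d \<omega> \<in> carrier T"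
  by (erule kclsE) (simp add: pairing_kcls T.frag_eval_closed[OF ev_fun])

lemma pairing_add:
  assumes "\<omega> \<in> carrier \<Omega>" "\<eta> \<in> carrier \<Omega>"
  shows "pairing T h d (\<omega> \<oplus>\<^bsub>\<Omega>\<^esub> \<eta>) = pairing T h d \<omega> \<oplus>\<^bsub>T\<^esub> pairing T h d \<eta>"
proof -
  obtain c e where "Poly_Mapping.keys c \<subseteq> carrier S \<times> carrier S" "\<omega> = kcls S K c"
    and "Poly_Mapping.keys e \<subseteq> carrier S \<times> carrier S" "\<eta> = kcls S K e" using assms by (metis kclsE)
  then show ?thesis by (simp add: kcls_add pairing_kcls keys_add_subset T.frag_eval_add[OF ev_fun])
qed

lemma pairing_zero: "pairing T h d \<zero>\<^bsub>\<Omega>\<^esub> = \<zero>\<^bsub>T\<^esub>"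
  by (simp add: kcls_zero pairing_kcls)

lemma pairing_diff:
  assumes "\<omega> \<in> carrier \<Omega>" "\<eta> \<in> carrier \<Omega>"
  shows "pairing T h d (\<omega> \<ominus>\<^bsub>\<Omega>\<^esub> \<eta>) = pairing T h d \<omega> \<ominus>\<^bsub>T\<^esub> pairing T h d \<eta>"
proof -
  obtain c e where "Poly_Mapping.keys c \<subseteq> carrier S \<times> carrier S" "\<omega> = kcls S K c"
    and "Poly_Mapping.keys e \<subseteq> carrier S \<times> carrier S" "\<eta> = kcls S K e" using assms by (metis kclsE)
  then show ?thesis by (simp add: kcls_diff[symmetric] pairing_kcls keys_diff_subset ev_diff)
qed

lemma pairing_smult:
  assumes "s \<in> carrier S" "\<omega> \<in> carrier \<Omega>"
  shows "pairing T h d (s \<odot>\<^bsub>\<Omega>\<^esub> \<omega>) = h s \<otimes>\<^bsub>T\<^esub> pairing T h d \<omega>"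
  using assms(2)
proof (induction rule: kaehler_induct)
  case (diff \<omega> \<eta>)
  then show ?case using assms(1)
    by (simp add: smult_diff pairing_diff smult_closed T.minus_eq T.r_distr T.r_minus pairing_closed)
qed (use assms in \<open>simp_all add: smult_zero pairing_zero smult_form pairing_kcls ring_hom_mult[OF h] T.m_assoc\<close>)

lemma pairing_nat_mult:
  assumes "\<omega> \<in> carrier \<Omega>"
  shows "pairing T h d ([(n::nat)] \<cdot>\<^bsub>\<Omega>\<^esub> \<omega>) = [n] \<cdot>\<^bsub>T\<^esub> pairing T h d \<omega>"
  by (induction n) (use assms in \<open>simp_all add: pairing_zero pairing_add\<close>)

lemma pairing_finsum:
  assumes "g \<in> I \<rightarrow> carrier \<Omega>"
  shows "pairing T h d (finsum \<Omega> g I) = finsum T (\<lambda>i. pairing T h d (g i)) I"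
  by (rule abelian_group_hom_finsum[OF abelian_group_kaehler T.abelian_group_axioms _ _ assms])
     (auto simp: pairing_closed pairing_add)

end

text \<open>Both sides send a db to \<open>h (k a)\<close> times \<open>d (k b)\<close>, so a
  pullback can be traded for a derivation composed with \<open>k\<close>. The composite is a
  derivation along \<open>h\<close> after \<open>k\<close>; this is why pairings allow a twist by a
  homomorphism.\<close>

lemma pairing_pullback:
  assumes S': "kaehler_base S' K'" and p: "kaehler_pairing S K T h d"
    and k: "k \<in> ring_hom S' S" and kK: "k ` K' \<subseteq> K"
    and \<omega>: "\<omega> \<in> carrier (kaehler S' K')"
  shows "pairing T h d (pullback S K k \<omega>) = pairing T (\<lambda>x. h (k x)) (\<lambda>x. d (k x)) \<omega>"
proof -
  interpret p: kaehler_pairing S K T h d by fact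
  interpret S': kaehler_base S' K' by fact
  have hk: "(\<lambda>x. h (k x)) \<in> ring_hom S' T" using ring_hom_trans[OF k p.h] by (simp add: comp_def)
  interpret q: kaehler_pairing S' K' T "\<lambda>x. h (k x)" "\<lambda>x. d (k x)"
    by unfold_locales (use hk derivation_along_comp[OF p.d k] kK p.dK in auto)
  obtain c where c: "Poly_Mapping.keys c \<subseteq> carrier S' \<times> carrier S'" "\<omega> = kcls S' K' c"
    using \<omega> by (rule S'.kclsE)
  let ?m = "\<lambda>(a, b). (k a, k b)"
  have m: "?m ` (carrier S' \<times> carrier S') \<subseteq> carrier S \<times> carrier S" using ring_hom_closed[OF k] by auto
  have "p.ev (frag_map ?m c) = q.ev c" using c(1)
  proof (induction c rule: frag_ind)
    case (diff x y)
    then show ?case by (simp add: frag_map_diff p.ev_diff q.ev_diff keys_frag_map[OF _ m])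
  next
    case (gen z)
    then show ?case using ring_hom_closed[OF k] by auto
  qed simp
  then show ?thesis
    unfolding c(2) pullback_kcls[OF S' p.kaehler_base_axioms k kK c(1)]
    using p.pairing_kcls[OF keys_frag_map[OF c(1) m]] q.pairing_kcls[OF c(1)] by simp
qed

section \<open>Idealization of a module\<close>

text \<open>The square zero extension of \<open>S\<close> by \<open>M\<close>. A homomorphism into
  it is a homomorphism into \<open>S\<close> together with a derivation into \<open>M\<close> along
  it; this converts derivations into points of \<open>G\<close>.\<close>

definition idealization :: "('s, 'm) ring_scheme \<Rightarrow> ('s, 'v, 'n) module_scheme \<Rightarrow> ('s \<times> 'v) ring" where
  "idealization S M =
     \<lparr>carrier = carrier S \<times> carrier M,
      monoid.mult = (\<lambda>x y. (fst x \<otimes>\<^bsub>S\<^esub> fst y, fst x \<odot>\<^bsub>M\<^esub> snd y \<oplus>\<^bsub>M\<^esub> fst y \<odot>\<^bsub>M\<^esub> snd x)),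
      one = (\<one>\<^bsub>S\<^esub>, \<zero>\<^bsub>M\<^esub>),
      ring.zero = (\<zero>\<^bsub>S\<^esub>, \<zero>\<^bsub>M\<^esub>),
      add = (\<lambda>x y. (fst x \<oplus>\<^bsub>S\<^esub> fst y, snd x \<oplus>\<^bsub>M\<^esub> snd y))\<rparr>"

lemma idealization_simps [simp]:
  "carrier (idealization S M) = carrier S \<times> carrier M"
  "x \<otimes>\<^bsub>idealization S M\<^esub> y = (fst x \<otimes>\<^bsub>S\<^esub> fst y, fst x \<odot>\<^bsub>M\<^esub> snd y \<oplus>\<^bsub>M\<^esub> fst y \<odot>\<^bsub>M\<^esub> snd x)"
  "\<one>\<^bsub>idealization S M\<^esub> = (\<one>\<^bsub>S\<^esub>, \<zero>\<^bsub>M\<^esub>)"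
  "\<zero>\<^bsub>idealization S M\<^esub> = (\<zero>\<^bsub>S\<^esub>, \<zero>\<^bsub>M\<^esub>)"
  "x \<oplus>\<^bsub>idealization S M\<^esub> y = (fst x \<oplus>\<^bsub>S\<^esub> fst y, snd x \<oplus>\<^bsub>M\<^esub> snd y)"
  by (simp_all add: idealization_def)

lemma cring_idealization:
  assumes "module S M" shows "cring (idealization S M)"
proof -
  interpret module S M by fact
  show ?thesis
  proof (rule cringI)
    show "abelian_group (idealization S M)"
    proof (rule abelian_groupI)
      fix x assume "x \<in> carrier (idealization S M)"
      then show "\<exists>y\<in>carrier (idealization S M). y \<oplus>\<^bsub>idealization S M\<^esub> x = \<zero>\<^bsub>idealization S M\<^esub>"
        by (intro bexI[of _ "(\<ominus>\<^bsub>S\<^esub> fst x, \<ominus>\<^bsub>M\<^esub> snd x)"]) (auto simp: R.l_neg M.l_neg)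
    qed (auto simp: R.a_ac M.a_ac)
    show "comm_monoid (idealization S M)"
      by (rule comm_monoidI)
        (auto simp: R.m_ac M.a_ac smult_r_distr smult_assoc1[symmetric])
  qed (auto simp: R.l_distr smult_r_distr smult_l_distr M.a_ac)
qed

lemma idealization_hom:
  assumes "module S' M" "cring S" and h: "h \<in> ring_hom S S'"
    and d: "d \<in> carrier S \<rightarrow> carrier M"
    and da: "\<And>x y. x \<in> carrier S \<Longrightarrow> y \<in> carrier S \<Longrightarrow> d (x \<oplus>\<^bsub>S\<^esub> y) = d x \<oplus>\<^bsub>M\<^esub> d y"
    and dm: "\<And>x y. x \<in> carrier S \<Longrightarrow> y \<in> carrier S \<Longrightarrow> d (x \<otimes>\<^bsub>S\<^esub> y) = h x \<odot>\<^bsub>M\<^esub> d y \<oplus>\<^bsub>M\<^esub> h y \<odot>\<^bsub>M\<^esub> d x"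
  shows "(\<lambda>x. (h x, d x)) \<in> ring_hom S (idealization S' M)"
proof -
  interpret module S' M by fact
  interpret S: cring S by fact
  have dc: "d x \<in> carrier M" if "x \<in> carrier S" for x using d that by auto
  \<comment> \<open>The product rule for 1 * 1 forces d 1 = 0, which the preservation of the unit
    requires.\<close>
  have "d \<one>\<^bsub>S\<^esub> = d \<one>\<^bsub>S\<^esub> \<oplus>\<^bsub>M\<^esub> d \<one>\<^bsub>S\<^esub>"
    using dm[of "\<one>\<^bsub>S\<^esub>" "\<one>\<^bsub>S\<^esub>"] dc ring_hom_one[OF h] by simp
  then have "d \<one>\<^bsub>S\<^esub> = \<zero>\<^bsub>M\<^esub>"
    using M.add.r_cancel_one'[of "d \<one>\<^bsub>S\<^esub>" "d \<one>\<^bsub>S\<^esub>"] dc by simp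
  then show ?thesis
    by (intro ring_hom_memI) (auto simp: dc da dm ring_hom_closed[OF h] ring_hom_add[OF h] ring_hom_mult[OF h] ring_hom_one[OF h])
qed

lemma idealization_fst_hom: "fst \<in> ring_hom (idealization S M) S"
  by (rule ring_hom_memI) auto

lemma idealization_inl_hom:
  assumes "module S M" "cring S"
  shows "(\<lambda>x. (x, \<zero>\<^bsub>M\<^esub>)) \<in> ring_hom S (idealization S M)"
proof -
  interpret module S M by fact
  show ?thesis by (rule ring_hom_memI) auto
qed

definition self_module :: "('s, 'm) ring_scheme \<Rightarrow> ('s, 's) module" where
  "self_module S = \<lparr>carrier = carrier S, monoid.mult = monoid.mult S, one = one S, ring.zero = ring.zero S,
     add = add S, smult = monoid.mult S\<rparr>"

lemma self_module_simps [simp]: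
  "carrier (self_module S) = carrier S" "\<zero>\<^bsub>self_module S\<^esub> = \<zero>\<^bsub>S\<^esub>"
  "add (self_module S) = add S" "smult (self_module S) = monoid.mult S"
  by (simp_all add: self_module_def)

lemma module_self:
  assumes "cring S" shows "module S (self_module S)"
proof -
  interpret cring S by fact
  show ?thesis
  proof (rule moduleI)
    show "abelian_group (self_module S)"
    proof (rule abelian_groupI)
      fix x assume "x \<in> carrier (self_module S)"
      then show "\<exists>y\<in>carrier (self_module S). y \<oplus>\<^bsub>self_module S\<^esub> x = \<zero>\<^bsub>self_module S\<^esub>"
        by (intro bexI[of _ "\<ominus>\<^bsub>S\<^esub> x"]) (simp_all add: l_neg)
    qed (auto simp: a_ac)
  qed (auto simp: l_distr r_distr m_assoc cring_axioms)
qed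

abbreviation "dual S \<equiv> idealization S (self_module S)"

lemma cring_dual: "cring S \<Longrightarrow> cring (dual S)"
  by (rule cring_idealization[OF module_self])

lemma derivation_dual:
  assumes "k \<in> ring_hom S (dual T)"
  shows "(\<lambda>x. fst (k x)) \<in> ring_hom S T" "derivation_along S T (\<lambda>x. fst (k x)) (\<lambda>x. snd (k x))"
  using ring_hom_trans[OF assms idealization_fst_hom] 
  by (simp add: comp_def) (use ring_hom_memE[OF assms] in \<open>auto simp: derivation_along_def mem_Times_iff\<close>)

lemma dual_hom:
  assumes "cring S" "cring T" "h \<in> ring_hom S T" "derivation_along S T h d"
  shows "(\<lambda>x. (h x, d x)) \<in> ring_hom S (dual T)"
  by (rule idealization_hom[OF module_self]) (use assms derivation_alongD[OF assms(4)] in auto)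

section \<open>Localizations\<close>

lemma ring_hom_Units:
  assumes h: "h \<in> ring_hom S T" and u: "u \<in> Units S"
  shows "h u \<in> Units T"
proof -
  obtain v where v: "v \<in> carrier S" "v \<otimes>\<^bsub>S\<^esub> u = \<one>\<^bsub>S\<^esub>" "u \<otimes>\<^bsub>S\<^esub> v = \<one>\<^bsub>S\<^esub>" and uc: "u \<in> carrier S"
    using u by (auto simp: Units_def)
  then have "h v \<otimes>\<^bsub>T\<^esub> h u = \<one>\<^bsub>T\<^esub>" "h u \<otimes>\<^bsub>T\<^esub> h v = \<one>\<^bsub>T\<^esub>"
    using ring_hom_mult[OF h v(1) uc] ring_hom_mult[OF h uc v(1)] ring_hom_one[OF h] by auto
  then show ?thesis
    using ring_hom_closed[OF h v(1)] ring_hom_closed[OF h uc] by (auto simp: Units_def)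
qed

lemma (in comm_monoid) Units_cancel_right:
  assumes "u \<in> Units G" "x \<in> carrier G" "y \<in> carrier G" "x \<otimes> u = y \<otimes> u"
  shows "x = y"
  using assms Units_l_cancel[of u x y] m_comm[of u x] m_comm[of u y] Units_closed[of u] by simp

locale localization_base =
  fixes A :: "('r, 'a, 'm) algebra_scheme" (structure) and f
  assumes cring_A: "cring A" and f [simp]: "f \<in> carrier A"
begin

sublocale cring A by (rule cring_A)

abbreviation "P \<equiv> powers A f"
abbreviation "L \<equiv> localization A f"
abbreviation "frc \<equiv> fraction A f"

lemma P_closed: "s \<in> P \<Longrightarrow> s \<in> carrier A"
  by (auto simp: powers_def)

lemma P_one [simp]: "\<one> \<in> P"
  unfolding powers_def by (rule range_eqI[of _ _ 0]) simp

lemma P_mult [simp]: "s \<in> P \<Longrightarrow> t \<in> P \<Longrightarrow> s \<otimes> t \<in> P"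
  unfolding powers_def by (auto simp: nat_pow_mult)

lemma P_f [simp]: "f \<in> P"
  unfolding powers_def by (rule range_eqI[of _ _ 1]) simp

lemma P_pow [simp]: "f [^] (k::nat) \<in> P"
  by (auto simp: powers_def)

lemma rel_iff: "((a, s), (b, t)) \<in> fraction_rel A f \<longleftrightarrow>
    a \<in> carrier A \<and> b \<in> carrier A \<and> s \<in> P \<and> t \<in> P \<and> (\<exists>u\<in>P. u \<otimes> (a \<otimes> t) = u \<otimes> (b \<otimes> s))"
  by (auto simp: fraction_rel_def)

lemma equiv_rel: "equiv (carrier A \<times> P) (fraction_rel A f)"
proof (rule equivI)
  show "fraction_rel A f \<subseteq> (carrier A \<times> P) \<times> (carrier A \<times> P)" by (auto simp: fraction_rel_def)
  show "refl_on (carrier A \<times> P) (fraction_rel A f)"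
    by (rule refl_onI) (use P_one in \<open>auto simp: rel_iff\<close>)
  show "sym (fraction_rel A f)"
  proof (rule symI)
    fix x y assume "(x, y) \<in> fraction_rel A f"
    moreover obtain a s b t where "x = (a, s)" "y = (b, t)" by (cases x, cases y) auto
    ultimately show "(y, x) \<in> fraction_rel A f" by (auto simp: rel_iff intro: sym)
  qed
  show "trans (fraction_rel A f)"
  proof (rule transI)
    fix x y z assume "(x, y) \<in> fraction_rel A f" "(y, z) \<in> fraction_rel A f"
    moreover obtain a s b t c w where xyz: "x = (a, s)" "y = (b, t)" "z = (c, w)" by (cases x, cases y, cases z) auto
    ultimately obtain u v where c: "a \<in> carrier A" "b \<in> carrier A" "c \<in> carrier A" "s \<in> P" "t \<in> P" "w \<in> P" "u \<in> P" "v \<in> P"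
      and e: "u \<otimes> (a \<otimes> t) = u \<otimes> (b \<otimes> s)" "v \<otimes> (b \<otimes> w) = v \<otimes> (c \<otimes> t)"
      by (auto simp: rel_iff)
    note cc = c(1-3) c(4-8)[THEN P_closed]
    \<comment> \<open>The multiplier for the composite contains the middle denominator
      \<open>t\<close> besides \<open>u\<close> and \<open>v\<close>, since \<open>t\<close> cannot
      be cancelled in a ring with zero divisors.\<close>
    have "(u \<otimes> v \<otimes> t) \<otimes> (a \<otimes> w) = (v \<otimes> w) \<otimes> (u \<otimes> (a \<otimes> t))" using cc by (simp add: m_ac)
    also have "\<dots> = (u \<otimes> s) \<otimes> (v \<otimes> (b \<otimes> w))" unfolding e(1) using cc by (simp add: m_ac)
    also have "\<dots> = (u \<otimes> v \<otimes> t) \<otimes> (c \<otimes> s)" unfolding e(2) using cc by (simp add: m_ac)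
    finally show "(x, z) \<in> fraction_rel A f"
      unfolding xyz rel_iff using c by (auto intro!: bexI[of _ "u \<otimes> v \<otimes> t"])
  qed
qed

lemma frc_eq_iff:
  assumes "a \<in> carrier A" "b \<in> carrier A" "s \<in> P" "t \<in> P"
  shows "frc a s = frc b t \<longleftrightarrow> (\<exists>u\<in>P. u \<otimes> (a \<otimes> t) = u \<otimes> (b \<otimes> s))"
  unfolding fraction_def using eq_equiv_class_iff[OF equiv_rel, of "(a, s)" "(b, t)"] assms by (simp add: rel_iff)

lemma frc_eqI:
  assumes "a \<in> carrier A" "b \<in> carrier A" "s \<in> P" "t \<in> P" "a \<otimes> t = b \<otimes> s"
  shows "frc a s = frc b t"
  using assms P_one by (auto simp: frc_eq_iff)

lemma frc_mem: "(b, t) \<in> frc a s \<longleftrightarrow> ((a, s), (b, t)) \<in> fraction_rel A f"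
  by (auto simp: fraction_def)

lemma frc_self: "a \<in> carrier A \<Longrightarrow> s \<in> P \<Longrightarrow> (a, s) \<in> frc a s"
  using P_one by (auto simp: frc_mem rel_iff)

lemma frc_closed [simp]: "a \<in> carrier A \<Longrightarrow> s \<in> P \<Longrightarrow> frc a s \<in> carrier L"
  by (auto simp: localization_def fraction_def intro!: quotientI)

lemma frcE:
  assumes "x \<in> carrier L"
  obtains a s where "a \<in> carrier A" "s \<in> P" "x = frc a s"
  using assms by (auto simp: localization_def fraction_def elim!: quotientE)

lemma L_simps: "\<one>\<^bsub>L\<^esub> = frc \<one> \<one>" "\<zero>\<^bsub>L\<^esub> = frc \<zero> \<one>" "algmap L r = frc (algmap A r) \<one>"
  by (simp_all add: localization_def)

lemma frc_mult:
  assumes "a \<in> carrier A" "s \<in> P" "b \<in> carrier A" "t \<in> P"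
  shows "frc a s \<otimes>\<^bsub>L\<^esub> frc b t = frc (a \<otimes> b) (s \<otimes> t)"
proof -
  have *: "frc (a' \<otimes> b') (s' \<otimes> t') = frc (a \<otimes> b) (s \<otimes> t)"
    if abst: "(a', s') \<in> frc a s" "(b', t') \<in> frc b t" for a' s' b' t'
  proof -
    obtain u v where c: "a' \<in> carrier A" "b' \<in> carrier A" "s' \<in> P" "t' \<in> P" "u \<in> P" "v \<in> P"
      and e: "u \<otimes> (a \<otimes> s') = u \<otimes> (a' \<otimes> s)" "v \<otimes> (b \<otimes> t') = v \<otimes> (b' \<otimes> t)"
      using abst by (auto simp: frc_mem rel_iff)
    note cc = assms(1,3) assms(2,4)[THEN P_closed] c(1,2) c(3-6)[THEN P_closed]
    have "(u \<otimes> v) \<otimes> ((a' \<otimes> b') \<otimes> (s \<otimes> t)) = (u \<otimes> (a' \<otimes> s)) \<otimes> (v \<otimes> (b' \<otimes> t))" using cc by (simp add: m_ac)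
    also have "\<dots> = (u \<otimes> v) \<otimes> ((a \<otimes> b) \<otimes> (s' \<otimes> t'))" unfolding e[symmetric] using cc by (simp add: m_ac)
    finally show ?thesis using assms c by (subst frc_eq_iff) (auto intro!: bexI[of _ "u \<otimes> v"])
  qed
  have "frc a s \<otimes>\<^bsub>L\<^esub> frc b t = (\<Union>z\<in>frc a s. \<Union>w\<in>frc b t. frc (fst z \<otimes> fst w) (snd z \<otimes> snd w))"
    by (simp add: localization_def case_prod_beta)
  also have "\<dots> = (\<Union>z\<in>frc a s. \<Union>w\<in>frc b t. frc (a \<otimes> b) (s \<otimes> t))"
    by (intro SUP_cong refl *) simp_all
  also have "\<dots> = frc (a \<otimes> b) (s \<otimes> t)"
    using frc_self[OF assms(1,2)] frc_self[OF assms(3,4)] by (auto simp del: frc_closed)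
  finally show ?thesis .
qed

lemma frc_add:
  assumes "a \<in> carrier A" "s \<in> P" "b \<in> carrier A" "t \<in> P"
  shows "frc a s \<oplus>\<^bsub>L\<^esub> frc b t = frc (a \<otimes> t \<oplus> b \<otimes> s) (s \<otimes> t)"
proof -
  have *: "frc (a' \<otimes> t' \<oplus> b' \<otimes> s') (s' \<otimes> t') = frc (a \<otimes> t \<oplus> b \<otimes> s) (s \<otimes> t)"
    if abst: "(a', s') \<in> frc a s" "(b', t') \<in> frc b t" for a' s' b' t'
  proof -
    obtain u v where c: "a' \<in> carrier A" "b' \<in> carrier A" "s' \<in> P" "t' \<in> P" "u \<in> P" "v \<in> P"
      and e: "u \<otimes> (a \<otimes> s') = u \<otimes> (a' \<otimes> s)" "v \<otimes> (b \<otimes> t') = v \<otimes> (b' \<otimes> t)"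
      using abst by (auto simp: frc_mem rel_iff)
    note cc = assms(1,3) assms(2,4)[THEN P_closed] c(1,2) c(3-6)[THEN P_closed]
    have "(u \<otimes> v) \<otimes> ((a' \<otimes> t' \<oplus> b' \<otimes> s') \<otimes> (s \<otimes> t)) =
        (u \<otimes> (a' \<otimes> s)) \<otimes> (v \<otimes> (t' \<otimes> t)) \<oplus> (u \<otimes> (s' \<otimes> s)) \<otimes> (v \<otimes> (b' \<otimes> t))"
      using cc by (simp add: m_ac l_distr r_distr)
    also have "\<dots> = (u \<otimes> v) \<otimes> ((a \<otimes> t \<oplus> b \<otimes> s) \<otimes> (s' \<otimes> t'))"
      unfolding e[symmetric] using cc by (simp add: m_ac l_distr r_distr)
    finally show ?thesis using assms c
      by (subst frc_eq_iff) (auto simp: P_closed intro!: bexI[of _ "u \<otimes> v"])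
  qed
  have "frc a s \<oplus>\<^bsub>L\<^esub> frc b t = (\<Union>z\<in>frc a s. \<Union>w\<in>frc b t. frc (fst z \<otimes> snd w \<oplus> fst w \<otimes> snd z) (snd z \<otimes> snd w))"
    by (simp add: localization_def case_prod_beta)
  also have "\<dots> = (\<Union>z\<in>frc a s. \<Union>w\<in>frc b t. frc (a \<otimes> t \<oplus> b \<otimes> s) (s \<otimes> t))"
    by (intro SUP_cong refl *) simp_all
  also have "\<dots> = frc (a \<otimes> t \<oplus> b \<otimes> s) (s \<otimes> t)"
    using frc_self[OF assms(1,2)] frc_self[OF assms(3,4)] by (auto simp del: frc_closed)
  finally show ?thesis .
qed

lemma cring_L: "cring L"
proof (rule cringI)
  note sim = frc_mult frc_add L_simps P_closed
  show "abelian_group L"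
  proof (rule abelian_groupI)
    show "\<zero>\<^bsub>L\<^esub> \<in> carrier L" by (simp add: L_simps)
    fix x y assume "x \<in> carrier L" "y \<in> carrier L"
    then obtain a s b t where x: "a \<in> carrier A" "s \<in> P" "x = frc a s" and y: "b \<in> carrier A" "t \<in> P" "y = frc b t"
      by (metis frcE)
    show "x \<oplus>\<^bsub>L\<^esub> y \<in> carrier L" using x y by (simp add: sim)
    show "x \<oplus>\<^bsub>L\<^esub> y = y \<oplus>\<^bsub>L\<^esub> x" using x y by (simp add: sim a_comm m_comm)
    fix z assume "z \<in> carrier L"
    then obtain c w where z: "c \<in> carrier A" "w \<in> P" "z = frc c w" by (metis frcE)
    show "x \<oplus>\<^bsub>L\<^esub> y \<oplus>\<^bsub>L\<^esub> z = x \<oplus>\<^bsub>L\<^esub> (y \<oplus>\<^bsub>L\<^esub> z)"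
      using x y z by (simp add: sim m_ac a_ac l_distr r_distr)
  next
    fix x assume "x \<in> carrier L"
    then obtain a s where x: "a \<in> carrier A" "s \<in> P" "x = frc a s" by (metis frcE)
    show "\<zero>\<^bsub>L\<^esub> \<oplus>\<^bsub>L\<^esub> x = x" using x by (simp add: sim)
    have "frc (\<ominus> a) s \<oplus>\<^bsub>L\<^esub> x = \<zero>\<^bsub>L\<^esub>"
      using x by (simp add: sim l_neg flip: l_distr) (rule frc_eqI; simp add: P_closed)
    then show "\<exists>y\<in>carrier L. y \<oplus>\<^bsub>L\<^esub> x = \<zero>\<^bsub>L\<^esub>" using x by (intro bexI[of _ "frc (\<ominus> a) s"]) auto
  qed
  show "comm_monoid L"
  proof (rule comm_monoidI)
    show "\<one>\<^bsub>L\<^esub> \<in> carrier L" by (simp add: L_simps)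
    fix x y assume "x \<in> carrier L" "y \<in> carrier L"
    then obtain a s b t where x: "a \<in> carrier A" "s \<in> P" "x = frc a s" and y: "b \<in> carrier A" "t \<in> P" "y = frc b t"
      by (metis frcE)
    show "x \<otimes>\<^bsub>L\<^esub> y \<in> carrier L" using x y by (simp add: sim)
    show "x \<otimes>\<^bsub>L\<^esub> y = y \<otimes>\<^bsub>L\<^esub> x" using x y by (simp add: sim m_comm)
    fix z assume "z \<in> carrier L"
    then obtain c w where z: "c \<in> carrier A" "w \<in> P" "z = frc c w" by (metis frcE)
    show "x \<otimes>\<^bsub>L\<^esub> y \<otimes>\<^bsub>L\<^esub> z = x \<otimes>\<^bsub>L\<^esub> (y \<otimes>\<^bsub>L\<^esub> z)"
      using x y z by (simp add: sim m_ac)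
  next
    fix x assume "x \<in> carrier L"
    then obtain a s where x: "a \<in> carrier A" "s \<in> P" "x = frc a s" by (metis frcE)
    show "\<one>\<^bsub>L\<^esub> \<otimes>\<^bsub>L\<^esub> x = x" using x by (simp add: sim)
  qed
  fix x y z assume "x \<in> carrier L" "y \<in> carrier L" "z \<in> carrier L"
  then obtain a s b t c w where x: "a \<in> carrier A" "s \<in> P" "x = frc a s" and y: "b \<in> carrier A" "t \<in> P" "y = frc b t"
    and z: "c \<in> carrier A" "w \<in> P" "z = frc c w" by (metis frcE)
  show "(x \<oplus>\<^bsub>L\<^esub> y) \<otimes>\<^bsub>L\<^esub> z = x \<otimes>\<^bsub>L\<^esub> z \<oplus>\<^bsub>L\<^esub> y \<otimes>\<^bsub>L\<^esub> z"
    using x y z by (simp add: sim) (rule frc_eqI; simp add: P_closed m_ac a_ac l_distr r_distr)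
qed

sublocale L: cring L by (rule cring_L)

definition incl :: "'a \<Rightarrow> ('a \<times> 'a) set" where "incl a = frc a \<one>"

lemma incl_hom: "incl \<in> ring_hom A L"
  by (rule ring_hom_memI) (simp_all add: incl_def frc_mult frc_add L_simps)

lemma incl_closed [simp]: "a \<in> carrier A \<Longrightarrow> incl a \<in> carrier L"
  by (rule ring_hom_closed[OF incl_hom])

lemma frc_incl: "a \<in> carrier A \<Longrightarrow> s \<in> P \<Longrightarrow> frc a s \<otimes>\<^bsub>L\<^esub> incl s = incl a"
  unfolding incl_def by (subst frc_mult) (simp_all add: P_closed, rule frc_eqI, simp_all add: P_closed)

lemma incl_unit: "incl f \<in> Units L"
proof -
  have "incl f \<otimes>\<^bsub>L\<^esub> frc \<one> f = \<one>\<^bsub>L\<^esub>"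
    unfolding incl_def L_simps by (subst frc_mult) (simp_all, rule frc_eqI, simp_all)
  then show ?thesis using L.m_comm[of "incl f" "frc \<one> f"] by (auto simp: Units_def intro!: bexI[of _ "frc \<one> f"])
qed

lemma incl_eqD:
  assumes "a \<in> carrier A" "b \<in> carrier A" "incl a = incl b"
  shows "\<exists>k::nat. f [^] k \<otimes> a = f [^] k \<otimes> b"
  using assms(3) frc_eq_iff[OF assms(1,2) P_one P_one] assms(1,2) by (auto simp: incl_def powers_def)

text \<open>The image of a class is the one \<open>y\<close> with
  \<open>y \<otimes> h s = h a\<close> for every representative \<open>(a, s)\<close>. Uniqueness
  comes from \<open>h s\<close> being a unit, and it also yields additivity and multiplicativity by
  comparing after multiplication with the denominators.\<close>

lemma localization_lift:
  assumes T: "cring T" and h: "h \<in> ring_hom A T" and hf: "h f \<in> Units T"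
  shows "\<exists>H \<in> ring_hom L T. \<forall>a\<in>carrier A. H (incl a) = h a"
proof -
  interpret T: cring T by fact
  have hc: "h a \<in> carrier T" if "a \<in> carrier A" for a using ring_hom_closed[OF h that] .
  have hP: "h s \<in> Units T" if sP: "s \<in> P" for s
  proof -
    obtain k :: nat where "s = f [^] k" using sP by (auto simp: powers_def)
    then show ?thesis
      using ring_hom_nat_pow[OF h ring_axioms T.ring_axioms f, of k] T.Units_pow_closed[OF hf] by simp
  qed
  have ex1: "\<exists>!y. y \<in> carrier T \<and> (\<forall>(a, s)\<in>x. y \<otimes>\<^bsub>T\<^esub> h s = h a)" if xL: "x \<in> carrier L" for x
  proof -
    obtain a s where x: "a \<in> carrier A" "s \<in> P" "x = frc a s" using xL by (metis frcE)
    let ?y = "h a \<otimes>\<^bsub>T\<^esub> inv\<^bsub>T\<^esub> (h s)"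
    have y: "?y \<in> carrier T" using hc[OF x(1)] hP[OF x(2)] by simp
    have ys: "?y \<otimes>\<^bsub>T\<^esub> h s = h a"
      using hc[OF x(1)] hP[OF x(2)] hc[OF P_closed[OF x(2)]] by (simp add: T.m_assoc)
    have "?y \<otimes>\<^bsub>T\<^esub> h t = h b" if bt: "(b, t) \<in> x" for b t
    proof -
      obtain u where c: "b \<in> carrier A" "t \<in> P" "u \<in> P" "u \<otimes> (a \<otimes> t) = u \<otimes> (b \<otimes> s)"
        using bt x by (auto simp: frc_mem rel_iff)
      note cc = x(1) c(1) x(2)[THEN P_closed] c(2,3)[THEN P_closed]
      note hh = cc[THEN hc]
      have "h (u \<otimes> (a \<otimes> t)) = h (u \<otimes> (b \<otimes> s))" using c by simp
      then have "h u \<otimes>\<^bsub>T\<^esub> (h a \<otimes>\<^bsub>T\<^esub> h t) = h u \<otimes>\<^bsub>T\<^esub> (h b \<otimes>\<^bsub>T\<^esub> h s)"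
        using cc by (simp add: ring_hom_mult[OF h])
      then have "h a \<otimes>\<^bsub>T\<^esub> h t = h b \<otimes>\<^bsub>T\<^esub> h s"
        using T.Units_l_cancel[OF hP[OF c(3)]] hh by simp
      then have "(?y \<otimes>\<^bsub>T\<^esub> h t) \<otimes>\<^bsub>T\<^esub> h s = h b \<otimes>\<^bsub>T\<^esub> h s"
        using ys hh y by (metis T.m_assoc T.m_comm)
      then show ?thesis using T.Units_cancel_right[OF hP[OF x(2)]] y hh by simp
    qed
    then have "?y \<in> carrier T \<and> (\<forall>(a, s)\<in>x. ?y \<otimes>\<^bsub>T\<^esub> h s = h a)" using y by auto
    moreover have "y' = ?y" if "y' \<in> carrier T \<and> (\<forall>(a, s)\<in>x. y' \<otimes>\<^bsub>T\<^esub> h s = h a)" for y'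
      using that frc_self[OF x(1,2)] x(3) ys y T.Units_cancel_right[OF hP[OF x(2)], of y' ?y] by auto
    ultimately show ?thesis by blast
  qed
  define H where "H x = (THE y. y \<in> carrier T \<and> (\<forall>(a, s)\<in>x. y \<otimes>\<^bsub>T\<^esub> h s = h a))" for x
  have H: "H x \<in> carrier T" "(a, s) \<in> x \<Longrightarrow> H x \<otimes>\<^bsub>T\<^esub> h s = h a" if "x \<in> carrier L" for x a s
    using theI'[OF ex1[OF that]] unfolding H_def by auto
  have Hfrac: "H (frc a s) \<otimes>\<^bsub>T\<^esub> h s = h a" if "a \<in> carrier A" "s \<in> P" for a s
    using H(2)[of "frc a s"] that frc_self by simp
  have Heq: "H (frc a s) = y" if "a \<in> carrier A" "s \<in> P" "y \<in> carrier T" "y \<otimes>\<^bsub>T\<^esub> h s = h a" for a s y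
    using T.Units_cancel_right[OF hP[OF that(2)], of "H (frc a s)" y] Hfrac[OF that(1,2)] that H(1)[of "frc a s"] by simp
  have incl: "H (incl a) = h a" if "a \<in> carrier A" for a
    unfolding incl_def using that hc ring_hom_one[OF h] by (intro Heq) simp_all
  have "H \<in> ring_hom L T"
  proof (rule ring_hom_memI)
    show "H \<one>\<^bsub>L\<^esub> = \<one>\<^bsub>T\<^esub>" unfolding L_simps using ring_hom_one[OF h] by (intro Heq) simp_all
    fix x assume xL: "x \<in> carrier L"
    then show "H x \<in> carrier T" by (rule H)
    fix y assume yL: "y \<in> carrier L"
    obtain a s b t where x: "a \<in> carrier A" "s \<in> P" "x = frc a s" and y: "b \<in> carrier A" "t \<in> P" "y = frc b t"
      using xL yL by (metis frcE)
    note e = Hfrac[OF x(1,2), folded x(3)] Hfrac[OF y(1,2), folded y(3)]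
    note cc = hc[OF x(1)] hc[OF y(1)] hc[OF P_closed[OF x(2)]] hc[OF P_closed[OF y(2)]] H(1)[OF xL] H(1)[OF yL]
    show "H (x \<otimes>\<^bsub>L\<^esub> y) = H x \<otimes>\<^bsub>T\<^esub> H y"
      unfolding x(3) y(3) frc_mult[OF x(1,2) y(1,2)]
    proof (rule Heq)
      have "H (frc a s) \<otimes>\<^bsub>T\<^esub> H (frc b t) \<otimes>\<^bsub>T\<^esub> (h s \<otimes>\<^bsub>T\<^esub> h t) = (H x \<otimes>\<^bsub>T\<^esub> h s) \<otimes>\<^bsub>T\<^esub> (H y \<otimes>\<^bsub>T\<^esub> h t)"
        unfolding x(3)[symmetric] y(3)[symmetric] using cc by (simp add: T.m_ac)
      then show "H (frc a s) \<otimes>\<^bsub>T\<^esub> H (frc b t) \<otimes>\<^bsub>T\<^esub> h (s \<otimes> t) = h (a \<otimes> b)"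
        unfolding e using x y by (simp add: ring_hom_mult[OF h] P_closed)
    qed (use x y cc in auto)
    show "H (x \<oplus>\<^bsub>L\<^esub> y) = H x \<oplus>\<^bsub>T\<^esub> H y"
      unfolding x(3) y(3) frc_add[OF x(1,2) y(1,2)]
    proof (rule Heq)
      have "(H (frc a s) \<oplus>\<^bsub>T\<^esub> H (frc b t)) \<otimes>\<^bsub>T\<^esub> (h s \<otimes>\<^bsub>T\<^esub> h t) = (H x \<otimes>\<^bsub>T\<^esub> h s) \<otimes>\<^bsub>T\<^esub> h t \<oplus>\<^bsub>T\<^esub> (H y \<otimes>\<^bsub>T\<^esub> h t) \<otimes>\<^bsub>T\<^esub> h s"
        unfolding x(3)[symmetric] y(3)[symmetric] using cc by (simp add: T.l_distr) (simp add: T.m_ac)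
      then show "(H (frc a s) \<oplus>\<^bsub>T\<^esub> H (frc b t)) \<otimes>\<^bsub>T\<^esub> h (s \<otimes> t) = h (a \<otimes> t \<oplus> b \<otimes> s)"
        unfolding e using x y by (simp add: ring_hom_mult[OF h] ring_hom_add[OF h] P_closed)
    qed (use x y cc in \<open>auto simp: P_closed\<close>)
  qed
  then show ?thesis using incl by blast
qed

end

section \<open>Pieces of the completion\<close>

locale piece_base = localization_base A f for A :: "('r, 'a, 'm) algebra_scheme" (structure) and f +
  fixes p n :: nat
begin

abbreviation "q \<equiv> [(p ^ n)] \<cdot>\<^bsub>L\<^esub> \<one>\<^bsub>L\<^esub>"
abbreviation "B \<equiv> piece A p f n"
abbreviation "\<iota> \<equiv> to_piece A p f n"

lemma q_closed: "q \<in> carrier L"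
  by simp

sublocale I: ideal "PIdl\<^bsub>L\<^esub> q" L
  by (rule L.cgenideal_ideal[OF q_closed])

lemma cring_B: "cring B"
  unfolding piece_def reduction_def quot_algebra_def
  by (intro cring_with_algmap I.quotient_is_cring cring_L)

sublocale B: cring B by (rule cring_B)

lemma \<pi>_hom: "(+>\<^bsub>L\<^esub>) (PIdl\<^bsub>L\<^esub> q) \<in> ring_hom L B"
  unfolding piece_def reduction_def quot_algebra_def using I.rcos_ring_hom by simp

lemma \<iota>_eq: "\<iota> a = PIdl\<^bsub>L\<^esub> q +>\<^bsub>L\<^esub> incl a"
  by (simp add: to_piece_def incl_def)

lemma \<iota>_hom: "\<iota> \<in> ring_hom A B"
  using ring_hom_trans[OF incl_hom \<pi>_hom] by (simp add: \<iota>_eq[abs_def] comp_def)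

lemma \<iota>_closed [simp]: "a \<in> carrier A \<Longrightarrow> \<iota> a \<in> carrier B"
  by (rule ring_hom_closed[OF \<iota>_hom])

lemma algmap_B: "algmap B r = \<iota> (algmap A r)"
  by (simp add: piece_def reduction_def quot_algebra_def \<iota>_eq L_simps incl_def)

lemma \<iota>_unit: "\<iota> f \<in> Units B"
  unfolding \<iota>_eq by (rule ring_hom_Units[OF \<pi>_hom incl_unit])

lemma \<iota>_pow: "\<iota> (f [^] (k::nat)) = \<iota> f [^]\<^bsub>B\<^esub> k"
  by (rule ring_hom_nat_pow[OF \<iota>_hom ring_axioms B.ring_axioms f])

lemma \<iota>_pow_unit: "\<iota> (f [^] (k::nat)) \<in> Units B"
  unfolding \<iota>_pow by (rule B.Units_pow_closed[OF \<iota>_unit])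

lemma B_E:
  assumes "x \<in> carrier B"
  obtains y where "y \<in> carrier L" "x = PIdl\<^bsub>L\<^esub> q +>\<^bsub>L\<^esub> y"
  using assms unfolding piece_def reduction_def quot_algebra_def
  by (auto elim: carrier_quotE)

text \<open>Clearing denominators: every element of a piece becomes the image of an element of
  \<open>A\<close> after multiplication with a power of \<open>f\<close>, which is a unit there.
  Statements about pieces are reduced to \<open>A\<close> in this way.\<close>

lemma B_fracE:
  assumes "x \<in> carrier B"
  obtains a k where "a \<in> carrier A" "x \<otimes>\<^bsub>B\<^esub> \<iota> (f [^] (k::nat)) = \<iota> a"
proof -
  obtain y where y: "y \<in> carrier L" "x = PIdl\<^bsub>L\<^esub> q +>\<^bsub>L\<^esub> y" using assms by (rule B_E)
  obtain a s where a: "a \<in> carrier A" "s \<in> P" "y = frc a s" using y(1) by (rule frcE)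
  obtain k :: nat where k: "s = f [^] k" using a(2) by (auto simp: powers_def)
  have "x \<otimes>\<^bsub>B\<^esub> \<iota> (f [^] k) = \<iota> a"
    unfolding \<iota>_eq y(2) frc_incl[OF a(1,2), symmetric] a(3)[symmetric] k[symmetric]
    using y(1) a(2) by (simp add: ring_hom_mult[OF \<pi>_hom] P_closed)
  then show ?thesis using that a(1) by blast
qed

lemma B_char: "[(p ^ n)] \<cdot>\<^bsub>B\<^esub> \<one>\<^bsub>B\<^esub> = \<zero>\<^bsub>B\<^esub>"
proof -
  have "PIdl\<^bsub>L\<^esub> q +>\<^bsub>L\<^esub> q = \<zero>\<^bsub>L Quot PIdl\<^bsub>L\<^esub> q\<^esub>"
    using L.quotient_eq_iff_same_a_r_cos[OF I.ideal_axioms q_closed L.zero_closed] L.cgenideal_self[OF q_closed]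
      ring_hom_zero[OF I.rcos_ring_hom L.ring_axioms I.quotient_is_ring] by (simp add: L.minus_eq)
  moreover have "(PIdl\<^bsub>L\<^esub> q +>\<^bsub>L\<^esub> q) = [(p ^ n)] \<cdot>\<^bsub>B\<^esub> \<one>\<^bsub>B\<^esub>"
    using ring_hom_nat_mult[OF \<pi>_hom L.ring_axioms B.ring_axioms L.one_closed] ring_hom_one[OF \<pi>_hom] by simp
  ultimately show ?thesis by (simp add: piece_def reduction_def quot_algebra_def)
qed

text \<open>The kernel of the map from \<open>A\<close> to the piece, with all fractions cleared.
  The power of \<open>f\<close> collects a denominator from the multiple of p^n and a multiplier
  from the equality of fractions.\<close>

lemma \<iota>_zeroD:
  assumes a: "a \<in> carrier A" and 0: "\<iota> a = \<zero>\<^bsub>B\<^esub>"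
  shows "\<exists>(k::nat) b. b \<in> carrier A \<and> f [^] k \<otimes> a = [(p ^ n)] \<cdot> b"
proof -
  have "PIdl\<^bsub>L\<^esub> q +>\<^bsub>L\<^esub> incl a = PIdl\<^bsub>L\<^esub> q"
    using 0 by (simp add: \<iota>_eq piece_def reduction_def quot_algebra_def FactRing_def)
  then have "incl a \<in> PIdl\<^bsub>L\<^esub> q" using I.a_rcos_self[of "incl a"] a by simp
  then obtain y where y: "y \<in> carrier L" "incl a = y \<otimes>\<^bsub>L\<^esub> q" unfolding cgenideal_def by blast
  obtain b s where b: "b \<in> carrier A" "s \<in> P" "y = frc b s" using y(1) by (rule frcE)
  obtain k :: nat where k: "s = f [^] k" using b(2) by (auto simp: powers_def)
  note sc = P_closed[OF b(2)]
  have qy: "y \<otimes>\<^bsub>L\<^esub> q = [(p ^ n)] \<cdot>\<^bsub>L\<^esub> y" using y(1) L.add_pow_rdistr[of y "\<one>\<^bsub>L\<^esub>" "p ^ n"] by simp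
  have "incl (a \<otimes> s) = incl a \<otimes>\<^bsub>L\<^esub> incl s" by (rule ring_hom_mult[OF incl_hom a sc])
  also have "\<dots> = [(p ^ n)] \<cdot>\<^bsub>L\<^esub> (y \<otimes>\<^bsub>L\<^esub> incl s)"
    unfolding y(2) qy using y(1) sc by (simp add: L.add_pow_ldistr)
  also have "\<dots> = incl ([(p ^ n)] \<cdot> b)"
    unfolding b(3) frc_incl[OF b(1,2)] by (rule ring_hom_nat_mult[OF incl_hom ring_axioms L.ring_axioms b(1), symmetric])
  finally obtain j :: nat where "f [^] j \<otimes> (a \<otimes> s) = f [^] j \<otimes> ([(p ^ n)] \<cdot> b)"
    using incl_eqD[of "a \<otimes> s" "[(p ^ n)] \<cdot> b"] a b sc by auto
  then have e: "f [^] j \<otimes> (a \<otimes> s) = f [^] j \<otimes> ([(p ^ n)] \<cdot> b)" .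
  have fj: "f [^] j \<in> carrier A" by simp
  have "f [^] (j + k) \<otimes> a = (f [^] j \<otimes> s) \<otimes> a" unfolding k by (simp only: nat_pow_mult f)
  also have "\<dots> = f [^] j \<otimes> (a \<otimes> s)" using a sc fj by (simp only: m_assoc m_comm[of s a])
  also have "\<dots> = [(p ^ n)] \<cdot> (f [^] j \<otimes> b)" unfolding e by (rule add_pow_rdistr[OF fj b(1)])
  finally have "f [^] (j + k) \<otimes> a = [(p ^ n)] \<cdot> (f [^] j \<otimes> b)" .
  moreover have "f [^] j \<otimes> b \<in> carrier A" using fj b(1) by simp
  ultimately show ?thesis by blast
qed

lemma piece_lift:
  assumes T: "cring T" and h: "h \<in> ring_hom A T" and hf: "h f \<in> Units T"
    and hp: "[(p ^ n)] \<cdot>\<^bsub>T\<^esub> \<one>\<^bsub>T\<^esub> = \<zero>\<^bsub>T\<^esub>"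
  shows "\<exists>H \<in> ring_hom B T. \<forall>a\<in>carrier A. H (\<iota> a) = h a"
proof -
  interpret T: cring T by fact
  obtain H where H: "H \<in> ring_hom L T" "\<forall>a\<in>carrier A. H (incl a) = h a"
    using localization_lift[OF T h hf] by blast
  have Hq: "H q = \<zero>\<^bsub>T\<^esub>"
    using ring_hom_nat_mult[OF H(1) L.ring_axioms T.ring_axioms L.one_closed] ring_hom_one[OF H(1)] hp by simp
  have HI: "\<forall>x\<in>PIdl\<^bsub>L\<^esub> q. H x = \<zero>\<^bsub>T\<^esub>"
  proof
    fix x assume "x \<in> PIdl\<^bsub>L\<^esub> q"
    then obtain y where y: "y \<in> carrier L" "x = y \<otimes>\<^bsub>L\<^esub> q" unfolding cgenideal_def by blast
    show "H x = \<zero>\<^bsub>T\<^esub>"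
      unfolding y(2) ring_hom_mult[OF H(1) y(1) q_closed] Hq
      using ring_hom_closed[OF H(1) y(1)] by (rule T.r_null)
  qed
  show ?thesis
  proof (rule bexI)
    show "(\<lambda>t. the_elem (H ` t)) \<in> ring_hom B T"
      using quot_lift_hom[OF I.ideal_axioms T.ring_axioms H(1) HI]
      by (simp add: piece_def reduction_def quot_algebra_def)
    show "\<forall>a\<in>carrier A. the_elem (H ` \<iota> a) = h a"
      using H(2) by (simp add: \<iota>_eq the_elem_image_coset[OF I.ideal_axioms T.ring_axioms H(1) HI])
  qed
qed

text \<open>The map from \<open>A\<close> to the piece is an epimorphism of rings: a homomorphism is
  determined by its values on the numerator and on the unit f^k.\<close>

lemma piece_hom_eq:
  assumes T: "cring T" and H: "H \<in> ring_hom B T" "H' \<in> ring_hom B T"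
    and eq: "\<And>a. a \<in> carrier A \<Longrightarrow> H (\<iota> a) = H' (\<iota> a)" and x: "x \<in> carrier B"
  shows "H x = H' x"
proof -
  interpret T: cring T by fact
  obtain a and k :: nat where a: "a \<in> carrier A" "x \<otimes>\<^bsub>B\<^esub> \<iota> (f [^] k) = \<iota> a" using x by (rule B_fracE)
  have "H x \<otimes>\<^bsub>T\<^esub> H (\<iota> (f [^] k)) = H' x \<otimes>\<^bsub>T\<^esub> H (\<iota> (f [^] k))"
    using eq[OF a(1)] ring_hom_mult[OF H(1) x, of "\<iota> (f [^] k)"] ring_hom_mult[OF H(2) x, of "\<iota> (f [^] k)"] eq[of "f [^] k"]
    by (simp flip: a(2))
  then show ?thesis
    using T.Units_cancel_right[OF ring_hom_Units[OF H(1) \<iota>_pow_unit]] ring_hom_closed[OF H(1) x] ring_hom_closed[OF H(2) x] by blast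
qed

end

section \<open>Binomial sums and derivations\<close>

context abelian_group
begin

lemma nat_mult_closed: "x \<in> carrier G \<Longrightarrow> [(n::nat)] \<cdot> x \<in> carrier G"
  by simp

lemma nat_mult_add: "x \<in> carrier G \<Longrightarrow> [(m + n::nat)] \<cdot> x = [m] \<cdot> x \<oplus> [n] \<cdot> x"
  by (simp add: add.nat_pow_mult)

lemma nat_mult_mult: "x \<in> carrier G \<Longrightarrow> [(m * n::nat)] \<cdot> x = [m] \<cdot> ([n] \<cdot> x)"
  by (simp add: add.nat_pow_pow mult.commute)

lemma nat_mult_distr: "x \<in> carrier G \<Longrightarrow> y \<in> carrier G \<Longrightarrow> [(n::nat)] \<cdot> (x \<oplus> y) = [n] \<cdot> x \<oplus> [n] \<cdot> y"
  by (rule add.nat_pow_distrib)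

lemma nat_mult_minus:
  assumes x: "x \<in> carrier G" and y: "y \<in> carrier G"
  shows "[(n::nat)] \<cdot> (x \<ominus> y) = [n] \<cdot> x \<ominus> [n] \<cdot> y"
proof -
  have "x \<ominus> y \<oplus> y = x" using x y by (simp add: minus_eq a_assoc l_neg)
  then have "[n] \<cdot> x = [n] \<cdot> (x \<ominus> y) \<oplus> [n] \<cdot> y"
    using nat_mult_distr[of "x \<ominus> y" y n] x y by simp
  then show ?thesis using x y by (simp add: minus_eq a_assoc r_neg)
qed

lemma nat_mult_zero: "[(n::nat)] \<cdot> \<zero> = \<zero>"
  by simp

lemma nat_mult_finsum:
  assumes "f \<in> I \<rightarrow> carrier G"
  shows "[(n::nat)] \<cdot> finsum G f I = finsum G (\<lambda>i. [n] \<cdot> f i) I"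
  by (rule abelian_group_hom_finsum[OF abelian_group_axioms abelian_group_axioms _ _ assms])
     (auto simp: nat_mult_distr)

text \<open>Bezout: x is an integral combination of k x and p x. This takes the place of division by
  integers prime to p.\<close>

lemma coprime_nat_mult_zero:
  assumes "coprime k p" "x \<in> carrier G" "[(k::nat)] \<cdot> x = \<zero>" "[(p::nat)] \<cdot> x = \<zero>"
  shows "x = \<zero>"
proof (cases "p = 1")
  case True
  then show ?thesis using assms by simp
next
  case False
  obtain u v where uv: "k * u = p * v + 1" using coprime_bezout_strong[OF assms(1) False] by blast
  have "[(k * u)] \<cdot> x = \<zero>" unfolding mult.commute[of k] nat_mult_mult[OF assms(2)] assms(3) by simp
  moreover have "[(p * v + 1)] \<cdot> x = x"
    unfolding mult.commute[of p] using assms by (simp only: nat_mult_add nat_mult_mult nat_mult_zero) simp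
  ultimately show ?thesis using uv by simp
qed

text \<open>The induction step common to the binomial theorem, the Leibniz rule and the recursion
  for Bell polynomials, with \<open>F i j\<close> standing for a term of bidegree (i, j).\<close>

lemma pascal_sum:
  assumes "\<And>i j. F i j \<in> carrier G"
  shows "finsum G (\<lambda>i. [(n choose i)] \<cdot> F (Suc i) (n - i)) {..n} \<oplus> finsum G (\<lambda>i. [(n choose i)] \<cdot> F i (Suc n - i)) {..n} =
    finsum G (\<lambda>i. [(Suc n choose i)] \<cdot> F i (Suc n - i)) {..Suc n}"
proof -
  have fc: "(\<lambda>i. [(c i :: nat)] \<cdot> F (u i) (v i)) \<in> I \<rightarrow> carrier G" for c u v and I :: "nat set"
    using assms by simp
  note [simp] = assms
  have "finsum G (\<lambda>i. [(Suc n choose i)] \<cdot> F i (Suc n - i)) {..Suc n} =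
      finsum G (\<lambda>i. [(Suc n choose Suc i)] \<cdot> F (Suc i) (n - i)) {..n} \<oplus> F 0 (Suc n)"
    using fc by (subst finsum_Suc2) simp_all
  also have "finsum G (\<lambda>i. [(Suc n choose Suc i)] \<cdot> F (Suc i) (n - i)) {..n} =
      finsum G (\<lambda>i. [(n choose i)] \<cdot> F (Suc i) (n - i)) {..n} \<oplus> finsum G (\<lambda>i. [(n choose Suc i)] \<cdot> F (Suc i) (n - i)) {..n}"
    unfolding binomial_Suc_Suc using fc by (simp only: nat_mult_add assms finsum_addf)
  also have "\<dots> \<oplus> F 0 (Suc n) = finsum G (\<lambda>i. [(n choose i)] \<cdot> F (Suc i) (n - i)) {..n} \<oplus>
      (finsum G (\<lambda>i. [(n choose Suc i)] \<cdot> F (Suc i) (n - i)) {..n} \<oplus> F 0 (Suc n))"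
    using fc by (intro a_assoc finsum_closed assms) simp_all
  also have "finsum G (\<lambda>i. [(n choose Suc i)] \<cdot> F (Suc i) (n - i)) {..n} \<oplus> F 0 (Suc n) =
      finsum G (\<lambda>i. [(n choose i)] \<cdot> F i (Suc n - i)) {..Suc n}"
    using fc by (subst finsum_Suc2) simp_all
  also have "\<dots> = finsum G (\<lambda>i. [(n choose i)] \<cdot> F i (Suc n - i)) {..n}"
    using fc by (subst finsum_Suc) (simp_all add: finsum_closed binomial_eq_0)
  finally show ?thesis by simp
qed

text \<open>All inner binomial coefficients are divisible by p. The exact quotient is kept in the
  statement: it is \<open>frob_poly\<close> for p-th powers, and the error term for p-fold
  derivatives of a product.\<close>

lemma sum_binomial_prime:
  assumes p: "Factorial_Ring.prime p" and F: "\<And>i. F i \<in> carrier G"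
  shows "finsum G (\<lambda>i. [(p choose i)] \<cdot> F i) {..p} =
    F 0 \<oplus> (F p \<oplus> [p] \<cdot> finsum G (\<lambda>i. [((p choose i) div p)] \<cdot> F i) {1..<p})"
proof -
  have p0: "p > 0" using p by (simp add: prime_gt_0_nat)
  have s: "{..p} = insert 0 (insert p {1..<p})" using p0 by auto
  have "finsum G (\<lambda>i. [(p choose i)] \<cdot> F i) {..p} = F 0 \<oplus> (F p \<oplus> finsum G (\<lambda>i. [(p choose i)] \<cdot> F i) {1..<p})"
    unfolding s using p0 F by (subst finsum_insert, simp, simp, simp, simp, subst finsum_insert) simp_all
  also have "finsum G (\<lambda>i. [(p choose i)] \<cdot> F i) {1..<p} = finsum G (\<lambda>i. [p] \<cdot> ([((p choose i) div p)] \<cdot> F i)) {1..<p}"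
  proof (rule finsum_cong')
    fix i assume "i \<in> {1..<p}"
    then have "p dvd (p choose i)" using p by (intro dvd_choose_prime) auto
    then show "[(p choose i)] \<cdot> F i = [p] \<cdot> ([((p choose i) div p)] \<cdot> F i)"
      using F by (simp flip: nat_mult_mult)
  qed (use F in simp_all)
  also have "\<dots> = [p] \<cdot> finsum G (\<lambda>i. [((p choose i) div p)] \<cdot> F i) {1..<p}"
    using F by (subst nat_mult_finsum) simp_all
  finally show ?thesis .
qed

end

section \<open>The p-th power of a sum\<close>

context cring
begin

lemma binomial_ring:
  assumes x: "x \<in> carrier R" and y: "y \<in> carrier R"
  shows "(x \<oplus> y) [^] (n::nat) = finsum R (\<lambda>i. [(n choose i)] \<cdot> (x [^] i \<otimes> y [^] (n - i))) {..n}"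
proof (induction n)
  case 0
  then show ?case by simp
next
  case (Suc n)
  let ?g = "\<lambda>i. [(n choose i)] \<cdot> (x [^] i \<otimes> y [^] (n - i))"
  have g: "?g \<in> {..n} \<rightarrow> carrier R" using assms by simp
  have "(x \<oplus> y) [^] Suc n = finsum R ?g {..n} \<otimes> x \<oplus> finsum R ?g {..n} \<otimes> y"
    using Suc assms g by (simp add: r_distr finsum_closed)
  also have "finsum R ?g {..n} \<otimes> x = finsum R (\<lambda>i. [(n choose i)] \<cdot> (x [^] Suc i \<otimes> y [^] (n - i))) {..n}"
    using assms g by (subst finsum_ldistr) (auto intro!: finsum_cong' simp: add_pow_ldistr add_pow_rdistr m_ac)
  also have "finsum R ?g {..n} \<otimes> y = finsum R (\<lambda>i. [(n choose i)] \<cdot> (x [^] i \<otimes> y [^] (Suc n - i))) {..n}"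
    using assms g by (subst finsum_ldistr) (auto intro!: finsum_cong' simp: add_pow_ldistr add_pow_rdistr m_ac Suc_diff_le)
  finally show ?case
    using pascal_sum[of "\<lambda>i j. x [^] i \<otimes> y [^] j" n] assms by simp
qed

text \<open>The polynomial \<open>((x + y)\<^sup>p - x\<^sup>p - y\<^sup>p) / p\<close>.\<close>

definition frob_poly :: "nat \<Rightarrow> 'a \<Rightarrow> 'a \<Rightarrow> 'a" where
  "frob_poly p x y = finsum R (\<lambda>i. [((p choose i) div p)] \<cdot> (x [^] i \<otimes> y [^] (p - i))) {1..<p}"

lemma frob_poly_closed: "x \<in> carrier R \<Longrightarrow> y \<in> carrier R \<Longrightarrow> frob_poly p x y \<in> carrier R"
  unfolding frob_poly_def by (rule finsum_closed) simp

lemma frobenius_add: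
  assumes p: "Factorial_Ring.prime p" and x: "x \<in> carrier R" and y: "y \<in> carrier R"
  shows "(x \<oplus> y) [^] p = x [^] p \<oplus> y [^] p \<oplus> [p] \<cdot> frob_poly p x y"
proof -
  have "(x \<oplus> y) [^] p = y [^] p \<oplus> (x [^] p \<oplus> [p] \<cdot> frob_poly p x y)"
    unfolding binomial_ring[OF x y] frob_poly_def
    using sum_binomial_prime[OF p, of "\<lambda>i. x [^] i \<otimes> y [^] (p - i)"] x y by simp
  then show ?thesis using x y frob_poly_closed[OF x y] by (simp add: a_ac)
qed

end

lemma ring_hom_frob_poly:
  assumes h: "h \<in> ring_hom S C" and S: "cring S" and C: "cring C" and x: "x \<in> carrier S" "y \<in> carrier S"
  shows "h (cring.frob_poly S p x y) = cring.frob_poly C p (h x) (h y)"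
proof -
  interpret S: cring S by fact
  interpret C: cring C by fact
  have "h (cring.frob_poly S p x y) = finsum C (\<lambda>i. h ([((p choose i) div p)] \<cdot>\<^bsub>S\<^esub> (x [^]\<^bsub>S\<^esub> i \<otimes>\<^bsub>S\<^esub> y [^]\<^bsub>S\<^esub> (p - i)))) {1..<p}"
    unfolding S.frob_poly_def by (rule ring_hom_finsum[OF h S.ring_axioms C.ring_axioms]) (use x in simp)
  also have "\<dots> = cring.frob_poly C p (h x) (h y)"
    unfolding C.frob_poly_def using x ring_hom_closed[OF h]
    by (intro C.finsum_cong') (simp_all add: ring_hom_nat_mult[OF h S.ring_axioms C.ring_axioms]
      ring_hom_mult[OF h] ring_hom_nat_pow[OF h S.ring_axioms C.ring_axioms])
  finally show ?thesis .
qed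

section \<open>Iterated derivations and p-th powers\<close>

locale derivation_ring = cring R for R (structure) +
  fixes D assumes D: "derivation_along R R (\<lambda>x. x) D"
begin

lemma D_closed [simp]: "x \<in> carrier R \<Longrightarrow> D x \<in> carrier R"
  and D_add: "x \<in> carrier R \<Longrightarrow> y \<in> carrier R \<Longrightarrow> D (x \<oplus> y) = D x \<oplus> D y"
  and D_mult: "x \<in> carrier R \<Longrightarrow> y \<in> carrier R \<Longrightarrow> D (x \<otimes> y) = x \<otimes> D y \<oplus> y \<otimes> D x"
  using derivation_alongD[OF D] by auto

lemma D_zero [simp]: "D \<zero> = \<zero>"
  using D_add[of \<zero> \<zero>] add.r_cancel_one'[of "D \<zero>" "D \<zero>"] by simp

lemma D_one [simp]: "D \<one> = \<zero>"
  using D_mult[of \<one> \<one>] add.r_cancel_one'[of "D \<one>" "D \<one>"] by simp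

lemma D_nat_mult: "x \<in> carrier R \<Longrightarrow> D ([(n::nat)] \<cdot> x) = [n] \<cdot> D x"
  by (induction n) (simp_all add: D_add)

lemma D_finsum:
  assumes "f \<in> I \<rightarrow> carrier R"
  shows "D (finsum R f I) = finsum R (\<lambda>i. D (f i)) I"
  by (rule abelian_group_hom_finsum[OF abelian_group_axioms abelian_group_axioms _ _ assms]) (auto simp: D_add)

lemma D_power:
  assumes x: "x \<in> carrier R"
  shows "D (x [^] Suc n) = [Suc n] \<cdot> (x [^] n \<otimes> D x)"
proof (induction n)
  case (Suc n)
  have "D (x [^] Suc (Suc n)) = x [^] Suc n \<otimes> D x \<oplus> x \<otimes> D (x [^] Suc n)"
    using D_mult[of "x [^] Suc n" x] x by simp
  also have "x \<otimes> D (x [^] Suc n) = [Suc n] \<cdot> (x [^] Suc n \<otimes> D x)"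
    unfolding Suc using x by (simp add: add_pow_rdistr m_ac del: add.nat_pow_Suc)
  finally show ?case using x by (simp add: a_comm)
qed (use x in simp)

abbreviation "DD n \<equiv> (D ^^ n)"

lemma DD_closed [simp]: "x \<in> carrier R \<Longrightarrow> DD n x \<in> carrier R"
  by (induction n) simp_all

lemma DD_add: "x \<in> carrier R \<Longrightarrow> y \<in> carrier R \<Longrightarrow> DD n (x \<oplus> y) = DD n x \<oplus> DD n y"
  by (induction n) (simp_all add: D_add)

lemma DD_zero: "DD n \<zero> = \<zero>"
  by (induction n) simp_all

lemma DD_nat_mult: "x \<in> carrier R \<Longrightarrow> DD n ([(m::nat)] \<cdot> x) = [m] \<cdot> DD n x"
  by (induction n) (simp_all add: D_nat_mult)

lemma leibniz:
  assumes x: "x \<in> carrier R" and y: "y \<in> carrier R"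
  shows "DD n (x \<otimes> y) = finsum R (\<lambda>i. [(n choose i)] \<cdot> (DD i x \<otimes> DD (n - i) y)) {..n}"
proof (induction n)
  case 0
  then show ?case using assms by simp
next
  case (Suc n)
  let ?g = "\<lambda>i. [(n choose i)] \<cdot> (DD i x \<otimes> DD (n - i) y)"
  have "DD (Suc n) (x \<otimes> y) = finsum R (\<lambda>i. D (?g i)) {..n}"
    using Suc assms by (simp add: D_finsum)
  also have "\<dots> = finsum R (\<lambda>i. [(n choose i)] \<cdot> (DD (Suc i) x \<otimes> DD (n - i) y) \<oplus> [(n choose i)] \<cdot> (DD i x \<otimes> DD (Suc n - i) y)) {..n}"
    using assms
    by (intro finsum_cong') (auto simp: D_nat_mult D_mult nat_mult_distr Suc_diff_le m_comm a_comm)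
  also have "\<dots> = finsum R (\<lambda>i. [(n choose i)] \<cdot> (DD (Suc i) x \<otimes> DD (n - i) y)) {..n} \<oplus>
     finsum R (\<lambda>i. [(n choose i)] \<cdot> (DD i x \<otimes> DD (Suc n - i) y)) {..n}"
    using assms by (intro finsum_addf) auto
  finally show ?case
    using pascal_sum[of "\<lambda>i j. DD i x \<otimes> DD j y" n] assms by (simp del: funpow.simps)
qed

text \<open>Modulo p the p-th iterate of a derivation is again a derivation, so that its
  divisibility by p can be tested on generators.\<close>

lemma leibniz_prime:
  assumes p: "Factorial_Ring.prime p" and x: "x \<in> carrier R" and y: "y \<in> carrier R"
  shows "\<exists>z\<in>carrier R. DD p (x \<otimes> y) = x \<otimes> DD p y \<oplus> (DD p x \<otimes> y \<oplus> [p] \<cdot> z)"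
proof
  show "DD p (x \<otimes> y) = x \<otimes> DD p y \<oplus> (DD p x \<otimes> y \<oplus> [p] \<cdot> finsum R (\<lambda>i. [((p choose i) div p)] \<cdot> (DD i x \<otimes> DD (p - i) y)) {1..<p})"
    unfolding leibniz[OF x y]
    using sum_binomial_prime[OF p, of "\<lambda>i. DD i x \<otimes> DD (p - i) y"] x y by simp
qed (use x y in simp)

text \<open>The partial Bell polynomials in the derivatives of \<open>b\<close>.\<close>

fun bell :: "'a \<Rightarrow> nat \<Rightarrow> nat \<Rightarrow> 'a" where
  "bell b 0 k = (if k = 0 then \<one> else \<zero>)"
| "bell b (Suc n) 0 = D (bell b n 0)"
| "bell b (Suc n) (Suc k) = D (bell b n (Suc k)) \<oplus> D b \<otimes> bell b n k"

context
  fixes b assumes b [simp]: "b \<in> carrier R"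
begin

lemma bell_closed [simp]: "bell b n k \<in> carrier R"
proof (induction n arbitrary: k)
  case (Suc n)
  then show ?case by (cases k) simp_all
qed simp

lemma bell_gt: "k > n \<Longrightarrow> bell b n k = \<zero>"
proof (induction n arbitrary: k)
  case (Suc n)
  then show ?case by (cases k) simp_all
qed simp

lemma bell_diag: "bell b n n = D b [^] n"
  by (induction n) (simp_all add: bell_gt m_comm)

lemma bell_zero: "n > 0 \<Longrightarrow> bell b n 0 = \<zero>"
proof (induction n)
  case (Suc n)
  then show ?case by (cases n) simp_all
qed simp

abbreviation (input) "falling m k \<equiv> (\<Prod>i<k. m - i :: nat)"

text \<open>Faa di Bruno's formula for x -> x^m; the falling factorial is the coefficient of the
  k-th derivative of x^m.\<close>

lemma DD_power_bell:
  assumes "n \<le> m"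
  shows "DD n (b [^] m) = finsum R (\<lambda>k. [(falling m k)] \<cdot> (b [^] (m - k) \<otimes> bell b n k)) {..n}"
  using assms
proof (induction n)
  case 0
  then show ?case by simp
next
  case (Suc n)
  let ?F = "\<lambda>k. [(falling m k)] \<cdot> (b [^] (m - k) \<otimes> D (bell b n k))"
  let ?H = "\<lambda>k. [(falling m (Suc k))] \<cdot> (b [^] (m - Suc k) \<otimes> (D b \<otimes> bell b n k))"
  have "DD (Suc n) (b [^] m) = finsum R (\<lambda>k. D ([(falling m k)] \<cdot> (b [^] (m - k) \<otimes> bell b n k))) {..n}"
    using Suc by (simp add: D_finsum)
  also have "\<dots> = finsum R (\<lambda>k. ?F k \<oplus> ?H k) {..n}"
  proof (rule finsum_cong')
    fix k assume k: "k \<in> {..n}"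
    \<comment> \<open>Here k <= n < m, so the exponent m - k is positive and \<open>D_power\<close>
      applies in its successor form.\<close>
    then obtain j where j: "m - k = Suc j" "m - Suc k = j" using Suc.prems by (cases "m - k") auto
    have "D (b [^] (m - k) \<otimes> bell b n k) = b [^] (m - k) \<otimes> D (bell b n k) \<oplus> bell b n k \<otimes> [(m - k)] \<cdot> (b [^] (m - Suc k) \<otimes> D b)"
      unfolding j using D_power[OF b, of j] by (simp add: D_mult)
    also have "bell b n k \<otimes> [(m - k)] \<cdot> (b [^] (m - Suc k) \<otimes> D b) = [(m - k)] \<cdot> (b [^] (m - Suc k) \<otimes> (D b \<otimes> bell b n k))"
      by (simp add: add_pow_rdistr m_ac)
    finally show "D ([(falling m k)] \<cdot> (b [^] (m - k) \<otimes> bell b n k)) = ?F k \<oplus> ?H k"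
      by (simp add: D_nat_mult nat_mult_distr nat_mult_mult)
  qed simp_all
  also have "\<dots> = finsum R ?F {..n} \<oplus> finsum R ?H {..n}"
    by (intro finsum_addf) auto
  also have "finsum R ?F {..n} = finsum R ?F {..Suc n}"
    using finsum_Suc[of ?F n] by (simp add: bell_gt finsum_closed)
  also have "finsum R ?H {..n} = finsum R (\<lambda>k. if k = 0 then \<zero> else ?H (k - 1)) {..Suc n}"
    by (subst finsum_Suc2) (simp_all add: finsum_closed)
  also have "finsum R ?F {..Suc n} \<oplus> \<dots> = finsum R (\<lambda>k. ?F k \<oplus> (if k = 0 then \<zero> else ?H (k - 1))) {..Suc n}"
    by (intro finsum_addf[symmetric]) auto
  also have "\<dots> = finsum R (\<lambda>k. [(falling m k)] \<cdot> (b [^] (m - k) \<otimes> bell b (Suc n) k)) {..Suc n}"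
  proof (rule finsum_cong')
    fix k assume "k \<in> {..Suc n}"
    show "?F k \<oplus> (if k = 0 then \<zero> else ?H (k - 1)) = [(falling m k)] \<cdot> (b [^] (m - k) \<otimes> bell b (Suc n) k)"
      by (cases k) (simp_all add: r_distr nat_mult_distr del: prod.lessThan_Suc)
  qed simp_all
  finally show ?case .
qed

abbreviation "deriv j \<equiv> (if j = 0 then \<zero> else DD j b)"

text \<open>In exponential generating functions the k-th Bell polynomial is X^k / k!, where X is the
  series of the derivatives of b of positive order; hence \<open>deriv\<close> vanishes at 0.
  Comparing (k + 1) B_(k+1) with X B_k gives this recursion, which is proved without denominators.
  Its binomial coefficients are what makes the case n = p divisible by p.\<close>

lemma bell_rec:
  "[Suc k] \<cdot> bell b n (Suc k) = finsum R (\<lambda>j. [(n choose j)] \<cdot> (deriv j \<otimes> bell b (n - j) k)) {..n}"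
proof (induction n arbitrary: k)
  case 0
  then show ?case by simp
next
  case (Suc n)
  let ?y = "\<lambda>j. deriv j"
  let ?c = "\<lambda>j. (n choose j)"
  have y: "?y j \<in> carrier R" for j by simp
  have ys: "?y (Suc j) = D (?y j) \<oplus> (if j = 0 then D b else \<zero>)" for j
    by (cases j) simp_all
  \<comment> \<open>Both parts of the Pascal sum leave a remainder: the shift of
    \<open>deriv\<close> at j = 0 contributes D b * B_k, and the recursion of \<open>bell\<close>
    contributes \<open>V\<close>. Together they are (k + 1) D b * B_k.\<close>
  define V where "V = (if k = 0 then \<zero> else D b \<otimes> ([k] \<cdot> bell b n k))"
  have Vc: "V \<in> carrier R" by (simp add: V_def)
  have s1: "finsum R (\<lambda>j. [(?c j)] \<cdot> (?y (Suc j) \<otimes> bell b (n - j) k)) {..n} =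
      finsum R (\<lambda>j. [(?c j)] \<cdot> (D (?y j) \<otimes> bell b (n - j) k)) {..n} \<oplus> D b \<otimes> bell b n k"
  proof -
    have "finsum R (\<lambda>j. [(?c j)] \<cdot> (?y (Suc j) \<otimes> bell b (n - j) k)) {..n} =
      finsum R (\<lambda>j. [(?c j)] \<cdot> (D (?y j) \<otimes> bell b (n - j) k) \<oplus> (if j = 0 then D b \<otimes> bell b n k else \<zero>)) {..n}"
    proof (rule finsum_cong')
      fix j assume "j \<in> {..n}"
      show "[(?c j)] \<cdot> (?y (Suc j) \<otimes> bell b (n - j) k) = [(?c j)] \<cdot> (D (?y j) \<otimes> bell b (n - j) k) \<oplus> (if j = 0 then D b \<otimes> bell b n k else \<zero>)"
        unfolding ys by (cases j) (simp_all add: l_distr)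
    qed simp_all
    also have "\<dots> = finsum R (\<lambda>j. [(?c j)] \<cdot> (D (?y j) \<otimes> bell b (n - j) k)) {..n} \<oplus> finsum R (\<lambda>j. if j = 0 then D b \<otimes> bell b n k else \<zero>) {..n}"
      by (intro finsum_addf) simp_all
    also have "finsum R (\<lambda>j. if j = 0 then D b \<otimes> bell b n k else \<zero>) {..n} = D b \<otimes> bell b n k"
      using finsum_singleton[of 0 "{..n}" "\<lambda>_. D b \<otimes> bell b n k"] by (simp add: eq_commute)
    finally show ?thesis .
  qed
  have s2: "finsum R (\<lambda>j. [(?c j)] \<cdot> (?y j \<otimes> bell b (Suc n - j) k)) {..n} =
      finsum R (\<lambda>j. [(?c j)] \<cdot> (?y j \<otimes> D (bell b (n - j) k))) {..n} \<oplus> V"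
  proof (cases k)
    case 0
    have "finsum R (\<lambda>j. [(?c j)] \<cdot> (?y j \<otimes> bell b (Suc n - j) k)) {..n} =
      finsum R (\<lambda>j. [(?c j)] \<cdot> (?y j \<otimes> D (bell b (n - j) k))) {..n}"
      by (rule finsum_cong') (simp_all add: Suc_diff_le 0)
    then show ?thesis by (simp add: V_def 0 finsum_closed)
  next
    case (Suc k')
    have "finsum R (\<lambda>j. [(?c j)] \<cdot> (?y j \<otimes> bell b (Suc n - j) k)) {..n} =
      finsum R (\<lambda>j. [(?c j)] \<cdot> (?y j \<otimes> D (bell b (n - j) k)) \<oplus> D b \<otimes> ([(?c j)] \<cdot> (?y j \<otimes> bell b (n - j) k'))) {..n}"
    proof (rule finsum_cong')
      fix j assume "j \<in> {..n}"
      then have e: "bell b (Suc n - j) k = D (bell b (n - j) k) \<oplus> D b \<otimes> bell b (n - j) k'"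
        using Suc by (simp add: Suc_diff_le)
      show "[(?c j)] \<cdot> (?y j \<otimes> bell b (Suc n - j) k) = [(?c j)] \<cdot> (?y j \<otimes> D (bell b (n - j) k)) \<oplus> D b \<otimes> ([(?c j)] \<cdot> (?y j \<otimes> bell b (n - j) k'))"
        unfolding e using y[of j] by (simp only: r_distr nat_mult_distr add_pow_rdistr m_closed D_closed bell_closed b m_lcomm)
    qed simp_all
    also have "\<dots> = finsum R (\<lambda>j. [(?c j)] \<cdot> (?y j \<otimes> D (bell b (n - j) k))) {..n} \<oplus> finsum R (\<lambda>j. D b \<otimes> ([(?c j)] \<cdot> (?y j \<otimes> bell b (n - j) k'))) {..n}"
      by (intro finsum_addf) simp_all
    also have "finsum R (\<lambda>j. D b \<otimes> ([(?c j)] \<cdot> (?y j \<otimes> bell b (n - j) k'))) {..n} = D b \<otimes> ([Suc k'] \<cdot> bell b n (Suc k'))"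
      unfolding Suc.IH by (rule finsum_rdistr[symmetric]) simp_all
    finally show ?thesis by (simp add: V_def Suc del: add.nat_pow_Suc)
  qed
  have "finsum R (\<lambda>j. [(Suc n choose j)] \<cdot> (?y j \<otimes> bell b (Suc n - j) k)) {..Suc n} =
     finsum R (\<lambda>j. [(?c j)] \<cdot> (?y (Suc j) \<otimes> bell b (n - j) k)) {..n} \<oplus> finsum R (\<lambda>j. [(?c j)] \<cdot> (?y j \<otimes> bell b (Suc n - j) k)) {..n}"
    by (rule pascal_sum[symmetric]) simp
  also have "\<dots> = (finsum R (\<lambda>j. [(?c j)] \<cdot> (D (?y j) \<otimes> bell b (n - j) k)) {..n} \<oplus> D b \<otimes> bell b n k) \<oplus>
     (finsum R (\<lambda>j. [(?c j)] \<cdot> (?y j \<otimes> D (bell b (n - j) k))) {..n} \<oplus> V)"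
    unfolding s1 s2 ..
  also have "\<dots> = (finsum R (\<lambda>j. [(?c j)] \<cdot> (D (?y j) \<otimes> bell b (n - j) k)) {..n} \<oplus>
     finsum R (\<lambda>j. [(?c j)] \<cdot> (?y j \<otimes> D (bell b (n - j) k))) {..n}) \<oplus> (D b \<otimes> bell b n k \<oplus> V)"
    using Vc by (simp add: a_ac finsum_closed)
  also have "finsum R (\<lambda>j. [(?c j)] \<cdot> (D (?y j) \<otimes> bell b (n - j) k)) {..n} \<oplus>
     finsum R (\<lambda>j. [(?c j)] \<cdot> (?y j \<otimes> D (bell b (n - j) k))) {..n} = 
     finsum R (\<lambda>j. [(?c j)] \<cdot> (D (?y j) \<otimes> bell b (n - j) k) \<oplus> [(?c j)] \<cdot> (?y j \<otimes> D (bell b (n - j) k))) {..n}"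
    by (intro finsum_addf[symmetric]) simp_all
  also have "\<dots> = finsum R (\<lambda>j. D ([(?c j)] \<cdot> (?y j \<otimes> bell b (n - j) k))) {..n}"
    using y by (intro finsum_cong') (simp_all add: D_nat_mult D_mult nat_mult_distr a_comm m_comm del: if_split)
  also have "\<dots> = D ([Suc k] \<cdot> bell b n (Suc k))"
    unfolding Suc.IH by (rule D_finsum[symmetric]) simp
  also have "D b \<otimes> bell b n k \<oplus> V = [Suc k] \<cdot> (D b \<otimes> bell b n k)"
    by (cases k) (simp_all add: V_def add_pow_rdistr r_distr a_comm)
  finally show ?case
    by (simp add: D_nat_mult nat_mult_distr del: add.nat_pow_Suc)
qed

text \<open>
  Only the two extreme terms of the formula of Faa di Bruno survive: the Bell polynomials with
  index strictly between \<open>1\<close> and \<open>p\<close> are divisible by \<open>p\<close>.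
\<close>

lemma DD_prime_power:
  assumes p: "Factorial_Ring.prime p"
    and pp: "\<forall>x\<in>carrier R. [p] \<cdot> ([p] \<cdot> x) = \<zero>"
    and Dp: "[p] \<cdot> DD p b = \<zero>"
  shows "DD p (b [^] p) = [(fact p :: nat)] \<cdot> (D b [^] p)"
proof -
  have p0: "p > 0" using p by (simp add: prime_gt_0_nat)
  \<comment> \<open>As p^2 kills the ring, divisibility by p is used in the weaker form of being
    annihilated by p. The factor k + 1 is prime to p and can be removed.\<close>
  have pB: "[p] \<cdot> bell b p (Suc k) = \<zero>" if k: "Suc k < p" for k
  proof (rule coprime_nat_mult_zero)
    show "coprime (Suc k) p"
      using p k by (meson coprime_commute nat_dvd_not_less prime_imp_coprime zero_less_Suc)
    have "[Suc k] \<cdot> ([p] \<cdot> bell b p (Suc k)) = [p] \<cdot> ([Suc k] \<cdot> bell b p (Suc k))"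
      unfolding nat_mult_mult[OF bell_closed, symmetric] by (simp only: mult.commute)
    also have "\<dots> = finsum R (\<lambda>j. [p] \<cdot> ([(p choose j)] \<cdot> (deriv j \<otimes> bell b (p - j) k))) {..p}"
      unfolding bell_rec by (rule nat_mult_finsum) simp
    also have "\<dots> = finsum R (\<lambda>j. \<zero>) {..p}"
    proof (rule finsum_cong')
      fix j assume j: "j \<in> {..p}"
      have dc: "deriv j \<otimes> bell b (p - j) k \<in> carrier R" by simp
      \<comment> \<open>Three reasons for vanishing: \<open>deriv\<close> is zero at 0, p D^p b = 0
        by hypothesis, and an inner binomial coefficient brings a second factor p.\<close>
      consider "j = 0" | "j = p" | "0 < j" "j < p" using j by force
      then show "[p] \<cdot> ([(p choose j)] \<cdot> (deriv j \<otimes> bell b (p - j) k)) = \<zero>"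
      proof cases
        case 2
        then show ?thesis using p0 Dp by (simp flip: add_pow_ldistr)
      next
        case 3
        then have "p dvd (p choose j)" using p by (intro dvd_choose_prime) auto
        then obtain c where c: "(p choose j) = p * c" by blast
        show ?thesis
          unfolding c nat_mult_mult[OF dc] using pp dc by simp
      qed simp
    qed simp_all
    finally show "[Suc k] \<cdot> ([p] \<cdot> bell b p (Suc k)) = \<zero>" by simp
    show "[p] \<cdot> ([p] \<cdot> bell b p (Suc k)) = \<zero>" using pp by simp
  qed simp
  let ?t = "\<lambda>k. [(falling p k)] \<cdot> (b [^] (p - k) \<otimes> bell b p k)"
  have t0: "?t k = \<zero>" if k: "k < p" for k
  proof (cases k)
    case 0
    then show ?thesis using bell_zero[OF p0] by simp
  next
    case (Suc j)
    \<comment> \<open>For k > 0 the leading factor of the falling factorial is p itself; it meets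
      the Bell polynomial, which p annihilates.\<close>
    have "falling p k = p * (\<Prod>i<j. p - Suc i)"
      unfolding Suc prod.lessThan_Suc_shift by simp
    then have "?t k = [(\<Prod>i<j. p - Suc i)] \<cdot> (b [^] (p - k) \<otimes> [p] \<cdot> bell b p k)"
      by (simp add: nat_mult_mult mult.commute[of p] add_pow_rdistr)
    also have "[p] \<cdot> bell b p k = \<zero>" using pB[of j] k Suc by simp
    finally show ?thesis by simp
  qed
  have "DD p (b [^] p) = finsum R ?t {..p}" by (rule DD_power_bell) simp
  also have "\<dots> = finsum R (\<lambda>k. if p = k then [(fact p :: nat)] \<cdot> (D b [^] p) else \<zero>) {..p}"
  proof (rule finsum_cong')
    fix k assume k: "k \<in> {..p}"
    have "falling p p = fact p" by (simp add: fact_prod_rev atLeast0LessThan)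
    then show "?t k = (if p = k then [(fact p :: nat)] \<cdot> (D b [^] p) else \<zero>)"
      using t0[of k] k by (auto simp: bell_diag)
  qed simp_all
  also have "\<dots> = [(fact p :: nat)] \<cdot> (D b [^] p)"
    by (rule finsum_singleton) simp_all
  finally show ?thesis .
qed

end

text \<open>A factor whose derivative is divisible by p is constant with respect to multiples of p,
  because the cross terms contain p^2.\<close>

lemma DD_mult_const_mod:
  assumes pp: "\<forall>x\<in>carrier R. [(p::nat)] \<cdot> ([p] \<cdot> x) = \<zero>"
    and x: "x \<in> carrier R" "x' \<in> carrier R" "D x = [p] \<cdot> x'"
    and y: "y' \<in> carrier R"
  shows "DD n (x \<otimes> [p] \<cdot> y') = x \<otimes> [p] \<cdot> DD n y'"
proof (induction n)
  case (Suc n)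
  have "D (x \<otimes> [p] \<cdot> DD n y') = x \<otimes> [p] \<cdot> DD (Suc n) y' \<oplus> [p] \<cdot> DD n y' \<otimes> [p] \<cdot> x'"
    using x y by (simp add: D_mult D_nat_mult)
  also have "[p] \<cdot> DD n y' \<otimes> [p] \<cdot> x' = \<zero>"
    using x y pp by (simp add: add_pow_ldistr add_pow_rdistr)
  finally show ?case using Suc x y by simp
qed simp

text \<open>The congruence of \<open>F\<close> with the p-th power map makes D (F b) equal to p
  times an explicit element, and D (F a) divisible by p. So F a passes through the p - 1 outer
  derivations, and these complete D (F b) to D^p (F b) = D^p (b^p).\<close>

lemma frobenius_pairing:
  assumes p: "Factorial_Ring.prime p"
    and pp: "\<forall>x\<in>carrier R. [p] \<cdot> ([p] \<cdot> x) = \<zero>"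
    and Dp: "\<forall>x\<in>carrier R. \<exists>z\<in>carrier R. DD p x = [p] \<cdot> z"
    and F: "\<forall>x\<in>carrier R. \<exists>z\<in>carrier R. F x = x [^] p \<oplus> [p] \<cdot> z"
    and a: "a \<in> carrier R" and b: "b \<in> carrier R"
  shows "DD (p - 1) (F a \<otimes> D (F b)) = [(fact p :: nat)] \<cdot> ((a \<otimes> D b) [^] p)"
proof -
  obtain q where q: "p = Suc q" using p by (metis not0_implies_Suc not_prime_0)
  obtain a' where a': "a' \<in> carrier R" "F a = a [^] p \<oplus> [p] \<cdot> a'" using F a by blast
  obtain b' where b': "b' \<in> carrier R" "F b = b [^] p \<oplus> [p] \<cdot> b'" using F b by blast
  have DF: "D (c [^] p \<oplus> [p] \<cdot> c') = [p] \<cdot> (c [^] q \<otimes> D c \<oplus> D c')" if "c \<in> carrier R" "c' \<in> carrier R" for c c'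
    using that D_power[of c q] by (simp add: D_add D_nat_mult nat_mult_distr q del: add.nat_pow_Suc nat_pow_Suc)
  have cl: "b [^] q \<otimes> D b \<oplus> D b' \<in> carrier R" using b b' by simp
  have pDp: "[p] \<cdot> DD p x = \<zero>" if "x \<in> carrier R" for x
    using Dp pp that by metis
  have pq: "[p] \<cdot> DD q (b [^] q \<otimes> D b \<oplus> D b') = DD p (b [^] p)"
  proof -
    have "[p] \<cdot> DD q (b [^] q \<otimes> D b \<oplus> D b') = DD q (D (F b))"
      unfolding b'(2) DF[OF b b'(1)] using cl by (simp add: DD_nat_mult)
    also have "\<dots> = DD p (F b)" by (simp add: q funpow_swap1)
    also have "\<dots> = DD p (b [^] p)"
      unfolding b'(2) using b b' pDp by (simp add: DD_add DD_nat_mult)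
    finally show ?thesis .
  qed
  have "DD (p - 1) (F a \<otimes> D (F b)) = F a \<otimes> DD p (b [^] p)"
    unfolding b'(2) DF[OF b b'(1)] pq[symmetric]
    using DD_mult_const_mod[OF pp _ _ DF[OF a a'(1)] cl, of q] a a' by (simp add: q del: add.nat_pow_Suc nat_pow_Suc)
  also have "\<dots> = F a \<otimes> [(fact p :: nat)] \<cdot> (D b [^] p)"
    using DD_prime_power[OF b p pp pDp[OF b]] by simp
  also have "\<dots> = a [^] p \<otimes> [(fact p :: nat)] \<cdot> (D b [^] p) \<oplus> [p] \<cdot> a' \<otimes> [(fact p :: nat)] \<cdot> (D b [^] p)"
    unfolding a'(2) using a a' b by (intro l_distr) simp_all
  \<comment> \<open>Replacing F a by a^p costs a multiple of p * p!, which is a multiple of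
    p^2.\<close>
  also have "[p] \<cdot> a' \<otimes> [(fact p :: nat)] \<cdot> (D b [^] p) = \<zero>"
  proof -
    have "(fact p :: nat) = p * fact q" by (simp add: q)
    moreover have "[p] \<cdot> ([(fact q :: nat)] \<cdot> ([p] \<cdot> w)) = \<zero>" if "w \<in> carrier R" for w
      using pp that by (simp flip: nat_mult_mult add: mult.left_commute[of p "fact q"]) (simp add: nat_mult_mult)
    ultimately show ?thesis
      using a' b by (simp add: nat_mult_mult add_pow_ldistr add_pow_rdistr)
  qed
  finally show ?thesis using a b by (simp add: add_pow_rdistr nat_pow_distrib)
qed

end

section \<open>The base ring\<close>

lemma (in abelian_group) add_eqD:
  assumes "a \<oplus> b = c" "a \<in> carrier G" "b \<in> carrier G"
  shows "b = c \<ominus> a"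
  using assms(2,3) by (simp add: assms(1)[symmetric] minus_eq a_comm[of a b] a_assoc r_neg)

locale unramified_ring = domain R for R :: "'r ring" (structure) +
  fixes p :: nat
  assumes p: "Factorial_Ring.prime p"
    and not_field: "\<not> field R"
    and maximal: "maximalideal (PIdl ([p] \<cdot> \<one>)) R"
    and complete: "adically_complete R ([p] \<cdot> \<one>)"
begin

abbreviation "pr \<equiv> [p] \<cdot> \<one>"

lemma pr_closed [simp]: "pr \<in> carrier R"
  by simp

lemma p_pos: "p > 0" "p > 1"
  using prime_gt_0_nat[OF p] prime_gt_1_nat[OF p] by auto

lemma pow_idealI: "s \<in> carrier R \<Longrightarrow> s \<otimes> pr [^] (n::nat) \<in> PIdl (pr [^] n)"
  unfolding cgenideal_def by blast

lemma pow_idealE: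
  assumes "r \<in> PIdl (pr [^] (n::nat))"
  obtains s where "s \<in> carrier R" "r = s \<otimes> pr [^] n"
  using assms unfolding cgenideal_def by blast

lemma mult_pr: "s \<in> carrier R \<Longrightarrow> s \<otimes> pr = [p] \<cdot> s"
  by (simp add: add_pow_rdistr)

lemma p_idealE:
  assumes "r \<in> PIdl pr"
  obtains s where "s \<in> carrier R" "r = [p] \<cdot> s"
  using assms mult_pr unfolding cgenideal_def by fastforce

lemma p_idealI: "s \<in> carrier R \<Longrightarrow> [p] \<cdot> s \<in> PIdl pr"
  unfolding cgenideal_def using mult_pr[of s] by (metis (mono_tags, lifting) mem_Collect_eq)

text \<open>If p were zero in R, the zero ideal would be maximal and R would be a field.\<close>

lemma pr_nonzero: "pr \<noteq> \<zero>"
proof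
  assume 0: "pr = \<zero>"
  have "PIdl \<zero> = {\<zero>}" unfolding cgenideal_def by force
  then have "maximalideal {\<zero>} R" using maximal 0 by simp
  then show False using zeromaximalideal_fieldI not_field by blast
qed

lemma p_cancel: "x \<in> carrier R \<Longrightarrow> [p] \<cdot> x = \<zero> \<Longrightarrow> x = \<zero>"
  using mult_pr[of x] integral[of x pr] pr_nonzero by auto

lemma one_not_p: "\<one> \<notin> PIdl pr"
  using maximalideal.I_notcarr[OF maximal] ideal.one_imp_carrier[OF maximalideal.axioms(1)[OF maximal]] by blast

text \<open>A relation k u = p v + 1 would put 1 into the maximal ideal.\<close>

lemma nat_not_p:
  assumes "coprime k p"
  shows "[k] \<cdot> \<one> \<notin> PIdl pr"
proof
  assume "[k] \<cdot> \<one> \<in> PIdl pr"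
  then obtain s where s: "s \<in> carrier R" "[k] \<cdot> \<one> = [p] \<cdot> s" by (rule p_idealE)
  obtain u v where uv: "k * u = p * v + 1"
    using coprime_bezout_strong[OF assms] p_pos by auto
  have "[p] \<cdot> ([v] \<cdot> \<one>) \<oplus> \<one> = [(p * v + 1)] \<cdot> \<one>"
    by (simp only: nat_mult_add nat_mult_mult one_closed) simp
  also have "\<dots> = [u] \<cdot> ([k] \<cdot> \<one>)"
    unfolding uv[symmetric] mult.commute[of k] by (simp only: nat_mult_mult one_closed)
  also have "\<dots> = [p] \<cdot> ([u] \<cdot> s)"
    unfolding s(2) using s(1) by (simp only: nat_mult_mult[symmetric] mult.commute)
  finally have "[p] \<cdot> ([v] \<cdot> \<one>) \<oplus> \<one> = [p] \<cdot> ([u] \<cdot> s)" .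
  then have "\<one> = [p] \<cdot> ([u] \<cdot> s) \<ominus> [p] \<cdot> ([v] \<cdot> \<one>)"
    using s(1) by (intro add_eqD) simp_all
  then have "\<one> = [p] \<cdot> ([u] \<cdot> s \<ominus> [v] \<cdot> \<one>)"
    using s by (simp only: nat_mult_minus nat_mult_closed one_closed)
  then show False using one_not_p p_idealI[of "[u] \<cdot> s \<ominus> [v] \<cdot> \<one>"] s by simp
qed

text \<open>Factors p are split off from n by induction; what remains is outside the maximal ideal,
  hence non-zero and cancellable in a domain.\<close>

lemma torsion_free:
  assumes "n > 0" "x \<in> carrier R" "[(n::nat)] \<cdot> x = \<zero>"
  shows "x = \<zero>"
  using assms
proof (induction n rule: less_induct)
  case (less n)
  show ?case
  proof (cases "p dvd n")
    case True
    then obtain m where m: "n = p * m" by blast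
    then have "[m] \<cdot> x = \<zero>" using less.prems p_cancel[of "[m] \<cdot> x"] by (simp add: nat_mult_mult)
    then show ?thesis using less.IH[of m] less.prems m p_pos by simp
  next
    case False
    have "[n] \<cdot> \<one> \<otimes> x = \<zero>" using less.prems by (simp add: add_pow_ldistr)
    moreover have "[n] \<cdot> \<one> \<noteq> \<zero>"
      using nat_not_p[of n] prime_imp_coprime[OF p False] p_idealI[of \<zero>] by (auto simp: coprime_commute)
    ultimately show ?thesis using integral[of "[n] \<cdot> \<one>" x] less.prems by simp
  qed
qed

text \<open>Uniqueness of limits in the completeness condition: both r and 0 are limits of the zero
  sequence.\<close>

lemma separated:
  assumes r: "r \<in> carrier R" and all: "\<And>n::nat. r \<in> PIdl (pr [^] n)"
  shows "r = \<zero>"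
proof -
  have z: "\<zero> \<in> PIdl (pr [^] (n::nat))" for n using pow_idealI[of \<zero> n] by simp
  have "\<exists>!y. y \<in> carrier R \<and> (\<forall>n. y \<ominus> \<zero> \<in> PIdl (pr [^] (n::nat)))"
    using complete[unfolded adically_complete_def, rule_format, of "\<lambda>_. \<zero>"] z by (simp add: minus_eq)
  moreover have "r \<in> carrier R \<and> (\<forall>n. r \<ominus> \<zero> \<in> PIdl (pr [^] (n::nat)))"
    using r all by (simp add: minus_eq)
  moreover have "\<zero> \<in> carrier R \<and> (\<forall>n. \<zero> \<ominus> \<zero> \<in> PIdl (pr [^] (n::nat)))"
    using z by (simp add: minus_eq)
  ultimately show ?thesis by blast
qed

text \<open>Modulo p the element has an inverse r, so r c = 1 - t with t divisible by p; the
  geometric series in t converges p-adically and inverts r c.\<close>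

lemma unitI:
  assumes c: "c \<in> carrier R" "c \<notin> PIdl pr"
  shows "c \<in> Units R"
proof -
  interpret m: maximalideal "PIdl pr" R by (rule maximal)
  have field: "field (R Quot PIdl pr)" by (rule m.quotient_is_field[OF is_cring])
  interpret Q: field "R Quot PIdl pr" by (rule field)
  note \<pi> = m.rcos_ring_hom
  have "PIdl pr +> c \<noteq> \<zero>\<^bsub>R Quot PIdl pr\<^esub>"
    using m.a_rcos_self[OF c(1)] c(2) by (auto simp: FactRing_def)
  then have "PIdl pr +> c \<in> Units (R Quot PIdl pr)"
    using Q.field_Units ring_hom_closed[OF \<pi> c(1)] by blast
  then obtain d where d: "d \<in> carrier (R Quot PIdl pr)" "d \<otimes>\<^bsub>R Quot PIdl pr\<^esub> (PIdl pr +> c) = \<one>\<^bsub>R Quot PIdl pr\<^esub>"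
    unfolding Units_def by blast
  obtain r where r: "r \<in> carrier R" "d = PIdl pr +> r" using d(1) by (rule carrier_quotE)
  have "PIdl pr +> \<one> = PIdl pr +> (r \<otimes> c)"
    using d(2) ring_hom_mult[OF \<pi> r(1) c(1)] ring_hom_one[OF \<pi>] r(2) by simp
  then have "\<one> \<ominus> r \<otimes> c \<in> PIdl pr"
    using quotient_eq_iff_same_a_r_cos[OF m.ideal_axioms one_closed, of "r \<otimes> c"] r c by simp
  then obtain s where s: "s \<in> carrier R" "\<one> \<ominus> r \<otimes> c = [p] \<cdot> s" by (rule p_idealE)
  define t where "t = s \<otimes> pr"
  have t: "t \<in> carrier R" "\<one> \<ominus> t = r \<otimes> c"
  proof -
    show "t \<in> carrier R" using s by (simp add: t_def)
    have "t = \<one> \<ominus> r \<otimes> c" using s by (simp add: t_def mult_pr)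
    then show "\<one> \<ominus> t = r \<otimes> c" using r c
      by (simp add: minus_eq minus_add a_assoc[symmetric] r_neg)
  qed
  have tn: "t [^] n = (s [^] n) \<otimes> pr [^] (n::nat)" for n
    unfolding t_def using s by (intro nat_pow_distrib) simp_all
  \<comment> \<open>The n-th partial sum has the exponents below n, so that consecutive ones differ
    by exactly t^n, which lies in the n-th power of the ideal.\<close>
  define x where "x = rec_nat \<zero> (\<lambda>n y. y \<oplus> t [^] (n::nat))"
  have x0: "x 0 = \<zero>" and xS: "x (Suc n) = x n \<oplus> t [^] n" for n by (simp_all add: x_def)
  have xc: "x n \<in> carrier R" for n by (induction n) (simp_all add: x0 xS t)
  have gs: "(\<one> \<ominus> t) \<otimes> x n \<oplus> t [^] n = \<one>" for n
  proof (induction n)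
    case 0
    then show ?case using t r c by (simp add: x0)
  next
    case (Suc n)
    have "(\<one> \<ominus> t) \<otimes> x (Suc n) \<oplus> t [^] Suc n = (\<one> \<ominus> t) \<otimes> x n \<oplus> ((\<one> \<ominus> t) \<otimes> t [^] n \<oplus> t \<otimes> t [^] n)"
      using t(1) xc by (simp add: xS r_distr a_assoc m_comm[of t])
    also have "(\<one> \<ominus> t) \<otimes> t [^] n \<oplus> t \<otimes> t [^] n = t [^] n"
      using t(1) by (simp add: l_distr[symmetric] minus_eq a_assoc l_neg)
    finally show ?case using Suc by simp
  qed
  have "x (Suc n) \<ominus> x n \<in> PIdl (pr [^] n)" for n
  proof -
    have "x (Suc n) \<ominus> x n = t [^] n"
      using xc[of n] t by (simp add: xS minus_eq a_comm[of "x n"] a_assoc r_neg)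
    then show ?thesis using s by (simp add: tn pow_idealI)
  qed
  then obtain y where y: "y \<in> carrier R" "\<And>n. y \<ominus> x n \<in> PIdl (pr [^] (n::nat))"
    using complete[unfolded adically_complete_def, rule_format, of x] xc by blast
  have rc: "r \<otimes> c \<in> carrier R" using r c by simp
  have "(r \<otimes> c) \<otimes> y \<ominus> \<one> = \<zero>"
  proof (rule separated)
    fix n :: nat
    obtain z where z: "z \<in> carrier R" "y \<ominus> x n = z \<otimes> pr [^] n" using y(2)[of n] by (rule pow_idealE)
    have yz: "y = x n \<oplus> z \<otimes> pr [^] n"
      unfolding z(2)[symmetric] using y xc by (simp add: minus_eq a_comm[of "x n"] a_assoc l_neg)
    have "(r \<otimes> c) \<otimes> y \<ominus> \<one> = (r \<otimes> c) \<otimes> y \<ominus> ((r \<otimes> c) \<otimes> x n \<oplus> t [^] n)"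
      using gs[of n] t by simp
    also have "\<dots> = ((r \<otimes> c) \<otimes> z \<ominus> s [^] n) \<otimes> pr [^] n"
      unfolding tn yz using rc xc[of n] z s
      by (simp add: r_distr l_distr minus_eq minus_add l_minus a_ac r_neg r_neg1 r_neg2 m_assoc)
    finally show "(r \<otimes> c) \<otimes> y \<ominus> \<one> \<in> PIdl (pr [^] n)"
      using rc z s by (simp add: pow_idealI)
  qed (use rc y in simp)
  then have "(r \<otimes> c) \<otimes> y = \<one>" using rc y by (simp add: r_right_minus_eq)
  then have "c \<otimes> (r \<otimes> y) = \<one>" using r c y by (simp add: m_ac)
  then show ?thesis unfolding Units_def using r c y by (auto intro!: bexI[of _ "r \<otimes> y"] simp: m_comm)
qed

lemma nat_unit:
  assumes "0 < k" "k < p"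
  shows "[k] \<cdot> \<one> \<in> Units R"
proof (rule unitI)
  have "coprime k p" using p assms by (meson coprime_commute nat_dvd_not_less prime_imp_coprime)
  then show "[k] \<cdot> \<one> \<notin> PIdl pr" by (rule nat_not_p)
qed simp

end

section \<open>Witt vectors of length two\<close>

lemma (in cring) nat_mult_pow:
  "x \<in> carrier R \<Longrightarrow> ([(n::nat)] \<cdot> x) [^] (k::nat) = [(n ^ k)] \<cdot> (x [^] k)"
proof (induction k)
  case (Suc k)
  then show ?case by (simp add: add_pow_ldistr add_pow_rdistr mult.commute[of n] flip: nat_mult_mult)
qed simp

section \<open>Identities for the Frobenius polynomial in rings without p-torsion\<close>

locale p_torsion_free = cring S for S (structure) +
  fixes p :: nat
  assumes p: "Factorial_Ring.prime p"
    and cancel: "\<And>x. x \<in> carrier S \<Longrightarrow> [p] \<cdot> x = \<zero> \<Longrightarrow> x = \<zero>"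
begin

abbreviation "w \<equiv> frob_poly p"

lemma cancel_eq:
  assumes "x \<in> carrier S" "y \<in> carrier S" "[p] \<cdot> x = [p] \<cdot> y"
  shows "x = y"
proof -
  have "[p] \<cdot> (x \<ominus> y) = [p] \<cdot> x \<ominus> [p] \<cdot> y"
    using assms(1,2) by (rule nat_mult_minus)
  then have "x \<ominus> y = \<zero>" using assms cancel[of "x \<ominus> y"] by (simp add: minus_eq r_neg)
  then show ?thesis using assms by (simp add: r_right_minus_eq)
qed

lemma w_closed [simp]: "x \<in> carrier S \<Longrightarrow> y \<in> carrier S \<Longrightarrow> w x y \<in> carrier S"
  by (rule frob_poly_closed)

lemmas w = frobenius_add[OF p]

text \<open>The summand \<open>u\<close> is there because each identity for \<open>w\<close> arises
  by expanding one p-th power in two ways, which equates u + p x with u + p y.\<close>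

lemma w_eqI:
  assumes "x \<in> carrier S" "y \<in> carrier S" "z \<in> carrier S" "u \<in> carrier S" "u \<oplus> [p] \<cdot> x = u \<oplus> [p] \<cdot> y"
  shows "x = y"
proof (rule cancel_eq[OF assms(1,2)])
  have c: "[p] \<cdot> x \<in> carrier S" "[p] \<cdot> y \<in> carrier S" using assms(1,2) by simp_all
  show "[p] \<cdot> x = [p] \<cdot> y"
    by (rule add.l_cancel[OF assms(5) c assms(4)])
qed

lemma w_comm: "x \<in> carrier S \<Longrightarrow> y \<in> carrier S \<Longrightarrow> w x y = w y x"
proof (rule w_eqI[of _ _ x "x [^] p \<oplus> y [^] p"])
  assume x: "x \<in> carrier S" and y: "y \<in> carrier S"
  have "x [^] p \<oplus> y [^] p \<oplus> [p] \<cdot> w x y = (x \<oplus> y) [^] p" by (rule w[OF x y, symmetric])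
  also have "\<dots> = (y \<oplus> x) [^] p" by (simp only: a_comm[OF x y])
  also have "\<dots> = y [^] p \<oplus> x [^] p \<oplus> [p] \<cdot> w y x" by (rule w[OF y x])
  also have "y [^] p \<oplus> x [^] p = x [^] p \<oplus> y [^] p" using x y by (intro a_comm) simp_all
  finally show "x [^] p \<oplus> y [^] p \<oplus> [p] \<cdot> w x y = x [^] p \<oplus> y [^] p \<oplus> [p] \<cdot> w y x" .
qed simp_all

lemma w_zero: "x \<in> carrier S \<Longrightarrow> w x \<zero> = \<zero>"
proof (rule w_eqI[of _ _ x "x [^] p"])
  assume x: "x \<in> carrier S"
  have "\<zero> [^] p = \<zero>" using p by (intro nat_pow_zero) (simp add: prime_gt_0_nat)
  then show "x [^] p \<oplus> [p] \<cdot> w x \<zero> = x [^] p \<oplus> [p] \<cdot> \<zero>"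
    using w[of x \<zero>] x by simp
qed simp_all

lemma w_assoc:
  assumes x: "x \<in> carrier S" and y: "y \<in> carrier S" and z: "z \<in> carrier S"
  shows "w x y \<oplus> w (x \<oplus> y) z = w y z \<oplus> w x (y \<oplus> z)"
proof (rule w_eqI[of _ _ x "x [^] p \<oplus> (y [^] p \<oplus> z [^] p)"])
  have "x [^] p \<oplus> (y [^] p \<oplus> z [^] p) \<oplus> [p] \<cdot> (w x y \<oplus> w (x \<oplus> y) z) = (x \<oplus> y) [^] p \<oplus> z [^] p \<oplus> [p] \<cdot> w (x \<oplus> y) z"
    using x y z by (simp add: w[OF x y] nat_mult_distr a_ac)
  also have "\<dots> = (x \<oplus> y \<oplus> z) [^] p" using w[of "x \<oplus> y" z] x y z by (simp only: a_closed)
  also have "\<dots> = (x \<oplus> (y \<oplus> z)) [^] p" using x y z by (simp only: a_assoc)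
  also have "\<dots> = x [^] p \<oplus> (y \<oplus> z) [^] p \<oplus> [p] \<cdot> w x (y \<oplus> z)" using x y z by (simp add: w)
  also have "\<dots> = x [^] p \<oplus> (y [^] p \<oplus> z [^] p) \<oplus> [p] \<cdot> (w y z \<oplus> w x (y \<oplus> z))"
    using x y z by (simp add: w[OF y z] nat_mult_distr a_ac)
  finally show "x [^] p \<oplus> (y [^] p \<oplus> z [^] p) \<oplus> [p] \<cdot> (w x y \<oplus> w (x \<oplus> y) z) =
    x [^] p \<oplus> (y [^] p \<oplus> z [^] p) \<oplus> [p] \<cdot> (w y z \<oplus> w x (y \<oplus> z))" .
qed (use assms in simp_all)

lemma w_mult:
  assumes x: "x \<in> carrier S" and y: "y \<in> carrier S" and z: "z \<in> carrier S"
  shows "w (x \<otimes> z) (y \<otimes> z) = w x y \<otimes> z [^] p"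
proof (rule w_eqI[of _ _ x "(x \<otimes> z) [^] p \<oplus> (y \<otimes> z) [^] p"])
  have "(x \<otimes> z) [^] p \<oplus> (y \<otimes> z) [^] p \<oplus> [p] \<cdot> w (x \<otimes> z) (y \<otimes> z) = (x \<otimes> z \<oplus> y \<otimes> z) [^] p"
    using x y z by (simp add: w)
  also have "\<dots> = (x \<oplus> y) [^] p \<otimes> z [^] p" using x y z by (simp add: l_distr[symmetric] nat_pow_distrib)
  also have "\<dots> = (x \<otimes> z) [^] p \<oplus> (y \<otimes> z) [^] p \<oplus> [p] \<cdot> (w x y \<otimes> z [^] p)"
    using x y z by (simp add: w l_distr nat_pow_distrib add_pow_ldistr)
  finally show "(x \<otimes> z) [^] p \<oplus> (y \<otimes> z) [^] p \<oplus> [p] \<cdot> w (x \<otimes> z) (y \<otimes> z) =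
    (x \<otimes> z) [^] p \<oplus> (y \<otimes> z) [^] p \<oplus> [p] \<cdot> (w x y \<otimes> z [^] p)" .
qed (use assms in simp_all)

end

text \<open>This is ((n x)^p - n x^p) / p, built up without division in the ring. It is the second
  coordinate of n * (x, 0) in \<open>witt2\<close>.\<close>

primrec frob_sum :: "('a, 'm) ring_scheme \<Rightarrow> nat \<Rightarrow> 'a \<Rightarrow> nat \<Rightarrow> 'a" where
  "frob_sum C p x 0 = \<zero>\<^bsub>C\<^esub>"
| "frob_sum C p x (Suc n) = frob_sum C p x n \<oplus>\<^bsub>C\<^esub> cring.frob_poly C p ([n] \<cdot>\<^bsub>C\<^esub> x) x"

context p_torsion_free
begin

lemma frob_sum_closed [simp]: "x \<in> carrier S \<Longrightarrow> frob_sum S p x n \<in> carrier S"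
  by (induction n) simp_all

lemma frob_sum:
  assumes x: "x \<in> carrier S"
  shows "[p] \<cdot> frob_sum S p x n \<oplus> [n] \<cdot> (x [^] p) = ([n] \<cdot> x) [^] p"
proof (induction n)
  case 0
  then show ?case using x p by (simp add: nat_pow_zero prime_gt_0_nat)
next
  case (Suc n)
  have "([Suc n] \<cdot> x) [^] p = ([n] \<cdot> x) [^] p \<oplus> x [^] p \<oplus> [p] \<cdot> w ([n] \<cdot> x) x"
    using w[of "[n] \<cdot> x" x] x by simp
  then show ?case using x by (simp add: Suc[symmetric] nat_mult_distr a_ac)
qed

text \<open>For n = p the relation p * frob_sum + p x^p = p^p x^p can be divided by p.\<close>

lemma frob_sum_prime:
  assumes x: "x \<in> carrier S"
  shows "frob_sum S p x p \<oplus> x [^] p = [(p ^ (p - 1))] \<cdot> (x [^] p)"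
proof (rule cancel_eq)
  have "p = Suc (p - 1)" using p by (simp add: prime_gt_0_nat)
  then have pp: "p ^ p = p * p ^ (p - 1)" by (metis power_Suc)
  have "[p] \<cdot> (frob_sum S p x p \<oplus> x [^] p) = ([p] \<cdot> x) [^] p"
    using frob_sum[OF x, of p] x by (simp add: nat_mult_distr)
  also have "\<dots> = [p] \<cdot> ([(p ^ (p - 1))] \<cdot> (x [^] p))"
    using x by (simp add: nat_mult_pow pp nat_mult_mult)
  finally show "[p] \<cdot> (frob_sum S p x p \<oplus> x [^] p) = [p] \<cdot> ([(p ^ (p - 1))] \<cdot> (x [^] p))" .
qed (use x in simp_all)

end

lemma p_torsion_free_monoid_ring:
  assumes M: "comm_monoid M" and p: "Factorial_Ring.prime p"
  shows "p_torsion_free (monoid_ring M) p"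
proof -
  interpret cring "monoid_ring M" by (rule cring_monoid_ring[OF M])
  show ?thesis
  proof
    fix x assume "x \<in> carrier (monoid_ring M)" "[p] \<cdot>\<^bsub>monoid_ring M\<^esub> x = \<zero>\<^bsub>monoid_ring M\<^esub>"
    then show "x = \<zero>\<^bsub>monoid_ring M\<^esub>"
      using p by (simp add: monoid_ring_nat_pow[OF M])
  qed (rule p)
qed

text \<open>
  The integral identities satisfied by \<open>frob_poly\<close> hold in every commutative ring, as every such
  ring is a quotient of the integral monoid ring of its multiplicative monoid.
\<close>

context cring
begin

context
  fixes p :: nat assumes p: "Factorial_Ring.prime p"
begin

interpretation S: p_torsion_free "monoid_ring R" p
  by (rule p_torsion_free_monoid_ring[OF comm_monoid_axioms p])

lemma eval_hom: "frag_eval R (\<lambda>x. x) \<in> ring_hom (monoid_ring R) R"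
  by (rule frag_eval_ring_hom[OF comm_monoid_axioms is_cring]) simp_all

lemma eval_of: "x \<in> carrier R \<Longrightarrow> frag_eval R (\<lambda>x. x) (frag_of x) = x"
  by simp

lemma of_closed: "x \<in> carrier R \<Longrightarrow> frag_of x \<in> carrier (monoid_ring R)"
  by simp

lemma lift_poly:
  "x \<in> carrier (monoid_ring R) \<Longrightarrow> y \<in> carrier (monoid_ring R) \<Longrightarrow>
    frag_eval R (\<lambda>x. x) (S.w x y) = frob_poly p (frag_eval R (\<lambda>x. x) x) (frag_eval R (\<lambda>x. x) y)"
  by (rule ring_hom_frob_poly[OF eval_hom S.is_cring is_cring])

lemma lift_sum:
  assumes x: "x \<in> carrier (monoid_ring R)"
  shows "frag_eval R (\<lambda>x. x) (frob_sum (monoid_ring R) p x n) = frob_sum R p (frag_eval R (\<lambda>x. x) x) n"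
  by (induction n)
     (simp_all only: frob_sum.simps ring_hom_zero[OF eval_hom S.ring_axioms ring_axioms] ring_hom_add[OF eval_hom] lift_poly
       S.frob_sum_closed S.w_closed x S.nat_mult_closed ring_hom_nat_mult[OF eval_hom S.ring_axioms ring_axioms])

lemmas lifts = ring_hom_add[OF eval_hom] ring_hom_mult[OF eval_hom]
  ring_hom_nat_pow[OF eval_hom S.ring_axioms ring_axioms] ring_hom_nat_mult[OF eval_hom S.ring_axioms ring_axioms]
  lift_poly lift_sum eval_of of_closed S.a_closed S.m_closed S.w_closed S.nat_pow_closed S.nat_mult_closed S.frob_sum_closed

lemma frob_poly_comm:
  assumes "x \<in> carrier R" "y \<in> carrier R"
  shows "frob_poly p x y = frob_poly p y x"
  using arg_cong[OF S.w_comm[OF assms[THEN of_closed]], of "frag_eval R (\<lambda>x. x)"] assms by (simp only: lifts)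

lemma frob_poly_zero:
  assumes "x \<in> carrier R"
  shows "frob_poly p x \<zero> = \<zero>"
  using arg_cong[OF S.w_zero[OF assms[THEN of_closed]], of "frag_eval R (\<lambda>x. x)"] assms
    ring_hom_zero[OF eval_hom S.ring_axioms ring_axioms] by (simp only: lifts S.zero_closed)

lemma frob_poly_assoc:
  assumes "x \<in> carrier R" "y \<in> carrier R" "z \<in> carrier R"
  shows "frob_poly p x y \<oplus> frob_poly p (x \<oplus> y) z = frob_poly p y z \<oplus> frob_poly p x (y \<oplus> z)"
  using arg_cong[OF S.w_assoc[OF assms[THEN of_closed]], of "frag_eval R (\<lambda>x. x)"] assms by (simp only: lifts)

lemma frob_poly_mult:
  assumes "x \<in> carrier R" "y \<in> carrier R" "z \<in> carrier R"
  shows "frob_poly p (x \<otimes> z) (y \<otimes> z) = frob_poly p x y \<otimes> z [^] p"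
  using arg_cong[OF S.w_mult[OF assms[THEN of_closed]], of "frag_eval R (\<lambda>x. x)"] assms by (simp only: lifts)

lemma frob_sum_prime_ring:
  assumes "x \<in> carrier R"
  shows "frob_sum R p x p \<oplus> x [^] p = [(p ^ (p - 1))] \<cdot> (x [^] p)"
  using arg_cong[OF S.frob_sum_prime[OF assms[THEN of_closed]], of "frag_eval R (\<lambda>x. x)"] assms by (simp only: lifts)

end

end

text \<open>
  The second Witt coordinate is taken with the opposite sign, so that the addition law involves
  \<open>((x + y)\<^sup>p - x\<^sup>p - y\<^sup>p) / p\<close> instead of its negative.
\<close>

definition witt2 :: "('a, 'm) ring_scheme \<Rightarrow> nat \<Rightarrow> ('a \<times> 'a) ring" where
  "witt2 C p =
     \<lparr>carrier = carrier C \<times> carrier C,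
      monoid.mult = (\<lambda>x y. (fst x \<otimes>\<^bsub>C\<^esub> fst y, fst x [^]\<^bsub>C\<^esub> p \<otimes>\<^bsub>C\<^esub> snd y \<oplus>\<^bsub>C\<^esub> fst y [^]\<^bsub>C\<^esub> p \<otimes>\<^bsub>C\<^esub> snd x)),
      one = (\<one>\<^bsub>C\<^esub>, \<zero>\<^bsub>C\<^esub>),
      ring.zero = (\<zero>\<^bsub>C\<^esub>, \<zero>\<^bsub>C\<^esub>),
      add = (\<lambda>x y. (fst x \<oplus>\<^bsub>C\<^esub> fst y, snd x \<oplus>\<^bsub>C\<^esub> snd y \<oplus>\<^bsub>C\<^esub> cring.frob_poly C p (fst x) (fst y)))\<rparr>"

lemma witt2_simps [simp]:
  "carrier (witt2 C p) = carrier C \<times> carrier C"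
  "x \<otimes>\<^bsub>witt2 C p\<^esub> y = (fst x \<otimes>\<^bsub>C\<^esub> fst y, fst x [^]\<^bsub>C\<^esub> p \<otimes>\<^bsub>C\<^esub> snd y \<oplus>\<^bsub>C\<^esub> fst y [^]\<^bsub>C\<^esub> p \<otimes>\<^bsub>C\<^esub> snd x)"
  "\<one>\<^bsub>witt2 C p\<^esub> = (\<one>\<^bsub>C\<^esub>, \<zero>\<^bsub>C\<^esub>)"
  "\<zero>\<^bsub>witt2 C p\<^esub> = (\<zero>\<^bsub>C\<^esub>, \<zero>\<^bsub>C\<^esub>)"
  "x \<oplus>\<^bsub>witt2 C p\<^esub> y = (fst x \<oplus>\<^bsub>C\<^esub> fst y, snd x \<oplus>\<^bsub>C\<^esub> snd y \<oplus>\<^bsub>C\<^esub> cring.frob_poly C p (fst x) (fst y))"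
  by (simp_all add: witt2_def)

locale char_p_ring = cring C for C (structure) +
  fixes p :: nat
  assumes p: "Factorial_Ring.prime p" and char_p: "[p] \<cdot> \<one> = \<zero>"
begin

abbreviation "w \<equiv> frob_poly p"
abbreviation "W \<equiv> witt2 C p"

lemma p_mult: "x \<in> carrier C \<Longrightarrow> [p] \<cdot> x = \<zero>"
  using add_pow_ldistr[of \<one> x p] char_p by simp

lemma frob_add: "x \<in> carrier C \<Longrightarrow> y \<in> carrier C \<Longrightarrow> (x \<oplus> y) [^] p = x [^] p \<oplus> y [^] p"
  by (simp add: frobenius_add[OF p] p_mult frob_poly_closed)

text \<open>In general the product would contain p times the product of the second coordinates; in
  characteristic p this term is absent. Distributivity uses that the p-th power map is additive, and
  associativity of the addition is the cocycle identity \<open>frob_poly_assoc\<close>.\<close>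

lemma cring_witt2: "cring W"
proof (rule cringI)
  note [simp] = frob_poly_closed
  have p0: "p > 0" using p by (simp add: prime_gt_0_nat)
  show "abelian_group W"
  proof (rule abelian_groupI)
    fix x y z assume "x \<in> carrier W" "y \<in> carrier W" "z \<in> carrier W"
    then obtain x1 x2 y1 y2 z1 z2 where x: "x = (x1, x2)" "x1 \<in> carrier C" "x2 \<in> carrier C"
      and y: "y = (y1, y2)" "y1 \<in> carrier C" "y2 \<in> carrier C" and z: "z = (z1, z2)" "z1 \<in> carrier C" "z2 \<in> carrier C"
      by auto
    have "x2 \<oplus> y2 \<oplus> w x1 y1 \<oplus> z2 \<oplus> w (x1 \<oplus> y1) z1 = x2 \<oplus> y2 \<oplus> z2 \<oplus> (w x1 y1 \<oplus> w (x1 \<oplus> y1) z1)"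
      using x y z by (simp add: a_ac)
    also have "\<dots> = x2 \<oplus> (y2 \<oplus> z2 \<oplus> w y1 z1) \<oplus> w x1 (y1 \<oplus> z1)"
      using x y z by (simp add: frob_poly_assoc[OF p] a_ac)
    finally show "x \<oplus>\<^bsub>W\<^esub> y \<oplus>\<^bsub>W\<^esub> z = x \<oplus>\<^bsub>W\<^esub> (y \<oplus>\<^bsub>W\<^esub> z)" using x y z by (simp add: a_assoc)
  next
    fix x y assume "x \<in> carrier W" "y \<in> carrier W"
    then show "x \<oplus>\<^bsub>W\<^esub> y = y \<oplus>\<^bsub>W\<^esub> x" using frob_poly_comm[OF p] by (auto simp: a_comm)
  next
    fix x assume "x \<in> carrier W"
    then obtain x1 x2 where x: "x = (x1, x2)" "x1 \<in> carrier C" "x2 \<in> carrier C" by auto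
    show "\<zero>\<^bsub>W\<^esub> \<oplus>\<^bsub>W\<^esub> x = x" using x frob_poly_zero[OF p x(2)] frob_poly_comm[OF p x(2), of \<zero>] by simp
    show "\<exists>y\<in>carrier W. y \<oplus>\<^bsub>W\<^esub> x = \<zero>\<^bsub>W\<^esub>"
      using x by (intro bexI[of _ "(\<ominus> x1, \<ominus> (x2 \<oplus> w (\<ominus> x1) x1))"]) (simp_all add: l_neg a_assoc)
  qed auto
  show "comm_monoid W"
  proof (rule comm_monoidI)
    fix x assume "x \<in> carrier W"
    then show "\<one>\<^bsub>W\<^esub> \<otimes>\<^bsub>W\<^esub> x = x" by auto
  qed (auto simp: m_ac a_ac r_distr nat_pow_distrib)
  fix x y z assume "x \<in> carrier W" "y \<in> carrier W" "z \<in> carrier W"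
  then obtain x1 x2 y1 y2 z1 z2 where x: "x = (x1, x2)" "x1 \<in> carrier C" "x2 \<in> carrier C"
    and y: "y = (y1, y2)" "y1 \<in> carrier C" "y2 \<in> carrier C" and z: "z = (z1, z2)" "z1 \<in> carrier C" "z2 \<in> carrier C"
    by auto
  show "(x \<oplus>\<^bsub>W\<^esub> y) \<otimes>\<^bsub>W\<^esub> z = x \<otimes>\<^bsub>W\<^esub> z \<oplus>\<^bsub>W\<^esub> y \<otimes>\<^bsub>W\<^esub> z"
    using x y z by (simp add: l_distr r_distr frob_add frob_poly_mult[OF p] a_ac m_comm)
qed

lemma witt2_nat_mult:
  assumes "x \<in> carrier C" "y \<in> carrier C"
  shows "[(n::nat)] \<cdot>\<^bsub>W\<^esub> (x, y) = ([n] \<cdot> x, [n] \<cdot> y \<oplus> frob_sum C p x n)"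
proof -
  interpret W: cring W by (rule cring_witt2)
  have c: "frob_sum C p x n \<in> carrier C" for n using assms by (induction n) (simp_all add: frob_poly_closed)
  show ?thesis
    by (induction n) (use assms c in \<open>simp_all add: frob_poly_closed a_ac\<close>)
qed

text \<open>The second coordinate of p (x, y) is p y + p^(p-1) x^p - x^p. In characteristic p this
  is -x^p, because p - 1 is at least 1.\<close>

lemma witt2_p_torsion:
  assumes x: "x \<in> carrier C" and y: "y \<in> carrier C" and 0: "[p] \<cdot>\<^bsub>W\<^esub> (x, y) = \<zero>\<^bsub>W\<^esub>"
  shows "x [^] p = \<zero>"
proof -
  have c: "frob_sum C p x n \<in> carrier C" for n using x by (induction n) (simp_all add: frob_poly_closed)
  have "frob_sum C p x p = \<zero>"
    using 0 x y c p_mult[OF y] by (simp add: witt2_nat_mult)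
  then have "x [^] p = [(p ^ (p - 1))] \<cdot> (x [^] p)"
    using frob_sum_prime_ring[OF p x] x by simp
  also have "p ^ (p - 1) = p ^ (p - 2) * p"
    using p by (metis Suc_1 Suc_diff_le diff_Suc_Suc prime_ge_2_nat power_Suc2)
  also have "[(p ^ (p - 2) * p)] \<cdot> (x [^] p) = \<zero>"
    using x p_mult[of "x [^] p"] by (simp add: nat_mult_mult)
  finally show ?thesis .
qed

end

section \<open>Lifting along Witt vectors\<close>

lemma card_of_Times_ordLeq:
  assumes "infinite W" "ordLeq3 (card_of A) (card_of W)" "ordLeq3 (card_of B) (card_of W)"
  shows "ordLeq3 (card_of (A \<times> B)) (card_of W)"
  using card_of_Times_ordLeq_infinite_Field[of "card_of W" A B] assms
  by (simp add: card_of_Card_order Field_card_of)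

text \<open>The generated ring is contained in the union of countably many stages, each obtained
  from the previous one by applying the operations once; every stage stays within the cardinality of
  the infinite set \<open>W\<close>.\<close>

lemma card_of_generate_ring:
  fixes W :: "'w set"
  assumes W: "infinite W" and Y: "ordLeq3 (card_of Y) (card_of W)"
  shows "ordLeq3 (card_of (generate_ring A Y)) (card_of W)"
proof -
  define L where "L = rec_nat (insert \<one>\<^bsub>A\<^esub> Y) (\<lambda>_ Z. Z \<union> a_inv A ` Z \<union> (\<lambda>z. fst z \<oplus>\<^bsub>A\<^esub> snd z) ` (Z \<times> Z) \<union> (\<lambda>z. fst z \<otimes>\<^bsub>A\<^esub> snd z) ` (Z \<times> Z))"
  have L0: "L 0 = insert \<one>\<^bsub>A\<^esub> Y"
    and LS: "L (Suc n) = L n \<union> a_inv A ` L n \<union> (\<lambda>z. fst z \<oplus>\<^bsub>A\<^esub> snd z) ` (L n \<times> L n) \<union> (\<lambda>z. fst z \<otimes>\<^bsub>A\<^esub> snd z) ` (L n \<times> L n)" for n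
    by (simp_all add: L_def)
  have mono: "L m \<subseteq> L n" if "m \<le> n" for m n
    using that by (induction rule: dec_induct) (auto simp: LS)
  have sub: "generate_ring A Y \<subseteq> (\<Union>n. L n)"
  proof
    fix x assume "x \<in> generate_ring A Y"
    then show "x \<in> (\<Union>n. L n)"
    proof induction
      case one
      then show ?case using L0 by (intro UN_I[of 0]) auto
    next
      case (incl h)
      then show ?case using L0 by (intro UN_I[of 0]) auto
    next
      case (a_inv h)
      then obtain n where "h \<in> L n" by blast
      then have "a_inv A h \<in> L (Suc n)" unfolding LS by blast
      then show ?case by blast
    next
      case (eng_add h k)
      then obtain m n where "h \<in> L m" "k \<in> L n" by blast
      then have "h \<in> L (max m n)" "k \<in> L (max m n)" using mono[of m "max m n"] mono[of n "max m n"] by auto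
      then have "h \<oplus>\<^bsub>A\<^esub> k \<in> L (Suc (max m n))" unfolding LS by force
      then show ?case by blast
    next
      case (eng_mult h k)
      then obtain m n where "h \<in> L m" "k \<in> L n" by blast
      then have "h \<in> L (max m n)" "k \<in> L (max m n)" using mono[of m "max m n"] mono[of n "max m n"] by auto
      then have "h \<otimes>\<^bsub>A\<^esub> k \<in> L (Suc (max m n))" unfolding LS by force
      then show ?case by blast
    qed
  qed
  have im: "ordLeq3 (card_of (f ` Z)) (card_of W)" if "ordLeq3 (card_of Z) (card_of W)" for f :: "'v \<Rightarrow> 'u" and Z
    by (rule ordLeq_transitive[OF card_of_image that])
  have Un: "ordLeq3 (card_of (Z \<union> Z')) (card_of W)" if "ordLeq3 (card_of Z) (card_of W)" "ordLeq3 (card_of Z') (card_of W)" for Z Z' :: "'v set"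
    using card_of_Un_ordLeq_infinite_Field[of "card_of W" Z Z'] that W by (simp add: card_of_Card_order Field_card_of)
  have "ordLeq3 (card_of (L n)) (card_of W)" for n
  proof (induction n)
    case 0
    have "ordLeq3 (card_of {\<one>\<^bsub>A\<^esub>}) (card_of W)"
      using W by (intro ordLess_imp_ordLeq finite_ordLess_infinite2) auto
    then show ?case unfolding L0 using Un[of "{\<one>\<^bsub>A\<^esub>}" Y] Y by simp
  next
    case (Suc n)
    show ?case unfolding LS by (intro Un im card_of_Times_ordLeq W Suc)
  qed
  then have "ordLeq3 (card_of (\<Union>n. L n)) (card_of W)"
    using W by (intro card_of_UNION_ordLeq_infinite) (auto simp: infinite_iff_card_of_nat)
  then show ?thesis using card_of_mono1[OF sub] ordLeq_transitive by blast
qed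

text \<open>Quotients of \<open>A\<close> and pairs of their elements are thereby small enough to be
  copied into \<open>'r list\<close>, where \<open>formally_smooth\<close> takes its test
  algebras.\<close>

lemma finite_type_card:
  fixes R :: "'r ring" and A :: "('r, 'a, 'm) algebra_scheme"
  assumes "finite_type R A"
  shows "ordLeq3 (card_of (carrier A)) (card_of (UNIV :: 'r list set))"
proof -
  obtain E where E: "finite E" "carrier A = generate_ring A (algmap A ` carrier R \<union> E)"
    using assms by (auto simp: finite_type_def)
  have inf: "infinite (UNIV :: 'r list set)" by (rule infinite_UNIV_listI)
  have "ordLeq3 (card_of (carrier R)) (card_of (UNIV :: 'r list set))"
    by (rule card_of_ordLeqI[of "\<lambda>x. [x]"]) (auto simp: inj_on_def)
  then have "ordLeq3 (card_of (algmap A ` carrier R)) (card_of (UNIV :: 'r list set))"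
    using card_of_image ordLeq_transitive by blast
  moreover have "ordLeq3 (card_of E) (card_of (UNIV :: 'r list set))"
    using E inf by (intro ordLess_imp_ordLeq finite_ordLess_infinite2)
  ultimately have "ordLeq3 (card_of (algmap A ` carrier R \<union> E)) (card_of (UNIV :: 'r list set))"
    using card_of_Un_ordLeq_infinite_Field[of "card_of (UNIV :: 'r list set)" "algmap A ` carrier R" E] inf
    by (simp add: card_of_Card_order Field_card_of)
  then show ?thesis unfolding E(2) by (rule card_of_generate_ring[OF inf])
qed

text \<open>Carries a ring structure along an injection; with it, a small test ring of any type is
  turned into one with elements in \<open>'r list\<close>.\<close>

definition transport :: "('a \<Rightarrow> 'b) \<Rightarrow> ('a, 'm) ring_scheme \<Rightarrow> 'b ring" where
  "transport j S =
     \<lparr>carrier = j ` carrier S,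
      monoid.mult = (\<lambda>x y. j (inv_into (carrier S) j x \<otimes>\<^bsub>S\<^esub> inv_into (carrier S) j y)),
      one = j \<one>\<^bsub>S\<^esub>, ring.zero = j \<zero>\<^bsub>S\<^esub>,
      add = (\<lambda>x y. j (inv_into (carrier S) j x \<oplus>\<^bsub>S\<^esub> inv_into (carrier S) j y))\<rparr>"

context
  fixes S :: "('a, 'm) ring_scheme" and j :: "'a \<Rightarrow> 'b"
  assumes S: "cring S" and j: "inj_on j (carrier S)"
begin

interpretation S: cring S by (rule S)

lemma transport_simps:
  "carrier (transport j S) = j ` carrier S"
  "\<one>\<^bsub>transport j S\<^esub> = j \<one>\<^bsub>S\<^esub>"
  "\<zero>\<^bsub>transport j S\<^esub> = j \<zero>\<^bsub>S\<^esub>"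
  "x \<in> carrier S \<Longrightarrow> y \<in> carrier S \<Longrightarrow> j x \<otimes>\<^bsub>transport j S\<^esub> j y = j (x \<otimes>\<^bsub>S\<^esub> y)"
  "x \<in> carrier S \<Longrightarrow> y \<in> carrier S \<Longrightarrow> j x \<oplus>\<^bsub>transport j S\<^esub> j y = j (x \<oplus>\<^bsub>S\<^esub> y)"
  by (simp_all add: transport_def inv_into_f_f[OF j])

lemma cring_transport: "cring (transport j S)"
proof (rule cringI)
  show "abelian_group (transport j S)"
  proof (rule abelian_groupI)
    fix x assume "x \<in> carrier (transport j S)"
    then obtain a where a: "a \<in> carrier S" "x = j a" by (auto simp: transport_simps)
    show "\<exists>y\<in>carrier (transport j S). y \<oplus>\<^bsub>transport j S\<^esub> x = \<zero>\<^bsub>transport j S\<^esub>"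
      using a by (intro bexI[of _ "j (\<ominus>\<^bsub>S\<^esub> a)"]) (simp_all add: transport_simps S.l_neg)
  qed (auto simp: transport_simps S.a_ac)
  show "comm_monoid (transport j S)"
    by (rule comm_monoidI) (auto simp: transport_simps S.m_ac)
qed (auto simp: transport_simps S.l_distr)

lemma transport_hom: "j \<in> ring_hom S (transport j S)"
  by (rule ring_hom_memI) (auto simp: transport_simps)

lemma transport_inv_hom: "inv_into (carrier S) j \<in> ring_hom (transport j S) S"
  by (rule ring_hom_memI) (auto simp: transport_simps inv_into_f_f[OF j])

end

text \<open>Lifting against a surjection with square zero kernel and small source. The section
  \<open>s\<close> is a mere function witnessing surjectivity; through it, \<open>g\<close> is read
  as a map into the quotient of the transported ring by the kernel.\<close>

lemma formally_smooth_lift: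
  fixes R :: "'r ring" and A :: "('r, 'a, 'm) algebra_scheme" and W :: "('w, 'n) ring_scheme"
  assumes R: "cring R" and A: "is_algebra R A" and smooth: "formally_smooth R A"
    and W: "cring W" and k: "k \<in> ring_hom R W"
    and card: "ordLeq3 (card_of (carrier W)) (card_of (UNIV :: 'r list set))"
    and C: "cring C" and f: "f \<in> ring_hom W C"
    and sq: "\<forall>x\<in>carrier W. \<forall>y\<in>carrier W. f x = \<zero>\<^bsub>C\<^esub> \<longrightarrow> f y = \<zero>\<^bsub>C\<^esub> \<longrightarrow> x \<otimes>\<^bsub>W\<^esub> y = \<zero>\<^bsub>W\<^esub>"
    and s: "s \<in> carrier C \<rightarrow> carrier W" "\<forall>x\<in>carrier C. f (s x) = x"
    and g: "g \<in> ring_hom A C" and gk: "\<forall>r\<in>carrier R. g (algmap A r) = f (k r)"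
  shows "\<exists>h\<in>ring_hom A W. \<forall>a\<in>carrier A. f (h a) = g a"
proof -
  interpret R: cring R by fact
  interpret A: cring A using A by (simp add: is_algebra_def)
  interpret W: cring W by fact
  interpret C: cring C by fact
  obtain j :: "'w \<Rightarrow> 'r list" where j: "inj_on j (carrier W)"
    using card by (auto simp: card_of_ordLeq[symmetric])
  define T where "T = transport j W"
  interpret T: cring T unfolding T_def by (rule cring_transport[OF W j])
  note jh = transport_hom[OF W j, folded T_def] and ih = transport_inv_hom[OF W j, folded T_def]
  let ?i = "inv_into (carrier W) j"
  define B where "B = with_algmap T (\<lambda>r. j (k r))"
  have kj: "(\<lambda>r. j (k r)) \<in> ring_hom R T" using ring_hom_trans[OF k jh] by (simp add: comp_def)
  interpret B: cring B unfolding B_def by (rule cring_with_algmap[OF T.is_cring])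
  have B: "is_algebra R B" using R B.is_cring kj by (simp add: is_algebra_def B_def)
  have cB: "carrier B = j ` carrier W" by (simp add: B_def T_def transport_simps[OF W j])
  have F: "(\<lambda>x. f (?i x)) \<in> ring_hom B C" using ring_hom_trans[OF ih f] by (simp add: comp_def B_def)
  interpret F: ring_hom_ring B C "\<lambda>x. f (?i x)"
    by (rule ring_hom_ringI2[OF B.ring_axioms C.ring_axioms F])
  define I where "I = a_kernel B C (\<lambda>x. f (?i x))"
  have I: "ideal I B" unfolding I_def by (rule F.kernel_is_ideal)
  interpret I: ideal I B by (rule I)
  have memI: "x \<in> I \<longleftrightarrow> x \<in> carrier B \<and> f (?i x) = \<zero>\<^bsub>C\<^esub>" for x
    unfolding I_def a_kernel_def' by simp
  have ij: "?i (j w) = w" if "w \<in> carrier W" for w by (rule inv_into_f_f[OF j that])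
  have sq': "\<forall>x\<in>I. \<forall>y\<in>I. x \<otimes>\<^bsub>B\<^esub> y = \<zero>\<^bsub>B\<^esub>"
  proof (intro ballI)
    fix x y assume xI: "x \<in> I" and yI: "y \<in> I"
    obtain a b where ab: "a \<in> carrier W" "x = j a" "b \<in> carrier W" "y = j b"
      using xI yI memI cB by auto
    then have "a \<otimes>\<^bsub>W\<^esub> b = \<zero>\<^bsub>W\<^esub>" using sq xI yI memI ij by auto
    then show "x \<otimes>\<^bsub>B\<^esub> y = \<zero>\<^bsub>B\<^esub>" using ab by (simp add: B_def T_def transport_simps[OF W j])
  qed
  \<comment> \<open>Classes modulo the kernel are told apart by \<open>f\<close>, so that every
    identity for \<open>\<gamma>\<close> becomes one for \<open>g\<close>.\<close>
  have coset: "I +>\<^bsub>B\<^esub> x = I +>\<^bsub>B\<^esub> y \<longleftrightarrow> f (?i x) = f (?i y)" if "x \<in> carrier B" "y \<in> carrier B" for x y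
  proof -
    have "I +>\<^bsub>B\<^esub> x = I +>\<^bsub>B\<^esub> y \<longleftrightarrow> x \<ominus>\<^bsub>B\<^esub> y \<in> I"
      using B.quotient_eq_iff_same_a_r_cos[OF I that] by simp
    also have "\<dots> \<longleftrightarrow> f (?i x) \<ominus>\<^bsub>C\<^esub> f (?i y) = \<zero>\<^bsub>C\<^esub>"
      using that ring_hom_diff[OF F B.ring_axioms C.ring_axioms that] by (simp add: memI)
    also have "\<dots> \<longleftrightarrow> f (?i x) = f (?i y)"
      using ring_hom_closed[OF F] that by (simp add: C.r_right_minus_eq)
    finally show ?thesis .
  qed
  define \<gamma> where "\<gamma> a = I +>\<^bsub>B\<^esub> j (s (g a))" for a
  have sg: "s (g a) \<in> carrier W" "j (s (g a)) \<in> carrier B" "f (?i (j (s (g a)))) = g a" if "a \<in> carrier A" for a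
  proof -
    show w: "s (g a) \<in> carrier W" by (rule funcset_mem[OF s(1) ring_hom_closed[OF g that]])
    show "j (s (g a)) \<in> carrier B" using w cB by blast
    show "f (?i (j (s (g a)))) = g a" using ij[OF w] s(2) ring_hom_closed[OF g that] by simp
  qed
  note \<pi> = I.rcos_ring_hom
  have \<gamma>: "\<gamma> \<in> alg_hom R A (quot_algebra B I)"
  proof -
    have "\<gamma> \<in> ring_hom A (B Quot I)"
    proof (rule ring_hom_memI)
      fix x assume x: "x \<in> carrier A"
      show "\<gamma> x \<in> carrier (B Quot I)" unfolding \<gamma>_def by (rule ring_hom_closed[OF \<pi> sg(2)[OF x]])
      fix y assume y: "y \<in> carrier A"
      show "\<gamma> (x \<otimes>\<^bsub>A\<^esub> y) = \<gamma> x \<otimes>\<^bsub>B Quot I\<^esub> \<gamma> y"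
        unfolding \<gamma>_def ring_hom_mult[OF \<pi> sg(2)[OF x] sg(2)[OF y], symmetric]
          coset[OF sg(2)[OF A.m_closed[OF x y]] B.m_closed[OF sg(2)[OF x] sg(2)[OF y]]]
          ring_hom_mult[OF F sg(2)[OF x] sg(2)[OF y]] sg(3)[OF x] sg(3)[OF y] sg(3)[OF A.m_closed[OF x y]]
        by (rule ring_hom_mult[OF g x y])
      show "\<gamma> (x \<oplus>\<^bsub>A\<^esub> y) = \<gamma> x \<oplus>\<^bsub>B Quot I\<^esub> \<gamma> y"
        unfolding \<gamma>_def ring_hom_add[OF \<pi> sg(2)[OF x] sg(2)[OF y], symmetric]
          coset[OF sg(2)[OF A.a_closed[OF x y]] B.a_closed[OF sg(2)[OF x] sg(2)[OF y]]]
          ring_hom_add[OF F sg(2)[OF x] sg(2)[OF y]] sg(3)[OF x] sg(3)[OF y] sg(3)[OF A.a_closed[OF x y]]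
        by (rule ring_hom_add[OF g x y])
    next
      show "\<gamma> \<one>\<^bsub>A\<^esub> = \<one>\<^bsub>B Quot I\<^esub>"
        unfolding \<gamma>_def ring_hom_one[OF \<pi>, symmetric] coset[OF sg(2)[OF A.one_closed] B.one_closed]
          ring_hom_one[OF F] sg(3)[OF A.one_closed]
        by (rule ring_hom_one[OF g])
    qed
    moreover have "\<gamma> (algmap A r) = I +>\<^bsub>B\<^esub> algmap B r" if r: "r \<in> carrier R" for r
    proof -
      have ar: "algmap A r \<in> carrier A" using A r by (auto simp: is_algebra_def intro: ring_hom_closed)
      have kr: "k r \<in> carrier W" by (rule ring_hom_closed[OF k r])
      have "algmap B r = j (k r)" by (simp add: B_def)
      moreover have "j (k r) \<in> carrier B" using kr cB by auto
      ultimately show ?thesis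
        unfolding \<gamma>_def using sg[OF ar] gk r kr ij by (subst coset) auto
    qed
    ultimately show ?thesis by (simp add: alg_hom_def quot_algebra_def)
  qed
  obtain h where h: "h \<in> alg_hom R A B" "\<forall>a\<in>carrier A. I +>\<^bsub>B\<^esub> h a = \<gamma> a"
    using smooth[unfolded formally_smooth_def] B I sq' \<gamma> by blast
  then have hh: "h \<in> ring_hom A T" by (simp add: alg_hom_def B_def)
  show ?thesis
  proof (rule bexI)
    show "(\<lambda>a. ?i (h a)) \<in> ring_hom A W" using ring_hom_trans[OF hh ih] by (simp add: comp_def)
    show "\<forall>a\<in>carrier A. f (?i (h a)) = g a"
    proof
      fix a assume a: "a \<in> carrier A"
      have "h a \<in> carrier B" using ring_hom_closed[OF hh a] by (simp add: B_def)
      then show "f (?i (h a)) = g a"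
        using h(2) a coset[of "h a" "j (s (g a))"] sg[OF a] by (simp add: \<gamma>_def)
    qed
  qed
qed

section \<open>Lifts to Witt vectors and p-torsion in smooth algebras\<close>

lemma (in unramified_ring) p_torsion_free: "p_torsion_free R p"
  by unfold_locales (use p p_cancel in auto)

text \<open>The Frobenius lift yields the p-derivation
  \<open>\<delta> r = (r^p - \<phi> r) / p\<close>, with the sign that fits \<open>witt2\<close>,
  and r -> (r, \<delta> r) read in \<open>C\<close> is a homomorphism. It makes the Witt ring an
  R-algebra, as a lifting problem over R requires.\<close>

lemma (in unramified_ring) witt2_structure:
  assumes \<phi>: "frobenius_lift_ring R p \<phi>" and C: "char_p_ring C p" and \<kappa>: "\<kappa> \<in> ring_hom R C"
  shows "\<exists>k\<in>ring_hom R (witt2 C p). \<forall>r\<in>carrier R. fst (k r) = \<kappa> r"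
proof -
  interpret C: char_p_ring C p by fact
  interpret T: p_torsion_free R p by (rule p_torsion_free)
  have \<phi>h: "\<phi> \<in> ring_hom R R" using \<phi> by (simp add: frobenius_lift_ring_def)
  have "\<forall>r\<in>carrier R. \<exists>s. s \<in> carrier R \<and> r [^] p = \<phi> r \<oplus> [p] \<cdot> s"
  proof
    fix r assume r: "r \<in> carrier R"
    have \<phi>r: "\<phi> r \<in> carrier R" by (rule ring_hom_closed[OF \<phi>h r])
    have "\<phi> r \<ominus> r [^] p \<in> PIdl pr" using \<phi> r by (simp add: frobenius_lift_ring_def)
    then obtain s where s: "s \<in> carrier R" "\<phi> r \<ominus> r [^] p = [p] \<cdot> s" by (rule p_idealE)
    have "[p] \<cdot> (\<zero> \<ominus> s) = \<zero> \<ominus> (\<phi> r \<ominus> r [^] p)"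
      unfolding s(2) using s(1) nat_mult_minus[of \<zero> s p] by simp
    then have "r [^] p = \<phi> r \<oplus> [p] \<cdot> (\<zero> \<ominus> s)"
      using r \<phi>r by (simp add: minus_eq minus_add a_assoc[symmetric] r_neg)
    then show "\<exists>s. s \<in> carrier R \<and> r [^] p = \<phi> r \<oplus> [p] \<cdot> s" using s(1) by (intro exI[of _ "\<zero> \<ominus> s"]) simp
  qed
  then obtain \<delta> where \<delta>: "\<forall>r\<in>carrier R. \<delta> r \<in> carrier R \<and> r [^] p = \<phi> r \<oplus> [p] \<cdot> \<delta> r"
    using bchoice by metis
  then have \<delta>c: "\<delta> r \<in> carrier R" and \<delta>e: "r [^] p = \<phi> r \<oplus> [p] \<cdot> \<delta> r" if "r \<in> carrier R" for r
    using that by auto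
  note \<phi>c = ring_hom_closed[OF \<phi>h]
  note \<kappa>s = ring_hom_add[OF \<kappa>] ring_hom_mult[OF \<kappa>] ring_hom_nat_pow[OF \<kappa> ring_axioms C.ring_axioms]
    ring_hom_nat_mult[OF \<kappa> ring_axioms C.ring_axioms]
  note \<kappa>c = ring_hom_closed[OF \<kappa>]
  have one: "\<delta> \<one> = \<zero>"
  proof -
    have "\<one> \<oplus> [p] \<cdot> \<delta> \<one> = \<one>" using \<delta>e[of \<one>] ring_hom_one[OF \<phi>h] by simp
    then have "[p] \<cdot> \<delta> \<one> = \<one> \<ominus> \<one>" using \<delta>c[of \<one>] by (intro add_eqD) simp_all
    then show ?thesis using \<delta>c[of \<one>] p_cancel[of "\<delta> \<one>"] by (simp add: minus_eq r_neg)
  qed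
  have add: "\<delta> (r \<oplus> s) = \<delta> r \<oplus> \<delta> s \<oplus> frob_poly p r s" if r: "r \<in> carrier R" and s: "s \<in> carrier R" for r s
  proof (rule T.w_eqI[of _ _ r "\<phi> r \<oplus> \<phi> s"])
    note cc = r s \<phi>c[OF r] \<phi>c[OF s] \<delta>c[OF r] \<delta>c[OF s] T.w_closed[OF r s] nat_mult_closed a_closed
    have "\<phi> r \<oplus> \<phi> s \<oplus> [p] \<cdot> \<delta> (r \<oplus> s) = (r \<oplus> s) [^] p"
      using \<delta>e[of "r \<oplus> s"] ring_hom_add[OF \<phi>h r s] r s by simp
    also have "\<dots> = r [^] p \<oplus> s [^] p \<oplus> [p] \<cdot> frob_poly p r s" by (rule frobenius_add[OF p r s])
    also have "\<dots> = \<phi> r \<oplus> \<phi> s \<oplus> [p] \<cdot> (\<delta> r \<oplus> \<delta> s \<oplus> frob_poly p r s)"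
      unfolding \<delta>e[OF r] \<delta>e[OF s] using cc by (simp add: nat_mult_distr a_ac)
    finally show "\<phi> r \<oplus> \<phi> s \<oplus> [p] \<cdot> \<delta> (r \<oplus> s) = \<phi> r \<oplus> \<phi> s \<oplus> [p] \<cdot> (\<delta> r \<oplus> \<delta> s \<oplus> frob_poly p r s)" .
  qed (use r s \<delta>c \<phi>c in simp_all)
  \<comment> \<open>Over R the product rule has an extra term p \<delta> r \<delta> s; it is kept on
    the left and disappears under \<open>\<kappa>\<close>, where p = 0.\<close>
  have mult: "\<delta> (r \<otimes> s) \<oplus> [p] \<cdot> (\<delta> r \<otimes> \<delta> s) = r [^] p \<otimes> \<delta> s \<oplus> s [^] p \<otimes> \<delta> r" if r: "r \<in> carrier R" and s: "s \<in> carrier R" for r s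
  proof (rule T.w_eqI[of _ _ r "\<phi> r \<otimes> \<phi> s"])
    note cc = r s \<phi>c[OF r] \<phi>c[OF s] \<delta>c[OF r] \<delta>c[OF s]
    define u where "u = [p] \<cdot> \<delta> r"
    define v where "v = [p] \<cdot> \<delta> s"
    have uv: "u \<in> carrier R" "v \<in> carrier R" using cc by (simp_all add: u_def v_def)
    have "\<phi> r \<otimes> \<phi> s \<oplus> [p] \<cdot> (\<delta> (r \<otimes> s) \<oplus> [p] \<cdot> (\<delta> r \<otimes> \<delta> s)) = (\<phi> r \<otimes> \<phi> s \<oplus> [p] \<cdot> \<delta> (r \<otimes> s)) \<oplus> u \<otimes> v"
      using cc \<delta>c[of "r \<otimes> s"] by (simp add: u_def v_def nat_mult_distr a_assoc add_pow_ldistr add_pow_rdistr)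
    also have "\<phi> r \<otimes> \<phi> s \<oplus> [p] \<cdot> \<delta> (r \<otimes> s) = r [^] p \<otimes> s [^] p"
      using \<delta>e[of "r \<otimes> s"] ring_hom_mult[OF \<phi>h r s] r s by (simp add: nat_pow_distrib)
    also have "r [^] p \<otimes> s [^] p \<oplus> u \<otimes> v = \<phi> r \<otimes> \<phi> s \<oplus> ((\<phi> r \<oplus> u) \<otimes> v \<oplus> (\<phi> s \<oplus> v) \<otimes> u)"
      unfolding \<delta>e[OF r] \<delta>e[OF s] u_def[symmetric] v_def[symmetric]
      using cc uv by (simp add: l_distr r_distr m_ac a_ac)
    also have "(\<phi> r \<oplus> u) \<otimes> v \<oplus> (\<phi> s \<oplus> v) \<otimes> u = [p] \<cdot> (r [^] p \<otimes> \<delta> s \<oplus> s [^] p \<otimes> \<delta> r)"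
      unfolding u_def v_def \<delta>e[OF r, symmetric] \<delta>e[OF s, symmetric]
      using cc by (simp add: add_pow_rdistr nat_mult_distr)
    finally show "\<phi> r \<otimes> \<phi> s \<oplus> [p] \<cdot> (\<delta> (r \<otimes> s) \<oplus> [p] \<cdot> (\<delta> r \<otimes> \<delta> s)) =
      \<phi> r \<otimes> \<phi> s \<oplus> [p] \<cdot> (r [^] p \<otimes> \<delta> s \<oplus> s [^] p \<otimes> \<delta> r)" .
  qed (use r s \<delta>c \<phi>c in simp_all)
  have mult': "\<kappa> (\<delta> (r \<otimes> s)) = \<kappa> r [^]\<^bsub>C\<^esub> p \<otimes>\<^bsub>C\<^esub> \<kappa> (\<delta> s) \<oplus>\<^bsub>C\<^esub> \<kappa> s [^]\<^bsub>C\<^esub> p \<otimes>\<^bsub>C\<^esub> \<kappa> (\<delta> r)"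
    if r: "r \<in> carrier R" and s: "s \<in> carrier R" for r s
    using arg_cong[OF mult[OF r s], of \<kappa>] r s \<delta>c \<kappa>c by (simp add: \<kappa>s C.p_mult)
  have "(\<lambda>r. (\<kappa> r, \<kappa> (\<delta> r))) \<in> ring_hom R (witt2 C p)"
    using ring_hom_one[OF \<kappa>] ring_hom_zero[OF \<kappa> ring_axioms C.ring_axioms] \<delta>c \<kappa>c one
    by (intro ring_hom_memI)
       (simp_all add: mult' add \<kappa>s T.w_closed ring_hom_frob_poly[OF \<kappa> is_cring C.is_cring])
  then show ?thesis by (intro bexI[of _ "\<lambda>r. (\<kappa> r, \<kappa> (\<delta> r))"]) simp_all
qed

text \<open>
  A smooth algebra has no \<open>p\<close>-torsion outside the nilradical modulo \<open>p\<close>: the projection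
  \<open>A \<rightarrow> A/p\<close> lifts to the Witt vectors of length two, where \<open>p (x, y) = 0\<close> forces \<open>x\<^sup>p = 0\<close>.
\<close>

lemma (in unramified_ring) smooth_p_torsion:
  fixes A :: "('r, 'a, 'm) algebra_scheme"
  assumes \<phi>: "frobenius_lift_ring R p \<phi>" and A: "smooth_algebra R A"
    and e: "e \<in> carrier A" and pe: "[p] \<cdot>\<^bsub>A\<^esub> e = \<zero>\<^bsub>A\<^esub>"
  shows "\<exists>b\<in>carrier A. e [^]\<^bsub>A\<^esub> p = [p] \<cdot>\<^bsub>A\<^esub> b"
proof -
  have alg: "is_algebra R A" and ft: "finite_type R A" and sm: "formally_smooth R A"
    using A by (auto simp: smooth_algebra_def)
  interpret A: cring A using alg by (simp add: is_algebra_def)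
  have am: "algmap A \<in> ring_hom R A" using alg by (simp add: is_algebra_def)
  define q where "q = [p] \<cdot>\<^bsub>A\<^esub> \<one>\<^bsub>A\<^esub>"
  have q: "q \<in> carrier A" by (simp add: q_def)
  interpret I: ideal "PIdl\<^bsub>A\<^esub> q" A by (rule A.cgenideal_ideal[OF q])
  define C where "C = A Quot (PIdl\<^bsub>A\<^esub> q)"
  define \<pi> where "\<pi> = (+>\<^bsub>A\<^esub>) (PIdl\<^bsub>A\<^esub> q)"
  have \<pi>: "\<pi> \<in> ring_hom A C" unfolding \<pi>_def C_def by (rule I.rcos_ring_hom)
  interpret C: cring C unfolding C_def by (rule I.quotient_is_cring[OF A.is_cring])
  have \<pi>0: "\<pi> x = \<zero>\<^bsub>C\<^esub> \<longleftrightarrow> x \<in> PIdl\<^bsub>A\<^esub> q" if x: "x \<in> carrier A" for x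
  proof -
    have "\<pi> x = \<pi> \<zero>\<^bsub>A\<^esub> \<longleftrightarrow> x \<ominus>\<^bsub>A\<^esub> \<zero>\<^bsub>A\<^esub> \<in> PIdl\<^bsub>A\<^esub> q"
      unfolding \<pi>_def using A.quotient_eq_iff_same_a_r_cos[OF I.ideal_axioms x A.zero_closed] by simp
    then show ?thesis using x ring_hom_zero[OF \<pi> A.ring_axioms C.ring_axioms] by (simp add: A.minus_eq)
  qed
  have "[p] \<cdot>\<^bsub>C\<^esub> \<one>\<^bsub>C\<^esub> = \<pi> q"
    using ring_hom_nat_mult[OF \<pi> A.ring_axioms C.ring_axioms A.one_closed] ring_hom_one[OF \<pi>] by (simp add: q_def)
  then have "[p] \<cdot>\<^bsub>C\<^esub> \<one>\<^bsub>C\<^esub> = \<zero>\<^bsub>C\<^esub>" using \<pi>0[OF q] A.cgenideal_self[OF q] by simp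
  then interpret C: char_p_ring C p by unfold_locales (rule p)
  have \<kappa>: "(\<lambda>r. \<pi> (algmap A r)) \<in> ring_hom R C" using ring_hom_trans[OF am \<pi>] by (simp add: comp_def)
  obtain k where k: "k \<in> ring_hom R (witt2 C p)" "\<forall>r\<in>carrier R. fst (k r) = \<pi> (algmap A r)"
    using witt2_structure[OF \<phi> C.char_p_ring_axioms \<kappa>] by blast
  have inf: "infinite (UNIV :: 'r list set)" by (rule infinite_UNIV_listI)
  have "carrier C = \<pi> ` carrier A"
    by (auto simp: C_def \<pi>_def FactRing_def A_RCOSETS_def')
  then have cC: "ordLeq3 (card_of (carrier C)) (card_of (UNIV :: 'r list set))"
    using card_of_image finite_type_card[OF ft] ordLeq_transitive by metis
  \<comment> \<open>The Teichmueller map x -> (x, 0) serves as section. The kernel of the first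
    projection squares to zero, since products in it carry a factor 0^p with p > 0.\<close>
  have "\<exists>h\<in>ring_hom A (witt2 C p). \<forall>a\<in>carrier A. fst (h a) = \<pi> a"
  proof (rule formally_smooth_lift[OF is_cring alg sm C.cring_witt2 k(1) _ C.is_cring, where s = "\<lambda>x. (x, \<zero>\<^bsub>C\<^esub>)"])
    show "ordLeq3 (card_of (carrier (witt2 C p))) (card_of (UNIV :: 'r list set))"
      using card_of_Times_ordLeq[OF inf cC cC] by simp
    show "fst \<in> ring_hom (witt2 C p) C" by (rule ring_hom_memI) auto
    show "\<forall>x\<in>carrier (witt2 C p). \<forall>y\<in>carrier (witt2 C p). fst x = \<zero>\<^bsub>C\<^esub> \<longrightarrow> fst y = \<zero>\<^bsub>C\<^esub> \<longrightarrow> x \<otimes>\<^bsub>witt2 C p\<^esub> y = \<zero>\<^bsub>witt2 C p\<^esub>"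
      using p_pos by (auto simp: C.nat_pow_zero)
  qed (use k \<pi> in auto)
  then obtain h where h: "h \<in> ring_hom A (witt2 C p)" "\<forall>a\<in>carrier A. fst (h a) = \<pi> a" by blast
  interpret W: cring "witt2 C p" by (rule C.cring_witt2)
  have he: "h e \<in> carrier (witt2 C p)" by (rule ring_hom_closed[OF h(1) e])
  have "[p] \<cdot>\<^bsub>witt2 C p\<^esub> (fst (h e), snd (h e)) = \<zero>\<^bsub>witt2 C p\<^esub>"
    using ring_hom_nat_mult[OF h(1) A.ring_axioms W.ring_axioms e, of p] pe
      ring_hom_zero[OF h(1) A.ring_axioms W.ring_axioms] by simp
  then have "fst (h e) [^]\<^bsub>C\<^esub> p = \<zero>\<^bsub>C\<^esub>"
    using he by (intro C.witt2_p_torsion[of _ "snd (h e)"]) auto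
  then have "\<pi> (e [^]\<^bsub>A\<^esub> p) = \<zero>\<^bsub>C\<^esub>"
    using h(2) e ring_hom_nat_pow[OF \<pi> A.ring_axioms C.ring_axioms e] by simp
  then have "e [^]\<^bsub>A\<^esub> p \<in> PIdl\<^bsub>A\<^esub> q" using \<pi>0 e by simp
  then obtain b where "b \<in> carrier A" "e [^]\<^bsub>A\<^esub> p = b \<otimes>\<^bsub>A\<^esub> q" unfolding cgenideal_def by blast
  then show ?thesis by (auto simp: q_def A.add_pow_rdistr)
qed

section \<open>Matrices\<close>

lemma (in abelian_monoid) finsum_swap:
  assumes "\<And>i j. i < m \<Longrightarrow> j < n \<Longrightarrow> f i j \<in> carrier G"
  shows "finsum G (\<lambda>i. finsum G (f i) {..<n}) {..<m::nat} = finsum G (\<lambda>j. finsum G (\<lambda>i. f i j) {..<m}) {..<n::nat}"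
  using assms
proof (induction m)
  case 0
  then show ?case by simp
next
  case (Suc m)
  have c: "finsum G (f i) {..<n} \<in> carrier G" if "i < Suc m" for i
    using Suc.prems that by (intro finsum_closed) auto
  have "finsum G (\<lambda>i. finsum G (f i) {..<n}) {..<Suc m} = finsum G (f m) {..<n} \<oplus> finsum G (\<lambda>i. finsum G (f i) {..<n}) {..<m}"
    unfolding lessThan_Suc using c by (intro finsum_insert) auto
  also have "finsum G (\<lambda>i. finsum G (f i) {..<n}) {..<m} = finsum G (\<lambda>j. finsum G (\<lambda>i. f i j) {..<m}) {..<n}"
    using Suc by simp
  also have "finsum G (f m) {..<n} \<oplus> \<dots> = finsum G (\<lambda>j. f m j \<oplus> finsum G (\<lambda>i. f i j) {..<m}) {..<n}"
    using Suc.prems by (intro finsum_addf[symmetric]) (auto intro!: finsum_closed)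
  also have "\<dots> = finsum G (\<lambda>j. finsum G (\<lambda>i. f i j) {..<Suc m}) {..<n}"
  proof (rule finsum_cong'[OF refl])
    show "(\<lambda>j. finsum G (\<lambda>i. f i j) {..<Suc m}) \<in> {..<n} \<rightarrow> carrier G"
      using Suc.prems by (auto intro!: finsum_closed)
    fix j assume "j \<in> {..<n}"
    then show "f m j \<oplus> finsum G (\<lambda>i. f i j) {..<m} = finsum G (\<lambda>i. f i j) {..<Suc m}"
      unfolding lessThan_Suc using Suc.prems by (intro finsum_insert[symmetric]) auto
  qed
  finally show ?case .
qed

locale matrices = cring A for A (structure) +
  fixes N :: nat
begin

abbreviation "MR \<equiv> matrix_ring A N"

lemma MR_carrier: "Xa \<in> carrier MR \<longleftrightarrow>
    (\<forall>i j. (i < N \<and> j < N \<longrightarrow> Xa i j \<in> carrier A) \<and> (\<not> (i < N \<and> j < N) \<longrightarrow> Xa i j = \<zero>))"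
  by (simp add: matrix_ring_def)

lemma entry_closed: "Xa \<in> carrier MR \<Longrightarrow> Xa i j \<in> carrier A"
  by (cases "i < N \<and> j < N") (auto simp: MR_carrier)

lemma entry_outside: "Xa \<in> carrier MR \<Longrightarrow> \<not> (i < N \<and> j < N) \<Longrightarrow> Xa i j = \<zero>"
  by (simp add: MR_carrier)

lemma MR_eqI:
  assumes "Xa \<in> carrier MR" "Y \<in> carrier MR" "\<And>i j. i < N \<Longrightarrow> j < N \<Longrightarrow> Xa i j = Y i j"
  shows "Xa = Y"
proof (intro ext)
  fix i j show "Xa i j = Y i j"
    using assms(3) entry_outside[OF assms(1)] entry_outside[OF assms(2)] by (cases "i < N \<and> j < N") auto
qed

lemma MR_closedI:
  "(\<And>i j. i < N \<Longrightarrow> j < N \<Longrightarrow> F i j \<in> carrier A) \<Longrightarrow> (\<And>i j. \<not> (i < N \<and> j < N) \<Longrightarrow> F i j = \<zero>) \<Longrightarrow> F \<in> carrier MR"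
  by (simp add: MR_carrier)

lemma MR_simps:
  "\<one>\<^bsub>MR\<^esub> = (\<lambda>i j. if i < N \<and> i = j then \<one> else \<zero>)"
  "\<zero>\<^bsub>MR\<^esub> = (\<lambda>i j. \<zero>)"
  "Xa \<oplus>\<^bsub>MR\<^esub> Y = (\<lambda>i j. Xa i j \<oplus> Y i j)"
  "Xa \<otimes>\<^bsub>MR\<^esub> Y = (\<lambda>i j. if i < N \<and> j < N then finsum A (\<lambda>k. Xa i k \<otimes> Y k j) {..<N} else \<zero>)"
  by (simp_all add: matrix_ring_def)

lemma mult_entry: "i < N \<Longrightarrow> j < N \<Longrightarrow> (Xa \<otimes>\<^bsub>MR\<^esub> Y) i j = finsum A (\<lambda>k. Xa i k \<otimes> Y k j) {..<N}"
  by (simp add: MR_simps)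

lemma MR_closed: "Xa \<in> carrier MR \<Longrightarrow> Y \<in> carrier MR \<Longrightarrow> Xa \<otimes>\<^bsub>MR\<^esub> Y \<in> carrier MR"
  unfolding MR_simps using entry_closed[of Xa] entry_closed[of Y] by (intro MR_closedI) (auto intro!: finsum_closed)

lemma delta_left: "i < N \<Longrightarrow> c \<in> carrier A \<Longrightarrow> f \<in> {..<N} \<rightarrow> carrier A \<Longrightarrow>
    finsum A (\<lambda>k. (if i < N \<and> i = k then c else \<zero>) \<otimes> f k) {..<N} = c \<otimes> f i"
proof -
  assume i: "i < N" and c: "c \<in> carrier A" and f: "f \<in> {..<N} \<rightarrow> carrier A"
  have fk: "f k \<in> carrier A" if "k < N" for k using f that by auto
  have "finsum A (\<lambda>k. (if i < N \<and> i = k then c else \<zero>) \<otimes> f k) {..<N} = finsum A (\<lambda>k. if i = k then c \<otimes> f k else \<zero>) {..<N}"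
    using i c fk by (intro finsum_cong') auto
  also have "\<dots> = c \<otimes> f i" using i c fk by (intro finsum_singleton) auto
  finally show ?thesis .
qed

lemma delta_right: "j < N \<Longrightarrow> c \<in> carrier A \<Longrightarrow> f \<in> {..<N} \<rightarrow> carrier A \<Longrightarrow>
    finsum A (\<lambda>k. f k \<otimes> (if k < N \<and> k = j then c else \<zero>)) {..<N} = f j \<otimes> c"
proof -
  assume j: "j < N" and c: "c \<in> carrier A" and f: "f \<in> {..<N} \<rightarrow> carrier A"
  have fk: "f k \<in> carrier A" if "k < N" for k using f that by auto
  have "finsum A (\<lambda>k. f k \<otimes> (if k < N \<and> k = j then c else \<zero>)) {..<N} = finsum A (\<lambda>k. if j = k then f k \<otimes> c else \<zero>) {..<N}"
    using j c fk by (intro finsum_cong') auto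
  also have "\<dots> = f j \<otimes> c" using j c fk by (intro finsum_singleton) auto
  finally show ?thesis .
qed

lemma ring_MR: "ring MR"
proof (rule ringI)
  show "abelian_group MR"
  proof (rule abelian_groupI)
    fix Xa Y assume Xa: "Xa \<in> carrier MR" and Y: "Y \<in> carrier MR"
    note XY = entry_closed[OF Xa] entry_closed[OF Y]
    show "Xa \<oplus>\<^bsub>MR\<^esub> Y \<in> carrier MR"
      unfolding MR_simps using XY entry_outside[OF Xa] entry_outside[OF Y] by (intro MR_closedI) auto
    show "Xa \<oplus>\<^bsub>MR\<^esub> Y = Y \<oplus>\<^bsub>MR\<^esub> Xa" using XY by (simp add: MR_simps a_comm)
    fix Z assume Z: "Z \<in> carrier MR"
    show "Xa \<oplus>\<^bsub>MR\<^esub> Y \<oplus>\<^bsub>MR\<^esub> Z = Xa \<oplus>\<^bsub>MR\<^esub> (Y \<oplus>\<^bsub>MR\<^esub> Z)"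
      using XY entry_closed[OF Z] by (simp add: MR_simps a_assoc)
  next
    fix Xa assume Xa: "Xa \<in> carrier MR"
    note Xc = entry_closed[OF Xa]
    show "\<zero>\<^bsub>MR\<^esub> \<oplus>\<^bsub>MR\<^esub> Xa = Xa" using Xc by (simp add: MR_simps)
    have "(\<lambda>i j. \<ominus> Xa i j) \<in> carrier MR"
      using Xc entry_outside[OF Xa] by (intro MR_closedI) auto
    then show "\<exists>Y\<in>carrier MR. Y \<oplus>\<^bsub>MR\<^esub> Xa = \<zero>\<^bsub>MR\<^esub>"
      using Xc by (intro bexI[of _ "\<lambda>i j. \<ominus> Xa i j"]) (simp add: MR_simps l_neg)
  qed (simp add: MR_simps MR_carrier)
  show "Group.monoid MR"
  proof (rule monoidI)
    show "\<one>\<^bsub>MR\<^esub> \<in> carrier MR" by (simp add: MR_simps MR_carrier)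
    fix Xa Y Z assume Xa: "Xa \<in> carrier MR" and Y: "Y \<in> carrier MR" and Z: "Z \<in> carrier MR"
    note XYZ = entry_closed[OF Xa] entry_closed[OF Y] entry_closed[OF Z]
    show "Xa \<otimes>\<^bsub>MR\<^esub> Y \<otimes>\<^bsub>MR\<^esub> Z = Xa \<otimes>\<^bsub>MR\<^esub> (Y \<otimes>\<^bsub>MR\<^esub> Z)"
    proof (rule MR_eqI)
      fix i j assume i: "i < N" and j: "j < N"
      have "(Xa \<otimes>\<^bsub>MR\<^esub> Y \<otimes>\<^bsub>MR\<^esub> Z) i j = finsum A (\<lambda>k. finsum A (\<lambda>l. Xa i l \<otimes> Y l k) {..<N} \<otimes> Z k j) {..<N}"
        unfolding mult_entry[OF i j] using i Xa Y Z XYZ by (intro finsum_cong') (auto simp: mult_entry intro!: finsum_closed)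
      also have "\<dots> = finsum A (\<lambda>k. finsum A (\<lambda>l. Xa i l \<otimes> Y l k \<otimes> Z k j) {..<N}) {..<N}"
        using Xa Y Z XYZ by (intro finsum_cong' finsum_ldistr) (auto intro!: finsum_closed)
      also have "\<dots> = finsum A (\<lambda>l. finsum A (\<lambda>k. Xa i l \<otimes> Y l k \<otimes> Z k j) {..<N}) {..<N}"
        using Xa Y Z XYZ by (intro finsum_swap) simp
      also have "\<dots> = finsum A (\<lambda>l. Xa i l \<otimes> finsum A (\<lambda>k. Y l k \<otimes> Z k j) {..<N}) {..<N}"
      proof (rule finsum_cong'[OF refl])
        fix l assume "l \<in> {..<N}"
        have "finsum A (\<lambda>k. Xa i l \<otimes> Y l k \<otimes> Z k j) {..<N} = finsum A (\<lambda>k. Xa i l \<otimes> (Y l k \<otimes> Z k j)) {..<N}"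
          using Xa Y Z XYZ by (intro finsum_cong') (auto simp: m_assoc)
        also have "\<dots> = Xa i l \<otimes> finsum A (\<lambda>k. Y l k \<otimes> Z k j) {..<N}"
          using Xa Y Z XYZ by (intro finsum_rdistr[symmetric]) auto
        finally show "finsum A (\<lambda>k. Xa i l \<otimes> Y l k \<otimes> Z k j) {..<N} = Xa i l \<otimes> finsum A (\<lambda>k. Y l k \<otimes> Z k j) {..<N}" .
      qed (use Xa Y Z XYZ in \<open>auto intro!: finsum_closed\<close>)
      also have "\<dots> = (Xa \<otimes>\<^bsub>MR\<^esub> (Y \<otimes>\<^bsub>MR\<^esub> Z)) i j"
        unfolding mult_entry[OF i j] using j Xa Y Z XYZ by (intro finsum_cong') (auto simp: mult_entry intro!: finsum_closed)
      finally show "(Xa \<otimes>\<^bsub>MR\<^esub> Y \<otimes>\<^bsub>MR\<^esub> Z) i j = (Xa \<otimes>\<^bsub>MR\<^esub> (Y \<otimes>\<^bsub>MR\<^esub> Z)) i j" .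
    qed (use Xa Y Z MR_closed in auto)
  next
    fix Xa assume Xa: "Xa \<in> carrier MR"
    have o: "\<one>\<^bsub>MR\<^esub> \<in> carrier MR" by (simp add: MR_simps MR_carrier)
    note Xc = entry_closed[OF Xa]
    show "\<one>\<^bsub>MR\<^esub> \<otimes>\<^bsub>MR\<^esub> Xa = Xa"
    proof (rule MR_eqI[OF MR_closed[OF o Xa] Xa])
      fix i j assume i: "i < N" and j: "j < N"
      show "(\<one>\<^bsub>MR\<^esub> \<otimes>\<^bsub>MR\<^esub> Xa) i j = Xa i j"
        unfolding mult_entry[OF i j] unfolding MR_simps(1)
        using delta_left[OF i one_closed, of "\<lambda>k. Xa k j"] Xc by simp
    qed
    show "Xa \<otimes>\<^bsub>MR\<^esub> \<one>\<^bsub>MR\<^esub> = Xa"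
    proof (rule MR_eqI[OF MR_closed[OF Xa o] Xa])
      fix i j assume i: "i < N" and j: "j < N"
      show "(Xa \<otimes>\<^bsub>MR\<^esub> \<one>\<^bsub>MR\<^esub>) i j = Xa i j"
        unfolding mult_entry[OF i j] unfolding MR_simps(1)
        using delta_right[OF j one_closed, of "Xa i"] Xc by simp
    qed
  qed (rule MR_closed)
  fix Xa Y Z assume Xa: "Xa \<in> carrier MR" and Y: "Y \<in> carrier MR" and Z: "Z \<in> carrier MR"
  note XYZ = entry_closed[OF Xa] entry_closed[OF Y] entry_closed[OF Z]
  show "(Xa \<oplus>\<^bsub>MR\<^esub> Y) \<otimes>\<^bsub>MR\<^esub> Z = Xa \<otimes>\<^bsub>MR\<^esub> Z \<oplus>\<^bsub>MR\<^esub> Y \<otimes>\<^bsub>MR\<^esub> Z"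
    using Xa Y Z XYZ by (auto simp: MR_simps l_distr fun_eq_iff Pi_def intro!: finsum_addf)
  show "Z \<otimes>\<^bsub>MR\<^esub> (Xa \<oplus>\<^bsub>MR\<^esub> Y) = Z \<otimes>\<^bsub>MR\<^esub> Xa \<oplus>\<^bsub>MR\<^esub> Z \<otimes>\<^bsub>MR\<^esub> Y"
    using Xa Y Z XYZ by (auto simp: MR_simps r_distr fun_eq_iff Pi_def intro!: finsum_addf)
qed

sublocale MR: ring MR by (rule ring_MR)

lemma entry_add: "(Xa \<oplus>\<^bsub>MR\<^esub> Y) i j = Xa i j \<oplus> Y i j"
  by (simp add: MR_simps)

lemma entry_zero: "\<zero>\<^bsub>MR\<^esub> i j = \<zero>"
  by (simp add: MR_simps)

lemma entry_finsum:
  assumes "f \<in> I \<rightarrow> carrier MR"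
  shows "finsum MR f I i j = finsum A (\<lambda>k. f k i j) I"
  by (rule abelian_group_hom_finsum[OF MR.abelian_group_axioms abelian_group_axioms, of "\<lambda>Xa. Xa i j"])
     (use assms in \<open>auto simp: entry_add intro: entry_closed\<close>)

lemma entry_nat_mult:
  "Xa \<in> carrier MR \<Longrightarrow> ([(n::nat)] \<cdot>\<^bsub>MR\<^esub> Xa) i j = [n] \<cdot> Xa i j"
  by (induction n) (simp_all add: entry_zero entry_add)

text \<open>Scalars are embedded as matrices so that linear combinations of powers can be handled by
  ring operations alone.\<close>

definition scalar :: "'a \<Rightarrow> nat \<Rightarrow> nat \<Rightarrow> 'a" where
  "scalar c = (\<lambda>i j. if i < N \<and> i = j then c else \<zero>)"

lemma scalar_closed [simp]: "c \<in> carrier A \<Longrightarrow> scalar c \<in> carrier MR"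
  by (simp add: scalar_def MR_carrier)

lemma scalar_mult_entry:
  assumes "c \<in> carrier A" "Xa \<in> carrier MR" "i < N" "j < N"
  shows "(scalar c \<otimes>\<^bsub>MR\<^esub> Xa) i j = c \<otimes> Xa i j"
  unfolding mult_entry[OF assms(3,4)] scalar_def
  by (rule delta_left) (use assms entry_closed in auto)

lemma mult_scalar_entry:
  assumes "c \<in> carrier A" "Xa \<in> carrier MR" "i < N" "j < N"
  shows "(Xa \<otimes>\<^bsub>MR\<^esub> scalar c) i j = Xa i j \<otimes> c"
  unfolding mult_entry[OF assms(3,4)] scalar_def
  by (rule delta_right) (use assms entry_closed in auto)

lemma scalar_comm:
  "c \<in> carrier A \<Longrightarrow> Xa \<in> carrier MR \<Longrightarrow> scalar c \<otimes>\<^bsub>MR\<^esub> Xa = Xa \<otimes>\<^bsub>MR\<^esub> scalar c"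
  by (rule MR_eqI) (simp_all add: scalar_mult_entry mult_scalar_entry m_comm entry_closed)

lemma scalar_hom: "scalar \<in> ring_hom A MR"
proof (rule ring_hom_memI)
  fix x y assume x: "x \<in> carrier A" and y: "y \<in> carrier A"
  show "scalar (x \<otimes> y) = scalar x \<otimes>\<^bsub>MR\<^esub> scalar y"
    using x y by (intro MR_eqI) (simp_all add: scalar_mult_entry, simp add: scalar_def)
  show "scalar (x \<oplus> y) = scalar x \<oplus>\<^bsub>MR\<^esub> scalar y" using x y by (simp add: scalar_def MR_simps fun_eq_iff)
qed (simp_all, simp add: scalar_def MR_simps)

end

definition mat_map :: "nat \<Rightarrow> ('b, 'n) ring_scheme \<Rightarrow> ('a \<Rightarrow> 'b) \<Rightarrow> (nat \<Rightarrow> nat \<Rightarrow> 'a) \<Rightarrow> nat \<Rightarrow> nat \<Rightarrow> 'b" where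
  "mat_map N C h Xa = (\<lambda>i j. if i < N \<and> j < N then h (Xa i j) else \<zero>\<^bsub>C\<^esub>)"

lemma mat_map_entry: "i < N \<Longrightarrow> j < N \<Longrightarrow> mat_map N C h Xa i j = h (Xa i j)"
  by (simp add: mat_map_def)

lemma mat_map_hom:
  assumes A: "cring A" and C: "cring C" and h: "h \<in> ring_hom A C"
  shows "mat_map N C h \<in> ring_hom (matrix_ring A N) (matrix_ring C N)"
proof -
  interpret A: cring A by fact
  interpret C: cring C by fact
  interpret MA: matrices A N by unfold_locales
  interpret MC: matrices C N by unfold_locales
  have c: "mat_map N C h Xa \<in> carrier MC.MR" if "Xa \<in> carrier MA.MR" for Xa
    unfolding MC.MR_carrier mat_map_def using MA.entry_closed[OF that] ring_hom_closed[OF h] by auto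
  show ?thesis
  proof (rule ring_hom_memI)
    fix Xa Y assume Xa: "Xa \<in> carrier MA.MR" and Y: "Y \<in> carrier MA.MR"
    note XY = MA.entry_closed[OF Xa] MA.entry_closed[OF Y]
    show "mat_map N C h (Xa \<otimes>\<^bsub>MA.MR\<^esub> Y) = mat_map N C h Xa \<otimes>\<^bsub>MC.MR\<^esub> mat_map N C h Y"
    proof (rule MC.MR_eqI)
      fix i j assume i: "i < N" and j: "j < N"
      have "mat_map N C h (Xa \<otimes>\<^bsub>MA.MR\<^esub> Y) i j = finsum C (\<lambda>k. h (Xa i k \<otimes>\<^bsub>A\<^esub> Y k j)) {..<N}"
        unfolding mat_map_entry[OF i j] MA.mult_entry[OF i j]
        using XY by (intro ring_hom_finsum[OF h A.ring_axioms C.ring_axioms]) auto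
      also have "\<dots> = (mat_map N C h Xa \<otimes>\<^bsub>MC.MR\<^esub> mat_map N C h Y) i j"
        unfolding MC.mult_entry[OF i j] using i j XY ring_hom_closed[OF h]
        by (intro C.finsum_cong') (auto simp: mat_map_def ring_hom_mult[OF h])
      finally show "mat_map N C h (Xa \<otimes>\<^bsub>MA.MR\<^esub> Y) i j = (mat_map N C h Xa \<otimes>\<^bsub>MC.MR\<^esub> mat_map N C h Y) i j" .
    qed (use Xa Y c MA.MR_closed MC.MR_closed in auto)
    show "mat_map N C h (Xa \<oplus>\<^bsub>MA.MR\<^esub> Y) = mat_map N C h Xa \<oplus>\<^bsub>MC.MR\<^esub> mat_map N C h Y"
      using XY by (intro ext) (simp add: mat_map_def MA.MR_simps MC.MR_simps ring_hom_add[OF h])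
  next
    show "mat_map N C h \<one>\<^bsub>MA.MR\<^esub> = \<one>\<^bsub>MC.MR\<^esub>"
      by (intro ext) (auto simp: mat_map_def MA.MR_simps MC.MR_simps ring_hom_one[OF h] ring_hom_zero[OF h A.ring_axioms C.ring_axioms])
  qed (rule c)
qed

section \<open>Powers of unipotent elements\<close>

text \<open>The range of summation does not depend on n, because higher powers of T vanish. So each
  entry of the n-th power of a matrix is a fixed combination of binomial coefficients in n.\<close>

lemma (in ring) unipotent_power:
  assumes T: "T \<in> carrier R" and nil: "T [^] Suc m = \<zero>"
  shows "(\<one> \<oplus> T) [^] (n::nat) = finsum R (\<lambda>k. [(n choose k)] \<cdot> (T [^] k)) {..m}"
proof (induction n)
  case 0
  have "finsum R (\<lambda>k. [(0 choose k)] \<cdot> (T [^] k)) {..m} = finsum R (\<lambda>k. if 0 = k then \<one> else \<zero>) {..m}"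
    using T by (intro finsum_cong') (auto simp: binomial_eq_0)
  also have "\<dots> = \<one>" by (rule finsum_singleton) auto
  finally show ?case by simp
next
  case (Suc n)
  let ?g = "\<lambda>k. [(n choose k)] \<cdot> (T [^] k)"
  let ?h = "\<lambda>k. if k = 0 then \<zero> else [(n choose (k - 1))] \<cdot> (T [^] k)"
  have g: "?g \<in> {..m} \<rightarrow> carrier R" and h: "?h \<in> {..Suc m} \<rightarrow> carrier R" "?h \<in> {..m} \<rightarrow> carrier R" using T by auto
  have "(\<one> \<oplus> T) [^] Suc n = finsum R ?g {..m} \<oplus> finsum R ?g {..m} \<otimes> T"
    unfolding nat_pow_Suc Suc using T g by (simp add: r_distr finsum_closed)
  also have "finsum R ?g {..m} \<otimes> T = finsum R (\<lambda>k. [(n choose k)] \<cdot> (T [^] Suc k)) {..m}"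
    using T g by (subst finsum_ldistr) (auto intro!: finsum_cong' simp: add_pow_ldistr)
  also have "\<dots> = finsum R ?h {..Suc m}"
    using h T by (subst finsum_Suc2) (auto simp: finsum_closed simp del: nat_pow_Suc)
  \<comment> \<open>The term with T^(m+1) drops out by nilpotence.\<close>
  also have "\<dots> = finsum R ?h {..m}"
    using finsum_Suc[of ?h m] h nil by (simp add: finsum_closed del: nat_pow_Suc)
  also have "finsum R ?g {..m} \<oplus> finsum R ?h {..m} = finsum R (\<lambda>k. ?g k \<oplus> ?h k) {..m}"
    using g h by (intro finsum_addf[symmetric])
  also have "\<dots> = finsum R (\<lambda>k. [(Suc n choose k)] \<cdot> (T [^] k)) {..m}"
  proof (rule finsum_cong'[OF refl])
    fix k assume "k \<in> {..m}"
    show "?g k \<oplus> ?h k = [(Suc n choose k)] \<cdot> (T [^] k)"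
      using T by (cases k) (simp_all add: nat_mult_add a_comm del: nat_pow_Suc)
  qed (use T in auto)
  finally show ?case .
qed

lemma (in ring) finsum_nilpotent_factor:
  assumes T: "T \<in> carrier R" and d: "\<And>k. d k \<in> carrier R" "\<And>k. d k \<otimes> T = T \<otimes> d k"
  shows "\<exists>V\<in>carrier R. finsum R (\<lambda>k. d (Suc k) \<otimes> T [^] Suc k) {..n} = T \<otimes> V \<and> T \<otimes> V = V \<otimes> T"
proof -
  have e: "d (Suc k) \<otimes> T [^] Suc k = T \<otimes> (d (Suc k) \<otimes> T [^] k)" for k
  proof -
    have "d (Suc k) \<otimes> T [^] Suc k = d (Suc k) \<otimes> (T \<otimes> T [^] k)" using T by (simp only: nat_pow_Suc2)
    also have "\<dots> = (d (Suc k) \<otimes> T) \<otimes> T [^] k" using T d(1) by (intro m_assoc[symmetric]) simp_all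
    also have "\<dots> = (T \<otimes> d (Suc k)) \<otimes> T [^] k" by (simp only: d(2))
    also have "\<dots> = T \<otimes> (d (Suc k) \<otimes> T [^] k)" using T d(1) by (intro m_assoc) simp_all
    finally show ?thesis .
  qed
  have e': "d (Suc k) \<otimes> T [^] Suc k = (d (Suc k) \<otimes> T [^] k) \<otimes> T" for k
    using T d by (simp add: m_assoc)
  let ?V = "finsum R (\<lambda>k. d (Suc k) \<otimes> T [^] k) {..n}"
  have 1: "finsum R (\<lambda>k. d (Suc k) \<otimes> T [^] Suc k) {..n} = T \<otimes> ?V"
    unfolding e using T d by (intro finsum_rdistr[symmetric]) auto
  have 2: "finsum R (\<lambda>k. d (Suc k) \<otimes> T [^] Suc k) {..n} = ?V \<otimes> T"
    unfolding e' using T d by (intro finsum_ldistr[symmetric]) auto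
  have 3: "?V \<in> carrier R" using T d by (intro finsum_closed) auto
  show ?thesis using 1 2 3 by (intro bexI[of _ ?V]) auto
qed

text \<open>\<open>L\<close> plays the role of the logarithm of \<open>1 + T\<close>; only its shape \<open>T + T\<^sup>2 \<cdots>\<close> matters.\<close>

lemma (in ring) nilpotent_log:
  fixes c :: "nat \<Rightarrow> 'a"
  assumes T: "T \<in> carrier R" and nil: "T [^] Suc (Suc m) = \<zero>"
    and c: "\<And>k. c k \<in> carrier R" and comm: "\<And>k. c k \<otimes> T = T \<otimes> c k"
    and c0: "c 0 = \<zero>" and c1: "c 1 = \<one>"
    and L: "L = finsum R (\<lambda>k. c k \<otimes> T [^] k) {..Suc m}"
  shows "L [^] Suc (Suc m) = \<zero>" and "L = \<zero> \<Longrightarrow> T = \<zero>"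
proof -
  have sh: "finsum R (\<lambda>k. c k \<otimes> T [^] k) {..Suc m} = finsum R (\<lambda>k. c (Suc k) \<otimes> T [^] Suc k) {..m}"
    using T c c0 by (subst finsum_Suc2) (auto simp: finsum_closed simp del: nat_pow_Suc)
  obtain V where V: "V \<in> carrier R" "L = T \<otimes> V" "T \<otimes> V = V \<otimes> T"
    using finsum_nilpotent_factor[of T c m, OF T c comm] sh L by auto
  show "L [^] Suc (Suc m) = \<zero>"
    unfolding V(2) using pow_mult_distrib[OF V(3) T V(1), of "Suc (Suc m)"] nil T V(1) by (simp del: nat_pow_Suc)
  show "T = \<zero>" if "L = \<zero>"
  proof -
    \<comment> \<open>If the logarithm vanishes, T is minus the sum of the terms of order at least
      two, so T = T (T Z). Iterating gives T = T (T Z)^k, which is zero for large k.\<close>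
    have pw: "\<exists>Z\<in>carrier R. T = T \<otimes> (T \<otimes> Z) \<and> T \<otimes> Z = Z \<otimes> T"
    proof (cases m)
      case 0
      have "L = finsum R (\<lambda>k. c (Suc k) \<otimes> T [^] Suc k) {..0}" using L sh 0 by simp
      then have "L = T" using c1 T by simp
      then show ?thesis using that T by (intro bexI[of _ \<zero>]) auto
    next
      case (Suc m')
      obtain V' where V': "V' \<in> carrier R" "finsum R (\<lambda>k. c (Suc (Suc k)) \<otimes> T [^] Suc k) {..m'} = T \<otimes> V'" "T \<otimes> V' = V' \<otimes> T"
        using finsum_nilpotent_factor[of T "\<lambda>k. c (Suc k)" m', OF T c comm] by blast
      have "L = finsum R (\<lambda>k. c (Suc (Suc k)) \<otimes> T [^] Suc (Suc k)) {..m'} \<oplus> T"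
      proof -
        have "L = finsum R (\<lambda>k. c (Suc k) \<otimes> T [^] Suc k) {..Suc m'}" using L sh unfolding Suc by (simp only:)
        then show ?thesis
          using finsum_Suc2[of "\<lambda>k. c (Suc k) \<otimes> T [^] Suc k" m'] T c c1 by (simp del: nat_pow_Suc finsum_Suc)
      qed
      also have "finsum R (\<lambda>k. c (Suc (Suc k)) \<otimes> T [^] Suc (Suc k)) {..m'} = finsum R (\<lambda>k. c (Suc (Suc k)) \<otimes> T [^] Suc k) {..m'} \<otimes> T"
        using T c by (subst finsum_ldistr) (auto intro!: finsum_cong' simp: m_assoc)
      also have "\<dots> = T \<otimes> (T \<otimes> V')"
        unfolding V'(2) unfolding V'(3) using T V'(1) by (simp add: m_assoc[symmetric]) (simp add: V'(3) m_assoc)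
      finally have "T \<otimes> (T \<otimes> V') \<oplus> T = \<zero>" using that by simp
      then have "T = \<ominus> (T \<otimes> (T \<otimes> V'))" using T V'(1) by (metis a_comm m_closed minus_equality)
      then have "T = T \<otimes> (T \<otimes> \<ominus> V')" using T V'(1) by (simp add: r_minus)
      moreover have "T \<otimes> \<ominus> V' = \<ominus> V' \<otimes> T" using T V' by (simp add: r_minus l_minus)
      ultimately show ?thesis using V'(1) by (intro bexI[of _ "\<ominus> V'"]) auto
    qed
    then obtain Z where Z: "Z \<in> carrier R" "T = T \<otimes> (T \<otimes> Z)" "T \<otimes> Z = Z \<otimes> T" by auto
    have it: "T = T \<otimes> (T \<otimes> Z) [^] (k::nat)" for k
    proof (induction k)
      case (Suc k)
      have "T \<otimes> (T \<otimes> Z) [^] Suc k = (T \<otimes> (T \<otimes> Z) [^] k) \<otimes> (T \<otimes> Z)" using T Z(1) by (simp add: m_assoc)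
      also have "\<dots> = T" using Suc Z(2) by simp
      finally show ?case by simp
    qed (use T in simp)
    have "(T \<otimes> Z) [^] Suc (Suc m) = \<zero>"
      using pow_mult_distrib[OF Z(3) T Z(1), of "Suc (Suc m)"] nil T Z(1) by (simp del: nat_pow_Suc)
    then show ?thesis using it[of "Suc (Suc m)"] T by (simp del: nat_pow_Suc)
  qed
qed

section \<open>Polynomials and their values at natural numbers\<close>

context unramified_ring
begin

interpretation UP: UP_domain R "UP R" by unfold_locales simp
interpretation PU: UP_pre_univ_prop R R id "UP R" by unfold_locales simp

abbreviation "Pol \<equiv> UP R"
text \<open>Evaluation is restricted to images of natural numbers: these are the arguments at which
  powers of u give values, and in characteristic zero such values determine a polynomial.\<close>

definition ev :: "nat \<Rightarrow> (nat \<Rightarrow> 'r) \<Rightarrow> 'r" where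
  "ev n = UnivPoly.eval R R id ([n] \<cdot> \<one>)"

abbreviation "cf q k \<equiv> UnivPoly.coeff Pol q k"

lemma ev_hom: "ev n \<in> ring_hom Pol R"
  unfolding ev_def by (rule PU.eval_ring_hom) simp

lemma cring_Pol: "cring Pol"
  by (rule UP.UP_cring)

interpretation Pol: cring Pol by (rule cring_Pol)

lemma ev_const: "r \<in> carrier R \<Longrightarrow> ev n (UnivPoly.monom Pol r 0) = r"
  unfolding ev_def using PU.eval_const[of "[n] \<cdot> \<one>" r] by simp

lemma ev_X: "ev n (UnivPoly.monom Pol \<one> 1) = [n] \<cdot> \<one>"
  unfolding ev_def by (rule PU.eval_monom1) simp

lemma ev_smult: "r \<in> carrier R \<Longrightarrow> q \<in> carrier Pol \<Longrightarrow> ev n (r \<odot>\<^bsub>Pol\<^esub> q) = r \<otimes> ev n q"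
  using ring_hom_mult[OF ev_hom, of "UnivPoly.monom Pol r 0" q] ev_const[of r n] UP.monom_mult_is_smult[of r q] by simp

lemma ev_diff: "q \<in> carrier Pol \<Longrightarrow> q' \<in> carrier Pol \<Longrightarrow> ev n (q \<ominus>\<^bsub>Pol\<^esub> q') = ev n q \<ominus> ev n q'"
  by (rule ring_hom_diff[OF ev_hom UP.UP_ring ring_axioms])

lemma ev_closed: "q \<in> carrier Pol \<Longrightarrow> ev n q \<in> carrier R"
  by (rule ring_hom_closed[OF ev_hom])

lemma ev_0: "q \<in> carrier Pol \<Longrightarrow> ev 0 q = cf q 0"
proof -
  assume q: "q \<in> carrier Pol"
  have "ev 0 q = finsum R (\<lambda>i. cf q i \<otimes> \<zero> [^] i) {..UnivPoly.deg R q}"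
    unfolding ev_def using q by (simp add: UP.eval_on_carrier)
  also have "\<dots> = finsum R (\<lambda>i. if 0 = i then cf q i else \<zero>) {..UnivPoly.deg R q}"
    using q by (intro finsum_cong') (auto simp: nat_pow_zero)
  also have "\<dots> = cf q 0" using q by (intro finsum_singleton) auto
  finally show ?thesis .
qed

lemma nat_diff_ring: "m \<le> n \<Longrightarrow> [(n::nat)] \<cdot> \<one> \<ominus> [m] \<cdot> \<one> = [(n - m)] \<cdot> \<one>"
  using nat_mult_add[OF one_closed, of "n - m" m] by (simp add: minus_eq a_assoc r_neg)

lemma nat_mult_prod: "[(m::nat)] \<cdot> \<one> \<otimes> [(n::nat)] \<cdot> \<one> = [(m * n)] \<cdot> \<one>"
  by (simp add: add_pow_ldistr nat_mult_mult)

text \<open>Induction on the degree, splitting off the root k. The cofactor is known to vanish only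
  beyond k, since X - k is zero at k; hence the threshold in the statement.\<close>

lemma poly_zeroI:
  assumes "q \<in> carrier Pol" "\<And>n. n \<ge> k \<Longrightarrow> ev n q = \<zero>"
  shows "q = \<zero>\<^bsub>Pol\<^esub>"
  using assms
proof (induction "UnivPoly.deg R q" arbitrary: q k rule: less_induct)
  case less
  show ?case
  proof (rule ccontr)
    assume nz: "q \<noteq> \<zero>\<^bsub>Pol\<^esub>"
    let ?l = "UnivPoly.monom Pol \<one> 1 \<ominus>\<^bsub>Pol\<^esub> UnivPoly.monom Pol ([k] \<cdot> \<one>) 0"
    have nt: "carrier R \<noteq> {\<zero>}" using one_not_zero one_closed by blast
    obtain g where g: "g \<in> carrier Pol" "q = ?l \<otimes>\<^bsub>Pol\<^esub> g \<oplus>\<^bsub>Pol\<^esub> UnivPoly.monom Pol (ev k q) 0"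
      using UP.remainder_theorem[OF less.prems(1) _ nt, of "[k] \<cdot> \<one>", folded ev_def] by auto
    have l: "?l \<in> carrier Pol" by simp
    have q: "q = ?l \<otimes>\<^bsub>Pol\<^esub> g" using g less.prems(2)[of k] by simp
    have gz: "g \<noteq> \<zero>\<^bsub>Pol\<^esub>" using nz q l by auto
    have dl: "UnivPoly.deg R ?l = 1" using UP.deg_minus_monom[OF _ nt, of "[k] \<cdot> \<one>"] by simp
    then have lz: "?l \<noteq> \<zero>\<^bsub>Pol\<^esub>" by (metis UP.deg_zero zero_neq_one)
    have "UnivPoly.deg R q = 1 + UnivPoly.deg R g" using UP.deg_mult[OF lz gz l g(1)] dl q by simp
    moreover have "ev n g = \<zero>" if n: "n \<ge> Suc k" for n
    proof -
      have "ev n ?l = [(n - k)] \<cdot> \<one>" using n by (simp add: ev_diff ev_X[simplified] ev_const nat_diff_ring)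
      then have "[(n - k)] \<cdot> \<one> \<otimes> ev n g = \<zero>"
        using less.prems(2)[of n] n q g(1) l by (simp add: ring_hom_mult[OF ev_hom])
      moreover have "[(n - k)] \<cdot> \<one> \<noteq> \<zero>" using torsion_free[of "n - k" \<one>] n by auto
      ultimately show ?thesis using integral ev_closed[OF g(1)] by blast
    qed
    ultimately have "g = \<zero>\<^bsub>Pol\<^esub>" using less.hyps[of g "Suc k"] g(1) by simp
    then show False using gz by simp
  qed
qed

lemma poly_eqI:
  assumes "q \<in> carrier Pol" "q' \<in> carrier Pol" "\<And>n. ev n q = ev n q'"
  shows "q = q'"
proof -
  have "q \<ominus>\<^bsub>Pol\<^esub> q' = \<zero>\<^bsub>Pol\<^esub>"
    using assms by (intro poly_zeroI[of _ 0]) (simp_all add: ev_diff ev_closed)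
  then show ?thesis using assms by simp
qed

lemma cf_mult_1:
  assumes "q \<in> carrier Pol" "q' \<in> carrier Pol"
  shows "cf (q \<otimes>\<^bsub>Pol\<^esub> q') 1 = cf q 0 \<otimes> cf q' 1 \<oplus> cf q' 0 \<otimes> cf q 1"
proof -
  have c: "cf q k \<in> carrier R" "cf q' k \<in> carrier R" for k using assms by auto
  have "cf (q \<otimes>\<^bsub>Pol\<^esub> q') 1 = finsum R (\<lambda>i. cf q i \<otimes> cf q' (Suc 0 - i)) {..Suc 0}"
    using assms by simp
  also have "\<dots> = cf q 1 \<otimes> cf q' 0 \<oplus> cf q 0 \<otimes> cf q' 1"
    using c by (subst finsum_Suc) auto
  finally show ?thesis using c by (simp add: a_comm m_comm)
qed

text \<open>Each binomial coefficient is the previous one times (n - k) / (k + 1), and k + 1 is a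
  unit of R as long as it is less than p. This is where the bound on the index matters.\<close>

lemma binomial_polys:
  "\<exists>s. (\<forall>k<p. s k \<in> carrier Pol \<and> (\<forall>n. ev n (s k) = [(n choose k)] \<cdot> \<one>))"
proof -
  have "\<exists>s. s \<in> carrier Pol \<and> (\<forall>n. ev n s = [(n choose k)] \<cdot> \<one>)" if "k < p" for k
    using that
  proof (induction k)
    case 0
    show ?case
    proof (intro exI[of _ "\<one>\<^bsub>Pol\<^esub>"] conjI allI)
      fix n
      have "[(n choose 0)] \<cdot> \<one> = \<one>" by simp
      then show "ev n \<one>\<^bsub>Pol\<^esub> = [(n choose 0)] \<cdot> \<one>" by (simp only: ring_hom_one[OF ev_hom])
    qed simp
  next
    case (Suc k)
    then obtain s where s: "s \<in> carrier Pol" "\<And>n. ev n s = [(n choose k)] \<cdot> \<one>" by auto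
    have u: "[Suc k] \<cdot> \<one> \<in> Units R" using Suc.prems by (intro nat_unit) auto
    let ?i = "inv ([Suc k] \<cdot> \<one>)"
    have i: "?i \<in> carrier R" using u by simp
    let ?t = "?i \<odot>\<^bsub>Pol\<^esub> (s \<otimes>\<^bsub>Pol\<^esub> (UnivPoly.monom Pol \<one> 1 \<ominus>\<^bsub>Pol\<^esub> UnivPoly.monom Pol ([k] \<cdot> \<one>) 0))"
    have l: "UnivPoly.monom Pol \<one> 1 \<ominus>\<^bsub>Pol\<^esub> UnivPoly.monom Pol ([k] \<cdot> \<one>) 0 \<in> carrier Pol" by simp
    have "ev n ?t = [(n choose Suc k)] \<cdot> \<one>" for n
    proof -
      have "[(n choose k)] \<cdot> \<one> \<otimes> ([n] \<cdot> \<one> \<ominus> [k] \<cdot> \<one>) = [Suc k] \<cdot> \<one> \<otimes> [(n choose Suc k)] \<cdot> \<one>"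
      \<comment> \<open>Subtraction of natural numbers is truncated, whereas n - k is formed in R;
        for n < k both binomial coefficients vanish.\<close>
      proof (cases "k \<le> n")
        case True
        have "(n choose k) * (n - k) = Suc k * (n choose Suc k)"
          using binomial_absorb_comp[of n k] binomial_absorption[of k n] by (simp add: mult.commute)
        then show ?thesis
          unfolding nat_diff_ring[OF True] nat_mult_prod by (simp only:)
      next
        case False
        then show ?thesis by (simp add: binomial_eq_0 minus_eq del: add.nat_pow_Suc)
      qed
      moreover have "ev n ?t = ?i \<otimes> ([(n choose k)] \<cdot> \<one> \<otimes> ([n] \<cdot> \<one> \<ominus> [k] \<cdot> \<one>))"
        using i s l by (simp add: ev_smult ring_hom_mult[OF ev_hom] ev_diff ev_X[simplified] ev_const)
      ultimately show ?thesis using u i by (simp add: m_assoc[symmetric] del: add.nat_pow_Suc)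
    qed
    then show ?case using i s l by (intro exI[of _ ?t]) simp
  qed
  then have "\<forall>k. \<exists>s. k < p \<longrightarrow> s \<in> carrier Pol \<and> (\<forall>n. ev n s = [(n choose k)] \<cdot> \<one>)" by blast
  then obtain s where "\<forall>k. k < p \<longrightarrow> s k \<in> carrier Pol \<and> (\<forall>n. ev n (s k) = [(n choose k)] \<cdot> \<one>)"
    by (rule choice[THEN exE])
  then show ?thesis by blast
qed

text \<open>Write K = 1 + T. The entries of K^n are combinations of the polynomials binomial(X, k)
  evaluated at n, and \<open>L\<close> collects the coefficients of X. So \<open>L\<close> is the
  logarithm of K, truncated at the terms of order below p.\<close>

lemma unipotent_matrix_polys:
  assumes K: "K \<in> carrier (matrix_ring R N)"
    and nil: "(K \<ominus>\<^bsub>matrix_ring R N\<^esub> \<one>\<^bsub>matrix_ring R N\<^esub>) [^]\<^bsub>matrix_ring R N\<^esub> p = \<zero>\<^bsub>matrix_ring R N\<^esub>"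
  shows "\<exists>L\<in>carrier (matrix_ring R N). L [^]\<^bsub>matrix_ring R N\<^esub> p = \<zero>\<^bsub>matrix_ring R N\<^esub> \<and>
    (L = \<zero>\<^bsub>matrix_ring R N\<^esub> \<longrightarrow> K = \<one>\<^bsub>matrix_ring R N\<^esub>) \<and>
    (\<forall>i<N. \<forall>j<N. \<exists>q\<in>carrier Pol. (\<forall>n. ev n q = (K [^]\<^bsub>matrix_ring R N\<^esub> n) i j) \<and> cf q 1 = L i j)"
proof -
  interpret matrices R N by unfold_locales
  \<comment> \<open>The last power of T that can survive is m + 1 = p - 1; the double successor
    matches \<open>nilpotent_log\<close>.\<close>
  obtain m where m: "p = Suc (Suc m)" using less_imp_Suc_add[OF p_pos(2)] by auto
  define T where "T = K \<ominus>\<^bsub>MR\<^esub> \<one>\<^bsub>MR\<^esub>"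
  have T: "T \<in> carrier MR" using K by (simp add: T_def)
  have KT: "K = \<one>\<^bsub>MR\<^esub> \<oplus>\<^bsub>MR\<^esub> T"
    using K by (simp add: T_def MR.minus_eq MR.a_comm[of "\<one>\<^bsub>MR\<^esub>"] MR.a_assoc MR.l_neg)
  have nilT: "T [^]\<^bsub>MR\<^esub> Suc (Suc m) = \<zero>\<^bsub>MR\<^esub>" using nil m by (simp add: T_def)
  obtain s where s: "\<And>k. k < p \<Longrightarrow> s k \<in> carrier Pol" "\<And>k n. k < p \<Longrightarrow> ev n (s k) = [(n choose k)] \<cdot> \<one>"
    using binomial_polys by blast
  define c where "c k = (if k < p then cf (s k) 1 else \<zero>)" for k
  have c: "c k \<in> carrier R" for k using s by (simp add: c_def)
  have "s 0 = \<one>\<^bsub>Pol\<^esub>" using s p_pos by (intro poly_eqI) (simp_all add: ring_hom_one[OF ev_hom])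
  then have c0: "c 0 = \<zero>" by (simp add: c_def)
  have "s 1 = UnivPoly.monom Pol \<one> 1"
  proof (rule poly_eqI)
    show "ev n (s 1) = ev n (UnivPoly.monom Pol \<one> 1)" for n
      unfolding ev_X using s(2)[of 1 n] p_pos by simp
  qed (use s p_pos in auto)
  then have c1: "c 1 = \<one>" using p_pos by (simp add: c_def)
  define L where "L = finsum MR (\<lambda>k. scalar (c k) \<otimes>\<^bsub>MR\<^esub> T [^]\<^bsub>MR\<^esub> k) {..Suc m}"
  have L: "L \<in> carrier MR" unfolding L_def using c T by (intro MR.finsum_closed) auto
  have LL: "L [^]\<^bsub>MR\<^esub> Suc (Suc m) = \<zero>\<^bsub>MR\<^esub>" "L = \<zero>\<^bsub>MR\<^esub> \<Longrightarrow> T = \<zero>\<^bsub>MR\<^esub>"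
    using MR.nilpotent_log[OF T nilT, of "\<lambda>k. scalar (c k)" L] c scalar_comm[OF c T] c0 c1
      ring_hom_one[OF scalar_hom] ring_hom_zero[OF scalar_hom ring_axioms MR.ring_axioms] L_def by auto
  have q: "\<exists>q\<in>carrier Pol. (\<forall>n. ev n q = (K [^]\<^bsub>MR\<^esub> n) i j) \<and> cf q 1 = L i j"
    if i: "i < N" and j: "j < N" for i j
  proof
    let ?t = "\<lambda>k::nat. (T [^]\<^bsub>MR\<^esub> k) i j"
    have t: "?t k \<in> carrier R" for k using T by (intro entry_closed) simp
    let ?q = "finsum Pol (\<lambda>k. ?t k \<odot>\<^bsub>Pol\<^esub> s k) {..Suc m}"
    have sc: "?t k \<odot>\<^bsub>Pol\<^esub> s k \<in> carrier Pol" if "k \<in> {..Suc m}" for k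
      using s(1) t that m by auto
    then show "?q \<in> carrier Pol" by (intro UP.P.finsum_closed) auto
    have "ev n ?q = (K [^]\<^bsub>MR\<^esub> n) i j" for n
    proof -
      have "ev n ?q = finsum R (\<lambda>k. ev n (?t k \<odot>\<^bsub>Pol\<^esub> s k)) {..Suc m}"
        using sc by (intro ring_hom_finsum[OF ev_hom UP.UP_ring ring_axioms]) auto
      also have "\<dots> = finsum R (\<lambda>k. ([(n choose k)] \<cdot>\<^bsub>MR\<^esub> (T [^]\<^bsub>MR\<^esub> k)) i j) {..Suc m}"
        using s t m T by (intro finsum_cong') (auto simp: ev_smult entry_nat_mult add_pow_rdistr)
      also have "\<dots> = finsum MR (\<lambda>k. [(n choose k)] \<cdot>\<^bsub>MR\<^esub> (T [^]\<^bsub>MR\<^esub> k)) {..Suc m} i j"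
        using T by (intro entry_finsum[symmetric]) auto
      also have "\<dots> = (K [^]\<^bsub>MR\<^esub> n) i j"
        unfolding KT MR.unipotent_power[OF T nilT] ..
      finally show ?thesis .
    qed
    moreover have "cf ?q 1 = L i j"
    proof -
      have "cf ?q 1 = finsum R (\<lambda>k. cf (?t k \<odot>\<^bsub>Pol\<^esub> s k) 1) {..Suc m}"
        using sc by (intro UP.coeff_finsum) auto
      also have "\<dots> = finsum R (\<lambda>k. (scalar (c k) \<otimes>\<^bsub>MR\<^esub> T [^]\<^bsub>MR\<^esub> k) i j) {..Suc m}"
        using s t c m T i j by (intro finsum_cong') (auto simp: scalar_mult_entry c_def m_comm intro: entry_closed)
      also have "\<dots> = L i j" unfolding L_def using c T by (intro entry_finsum[symmetric]) auto
      finally show ?thesis .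
    qed
    ultimately show "(\<forall>n. ev n ?q = (K [^]\<^bsub>MR\<^esub> n) i j) \<and> cf ?q 1 = L i j" by blast
  qed
  show ?thesis
  proof (rule bexI[OF _ L], intro conjI impI allI)
    show "L [^]\<^bsub>MR\<^esub> p = \<zero>\<^bsub>MR\<^esub>" using LL(1) m by simp
    show "K = \<one>\<^bsub>MR\<^esub>" if "L = \<zero>\<^bsub>MR\<^esub>" using LL(2)[OF that] KT by simp
  qed (use q in blast)
qed

end

section \<open>The derivation attached to a unipotent point\<close>

lemma generate_ring_induct_closed [consumes 2, case_names one gen minus add mult]:
  assumes "x \<in> generate_ring A Y" and A: "ring A" and "Y \<subseteq> carrier A"
    and "P \<one>\<^bsub>A\<^esub>" and "\<And>y. y \<in> Y \<Longrightarrow> P y"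
    and "\<And>y. y \<in> carrier A \<Longrightarrow> P y \<Longrightarrow> P (\<ominus>\<^bsub>A\<^esub> y)"
    and "\<And>y z. y \<in> carrier A \<Longrightarrow> z \<in> carrier A \<Longrightarrow> P y \<Longrightarrow> P z \<Longrightarrow> P (y \<oplus>\<^bsub>A\<^esub> z)"
    and "\<And>y z. y \<in> carrier A \<Longrightarrow> z \<in> carrier A \<Longrightarrow> P y \<Longrightarrow> P z \<Longrightarrow> P (y \<otimes>\<^bsub>A\<^esub> z)"
  shows "P x"
proof -
  interpret ring A by fact
  have "x \<in> carrier A \<and> P x"
    using assms(1) by induction (use assms(3-) in auto)
  then show ?thesis ..
qed

context group_scheme
begin

text \<open>The coproduct formula for \<open>M\<close> says that G -> GL_N is multiplicative; on
  points it turns \<open>conv\<close> into the matrix product.\<close>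

lemma conv_matrix:
  assumes C: "cring C" and x: "is_point C \<kappa> x" and y: "is_point C \<kappa> y"
    and M: "\<And>i j. i < N \<Longrightarrow> j < N \<Longrightarrow> M i j \<in> carrier G"
    and comult: "\<And>i j. i < N \<Longrightarrow> j < N \<Longrightarrow> comult G (M i j) = finsum T2 (\<lambda>k. pure_tensor R G G (M i k) (M k j)) {..<N}"
  shows "mat_map N C (conv G C x y) M = mat_map N C x M \<otimes>\<^bsub>matrix_ring C N\<^esub> mat_map N C y M"
proof -
  interpret C: cring C by fact
  interpret MC: matrices C N by unfold_locales
  note xy = C is_pointD(1)[OF x] is_pointD(1)[OF y] is_point_agree[OF x y]
  have mc: "mat_map N C z M \<in> carrier MC.MR" if "is_point C \<kappa> z" for z
    by (rule MC.MR_closedI) (use M ring_hom_closed[OF is_pointD(1)[OF that]] in \<open>auto simp: mat_map_def\<close>)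
  show ?thesis
  proof (rule MC.MR_eqI[OF mc[OF conv_point[OF C x y]] MC.MR_closed[OF mc[OF x] mc[OF y]]])
    fix i j assume i: "i < N" and j: "j < N"
    have "mat_map N C (conv G C x y) M i j = copair C x y (finsum T2 (\<lambda>k. pure_tensor R G G (M i k) (M k j)) {..<N})"
      using i j by (simp add: mat_map_def conv_def comult)
    also have "\<dots> = finsum C (\<lambda>k. copair C x y (pure_tensor R G G (M i k) (M k j))) {..<N}"
      using M i j by (intro ring_hom_finsum[OF G2.copair_hom[OF xy] G2.T.ring_axioms C.ring_axioms]) auto
    also have "\<dots> = (mat_map N C x M \<otimes>\<^bsub>MC.MR\<^esub> mat_map N C y M) i j"
      unfolding MC.mult_entry[OF i j] using M i j ring_hom_closed[OF is_pointD(1)[OF x]] ring_hom_closed[OF is_pointD(1)[OF y]]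
      by (intro C.finsum_cong') (auto simp: mat_map_def G2.copair_pure[OF xy])
    finally show "mat_map N C (conv G C x y) M i j = (mat_map N C x M \<otimes>\<^bsub>MC.MR\<^esub> mat_map N C y M) i j" .
  qed
qed

end

locale embedded_group = group_scheme R G
  for R :: "'r ring" (structure) and G :: "('r, 'a, 'm) hopf_scheme" +
  fixes N M
  assumes emb: "gl_embedding R G N M"
begin

sublocale MG: matrices G N by unfold_locales
sublocale MR: matrices R N by unfold_locales

abbreviation "GM \<equiv> matrix_ring G N"
abbreviation "RM \<equiv> matrix_ring R N"
definition "W = inv\<^bsub>GM\<^esub> M"

lemma M_unit: "M \<in> Units GM" and M_comult: "i < N \<Longrightarrow> j < N \<Longrightarrow> comult G (M i j) = finsum T2 (\<lambda>k. pure_tensor R G G (M i k) (M k j)) {..<N}"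
  and G_gen: "carrier G = generate_ring G (constants R G \<union> {M i j | i j. i < N \<and> j < N} \<union> {W i j | i j. i < N \<and> j < N})"
  using emb by (auto simp: gl_embedding_def W_def)

lemma M: "M \<in> carrier GM" and W: "W \<in> carrier GM" and MW: "M \<otimes>\<^bsub>GM\<^esub> W = \<one>\<^bsub>GM\<^esub>" and WM: "W \<otimes>\<^bsub>GM\<^esub> M = \<one>\<^bsub>GM\<^esub>"
  using M_unit by (auto simp: W_def)

lemma M_entry: "M i j \<in> carrier G" and W_entry: "W i j \<in> carrier G"
  using MG.entry_closed M W by auto

text \<open>Since the embedding is closed, the functions on G are generated by the constants, the
  entries of the generic matrix and those of its inverse.\<close>

lemma G_induct [consumes 1, case_names const gen inv minus add mult]:
  assumes "a \<in> carrier G"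
    and "\<And>r. r \<in> carrier R \<Longrightarrow> P (algmap G r)"
    and "\<And>i j. i < N \<Longrightarrow> j < N \<Longrightarrow> P (M i j)"
    and "\<And>i j. i < N \<Longrightarrow> j < N \<Longrightarrow> P (W i j)"
    and "\<And>y. y \<in> carrier G \<Longrightarrow> P y \<Longrightarrow> P (\<ominus>\<^bsub>G\<^esub> y)"
    and "\<And>y z. y \<in> carrier G \<Longrightarrow> z \<in> carrier G \<Longrightarrow> P y \<Longrightarrow> P z \<Longrightarrow> P (y \<oplus>\<^bsub>G\<^esub> z)"
    and "\<And>y z. y \<in> carrier G \<Longrightarrow> z \<in> carrier G \<Longrightarrow> P y \<Longrightarrow> P z \<Longrightarrow> P (y \<otimes>\<^bsub>G\<^esub> z)"
  shows "P a"
proof -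
  have "P \<one>\<^bsub>G\<^esub>" using assms(2)[OF G2.R.one_closed] ring_hom_one[OF G2.AB(4)] by simp
  note 1 = this
  let ?Y = "constants R G \<union> {M i j | i j. i < N \<and> j < N} \<union> {W i j | i j. i < N \<and> j < N}"
  have Y: "?Y \<subseteq> carrier G" using M_entry W_entry G2.algmap_closed by blast
  have P: "P y" if "y \<in> ?Y" for y using that assms(2-4) by blast
  have "a \<in> generate_ring G ?Y" using assms(1) G_gen by simp
  from this G2.A.ring_axioms Y 1 P assms(5-7) show ?thesis
    by (rule generate_ring_induct_closed)
qed

end

section \<open>Powers of a unipotent point and their derivative\<close>

locale unipotent_point = unramified_ring R p + embedded_group R G N M
  for R :: "'r ring" (structure) and p and G :: "('r, 'a, 'm) hopf_scheme" and N M +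
  fixes u
  assumes u: "u \<in> rational_points R G"
    and nil: "(point_matrix R N M u \<ominus>\<^bsub>matrix_ring R N\<^esub> \<one>\<^bsub>matrix_ring R N\<^esub>) [^]\<^bsub>matrix_ring R N\<^esub> p = \<zero>\<^bsub>matrix_ring R N\<^esub>"
begin

definition "K = point_matrix R N M u"

lemma id_hom: "(\<lambda>r. r) \<in> ring_hom R R"
  by (simp add: ring_hom_def)

lemma u_point: "is_point R (\<lambda>r. r) u"
  using u by (simp add: rational_points_def alg_hom_def is_point_def)

lemma K_eq: "K = mat_map N R u M"
  by (simp add: K_def point_matrix_def mat_map_def)

lemma mm: "is_point R (\<lambda>r. r) x \<Longrightarrow> mat_map N R x \<in> ring_hom GM RM"
  by (rule mat_map_hom[OF G2.A.is_cring is_cring is_pointD(1)])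

lemma K: "K \<in> carrier RM"
  unfolding K_eq by (rule ring_hom_closed[OF mm[OF u_point] M])

primrec upow :: "nat \<Rightarrow> 'a \<Rightarrow> 'r" where
  "upow 0 = counit G"
| "upow (Suc n) = conv G R (upow n) u"

lemma counit_point: "is_point R (\<lambda>r. r) (counit G)"
  using is_point_counit[OF id_hom] by simp

lemma upow_point: "is_point R (\<lambda>r. r) (upow n)"
  by (induction n) (use counit_point conv_point[OF is_cring _ u_point] in auto)

text \<open>The matrix of the unit element is idempotent, as the unit is its own square, and it is
  invertible; hence it is 1.\<close>

lemma counit_matrix: "mat_map N R (counit G) M = \<one>\<^bsub>RM\<^esub>"
proof -
  let ?E = "mat_map N R (counit G) M"
  have "?E \<otimes>\<^bsub>RM\<^esub> ?E = mat_map N R (conv G R (counit G) (counit G)) M"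
    using conv_matrix[OF is_cring counit_point counit_point, of N M] M_entry M_comult by simp
  also have "\<dots> = ?E"
    using conv_unit_left[OF is_cring counit_point] M_entry by (simp add: mat_map_def fun_eq_iff)
  finally have e: "?E \<otimes>\<^bsub>RM\<^esub> ?E = ?E" .
  have E: "?E \<in> Units RM" by (rule ring_hom_Units[OF mm[OF counit_point] M_unit])
  then have Ec: "?E \<in> carrier RM" by (rule MR.MR.Units_closed)
  have "?E \<otimes>\<^bsub>RM\<^esub> ?E = ?E \<otimes>\<^bsub>RM\<^esub> \<one>\<^bsub>RM\<^esub>" using e Ec by simp
  then show ?thesis using MR.MR.Units_l_cancel[OF E Ec MR.MR.one_closed] by simp
qed

lemma upow_matrix: "mat_map N R (upow n) M = K [^]\<^bsub>RM\<^esub> n"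
proof (induction n)
  case (Suc n)
  then show ?case
    using conv_matrix[OF is_cring upow_point u_point, of N M] M_entry M_comult by (simp add: K_eq)
qed (simp add: counit_matrix)

definition "V = mat_map N R u W"

lemma V: "V \<in> carrier RM" and VK: "V \<otimes>\<^bsub>RM\<^esub> K = \<one>\<^bsub>RM\<^esub>" and KV: "K \<otimes>\<^bsub>RM\<^esub> V = \<one>\<^bsub>RM\<^esub>"
  unfolding V_def K_eq using ring_hom_closed[OF mm[OF u_point] W]
    ring_hom_mult[OF mm[OF u_point] W M] ring_hom_mult[OF mm[OF u_point] M W] MW WM ring_hom_one[OF mm[OF u_point]] by auto

lemma inverse_unique_matrix:
  assumes "A \<in> carrier RM" "B \<in> carrier RM" "C \<in> carrier RM" "A \<otimes>\<^bsub>RM\<^esub> B = \<one>\<^bsub>RM\<^esub>" "B \<otimes>\<^bsub>RM\<^esub> C = \<one>\<^bsub>RM\<^esub>"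
  shows "A = C"
  using MR.MR.inv_unique[OF assms(4,5,2,1,3)] .

lemma upow_inv_matrix: "mat_map N R (upow n) W = V [^]\<^bsub>RM\<^esub> n"
proof (rule inverse_unique_matrix)
  show "mat_map N R (upow n) W \<otimes>\<^bsub>RM\<^esub> K [^]\<^bsub>RM\<^esub> n = \<one>\<^bsub>RM\<^esub>"
    unfolding upow_matrix[symmetric] ring_hom_mult[OF mm[OF upow_point] W M, symmetric] WM by (rule ring_hom_one[OF mm[OF upow_point]])
  have "K [^]\<^bsub>RM\<^esub> n \<otimes>\<^bsub>RM\<^esub> V [^]\<^bsub>RM\<^esub> n = (K \<otimes>\<^bsub>RM\<^esub> V) [^]\<^bsub>RM\<^esub> n"
    by (rule MR.MR.pow_mult_distrib[symmetric]) (use K V KV VK in simp_all)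
  then show "K [^]\<^bsub>RM\<^esub> n \<otimes>\<^bsub>RM\<^esub> V [^]\<^bsub>RM\<^esub> n = \<one>\<^bsub>RM\<^esub>" by (simp add: KV)
qed (use K V ring_hom_closed[OF mm[OF upow_point] W] in auto)

text \<open>One has V - 1 = -V (K - 1) with commuting factors, so the p-th power of V - 1 vanishes
  with that of K - 1.\<close>

lemma V_nil: "(V \<ominus>\<^bsub>RM\<^esub> \<one>\<^bsub>RM\<^esub>) [^]\<^bsub>RM\<^esub> p = \<zero>\<^bsub>RM\<^esub>"
proof -
  let ?T = "K \<ominus>\<^bsub>RM\<^esub> \<one>\<^bsub>RM\<^esub>"
  have T: "?T \<in> carrier RM" using K by simp
  have c: "\<ominus>\<^bsub>RM\<^esub> V \<in> carrier RM" using V by simp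
  have 1: "\<ominus>\<^bsub>RM\<^esub> V \<otimes>\<^bsub>RM\<^esub> ?T = V \<ominus>\<^bsub>RM\<^esub> \<one>\<^bsub>RM\<^esub>"
    using K V VK by (simp add: MR.MR.minus_eq MR.MR.r_distr MR.MR.l_minus MR.MR.r_minus MR.MR.minus_add MR.MR.a_comm)
  have 2: "?T \<otimes>\<^bsub>RM\<^esub> \<ominus>\<^bsub>RM\<^esub> V = V \<ominus>\<^bsub>RM\<^esub> \<one>\<^bsub>RM\<^esub>"
    using K V KV by (simp add: MR.MR.minus_eq MR.MR.l_distr MR.MR.l_minus MR.MR.r_minus MR.MR.minus_add MR.MR.a_comm)
  have "(V \<ominus>\<^bsub>RM\<^esub> \<one>\<^bsub>RM\<^esub>) [^]\<^bsub>RM\<^esub> p = (\<ominus>\<^bsub>RM\<^esub> V) [^]\<^bsub>RM\<^esub> p \<otimes>\<^bsub>RM\<^esub> ?T [^]\<^bsub>RM\<^esub> p"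
    unfolding 1[symmetric] by (rule MR.MR.pow_mult_distrib[OF _ c T]) (simp only: 1 2)
  then show ?thesis using nil c by (simp add: K_def)
qed

text \<open>For the entries of M and W this is the matrix statement for K and for its inverse V.
  Polynomial functions form a ring and each power of u is a ring homomorphism, so it spreads to all
  functions.\<close>

lemma upow_poly:
  assumes "a \<in> carrier G"
  shows "\<exists>q\<in>carrier Pol. \<forall>n. ev n q = upow n a"
  using assms
proof (induction rule: G_induct)
  case (const r)
  interpret UP: UP_domain R "UP R" by unfold_locales simp
  show ?case
    by (rule bexI[of _ "UnivPoly.monom Pol r 0"]) (use const ev_const is_pointD(2)[OF upow_point] in auto)
next
  case (gen i j)
  then obtain q where "q \<in> carrier Pol" "\<forall>n. ev n q = (K [^]\<^bsub>RM\<^esub> n) i j"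
    using unipotent_matrix_polys[OF K nil[folded K_def]] by blast
  moreover have "(K [^]\<^bsub>RM\<^esub> n) i j = upow n (M i j)" for n
    using gen by (simp add: upow_matrix[symmetric] mat_map_def)
  ultimately show ?case by auto
next
  case (inv i j)
  then obtain q where "q \<in> carrier Pol" "\<forall>n. ev n q = (V [^]\<^bsub>RM\<^esub> n) i j"
    using unipotent_matrix_polys[OF V V_nil] by blast
  moreover have "(V [^]\<^bsub>RM\<^esub> n) i j = upow n (W i j)" for n
    using inv by (simp add: upow_inv_matrix[symmetric] mat_map_def)
  ultimately show ?case by auto
next
  case (minus y)
  then obtain q where q: "q \<in> carrier Pol" "\<forall>n. ev n q = upow n y" by blast
  interpret P: cring Pol by (rule cring_Pol)
  have "ev n (\<zero>\<^bsub>Pol\<^esub> \<ominus>\<^bsub>Pol\<^esub> q) = upow n (\<zero>\<^bsub>G\<^esub> \<ominus>\<^bsub>G\<^esub> y)" for n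
    using q ring_hom_diff[OF ev_hom P.ring_axioms ring_axioms P.zero_closed q(1)]
      ring_hom_diff[OF is_pointD(1)[OF upow_point] G2.A.ring_axioms ring_axioms G2.A.zero_closed minus(1)]
      ring_hom_zero[OF ev_hom P.ring_axioms ring_axioms] ring_hom_zero[OF is_pointD(1)[OF upow_point] G2.A.ring_axioms ring_axioms] by simp
  then show ?case using q(1) minus(1) by (intro bexI[of _ "\<zero>\<^bsub>Pol\<^esub> \<ominus>\<^bsub>Pol\<^esub> q"]) (simp_all add: G2.A.minus_eq)
next
  case (add y z)
  then obtain q q' where q: "q \<in> carrier Pol" "\<forall>n. ev n q = upow n y" "q' \<in> carrier Pol" "\<forall>n. ev n q' = upow n z" by blast
  interpret P: cring Pol by (rule cring_Pol)
  show ?case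
    using q ring_hom_add[OF ev_hom q(1,3)] ring_hom_add[OF is_pointD(1)[OF upow_point] add(1,2)]
    by (intro bexI[of _ "q \<oplus>\<^bsub>Pol\<^esub> q'"]) auto
next
  case (mult y z)
  then obtain q q' where q: "q \<in> carrier Pol" "\<forall>n. ev n q = upow n y" "q' \<in> carrier Pol" "\<forall>n. ev n q' = upow n z" by blast
  interpret P: cring Pol by (rule cring_Pol)
  show ?case
    using q ring_hom_mult[OF ev_hom q(1,3)] ring_hom_mult[OF is_pointD(1)[OF upow_point] mult(1,2)]
    by (intro bexI[of _ "q \<otimes>\<^bsub>Pol\<^esub> q'"]) auto
qed

text \<open>
  \<open>du\<close> is the derivative at \<open>0\<close> of the one-parameter group \<open>n \<mapsto> u\<^sup>n\<close>, whose coordinates are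
  polynomials in \<open>n\<close> over \<open>R\<close>.
\<close>

definition "upoly a = (SOME q. q \<in> carrier Pol \<and> (\<forall>n. ev n q = upow n a))"
definition "du a = cf (upoly a) 1"

lemma upoly: assumes "a \<in> carrier G" shows "upoly a \<in> carrier Pol" "ev n (upoly a) = upow n a"
  using someI_ex[of "\<lambda>q. q \<in> carrier Pol \<and> (\<forall>n. ev n q = upow n a)"] upow_poly[OF assms]
  unfolding upoly_def by blast+

text \<open>The choice made in \<open>upoly\<close> is immaterial, as values at natural numbers
  determine a polynomial. The rules for \<open>du\<close> are obtained by exhibiting the polynomial
  of a sum, product or constant.\<close>

lemma upoly_eqI: "a \<in> carrier G \<Longrightarrow> q \<in> carrier Pol \<Longrightarrow> (\<And>n. ev n q = upow n a) \<Longrightarrow> upoly a = q"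
  by (intro poly_eqI) (simp_all add: upoly)

interpretation UP: UP_domain R "UP R" by unfold_locales simp

lemma cf_closed: "q \<in> carrier Pol \<Longrightarrow> cf q k \<in> carrier R"
  by (rule UP.coeff_closed)

lemma du_closed: "a \<in> carrier G \<Longrightarrow> du a \<in> carrier R"
  unfolding du_def by (intro cf_closed upoly)

lemma upoly_0: "a \<in> carrier G \<Longrightarrow> cf (upoly a) 0 = counit G a"
  using ev_0[OF upoly(1)] upoly(2)[of a 0] by simp

lemma du_add:
  assumes "a \<in> carrier G" "b \<in> carrier G"
  shows "du (a \<oplus>\<^bsub>G\<^esub> b) = du a \<oplus> du b"
proof -
  have "upoly (a \<oplus>\<^bsub>G\<^esub> b) = upoly a \<oplus>\<^bsub>Pol\<^esub> upoly b"
    using assms upoly ring_hom_add[OF ev_hom upoly(1)[OF assms(1)] upoly(1)[OF assms(2)]] ring_hom_add[OF is_pointD(1)[OF upow_point] assms]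
    by (intro upoly_eqI) auto
  then show ?thesis using upoly assms by (simp add: du_def)
qed

text \<open>Comparison of the coefficients of X in a product of polynomials; their constant terms
  are the values at n = 0, where u^n is the unit.\<close>

lemma du_mult:
  assumes "a \<in> carrier G" "b \<in> carrier G"
  shows "du (a \<otimes>\<^bsub>G\<^esub> b) = counit G a \<otimes> du b \<oplus> counit G b \<otimes> du a"
proof -
  have "upoly (a \<otimes>\<^bsub>G\<^esub> b) = upoly a \<otimes>\<^bsub>Pol\<^esub> upoly b"
    using assms upoly ring_hom_mult[OF ev_hom upoly(1)[OF assms(1)] upoly(1)[OF assms(2)]] ring_hom_mult[OF is_pointD(1)[OF upow_point] assms]
    by (intro upoly_eqI) auto
  then show ?thesis
    unfolding du_def using cf_mult_1[OF upoly(1)[OF assms(1)] upoly(1)[OF assms(2)]] upoly_0 assms by simp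
qed

lemma du_algmap: "r \<in> carrier R \<Longrightarrow> du (algmap G r) = \<zero>"
proof -
  assume r: "r \<in> carrier R"
  have "upoly (algmap G r) = UnivPoly.monom Pol r 0"
    using r ev_const is_pointD(2)[OF upow_point] by (intro upoly_eqI) auto
  then show ?thesis using r by (simp add: du_def)
qed

lemma du_matrix:
  "\<exists>L\<in>carrier RM. L [^]\<^bsub>RM\<^esub> p = \<zero>\<^bsub>RM\<^esub> \<and> (L = \<zero>\<^bsub>RM\<^esub> \<longrightarrow> K = \<one>\<^bsub>RM\<^esub>) \<and> (\<forall>i<N. \<forall>j<N. du (M i j) = L i j)"
proof -
  obtain L where L: "L \<in> carrier RM" "L [^]\<^bsub>RM\<^esub> p = \<zero>\<^bsub>RM\<^esub>" "L = \<zero>\<^bsub>RM\<^esub> \<longrightarrow> K = \<one>\<^bsub>RM\<^esub>"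
    and q: "\<forall>i<N. \<forall>j<N. \<exists>q\<in>carrier Pol. (\<forall>n. ev n q = (K [^]\<^bsub>RM\<^esub> n) i j) \<and> cf q 1 = L i j"
    using unipotent_matrix_polys[OF K nil[folded K_def]] by blast
  have "du (M i j) = L i j" if i: "i < N" and j: "j < N" for i j
  proof -
    obtain q where q: "q \<in> carrier Pol" "\<And>n. ev n q = (K [^]\<^bsub>RM\<^esub> n) i j" "cf q 1 = L i j" using q i j by blast
    have "upoly (M i j) = q"
      using q M_entry i j by (intro upoly_eqI) (simp_all add: upow_matrix[symmetric] mat_map_def)
    then show ?thesis using q(3) by (simp add: du_def)
  qed
  then show ?thesis using L by blast
qed

text \<open>If \<open>du\<close> vanished, so would the logarithm of K, forcing K = 1; then u and
  the unit agree on generators, hence everywhere.\<close>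

lemma du_nonzero:
  assumes "\<exists>a\<in>carrier G. u a \<noteq> counit G a"
  shows "\<exists>a\<in>carrier G. du a \<noteq> \<zero>"
proof (rule ccontr)
  assume "\<not> (\<exists>a\<in>carrier G. du a \<noteq> \<zero>)"
  then have z: "du a = \<zero>" if "a \<in> carrier G" for a using that by blast
  obtain L where L: "L \<in> carrier RM" "L = \<zero>\<^bsub>RM\<^esub> \<longrightarrow> K = \<one>\<^bsub>RM\<^esub>" "\<forall>i<N. \<forall>j<N. du (M i j) = L i j"
    using du_matrix by blast
  have "L = \<zero>\<^bsub>RM\<^esub>"
  proof (rule MR.MR_eqI[OF L(1) MR.MR.zero_closed])
    fix i j assume "i < N" "j < N"
    then show "L i j = \<zero>\<^bsub>RM\<^esub> i j" using L(3) z[OF M_entry[of i j]] by (simp add: MR.entry_zero)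
  qed
  then have K1: "K = \<one>\<^bsub>RM\<^esub>" using L(2) by simp
  then have V1: "V = \<one>\<^bsub>RM\<^esub>" using VK V by simp
  have E: "mat_map N R (counit G) W = \<one>\<^bsub>RM\<^esub>" using upow_inv_matrix[of 0] by simp
  have "u a = counit G a" if "a \<in> carrier G" for a
    using that
  proof (induction rule: G_induct)
    case (const r)
    then show ?case using is_pointD(2)[OF u_point] is_pointD(2)[OF counit_point] by simp
  next
    case (gen i j)
    have "mat_map N R u M i j = mat_map N R (counit G) M i j" using K1 counit_matrix by (simp add: K_eq)
    then show ?case using gen by (simp add: mat_map_def)
  next
    case (inv i j)
    have "mat_map N R u W i j = mat_map N R (counit G) W i j" using V1 E by (simp add: V_def)
    then show ?case using inv by (simp add: mat_map_def)
  next
    case (minus y)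
    have "u (\<zero>\<^bsub>G\<^esub> \<ominus>\<^bsub>G\<^esub> y) = counit G (\<zero>\<^bsub>G\<^esub> \<ominus>\<^bsub>G\<^esub> y)"
      using minus ring_hom_diff[OF is_pointD(1)[OF u_point] G2.A.ring_axioms ring_axioms G2.A.zero_closed minus(1)]
        ring_hom_diff[OF counit_hom G2.A.ring_axioms ring_axioms G2.A.zero_closed minus(1)]
        ring_hom_zero[OF is_pointD(1)[OF u_point] G2.A.ring_axioms ring_axioms] ring_hom_zero[OF counit_hom G2.A.ring_axioms ring_axioms] by simp
    then show ?case using minus(1) by (simp add: G2.A.minus_eq)
  next
    case (add y z)
    then show ?case by (simp add: ring_hom_add[OF is_pointD(1)[OF u_point]] ring_hom_add[OF counit_hom])
  next
    case (mult y z)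
    then show ?case by (simp add: ring_hom_mult[OF is_pointD(1)[OF u_point]] ring_hom_mult[OF counit_hom])
  qed
  then show False using assms by blast
qed

text \<open>The values of \<open>du\<close> are divided by the largest power of p that divides all
  of them; it exists because R is p-adically separated. The derivation rules and the vanishing p-th
  power survive the division since R is a domain.\<close>

lemma unipotent_derivation:
  assumes nt: "\<exists>a\<in>carrier G. u a \<noteq> counit G a"
  shows "\<exists>d. (\<forall>a\<in>carrier G. d a \<in> carrier R) \<and>
    (\<forall>a\<in>carrier G. \<forall>b\<in>carrier G. d (a \<oplus>\<^bsub>G\<^esub> b) = d a \<oplus> d b) \<and>
    (\<forall>a\<in>carrier G. \<forall>b\<in>carrier G. d (a \<otimes>\<^bsub>G\<^esub> b) = counit G a \<otimes> d b \<oplus> counit G b \<otimes> d a) \<and>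
    (\<forall>r\<in>carrier R. d (algmap G r) = \<zero>) \<and>
    mat_map N R d M [^]\<^bsub>RM\<^esub> p = \<zero>\<^bsub>RM\<^esub> \<and>
    (\<exists>b\<in>carrier G. d b \<notin> PIdl pr)"
proof -
  let ?Q = "\<lambda>n::nat. \<forall>a\<in>carrier G. du a \<in> PIdl (pr [^] n)"
  have Q0: "?Q 0"
  proof
    fix a assume "a \<in> carrier G"
    then show "du a \<in> PIdl (pr [^] (0::nat))" using pow_idealI[OF du_closed, of a 0] du_closed by simp
  qed
  obtain a0 where "a0 \<in> carrier G" "du a0 \<noteq> \<zero>" using du_nonzero[OF nt] by blast
  then have ex: "\<exists>n. \<not> ?Q n" using separated[OF du_closed] by blast
  \<comment> \<open>The first exponent for which not all values are divisible. It is positive, and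
    its predecessor m is the exponent that is divided out.\<close>
  define l where "l = (LEAST n. \<not> ?Q n)"
  have l: "\<not> ?Q l" unfolding l_def by (rule LeastI_ex[OF ex])
  then obtain m where m: "l = Suc m" using Q0 by (cases l) auto
  have Qm: "?Q m" using not_less_Least[of m "\<lambda>n. \<not> ?Q n"] m unfolding l_def by force
  have "\<forall>a\<in>carrier G. \<exists>s. s \<in> carrier R \<and> du a = s \<otimes> pr [^] m"
    using Qm by (metis pow_idealE)
  then obtain d where d: "\<forall>a\<in>carrier G. d a \<in> carrier R \<and> du a = d a \<otimes> pr [^] m"
    using bchoice[of "carrier G" "\<lambda>a s. s \<in> carrier R \<and> du a = s \<otimes> pr [^] m"] by blast
  have dc: "d a \<in> carrier R" and de: "du a = d a \<otimes> pr [^] m" if "a \<in> carrier G" for a using d that by auto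
  have pz: "pr [^] k \<noteq> \<zero>" for k :: nat
  proof (induction k)
    case (Suc k)
    have "pr \<in> carrier R" by simp
    then show ?case using Suc pr_nonzero integral[of "pr [^] k" pr] by auto
  qed simp
  have cancel: "x = y" if "x \<in> carrier R" "y \<in> carrier R" "x \<otimes> pr [^] m = y \<otimes> pr [^] m" for x y
    using m_rcancel[OF pz _ that(1,2), of m] that(3) by simp
  have pm: "pr [^] m \<in> carrier R" by simp
  have add: "d (a \<oplus>\<^bsub>G\<^esub> b) = d a \<oplus> d b" if a: "a \<in> carrier G" and b: "b \<in> carrier G" for a b
  proof (rule cancel)
    show "d (a \<oplus>\<^bsub>G\<^esub> b) \<otimes> pr [^] m = (d a \<oplus> d b) \<otimes> pr [^] m"
      using du_add[OF a b] by (simp only: de G2.A.a_closed a b l_distr[OF dc[OF a] dc[OF b] pm])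
  qed (use a b dc in simp_all)
  have mult: "d (a \<otimes>\<^bsub>G\<^esub> b) = counit G a \<otimes> d b \<oplus> counit G b \<otimes> d a" if a: "a \<in> carrier G" and b: "b \<in> carrier G" for a b
  proof (rule cancel)
    show "d (a \<otimes>\<^bsub>G\<^esub> b) \<otimes> pr [^] m = (counit G a \<otimes> d b \<oplus> counit G b \<otimes> d a) \<otimes> pr [^] m"
      using du_mult[OF a b] 
      by (simp only: de G2.A.m_closed a b l_distr[OF m_closed[OF counit_closed[OF a] dc[OF b]] m_closed[OF counit_closed[OF b] dc[OF a]] pm]
        m_assoc[OF counit_closed[OF a] dc[OF b] pm] m_assoc[OF counit_closed[OF b] dc[OF a] pm])
  qed (use a b dc in simp_all)
  have const: "d (algmap G r) = \<zero>" if r: "r \<in> carrier R" for r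
  proof (rule cancel)
    show "d (algmap G r) \<otimes> pr [^] m = \<zero> \<otimes> pr [^] m"
      using du_algmap[OF r] de[OF G2.algmap_closed(1)[OF r]] pm by simp
  qed (use r dc in simp_all)
  obtain b where b: "b \<in> carrier G" "du b \<notin> PIdl (pr [^] Suc m)" using l m by blast
  have nb: "d b \<notin> PIdl pr"
  proof
    assume "d b \<in> PIdl pr"
    then obtain s where s: "s \<in> carrier R" "d b = s \<otimes> pr" unfolding cgenideal_def by blast
    have "du b = s \<otimes> pr [^] Suc m" using de[OF b(1)] s by (simp add: m_assoc m_comm)
    then show False using b(2) pow_idealI[OF s(1), of "Suc m"] by simp
  qed
  obtain L where L: "L \<in> carrier RM" "L [^]\<^bsub>RM\<^esub> p = \<zero>\<^bsub>RM\<^esub>" "\<forall>i<N. \<forall>j<N. du (M i j) = L i j"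
    using du_matrix by blast
  let ?L = "mat_map N R d M"
  have L': "?L \<in> carrier RM" by (rule MR.MR_closedI) (use dc M_entry in \<open>auto simp: mat_map_def\<close>)
  define c where "c = pr [^] m"
  have c: "c \<in> carrier R" by (simp add: c_def)
  have LL: "L = MR.scalar c \<otimes>\<^bsub>RM\<^esub> ?L"
  proof (rule MR.MR_eqI[OF L(1)])
    fix i j assume i: "i < N" and j: "j < N"
    show "L i j = (MR.scalar c \<otimes>\<^bsub>RM\<^esub> ?L) i j"
      unfolding MR.scalar_mult_entry[OF c L' i j] using L(3) i j de[OF M_entry] dc[OF M_entry] c
      by (simp add: mat_map_def m_comm c_def)
  qed (use L' c in simp)
  have "?L [^]\<^bsub>RM\<^esub> p = \<zero>\<^bsub>RM\<^esub>"
  proof (rule MR.MR_eqI)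
    fix i j assume i: "i < N" and j: "j < N"
    have "L [^]\<^bsub>RM\<^esub> p = MR.scalar c [^]\<^bsub>RM\<^esub> p \<otimes>\<^bsub>RM\<^esub> ?L [^]\<^bsub>RM\<^esub> p"
      unfolding LL by (rule MR.MR.pow_mult_distrib[OF MR.scalar_comm[OF c L'] MR.scalar_closed[OF c] L'])
    also have "MR.scalar c [^]\<^bsub>RM\<^esub> p = MR.scalar (c [^] p)"
      by (rule ring_hom_nat_pow[OF MR.scalar_hom ring_axioms MR.MR.ring_axioms c, symmetric])
    finally have e: "L [^]\<^bsub>RM\<^esub> p = MR.scalar (c [^] p) \<otimes>\<^bsub>RM\<^esub> ?L [^]\<^bsub>RM\<^esub> p" .
    have cp: "c [^] p \<in> carrier R" and Lp: "?L [^]\<^bsub>RM\<^esub> p \<in> carrier RM" using c L' by simp_all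
    have "c [^] p \<otimes> (?L [^]\<^bsub>RM\<^esub> p) i j = \<zero>"
      unfolding MR.scalar_mult_entry[OF cp Lp i j, symmetric] e[symmetric] L(2) by (rule MR.entry_zero)
    moreover have "c [^] p \<noteq> \<zero>" using pz by (simp add: c_def nat_pow_pow)
    ultimately have "(?L [^]\<^bsub>RM\<^esub> p) i j = \<zero>"
      using integral[OF _ cp MR.entry_closed[OF Lp]] by blast
    then show "(?L [^]\<^bsub>RM\<^esub> p) i j = \<zero>\<^bsub>RM\<^esub> i j" by (simp add: MR.entry_zero)
  qed (use L' in simp_all)
  then show ?thesis using dc add mult const b(1) nb by (intro exI[of _ d] conjI ballI bexI[of _ b])
qed

end

lemma frag_map_comp: "frag_map f (frag_map g c) = frag_map (\<lambda>x. f (g x)) c"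
  using frag_extend_compose[of "\<lambda>x. frag_of (f x)" g c] by (simp add: frag_map_def comp_def)

section \<open>Left invariant forms\<close>

context group_scheme
begin

sublocale GK: kaehler_base G "constants R G"
  by unfold_locales (use G2.algmap_closed in blast)

text \<open>Relative forms for the first projection: functions of the first factor count as
  constants, as in \<open>left_invariant_forms\<close>.\<close>

sublocale TK: kaehler_base T2 "tensor_in1 R G G ` carrier G"
  by unfold_locales (use ring_hom_closed[OF G2.tensor_in1_hom] in blast)

lemma comult_constants: "comult G ` constants R G \<subseteq> tensor_in1 R G G ` carrier G"
  and in2_constants: "tensor_in2 R G G ` constants R G \<subseteq> tensor_in1 R G G ` carrier G"
proof -
  have c: "comult G (algmap G r) = tensor_in1 R G G (algmap G r)" "tensor_in2 R G G (algmap G r) = tensor_in1 R G G (algmap G r)"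
    "algmap G r \<in> carrier G" if "r \<in> carrier R" for r
    using comult_algmap[OF that] G2.algmap_T[of r] G2.algmap_T2[OF that] G2.algmap_closed(1)[OF that] by simp_all
  show "comult G ` constants R G \<subseteq> tensor_in1 R G G ` carrier G"
    using c(1,3) by auto
  show "tensor_in2 R G G ` constants R G \<subseteq> tensor_in1 R G G ` carrier G"
    using c(2,3) by auto
qed

text \<open>\<open>maurer_cartan c\<close> is \<open>\<Sum> S(b\<^sub>1) d b\<^sub>2\<close>, where \<open>c\<close> represents the coproduct \<open>\<Sum> b\<^sub>1 \<otimes> b\<^sub>2\<close> of \<open>b\<close>.\<close>

definition maurer_cartan :: "('a \<times> 'a \<Rightarrow>\<^sub>0 int) \<Rightarrow> ('a \<times> 'a \<Rightarrow>\<^sub>0 int) set" where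
  "maurer_cartan c = kcls G (constants R G) (frag_map (\<lambda>(x, y). (antipode G x, y)) c)"

lemma maurer_cartan_keys:
  assumes "Poly_Mapping.keys c \<subseteq> carrier G \<times> carrier G"
  shows "Poly_Mapping.keys (frag_map (\<lambda>(x, y). (antipode G x, y)) c) \<subseteq> carrier G \<times> carrier G"
  by (rule keys_frag_map[OF assms]) auto

text \<open>In the square zero extension of \<open>G \<otimes> G\<close> by its relative forms, let
  \<alpha> and \<beta>0 be the two projections and \<beta> = \<beta>0 + d \<beta>0; \<alpha> gets no
  differential part, since its functions are constants. The pullback of the form is the second
  component of a quotient of points, (\<alpha> \<beta>0)^-1 (\<alpha> \<beta>) for the translation
  and \<beta>0^-1 \<beta> for the second projection, and these two quotients agree.\<close>

lemma maurer_cartan_invariant: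
  assumes b: "b \<in> carrier G" and c: "Poly_Mapping.keys c \<subseteq> carrier G \<times> carrier G"
    and cb: "comult G b = G2.J +>\<^bsub>G2.S\<^esub> c"
  shows "maurer_cartan c \<in> left_invariant_forms R G"
proof -
  let ?K = "tensor_in1 R G G ` carrier G"
  let ?\<Omega> = "kaehler T2 ?K"
  let ?C = "idealization T2 ?\<Omega>"
  let ?i1 = "tensor_in1 R G G" and ?i2 = "tensor_in2 R G G"
  define \<kappa> where "\<kappa> = (\<lambda>r. (algmap T2 r, \<zero>\<^bsub>?\<Omega>\<^esub>))"
  define \<alpha> where "\<alpha> = (\<lambda>a. (?i1 a, \<zero>\<^bsub>?\<Omega>\<^esub>))"
  define \<beta>0 where "\<beta>0 = (\<lambda>a. (?i2 a, \<zero>\<^bsub>?\<Omega>\<^esub>))"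
  define \<beta> where "\<beta> = (\<lambda>a. (?i2 a, form T2 ?K \<one>\<^bsub>T2\<^esub> (?i2 a)))"
  \<comment> \<open>\<open>V\<close> and \<open>U\<close> are two sections of the square zero
    extension, the trivial one and the one given by the universal derivation; they differ by
    d.\<close>
  define V where "V = (\<lambda>t :: ('a \<times> 'a \<Rightarrow>\<^sub>0 int) set. (t, \<zero>\<^bsub>?\<Omega>\<^esub>))"
  define U where "U = (\<lambda>t. (t, form T2 ?K \<one>\<^bsub>T2\<^esub> t))"
  note i1c = ring_hom_closed[OF G2.tensor_in1_hom] and i2c = ring_hom_closed[OF G2.tensor_in2_hom]
  have C: "cring ?C" by (rule cring_idealization[OF TK.module_kaehler])
  have V: "V \<in> ring_hom T2 ?C"
    unfolding V_def by (rule idealization_inl_hom[OF TK.module_kaehler G2.cring_T])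
  have id: "(\<lambda>t. t) \<in> ring_hom T2 T2" by (simp add: ring_hom_def)
  have U: "U \<in> ring_hom T2 ?C"
    unfolding U_def
  proof (rule idealization_hom[OF TK.module_kaehler G2.cring_T id])
    fix x y assume x: "x \<in> carrier T2" and y: "y \<in> carrier T2"
    show "form T2 ?K \<one>\<^bsub>T2\<^esub> (x \<oplus>\<^bsub>T2\<^esub> y) = form T2 ?K \<one>\<^bsub>T2\<^esub> x \<oplus>\<^bsub>?\<Omega>\<^esub> form T2 ?K \<one>\<^bsub>T2\<^esub> y"
      using x y by (simp add: TK.form_add_right)
    show "form T2 ?K \<one>\<^bsub>T2\<^esub> (x \<otimes>\<^bsub>T2\<^esub> y) = x \<odot>\<^bsub>?\<Omega>\<^esub> form T2 ?K \<one>\<^bsub>T2\<^esub> y \<oplus>\<^bsub>?\<Omega>\<^esub> y \<odot>\<^bsub>?\<Omega>\<^esub> form T2 ?K \<one>\<^bsub>T2\<^esub> x"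
      using x y by (simp add: TK.form_leibniz TK.smult_form)
  qed (use TK.form_closed in auto)
  have \<alpha>: "is_point ?C \<kappa> \<alpha>"
    using ring_hom_trans[OF G2.tensor_in1_hom V]
    by (simp add: is_point_def \<alpha>_def V_def \<kappa>_def comp_def G2.algmap_T)
  have \<beta>0: "is_point ?C \<kappa> \<beta>0"
    using ring_hom_trans[OF G2.tensor_in2_hom V]
    by (simp add: is_point_def \<beta>0_def V_def \<kappa>_def comp_def G2.algmap_T2)
  have Uc: "form T2 ?K \<one>\<^bsub>T2\<^esub> (?i2 (algmap G r)) = \<zero>\<^bsub>?\<Omega>\<^esub>" if "r \<in> carrier R" for r
    using in2_constants that by (intro TK.form_const) auto
  have \<beta>: "is_point ?C \<kappa> \<beta>"
    using ring_hom_trans[OF G2.tensor_in2_hom U]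
    by (simp add: is_point_def \<beta>_def U_def \<kappa>_def comp_def G2.algmap_T2 Uc)
  have Va: "V (comult G a) = conv G ?C \<alpha> \<beta>0 a" if "a \<in> carrier G" for a
    by (rule hom_comult[OF C V that \<alpha> \<beta>0]) (simp_all add: V_def \<alpha>_def \<beta>0_def)
  have Ua: "U (comult G a) = conv G ?C \<alpha> \<beta> a" if "a \<in> carrier G" for a
    by (rule hom_comult[OF C U that \<alpha> \<beta>]) (simp_all add: U_def \<alpha>_def \<beta>_def TK.form_const)
  \<comment> \<open>As \<open>V\<close> has no differential part, the product of V (h (S x)) and U
    (h y) has second component h (S x) d (h y), with S the antipode.\<close>
  have f: "kcls T2 ?K (frag_map (\<lambda>(x, y). (h (antipode G x), h y)) c) =
      snd (frag_eval ?C (\<lambda>(x, y). V (h (antipode G x)) \<otimes>\<^bsub>?C\<^esub> U (h y)) c)"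
    if h: "h \<in> ring_hom G T2" for h
  proof -
    interpret C: cring ?C by (rule C)
    have hc: "h a \<in> carrier T2" if "a \<in> carrier G" for a using ring_hom_closed[OF h that] .
    have g: "(\<lambda>(x, y). V (h (antipode G x)) \<otimes>\<^bsub>?C\<^esub> U (h y)) \<in> carrier G \<times> carrier G \<rightarrow> carrier ?C"
    proof
      fix z assume "z \<in> carrier G \<times> carrier G"
      then obtain x y where z: "z = (x, y)" "x \<in> carrier G" "y \<in> carrier G" by blast
      show "(\<lambda>(x, y). V (h (antipode G x)) \<otimes>\<^bsub>?C\<^esub> U (h y)) z \<in> carrier ?C"
        unfolding z(1) prod.case
        by (intro C.m_closed ring_hom_closed[OF V] ring_hom_closed[OF U] hc antipode_closed z)
    qed
    have "snd (frag_eval ?C (\<lambda>(x, y). V (h (antipode G x)) \<otimes>\<^bsub>?C\<^esub> U (h y)) c) =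
      frag_eval ?\<Omega> (\<lambda>z. snd ((\<lambda>(x, y). V (h (antipode G x)) \<otimes>\<^bsub>?C\<^esub> U (h y)) z)) c"
      by (rule abelian_group_hom_frag_eval[OF C.abelian_group_axioms TK.abelian_group_kaehler _ _ g c]) auto
    also have "\<dots> = frag_eval ?\<Omega> (\<lambda>z. kcls T2 ?K (frag_of ((\<lambda>(x, y). (h (antipode G x), h y)) z))) c"
    proof (rule TK.\<Omega>.frag_eval_cong)
      fix z assume "z \<in> Poly_Mapping.keys c"
      then obtain x y where z: "z = (x, y)" "x \<in> carrier G" "y \<in> carrier G" using c by blast
      then show "snd ((\<lambda>(x, y). V (h (antipode G x)) \<otimes>\<^bsub>?C\<^esub> U (h y)) z) =
          kcls T2 ?K (frag_of ((\<lambda>(x, y). (h (antipode G x), h y)) z))"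
        using hc TK.form_closed by (simp add: V_def U_def TK.smult_form TK.smult_zero)
    qed (use c hc in \<open>auto intro!: TK.form_closed\<close>)
    also have "\<dots> = kcls T2 ?K (frag_map (\<lambda>(x, y). (h (antipode G x), h y)) c)"
      by (rule TK.kcls_frag_map[OF _ c, symmetric]) (use hc in auto)
    finally show ?thesis by simp
  qed
  have p: "pullback T2 ?K h (maurer_cartan c) = snd (conv G ?C (\<lambda>x. V (h (antipode G x))) (\<lambda>y. U (h y)) b)"
    if h: "h \<in> ring_hom G T2" and hK: "h ` constants R G \<subseteq> ?K"
      and 1: "is_point ?C \<kappa> (\<lambda>x. V (h (antipode G x)))" and 2: "is_point ?C \<kappa> (\<lambda>y. U (h y))" for h
    unfolding maurer_cartan_def pullback_kcls[OF GK.kaehler_base_axioms TK.kaehler_base_axioms h hK maurer_cartan_keys[OF c]] frag_map_comp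
    using f[OF h] conv_rep[where a = b, OF C 1 2 c cb] by (simp add: case_prod_unfold)
  have eqp: "is_point ?C \<kappa> x" if "is_point ?C \<kappa> y" "\<And>a. a \<in> carrier G \<Longrightarrow> x a = y a" for x y
    using that G2.algmap_closed(1) unfolding is_point_def ring_hom_def by (auto simp: Pi_iff)
  note S\<beta>0 = is_point_antipode[OF \<beta>0] and \<alpha>\<beta>0 = conv_point[OF C \<alpha> \<beta>0] and \<alpha>\<beta> = conv_point[OF C \<alpha> \<beta>]
  note S\<alpha>\<beta>0 = is_point_antipode[OF \<alpha>\<beta>0]
  have 1: "is_point ?C \<kappa> (\<lambda>x. V (comult G (antipode G x)))"
    by (rule eqp[OF S\<alpha>\<beta>0]) (simp add: Va)
  have 2: "is_point ?C \<kappa> (\<lambda>x. U (comult G x))"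
    by (rule eqp[OF \<alpha>\<beta>]) (simp add: Ua)
  have V2: "V (?i2 (antipode G x)) = \<beta>0 (antipode G x)" and U2: "U (?i2 x) = \<beta> x" for x
    by (simp_all add: V_def U_def \<beta>0_def \<beta>_def)
  have "conv G ?C (\<lambda>x. V (comult G (antipode G x))) (\<lambda>y. U (comult G y)) b =
      conv G ?C (\<lambda>x. conv G ?C \<alpha> \<beta>0 (antipode G x)) (conv G ?C \<alpha> \<beta>) b"
    by (rule conv_cong[OF C 1 2 S\<alpha>\<beta>0 \<alpha>\<beta> _ _ b]) (simp_all add: Va Ua)
  also have "\<dots> = conv G ?C (\<lambda>x. \<beta>0 (antipode G x)) \<beta> b"
    by (rule conv_left_quotient[OF C \<alpha> \<beta>0 \<beta> b])
  finally have e: "conv G ?C (\<lambda>x. V (comult G (antipode G x))) (\<lambda>y. U (comult G y)) b =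
      conv G ?C (\<lambda>x. V (?i2 (antipode G x))) (\<lambda>y. U (?i2 y)) b" by (simp add: V2 U2)
  have "pullback T2 ?K (comult G) (maurer_cartan c) = pullback T2 ?K ?i2 (maurer_cartan c)"
    unfolding p[OF comult_hom comult_constants 1 2]
    by (subst p[OF G2.tensor_in2_hom in2_constants]) (simp_all add: V2 U2 S\<beta>0 \<beta> e)
  then show ?thesis
    using GK.kcls_closed[OF maurer_cartan_keys[OF c]] by (simp add: left_invariant_forms_def maurer_cartan_def)
qed

end

section \<open>Left invariant derivations\<close>

locale point_derivation = group_scheme R G
  for R :: "'r ring" (structure) and G :: "('r, 'a, 'm) hopf_scheme" +
  fixes d
  assumes d_closed: "a \<in> carrier G \<Longrightarrow> d a \<in> carrier R"
    and d_add: "a \<in> carrier G \<Longrightarrow> b \<in> carrier G \<Longrightarrow> d (a \<oplus>\<^bsub>G\<^esub> b) = d a \<oplus> d b"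
    and d_mult: "a \<in> carrier G \<Longrightarrow> b \<in> carrier G \<Longrightarrow> d (a \<otimes>\<^bsub>G\<^esub> b) = counit G a \<otimes> d b \<oplus> counit G b \<otimes> d a"
    and d_algmap: "r \<in> carrier R \<Longrightarrow> d (algmap G r) = \<zero>"
begin

abbreviation "\<iota> \<equiv> algmap G"
abbreviation "\<epsilon> \<equiv> counit G"

lemmas \<iota>_hom = G2.AB(4)
lemmas \<iota>_closed [simp] = G2.algmap_closed(1)

text \<open>\<open>x0\<close> is the universal point of G, seen over the dual numbers, and
  \<open>y0\<close> is the tangent vector d at the unit. Their product moves the universal point
  infinitesimally by d from the right, so \<open>D\<close> is \<open>(id \<otimes> d)\<close> after
  the coproduct, a left invariant derivation.\<close>

definition "x0 a = (a, \<zero>\<^bsub>G\<^esub>)"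
definition "y0 a = (\<iota> (\<epsilon> a), \<iota> (d a))"
definition "\<kappa> = (\<lambda>r. (\<iota> r, \<zero>\<^bsub>G\<^esub>))"
definition "D a = snd (conv G (dual G) x0 y0 a)"

lemma dual_cring: "cring (dual G)"
  by (rule cring_dual[OF G2.A.is_cring])

lemma x0_point: "is_point (dual G) \<kappa> x0"
  using idealization_inl_hom[OF module_self[OF G2.A.is_cring] G2.A.is_cring]
  by (simp add: is_point_def x0_def[abs_def] \<kappa>_def)

lemma y0_point: "is_point (dual G) \<kappa> y0"
proof -
  have "derivation_along G G (\<lambda>a. \<iota> (\<epsilon> a)) (\<lambda>a. \<iota> (d a))"
    unfolding derivation_along_def
    by (auto simp: d_closed d_add d_mult ring_hom_add[OF \<iota>_hom] ring_hom_mult[OF \<iota>_hom])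
  moreover have "(\<lambda>a. \<iota> (\<epsilon> a)) \<in> ring_hom G G"
    using ring_hom_trans[OF counit_hom \<iota>_hom] by (simp add: comp_def)
  ultimately have "y0 \<in> ring_hom G (dual G)"
    unfolding y0_def[abs_def] by (intro dual_hom G2.A.is_cring)
  then show ?thesis
    by (simp add: is_point_def y0_def \<kappa>_def counit_algmap d_algmap ring_hom_zero[OF \<iota>_hom G2.R.ring_axioms G2.A.ring_axioms])
qed

lemma conv_x0_y0: "a \<in> carrier G \<Longrightarrow> conv G (dual G) x0 y0 a = (a, D a)"
  using hom_conv[OF dual_cring G2.A.is_cring x0_point y0_point idealization_fst_hom, of a] hopf_axioms(2)[of a]
  by (simp add: x0_def y0_def D_def prod_eq_iff)

lemma conv_x0_y0_point: "is_point (dual G) \<kappa> (conv G (dual G) x0 y0)"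
  by (rule conv_point[OF dual_cring x0_point y0_point])

lemma D_algmap: "r \<in> carrier R \<Longrightarrow> D (\<iota> r) = \<zero>\<^bsub>G\<^esub>"
  using is_pointD(2)[OF conv_x0_y0_point] by (simp add: D_def \<kappa>_def)

sublocale derivation_ring G D
proof
  have "derivation_along G G (\<lambda>x. fst (conv G (dual G) x0 y0 x)) D"
    using derivation_dual(2)[OF is_pointD(1)[OF conv_x0_y0_point]] by (simp add: D_def[abs_def])
  then show "derivation_along G G (\<lambda>x. x) D"
    by (simp add: derivation_along_def conv_x0_y0)
qed

lemma id_hom_G: "(\<lambda>x. x) \<in> ring_hom G G"
  by (simp add: ring_hom_def)

sublocale P: kaehler_pairing G "constants R G" G "\<lambda>x. x" D
  by unfold_locales (use id_hom_G D D_algmap in auto)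

text \<open>The sum of the S(b1) D b2 is the second component, at b, of x0^-1 (x0 y0) = y0.\<close>

lemma pairing_maurer_cartan:
  assumes b: "b \<in> carrier G" and c: "Poly_Mapping.keys c \<subseteq> carrier G \<times> carrier G"
    and cb: "comult G b = G2.J +>\<^bsub>G2.S\<^esub> c"
  shows "pairing G (\<lambda>x. x) D (maurer_cartan c) = \<iota> (d b)"
proof -
  interpret C: cring "dual G" by (rule dual_cring)
  note S = is_point_antipode[OF x0_point]
  let ?g = "\<lambda>(x, y). x0 (antipode G x) \<otimes>\<^bsub>dual G\<^esub> conv G (dual G) x0 y0 y"
  have g: "?g \<in> carrier G \<times> carrier G \<rightarrow> carrier (dual G)"
    by (auto simp: x0_def conv_x0_y0)
  have "y0 b = conv G (dual G) (\<lambda>a. x0 (antipode G a)) (conv G (dual G) x0 y0) b"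
    by (rule conv_cancel_left(1)[OF dual_cring x0_point y0_point b, symmetric])
  also have "\<dots> = frag_eval (dual G) ?g c"
    by (rule conv_rep[OF dual_cring S conv_x0_y0_point c cb])
  finally have y: "y0 b = frag_eval (dual G) ?g c" .
  have "snd (y0 b) = frag_eval G (\<lambda>z. snd (?g z)) c"
    unfolding y by (rule abelian_group_hom_frag_eval[OF C.abelian_group_axioms G2.A.abelian_group_axioms _ _ g c]) auto
  also have "\<dots> = frag_eval G (\<lambda>z. antipode G (fst z) \<otimes>\<^bsub>G\<^esub> D (snd z)) c"
    by (rule G2.A.frag_eval_cong) (use c in \<open>auto simp: x0_def conv_x0_y0\<close>)
  also have "\<dots> = P.ev (frag_map (\<lambda>(x, y). (antipode G x, y)) c)"
    using c
  proof (induction c rule: frag_ind)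
    case (diff x y)
    have h: "(\<lambda>z. antipode G (fst z) \<otimes>\<^bsub>G\<^esub> D (snd z)) \<in> carrier G \<times> carrier G \<rightarrow> carrier G" by auto
    show ?case
      unfolding frag_map_diff P.ev_diff[OF maurer_cartan_keys[OF diff(1)] maurer_cartan_keys[OF diff(2)]]
        G2.A.frag_eval_diff[OF h diff(1,2)] diff(3,4) ..
  qed auto
  finally show ?thesis
    using P.pairing_kcls[OF maurer_cartan_keys[OF c]] by (simp add: maurer_cartan_def y0_def)
qed

text \<open>The points x0 and y0 form one homomorphism E on \<open>G \<otimes> G\<close>. Along the
  coproduct it is (a, D a), along the second inclusion it is (\<epsilon> a, d a), with values in the
  constants. Invariance equates the pairings of the two pullbacks.\<close>

lemma invariant_pairing:
  assumes "\<omega> \<in> left_invariant_forms R G"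
  shows "\<exists>c\<in>carrier R. pairing G (\<lambda>x. x) D \<omega> = \<iota> c"
proof -
  let ?K = "tensor_in1 R G G ` carrier G"
  have \<omega>: "\<omega> \<in> carrier (differentials R G)"
    and inv: "pullback T2 ?K (comult G) \<omega> = pullback T2 ?K (tensor_in2 R G G) \<omega>"
    using assms by (auto simp: left_invariant_forms_def)
  define E where "E = copair (dual G) x0 y0"
  note xy = dual_cring is_pointD(1)[OF x0_point] is_pointD(1)[OF y0_point] is_point_agree[OF x0_point y0_point]
  have E: "E \<in> ring_hom T2 (dual G)" unfolding E_def by (rule G2.copair_hom[OF xy])
  interpret E: kaehler_pairing T2 ?K G "\<lambda>t. fst (E t)" "\<lambda>t. snd (E t)"
    using derivation_dual[OF E] by unfold_locales (auto simp: E_def G2.copair_in1[OF xy] x0_def)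
  obtain c where c: "Poly_Mapping.keys c \<subseteq> carrier G \<times> carrier G" "\<omega> = kcls G (constants R G) c"
    using \<omega> by (rule GK.kclsE)
  have pb: "pairing G (\<lambda>t. fst (E t)) (\<lambda>t. snd (E t)) (pullback T2 ?K h \<omega>) = frag_eval G (\<lambda>(a, b). fst (E (h a)) \<otimes>\<^bsub>G\<^esub> snd (E (h b))) c"
    if h: "h \<in> ring_hom G T2" and hK: "h ` constants R G \<subseteq> ?K" for h
  proof -
    have hh: "(\<lambda>x. fst (E (h x))) \<in> ring_hom G G" using ring_hom_trans[OF h E.h] by (simp add: comp_def)
    interpret q: kaehler_pairing G "constants R G" G "\<lambda>x. fst (E (h x))" "\<lambda>x. snd (E (h x))"
    proof unfold_locales
      show "\<forall>k\<in>constants R G. snd (E (h k)) = \<zero>\<^bsub>G\<^esub>"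
      proof
        fix k assume "k \<in> constants R G"
        then have "h k \<in> ?K" using hK by blast
        then show "snd (E (h k)) = \<zero>\<^bsub>G\<^esub>" using E.dK by blast
      qed
    qed (fact hh, rule derivation_along_comp[OF E.d h])
    show ?thesis
      unfolding pairing_pullback[OF GK.kaehler_base_axioms E.kaehler_pairing_axioms h hK \<omega>]
      by (subst c(2)) (rule q.pairing_kcls[OF c(1)])
  qed
  have Ec: "E (comult G a) = (a, D a)" if "a \<in> carrier G" for a
    using conv_x0_y0[OF that] by (simp add: conv_def E_def)
  have Ei: "E (tensor_in2 R G G a) = (\<iota> (\<epsilon> a), \<iota> (d a))" if "a \<in> carrier G" for a
    using that by (simp add: E_def G2.copair_in2[OF xy] y0_def)
  have g: "(\<lambda>(a, b). \<epsilon> a \<otimes> d b) \<in> carrier G \<times> carrier G \<rightarrow> carrier R" using d_closed by auto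
  have "pairing G (\<lambda>x. x) D \<omega> = frag_eval G (\<lambda>(a, b). fst (E (comult G a)) \<otimes>\<^bsub>G\<^esub> snd (E (comult G b))) c"
    unfolding c(2) P.pairing_kcls[OF c(1)]
    by (rule G2.A.frag_eval_cong) (use c in \<open>auto simp: Ec\<close>)
  also have "\<dots> = frag_eval G (\<lambda>(a, b). fst (E (tensor_in2 R G G a)) \<otimes>\<^bsub>G\<^esub> snd (E (tensor_in2 R G G b))) c"
    using pb[OF comult_hom comult_constants] pb[OF G2.tensor_in2_hom in2_constants] inv by simp
  also have "\<dots> = frag_eval G (\<lambda>z. \<iota> ((\<lambda>(a, b). \<epsilon> a \<otimes> d b) z)) c"
    by (rule G2.A.frag_eval_cong) (use c d_closed in \<open>auto simp: Ei ring_hom_mult[OF \<iota>_hom]\<close>)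
  also have "\<dots> = \<iota> (frag_eval R (\<lambda>(a, b). \<epsilon> a \<otimes> d b) c)"
    by (rule ring_hom_frag_eval[OF \<iota>_hom G2.R.ring_axioms G2.A.ring_axioms g c(1), symmetric])
  finally show ?thesis using G2.R.frag_eval_closed[OF g c(1)] by blast
qed

text \<open>The value d b is the pairing of D with the Maurer-Cartan form of b, hence an R-linear
  combination of the pairings with the generators; so these cannot all lie in an ideal that misses d
  b. It will be applied to the ideal pR.\<close>

lemma nondegenerate_invariant_form:
  assumes gen: "generates_invariant_forms R G n \<omega>" and I: "ideal I R"
    and b: "b \<in> carrier G" "d b \<notin> I"
  shows "\<exists>i<n. \<exists>c\<in>carrier R. c \<notin> I \<and> pairing G (\<lambda>x. x) D (\<omega> i) = \<iota> c"
proof (rule ccontr)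
  assume neg: "\<not> ?thesis"
  interpret I: ideal I R by fact
  have "\<forall>i\<in>{..<n}. \<exists>c. c \<in> I \<and> pairing G (\<lambda>x. x) D (\<omega> i) = \<iota> c"
  proof
    fix i assume "i \<in> {..<n}"
    then have i: "i < n" by simp
    then have "\<omega> i \<in> left_invariant_forms R G" using gen by (simp add: generates_invariant_forms_def)
    from invariant_pairing[OF this] obtain c where "c \<in> carrier R" "pairing G (\<lambda>x. x) D (\<omega> i) = \<iota> c" ..
    then show "\<exists>c. c \<in> I \<and> pairing G (\<lambda>x. x) D (\<omega> i) = \<iota> c" using neg i by blast
  qed
  then obtain c where c: "\<And>i. i < n \<Longrightarrow> c i \<in> I" "\<And>i. i < n \<Longrightarrow> pairing G (\<lambda>x. x) D (\<omega> i) = \<iota> (c i)"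
    using bchoice[of "{..<n}" "\<lambda>i c. c \<in> I \<and> pairing G (\<lambda>x. x) D (\<omega> i) = \<iota> c"] by auto
  obtain f where f: "Poly_Mapping.keys f \<subseteq> carrier G \<times> carrier G" "comult G b = G2.J +>\<^bsub>G2.S\<^esub> f"
    by (rule comult_repE[OF b(1)])
  obtain e where e: "\<forall>i<n. e i \<in> carrier R"
    and eq: "maurer_cartan f = finsum (differentials R G) (\<lambda>i. \<iota> (e i) \<odot>\<^bsub>differentials R G\<^esub> \<omega> i) {..<n}"
    using gen[unfolded generates_invariant_forms_def, THEN conjunct2, rule_format, OF maurer_cartan_invariant[OF b(1) f]] by blast
  have \<omega>: "\<omega> i \<in> carrier (differentials R G)" if "i < n" for i
    using gen that by (auto simp: generates_invariant_forms_def left_invariant_forms_def)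
  have s: "(\<lambda>i. \<iota> (e i) \<odot>\<^bsub>differentials R G\<^esub> \<omega> i) \<in> {..<n} \<rightarrow> carrier (differentials R G)"
    using e \<omega> GK.smult_closed by auto
  have "\<iota> (d b) = finsum G (\<lambda>i. pairing G (\<lambda>x. x) D (\<iota> (e i) \<odot>\<^bsub>differentials R G\<^esub> \<omega> i)) {..<n}"
    unfolding pairing_maurer_cartan[OF b(1) f, symmetric] eq by (rule P.pairing_finsum[OF s])
  also have "\<dots> = finsum G (\<lambda>i. \<iota> (e i \<otimes> c i)) {..<n}"
    by (rule G2.A.finsum_cong') (use e c \<omega> I.a_subset in \<open>auto simp: P.pairing_smult ring_hom_mult[OF \<iota>_hom]\<close>)
  also have "\<dots> = \<iota> (finsum R (\<lambda>i. e i \<otimes> c i) {..<n})"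
    by (rule ring_hom_finsum[OF \<iota>_hom G2.R.ring_axioms G2.A.ring_axioms, symmetric]) (use e c I.a_subset in auto)
  \<comment> \<open>The counit is a retraction of the structure map, so the equality of constants
    descends to R.\<close>
  finally have "\<epsilon> (\<iota> (d b)) = \<epsilon> (\<iota> (finsum R (\<lambda>i. e i \<otimes> c i) {..<n}))" by simp
  moreover have "finsum R (\<lambda>i. e i \<otimes> c i) {..<n} \<in> carrier R"
    using e c I.a_subset by (intro G2.R.finsum_closed) auto
  ultimately have "d b = finsum R (\<lambda>i. e i \<otimes> c i) {..<n}"
    using counit_algmap d_closed[OF b(1)] by simp
  then have db: "d b \<in> I" if "finsum R (\<lambda>i. e i \<otimes> c i) {..<n} \<in> I" using that by simp
  have "finsum R (\<lambda>i. e i \<otimes> c i) {..<m} \<in> I" if "m \<le> n" for m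
    using that
  proof (induction m)
    case (Suc m)
    have "e i \<otimes> c i \<in> I" if "i < n" for i using that e c I.I_l_closed by blast
    then show ?case using Suc I.a_closed I.Icarr
      by (simp add: lessThan_Suc G2.R.finsum_insert Pi_iff)
  qed simp
  then show False using db b(2) by simp
qed

end

section \<open>The p-th iterate of the invariant derivation\<close>

locale nilpotent_derivation = embedded_group R G N M + point_derivation R G d
  for R :: "'r ring" (structure) and G :: "('r, 'a, 'm) hopf_scheme" and N M d +
  fixes p :: nat
  assumes p: "Factorial_Ring.prime p"
    and d_nil: "mat_map N R d M [^]\<^bsub>matrix_ring R N\<^esub> p = \<zero>\<^bsub>matrix_ring R N\<^esub>"
begin

definition "L = mat_map N R d M"
abbreviation "DM \<equiv> mat_map N G D"
abbreviation "\<iota>M \<equiv> mat_map N G \<iota>"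

lemma L: "L \<in> carrier RM"
  by (rule MR.MR_closedI) (use d_closed M_entry in \<open>auto simp: L_def mat_map_def\<close>)

lemma \<iota>M_hom: "\<iota>M \<in> ring_hom RM GM"
  by (rule mat_map_hom[OF G2.R.is_cring G2.A.is_cring \<iota>_hom])

lemma \<iota>M_closed: "C \<in> carrier RM \<Longrightarrow> \<iota>M C \<in> carrier GM"
  by (rule ring_hom_closed[OF \<iota>M_hom])

lemma DM_closed: "A \<in> carrier GM \<Longrightarrow> DM A \<in> carrier GM"
  by (rule MG.MR_closedI) (use MG.entry_closed in \<open>auto simp: mat_map_def\<close>)

lemma DM_mult:
  assumes A: "A \<in> carrier GM" and B: "B \<in> carrier GM"
  shows "DM (A \<otimes>\<^bsub>GM\<^esub> B) = DM A \<otimes>\<^bsub>GM\<^esub> B \<oplus>\<^bsub>GM\<^esub> A \<otimes>\<^bsub>GM\<^esub> DM B"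
proof (rule MG.MR_eqI)
  fix i j assume i: "i < N" and j: "j < N"
  note c = MG.entry_closed[OF A] MG.entry_closed[OF B]
  have "DM (A \<otimes>\<^bsub>GM\<^esub> B) i j = finsum G (\<lambda>k. D (A i k \<otimes>\<^bsub>G\<^esub> B k j)) {..<N}"
    unfolding mat_map_entry[OF i j] MG.mult_entry[OF i j] using c by (intro D_finsum) auto
  also have "\<dots> = finsum G (\<lambda>k. DM A i k \<otimes>\<^bsub>G\<^esub> B k j \<oplus>\<^bsub>G\<^esub> A i k \<otimes>\<^bsub>G\<^esub> DM B k j) {..<N}"
    using c i j by (intro G2.A.finsum_cong') (auto simp: mat_map_def D_mult G2.A.m_comm G2.A.a_comm)
  also have "\<dots> = finsum G (\<lambda>k. DM A i k \<otimes>\<^bsub>G\<^esub> B k j) {..<N} \<oplus>\<^bsub>G\<^esub> finsum G (\<lambda>k. A i k \<otimes>\<^bsub>G\<^esub> DM B k j) {..<N}"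
    using c MG.entry_closed[OF DM_closed[OF A]] MG.entry_closed[OF DM_closed[OF B]] by (intro G2.A.finsum_addf) auto
  finally show "DM (A \<otimes>\<^bsub>GM\<^esub> B) i j = (DM A \<otimes>\<^bsub>GM\<^esub> B \<oplus>\<^bsub>GM\<^esub> A \<otimes>\<^bsub>GM\<^esub> DM B) i j"
    unfolding MG.entry_add MG.mult_entry[OF i j] .
qed (use A B DM_closed in simp_all)

lemma DM_const: "C \<in> carrier RM \<Longrightarrow> DM (\<iota>M C) = \<zero>\<^bsub>GM\<^esub>"
  by (rule MG.MR_eqI[OF DM_closed[OF \<iota>M_closed]]) (use MR.entry_closed in \<open>auto simp: mat_map_def MG.entry_zero D_algmap\<close>)

lemma DM_one: "DM \<one>\<^bsub>GM\<^esub> = \<zero>\<^bsub>GM\<^esub>"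
  using DM_const[OF MR.MR.one_closed] ring_hom_one[OF \<iota>M_hom] by simp

text \<open>The coproduct of the generic matrix is the matrix product of its two copies;
  differentiating the second copy at the unit multiplies M on the right by the constant matrix of
  d.\<close>

lemma DM_M: "DM M = M \<otimes>\<^bsub>GM\<^esub> \<iota>M L"
proof (rule MG.MR_eqI[OF DM_closed[OF M] MG.MR_closed[OF M \<iota>M_closed[OF L]]])
  fix i j assume i: "i < N" and j: "j < N"
  interpret C: cring "dual G" by (rule dual_cring)
  interpret MC: matrices "dual G" N by unfold_locales
  have c: "x0 (M i k) \<otimes>\<^bsub>dual G\<^esub> y0 (M k j) \<in> carrier (dual G)" for k
    using M_entry d_closed by (simp add: x0_def y0_def)
  have "mat_map N (dual G) (conv G (dual G) x0 y0) M i j =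
      (mat_map N (dual G) x0 M \<otimes>\<^bsub>MC.MR\<^esub> mat_map N (dual G) y0 M) i j"
    by (subst conv_matrix[OF dual_cring x0_point y0_point M_entry M_comult]) simp_all
  also have "\<dots> = finsum (dual G) (\<lambda>k. x0 (M i k) \<otimes>\<^bsub>dual G\<^esub> y0 (M k j)) {..<N}"
    unfolding MC.mult_entry[OF i j] using i j c by (intro C.finsum_cong') (simp_all add: mat_map_def)
  finally have e: "conv G (dual G) x0 y0 (M i j) = finsum (dual G) (\<lambda>k. x0 (M i k) \<otimes>\<^bsub>dual G\<^esub> y0 (M k j)) {..<N}"
    using i j by (simp add: mat_map_def)
  have "DM M i j = snd (finsum (dual G) (\<lambda>k. x0 (M i k) \<otimes>\<^bsub>dual G\<^esub> y0 (M k j)) {..<N})"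
    unfolding e[symmetric] using i j by (simp add: mat_map_def D_def)
  also have "\<dots> = finsum G (\<lambda>k. snd (x0 (M i k) \<otimes>\<^bsub>dual G\<^esub> y0 (M k j))) {..<N}"
    by (rule abelian_group_hom_finsum[OF C.abelian_group_axioms G2.A.abelian_group_axioms]) (use c in auto)
  also have "\<dots> = (M \<otimes>\<^bsub>GM\<^esub> \<iota>M L) i j"
    unfolding MG.mult_entry[OF i j] using j M_entry d_closed
    by (intro G2.A.finsum_cong') (auto simp: x0_def y0_def mat_map_def L_def)
  finally show "DM M i j = (M \<otimes>\<^bsub>GM\<^esub> \<iota>M L) i j" .
qed

text \<open>Differentiate W M = 1 and solve for D W; the constant matrix now stands on the
  left.\<close>

lemma DM_W: "DM W = \<iota>M (\<ominus>\<^bsub>RM\<^esub> L) \<otimes>\<^bsub>GM\<^esub> W"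
proof -
  let ?\<Lambda> = "\<iota>M L" and ?A = "\<iota>M (\<ominus>\<^bsub>RM\<^esub> L)"
  have c: "?\<Lambda> \<in> carrier GM" "?A \<in> carrier GM" "DM W \<in> carrier GM" using \<iota>M_closed L DM_closed W by auto
  have "\<zero>\<^bsub>GM\<^esub> = DM W \<otimes>\<^bsub>GM\<^esub> M \<oplus>\<^bsub>GM\<^esub> W \<otimes>\<^bsub>GM\<^esub> (M \<otimes>\<^bsub>GM\<^esub> ?\<Lambda>)"
    using DM_mult[OF W M] by (simp only: WM DM_one DM_M)
  also have "W \<otimes>\<^bsub>GM\<^esub> (M \<otimes>\<^bsub>GM\<^esub> ?\<Lambda>) = ?\<Lambda>"
    using c by (simp add: MG.MR.m_assoc[OF W M c(1), symmetric] WM)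
  finally have 1: "DM W \<otimes>\<^bsub>GM\<^esub> M \<oplus>\<^bsub>GM\<^esub> ?\<Lambda> = \<zero>\<^bsub>GM\<^esub>" by simp
  have 2: "?A \<oplus>\<^bsub>GM\<^esub> ?\<Lambda> = \<zero>\<^bsub>GM\<^esub>"
    using ring_hom_add[OF \<iota>M_hom MR.MR.a_inv_closed[OF L] L] L
      ring_hom_zero[OF \<iota>M_hom MR.MR.ring_axioms MG.MR.ring_axioms] by (simp add: MR.MR.l_neg)
  have 3: "DM W \<otimes>\<^bsub>GM\<^esub> M = ?A"
    using MG.MR.minus_equality[OF 1 c(1)] MG.MR.minus_equality[OF 2 c(1,2)] c M by simp
  have "DM W = DM W \<otimes>\<^bsub>GM\<^esub> (M \<otimes>\<^bsub>GM\<^esub> W)" using MW c by simp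
  also have "\<dots> = ?A \<otimes>\<^bsub>GM\<^esub> W" unfolding MG.MR.m_assoc[OF c(3) M W, symmetric] 3 ..
  finally show ?thesis .
qed

lemma DM_pow_M: "(DM ^^ n) M = M \<otimes>\<^bsub>GM\<^esub> \<iota>M (L [^]\<^bsub>RM\<^esub> n)"
proof (induction n)
  case 0
  then show ?case using M ring_hom_one[OF \<iota>M_hom] by simp
next
  case (Suc n)
  let ?A = "\<iota>M (L [^]\<^bsub>RM\<^esub> n)"
  have c: "?A \<in> carrier GM" "\<iota>M L \<in> carrier GM" using \<iota>M_closed L by auto
  have "L [^]\<^bsub>RM\<^esub> Suc n = L \<otimes>\<^bsub>RM\<^esub> L [^]\<^bsub>RM\<^esub> n" using MR.MR.nat_pow_Suc2[OF L] .
  then have "\<iota>M (L [^]\<^bsub>RM\<^esub> Suc n) = \<iota>M L \<otimes>\<^bsub>GM\<^esub> ?A"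
    using ring_hom_mult[OF \<iota>M_hom L MR.MR.nat_pow_closed[OF L]] by simp
  then show ?case
    using DM_mult[OF M c(1)] DM_const[OF MR.MR.nat_pow_closed[OF L], of n] M c
    by (simp add: Suc DM_M MG.MR.m_assoc del: MR.MR.nat_pow_Suc)
qed

lemma DM_pow_W: "(DM ^^ n) W = \<iota>M ((\<ominus>\<^bsub>RM\<^esub> L) [^]\<^bsub>RM\<^esub> n) \<otimes>\<^bsub>GM\<^esub> W"
proof (induction n)
  case 0
  then show ?case using W ring_hom_one[OF \<iota>M_hom] by simp
next
  case (Suc n)
  have L': "\<ominus>\<^bsub>RM\<^esub> L \<in> carrier RM" using L by simp
  let ?A = "\<iota>M ((\<ominus>\<^bsub>RM\<^esub> L) [^]\<^bsub>RM\<^esub> n)"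
  have c: "?A \<in> carrier GM" "\<iota>M (\<ominus>\<^bsub>RM\<^esub> L) \<in> carrier GM" using \<iota>M_closed L' by auto
  have "\<iota>M ((\<ominus>\<^bsub>RM\<^esub> L) [^]\<^bsub>RM\<^esub> Suc n) = ?A \<otimes>\<^bsub>GM\<^esub> \<iota>M (\<ominus>\<^bsub>RM\<^esub> L)"
    using ring_hom_mult[OF \<iota>M_hom MR.MR.nat_pow_closed[OF L'] L'] by simp
  then show ?case
    using DM_mult[OF c(1) W] DM_const[OF MR.MR.nat_pow_closed[OF L'], of n] W c
    by (simp add: Suc DM_W MG.MR.m_assoc del: MR.MR.nat_pow_Suc)
qed

lemma mat_DD: "i < N \<Longrightarrow> j < N \<Longrightarrow> (DM ^^ n) A i j = DD n (A i j)"
  by (induction n) (simp_all add: mat_map_def)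

lemma minus_L_nil: "(\<ominus>\<^bsub>RM\<^esub> L) [^]\<^bsub>RM\<^esub> p = \<zero>\<^bsub>RM\<^esub>"
proof -
  let ?m = "\<ominus>\<^bsub>RM\<^esub> \<one>\<^bsub>RM\<^esub>"
  have m: "?m \<in> carrier RM" by simp
  have "\<ominus>\<^bsub>RM\<^esub> L = ?m \<otimes>\<^bsub>RM\<^esub> L" "?m \<otimes>\<^bsub>RM\<^esub> L = L \<otimes>\<^bsub>RM\<^esub> ?m"
    using L by (simp_all add: MR.MR.l_minus MR.MR.r_minus)
  then show ?thesis
    using MR.MR.pow_mult_distrib[OF _ m L, of p] d_nil m L by (simp add: L_def[symmetric])
qed

text \<open>Iterating D multiplies by powers of the constant matrices L and -L, whose p-th powers
  vanish.\<close>

lemma DD_p_M: "i < N \<Longrightarrow> j < N \<Longrightarrow> DD p (M i j) = \<zero>\<^bsub>G\<^esub>"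
  and DD_p_W: "i < N \<Longrightarrow> j < N \<Longrightarrow> DD p (W i j) = \<zero>\<^bsub>G\<^esub>"
  using DM_pow_M[of p] DM_pow_W[of p] M W
  by (simp_all add: mat_DD[symmetric] d_nil[folded L_def] minus_L_nil
      ring_hom_zero[OF \<iota>M_hom MR.MR.ring_axioms MG.MR.ring_axioms] MG.entry_zero)

text \<open>By \<open>leibniz_prime\<close> the elements whose p-th derivative is divisible by p
  form a subring; it contains the constants and the entries of M and W.\<close>

lemma DD_p_divisible:
  assumes "a \<in> carrier G"
  shows "\<exists>z\<in>carrier G. DD p a = [p] \<cdot>\<^bsub>G\<^esub> z"
  using assms
proof (induction rule: G_induct)
  case (const r)
  have "DD n (\<iota> r) = \<zero>\<^bsub>G\<^esub>" if "n > 0" for n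
    using that
  proof (induction n)
    case (Suc n)
    then show ?case using const D_algmap by (cases n) auto
  qed simp
  from this[of p] show ?case using prime_gt_0_nat[OF p] by (intro bexI[of _ "\<zero>\<^bsub>G\<^esub>"]) auto
next
  case (gen i j)
  then show ?case by (intro bexI[of _ "\<zero>\<^bsub>G\<^esub>"]) (simp_all add: DD_p_M)
next
  case (inv i j)
  then show ?case by (intro bexI[of _ "\<zero>\<^bsub>G\<^esub>"]) (simp_all add: DD_p_W)
next
  case (minus y)
  then obtain z where z: "z \<in> carrier G" "DD p y = [p] \<cdot>\<^bsub>G\<^esub> z" by blast
  have "DD p (\<ominus>\<^bsub>G\<^esub> y) \<oplus>\<^bsub>G\<^esub> DD p y = \<zero>\<^bsub>G\<^esub>"
    using DD_add[of "\<ominus>\<^bsub>G\<^esub> y" y p] minus(1) DD_zero by (simp add: G2.A.l_neg)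
  moreover have "[p] \<cdot>\<^bsub>G\<^esub> (\<ominus>\<^bsub>G\<^esub> z) \<oplus>\<^bsub>G\<^esub> [p] \<cdot>\<^bsub>G\<^esub> z = \<zero>\<^bsub>G\<^esub>"
    using z(1) by (simp add: G2.A.nat_mult_distr[symmetric] G2.A.l_neg)
  moreover have "DD p (\<ominus>\<^bsub>G\<^esub> y) \<in> carrier G" "[p] \<cdot>\<^bsub>G\<^esub> (\<ominus>\<^bsub>G\<^esub> z) \<in> carrier G" "[p] \<cdot>\<^bsub>G\<^esub> z \<in> carrier G"
    using z(1) minus(1) by simp_all
  ultimately have "DD p (\<ominus>\<^bsub>G\<^esub> y) = [p] \<cdot>\<^bsub>G\<^esub> (\<ominus>\<^bsub>G\<^esub> z)"
    unfolding z(2) by (metis G2.A.minus_equality)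
  then show ?case using z by (intro bexI[of _ "\<ominus>\<^bsub>G\<^esub> z"]) simp_all
next
  case (add y z)
  then obtain v w where "v \<in> carrier G" "DD p y = [p] \<cdot>\<^bsub>G\<^esub> v" "w \<in> carrier G" "DD p z = [p] \<cdot>\<^bsub>G\<^esub> w" by blast
  then show ?case using add(1,2)
    by (intro bexI[of _ "v \<oplus>\<^bsub>G\<^esub> w"]) (simp_all add: DD_add G2.A.nat_mult_distr)
next
  case (mult y z)
  then obtain v w where vw: "v \<in> carrier G" "DD p y = [p] \<cdot>\<^bsub>G\<^esub> v" "w \<in> carrier G" "DD p z = [p] \<cdot>\<^bsub>G\<^esub> w" by blast
  obtain e where e: "e \<in> carrier G" "DD p (y \<otimes>\<^bsub>G\<^esub> z) = y \<otimes>\<^bsub>G\<^esub> DD p z \<oplus>\<^bsub>G\<^esub> (DD p y \<otimes>\<^bsub>G\<^esub> z \<oplus>\<^bsub>G\<^esub> [p] \<cdot>\<^bsub>G\<^esub> e)"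
    using leibniz_prime[OF p mult(1,2)] by blast
  have "DD p (y \<otimes>\<^bsub>G\<^esub> z) = [p] \<cdot>\<^bsub>G\<^esub> (y \<otimes>\<^bsub>G\<^esub> w \<oplus>\<^bsub>G\<^esub> (v \<otimes>\<^bsub>G\<^esub> z \<oplus>\<^bsub>G\<^esub> e))"
    using vw e mult(1,2) by (simp add: G2.A.nat_mult_distr G2.A.add_pow_ldistr G2.A.add_pow_rdistr)
  then show ?case using vw e mult(1,2) by (intro bexI[of _ "y \<otimes>\<^bsub>G\<^esub> w \<oplus>\<^bsub>G\<^esub> (v \<otimes>\<^bsub>G\<^esub> z \<oplus>\<^bsub>G\<^esub> e)"]) simp_all
qed

end

section \<open>Frobenius lifts and derivations on affine pieces\<close>

lemma dual_nat_mult: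
  assumes "cring S" "x \<in> carrier S" "y \<in> carrier S"
  shows "[(n::nat)] \<cdot>\<^bsub>dual S\<^esub> (x, y) = ([n] \<cdot>\<^bsub>S\<^esub> x, [n] \<cdot>\<^bsub>S\<^esub> y)"
proof -
  interpret S: cring S by fact
  interpret D: cring "dual S" by (rule cring_dual[OF assms(1)])
  show ?thesis by (induction n) (use assms in simp_all)
qed

text \<open>The inverse is (u^-1, -u^-2 v), so only the first component matters for
  invertibility.\<close>

lemma dual_Units:
  assumes "cring S" "u \<in> Units S" "v \<in> carrier S"
  shows "(u, v) \<in> Units (dual S)"
proof -
  interpret S: cring S by fact
  interpret D: cring "dual S" by (rule cring_dual[OF assms(1)])
  let ?i = "inv\<^bsub>S\<^esub> u"
  have c: "u \<in> carrier S" "?i \<in> carrier S" "u \<otimes>\<^bsub>S\<^esub> ?i = \<one>\<^bsub>S\<^esub>" using assms(2) S.Units_closed by simp_all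
  have e: "u \<otimes>\<^bsub>S\<^esub> (?i \<otimes>\<^bsub>S\<^esub> (?i \<otimes>\<^bsub>S\<^esub> v)) = ?i \<otimes>\<^bsub>S\<^esub> v"
    using c assms(3) by (simp add: S.m_assoc[symmetric])
  have "(u, v) \<otimes>\<^bsub>dual S\<^esub> (?i, \<ominus>\<^bsub>S\<^esub> (?i \<otimes>\<^bsub>S\<^esub> (?i \<otimes>\<^bsub>S\<^esub> v))) = \<one>\<^bsub>dual S\<^esub>"
    using c assms(3) by (simp add: S.r_minus e S.l_neg)
  moreover have "(u, v) \<in> carrier (dual S)" "(?i, \<ominus>\<^bsub>S\<^esub> (?i \<otimes>\<^bsub>S\<^esub> (?i \<otimes>\<^bsub>S\<^esub> v))) \<in> carrier (dual S)"
    using c assms(3) by simp_all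
  ultimately show ?thesis by (metis D.unit_factor D.Units_one_closed)
qed

lemma (in piece_base) nat_mult_unit_cancel:
  assumes x: "x \<in> carrier B" and w: "w \<in> carrier B" and e: "x \<otimes>\<^bsub>B\<^esub> \<iota> (f [^] (k::nat)) = [(m::nat)] \<cdot>\<^bsub>B\<^esub> w"
  shows "\<exists>z\<in>carrier B. x = [m] \<cdot>\<^bsub>B\<^esub> z"
proof -
  let ?u = "\<iota> (f [^] k)"
  let ?v = "inv\<^bsub>B\<^esub> ?u"
  have u: "?u \<in> carrier B" "?v \<in> carrier B" "?u \<otimes>\<^bsub>B\<^esub> ?v = \<one>\<^bsub>B\<^esub>" using \<iota>_pow_unit[of k] by simp_all
  have "x = (x \<otimes>\<^bsub>B\<^esub> ?u) \<otimes>\<^bsub>B\<^esub> ?v" using x u by (simp add: B.m_assoc)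
  also have "\<dots> = [m] \<cdot>\<^bsub>B\<^esub> (w \<otimes>\<^bsub>B\<^esub> ?v)" unfolding e using w u by (simp add: B.add_pow_ldistr)
  finally show ?thesis using w u by blast
qed

text \<open>A derivation is a homomorphism into dual numbers with the identity as first component.
  It extends to the piece because f becomes invertible and p^n zero in the dual numbers of the
  piece; its first component is still the identity by uniqueness.\<close>

lemma (in piece_base) piece_derivation:
  assumes D: "derivation_along A A (\<lambda>x. x) D"
  shows "\<exists>D'. derivation_along B B (\<lambda>x. x) D' \<and> (\<forall>a\<in>carrier A. D' (\<iota> a) = \<iota> (D a))"
proof -
  interpret T: cring "dual B" by (rule cring_dual[OF cring_B])
  let ?h = "\<lambda>a. (\<iota> a, \<iota> (D a))"
  have "derivation_along A B \<iota> (\<lambda>a. \<iota> (D a))"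
    using derivation_alongD[OF D] by (auto simp: derivation_along_def ring_hom_add[OF \<iota>_hom] ring_hom_mult[OF \<iota>_hom])
  then have h: "?h \<in> ring_hom A (dual B)" by (rule dual_hom[OF is_cring cring_B \<iota>_hom])
  have hf: "?h f \<in> Units (dual B)"
    by (rule dual_Units[OF cring_B \<iota>_unit]) (use derivation_alongD(1)[OF D] f in simp)
  have hp: "[(p ^ n)] \<cdot>\<^bsub>dual B\<^esub> \<one>\<^bsub>dual B\<^esub> = \<zero>\<^bsub>dual B\<^esub>"
    using dual_nat_mult[OF cring_B, of "\<one>\<^bsub>B\<^esub>" "\<zero>\<^bsub>B\<^esub>" "p ^ n"] B_char by simp
  obtain H where H: "H \<in> ring_hom B (dual B)" "\<forall>a\<in>carrier A. H (\<iota> a) = ?h a"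
    using piece_lift[OF T.is_cring h hf hp] by blast
  have id: "(\<lambda>x. x) \<in> ring_hom B B" by (simp add: ring_hom_def)
  have fst: "fst (H x) = x" if "x \<in> carrier B" for x
    by (rule piece_hom_eq[OF cring_B derivation_dual(1)[OF H(1)] id _ that]) (simp add: H(2))
  have "derivation_along B B (\<lambda>x. x) (\<lambda>x. snd (H x))"
    using derivation_dual(2)[OF H(1)] by (simp add: derivation_along_def fst)
  then show ?thesis using H(2) by (intro exI[of _ "\<lambda>x. snd (H x)"]) simp
qed

context localization_base
begin

text \<open>The reduction from level 2 to level 1 has to be exhibited as an element of
  \<open>restrictions\<close>, the maps with which a Frobenius lift is required to be compatible.
  Elements of its kernel are multiples of p.\<close>

lemma restriction_to_special_fibre:
  fixes p :: nat
  shows "\<exists>\<rho>\<in>restrictions A p f 2 f 1. \<forall>y\<in>carrier (piece A p f 2). \<rho> y = \<zero>\<^bsub>piece A p f 1\<^esub> \<longrightarrow>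
    (\<exists>z\<in>carrier (piece A p f 2). y = [p] \<cdot>\<^bsub>piece A p f 2\<^esub> z)"
proof -
  interpret P2: piece_base A f p 2 by unfold_locales
  interpret P1: piece_base A f p 1 by unfold_locales
  have "[(p ^ 2)] \<cdot>\<^bsub>P1.B\<^esub> \<one>\<^bsub>P1.B\<^esub> = [p] \<cdot>\<^bsub>P1.B\<^esub> ([p] \<cdot>\<^bsub>P1.B\<^esub> \<one>\<^bsub>P1.B\<^esub>)"
    unfolding power2_eq_square by (rule P1.B.nat_mult_mult[OF P1.B.one_closed])
  then have "[(p ^ 2)] \<cdot>\<^bsub>P1.B\<^esub> \<one>\<^bsub>P1.B\<^esub> = \<zero>\<^bsub>P1.B\<^esub>" using P1.B_char by (simp del: One_nat_def)
  from P2.piece_lift[OF P1.cring_B P1.\<iota>_hom P1.\<iota>_unit this]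
  obtain \<rho> where \<rho>: "\<rho> \<in> ring_hom P2.B P1.B" "\<forall>a\<in>carrier A. \<rho> (P2.\<iota> a) = P1.\<iota> a" by blast
  have "\<exists>z\<in>carrier P2.B. y = [p] \<cdot>\<^bsub>P2.B\<^esub> z" if y: "y \<in> carrier P2.B" "\<rho> y = \<zero>\<^bsub>P1.B\<^esub>" for y
  proof -
    obtain a k where a: "a \<in> carrier A" "y \<otimes>\<^bsub>P2.B\<^esub> P2.\<iota> (f [^] (k::nat)) = P2.\<iota> a" using y(1) by (rule P2.B_fracE)
    have "P1.\<iota> a = \<rho> (P2.\<iota> a)" using \<rho>(2) a(1) by simp
    also have "\<dots> = \<rho> y \<otimes>\<^bsub>P1.B\<^esub> \<rho> (P2.\<iota> (f [^] k))"
      unfolding a(2)[symmetric] by (rule ring_hom_mult[OF \<rho>(1) y(1)]) (simp add: f)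
    finally have "P1.\<iota> a = \<zero>\<^bsub>P1.B\<^esub>" using y(2) \<rho>(2) f by (simp del: One_nat_def)
    then obtain m :: nat and b where b: "b \<in> carrier A" "f [^] m \<otimes> a = [p] \<cdot> b"
      using P1.\<iota>_zeroD[OF a(1)] by auto
    have "y \<otimes>\<^bsub>P2.B\<^esub> P2.\<iota> (f [^] (m + k)) = P2.\<iota> (f [^] m) \<otimes>\<^bsub>P2.B\<^esub> (y \<otimes>\<^bsub>P2.B\<^esub> P2.\<iota> (f [^] k))"
      using y(1) f ring_hom_mult[OF P2.\<iota>_hom, of "f [^] m" "f [^] k"] by (simp add: nat_pow_mult[symmetric] P2.B.m_ac)
    also have "\<dots> = P2.\<iota> (f [^] m \<otimes> a)"
      unfolding a(2) using a(1) f by (simp add: ring_hom_mult[OF P2.\<iota>_hom])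
    also have "\<dots> = [p] \<cdot>\<^bsub>P2.B\<^esub> P2.\<iota> b"
      unfolding b(2) by (rule ring_hom_nat_mult[OF P2.\<iota>_hom ring_axioms P2.B.ring_axioms b(1)])
    finally show ?thesis by (rule P2.nat_mult_unit_cancel[OF y(1) P2.\<iota>_closed[OF b(1)]])
  qed
  moreover have "\<rho> \<in> restrictions A p f 2 f 1" using \<rho> by (simp add: restrictions_def)
  ultimately show ?thesis by blast
qed

text \<open>The p-th power map is prescribed at level 1; the difference from it at level 2 dies
  under reduction and is thus a multiple of p.\<close>

lemma frobenius_lift_mod_p:
  assumes F: "frobenius_lift R p \<phi> A U \<Phi>" and fU: "f \<in> affine_pieces A U" and x: "x \<in> carrier (piece A p f 2)"
  shows "\<exists>z\<in>carrier (piece A p f 2). \<Phi> f 2 x = x [^]\<^bsub>piece A p f 2\<^esub> p \<oplus>\<^bsub>piece A p f 2\<^esub> [p] \<cdot>\<^bsub>piece A p f 2\<^esub> z"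
proof -
  interpret P2: piece_base A f p 2 by unfold_locales
  interpret P1: piece_base A f p 1 by unfold_locales
  obtain \<rho> where \<rho>: "\<rho> \<in> restrictions A p f 2 f 1"
    and ker: "\<forall>y\<in>carrier P2.B. \<rho> y = \<zero>\<^bsub>P1.B\<^esub> \<longrightarrow> (\<exists>z\<in>carrier P2.B. y = [p] \<cdot>\<^bsub>P2.B\<^esub> z)"
    using restriction_to_special_fibre[of p] by blast
  have h: "\<rho> \<in> ring_hom P2.B P1.B" using \<rho> by (simp add: restrictions_def)
  have \<Phi>: "\<Phi> f 2 \<in> ring_hom P2.B P2.B" "\<rho> (\<Phi> f 2 x) = \<Phi> f 1 (\<rho> x)" "\<Phi> f 1 (\<rho> x) = \<rho> x [^]\<^bsub>P1.B\<^esub> p"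
    using F fU \<rho> x ring_hom_closed[OF h x] unfolding frobenius_lift_def by blast+
  have c: "\<Phi> f 2 x \<in> carrier P2.B" "x [^]\<^bsub>P2.B\<^esub> p \<in> carrier P2.B" using ring_hom_closed[OF \<Phi>(1) x] x by simp_all
  have "\<rho> (\<Phi> f 2 x \<ominus>\<^bsub>P2.B\<^esub> x [^]\<^bsub>P2.B\<^esub> p) = \<zero>\<^bsub>P1.B\<^esub>"
    using ring_hom_diff[OF h P2.B.ring_axioms P1.B.ring_axioms c] ring_hom_nat_pow[OF h P2.B.ring_axioms P1.B.ring_axioms x, of p] \<Phi>(2,3)
      ring_hom_closed[OF h x] by (simp add: P1.B.minus_eq P1.B.r_neg del: One_nat_def)
  then obtain z where z: "z \<in> carrier P2.B" "\<Phi> f 2 x \<ominus>\<^bsub>P2.B\<^esub> x [^]\<^bsub>P2.B\<^esub> p = [p] \<cdot>\<^bsub>P2.B\<^esub> z" using ker c by blast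
  have "\<Phi> f 2 x = x [^]\<^bsub>P2.B\<^esub> p \<oplus>\<^bsub>P2.B\<^esub> (\<Phi> f 2 x \<ominus>\<^bsub>P2.B\<^esub> x [^]\<^bsub>P2.B\<^esub> p)"
    using c by (simp add: P2.B.minus_eq P2.B.a_lcomm[of "x [^]\<^bsub>P2.B\<^esub> p"] P2.B.r_neg)
  then show ?thesis using z by auto
qed

end

text \<open>A power u of f moves x into the image of G, where p-th derivatives are divisible by p.
  Modulo p the Leibniz rule for x u then leaves the p-th derivative of x times u, and u is a
  unit.\<close>

lemma (in nilpotent_derivation) piece_derivation_p_divisible:
  assumes f: "f \<in> carrier G" and D': "derivation_along (piece G p f n) (piece G p f n) (\<lambda>x. x) D'"
    and D'\<iota>: "\<forall>a\<in>carrier G. D' (to_piece G p f n a) = to_piece G p f n (D a)"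
    and x: "x \<in> carrier (piece G p f n)"
  shows "\<exists>z\<in>carrier (piece G p f n). (D' ^^ p) x = [p] \<cdot>\<^bsub>piece G p f n\<^esub> z"
proof -
  interpret B: piece_base G f p n by unfold_locales (rule f)
  interpret E: derivation_ring B.B D' by unfold_locales (rule D')
  have DD: "E.DD m (B.\<iota> a) = B.\<iota> (DD m a)" if "a \<in> carrier G" for a m
    using that by (induction m) (simp_all add: D'\<iota>)
  obtain a and k :: nat where a: "a \<in> carrier G" "x \<otimes>\<^bsub>B.B\<^esub> B.\<iota> (f [^]\<^bsub>G\<^esub> k) = B.\<iota> a" using x by (rule B.B_fracE)
  let ?u = "B.\<iota> (f [^]\<^bsub>G\<^esub> k)"
  have u: "?u \<in> carrier B.B" using f by simp
  obtain y where y: "y \<in> carrier G" "DD p a = [p] \<cdot>\<^bsub>G\<^esub> y" using DD_p_divisible[OF a(1)] by blast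
  obtain w where w: "w \<in> carrier G" "DD p (f [^]\<^bsub>G\<^esub> k) = [p] \<cdot>\<^bsub>G\<^esub> w" using DD_p_divisible[of "f [^]\<^bsub>G\<^esub> k"] f by auto
  have \<iota>p: "B.\<iota> ([p] \<cdot>\<^bsub>G\<^esub> v) = [p] \<cdot>\<^bsub>B.B\<^esub> B.\<iota> v" if "v \<in> carrier G" for v
    by (rule ring_hom_nat_mult[OF B.\<iota>_hom G2.A.ring_axioms B.B.ring_axioms that])
  obtain z where z: "z \<in> carrier B.B" "E.DD p (x \<otimes>\<^bsub>B.B\<^esub> ?u) = x \<otimes>\<^bsub>B.B\<^esub> E.DD p ?u \<oplus>\<^bsub>B.B\<^esub> (E.DD p x \<otimes>\<^bsub>B.B\<^esub> ?u \<oplus>\<^bsub>B.B\<^esub> [p] \<cdot>\<^bsub>B.B\<^esub> z)"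
    using E.leibniz_prime[OF p x u] by blast
  have cy: "B.\<iota> y \<in> carrier B.B" and cw: "x \<otimes>\<^bsub>B.B\<^esub> B.\<iota> w \<in> carrier B.B" and cx: "E.DD p x \<otimes>\<^bsub>B.B\<^esub> ?u \<in> carrier B.B"
    using x y w u by simp_all
  have "[p] \<cdot>\<^bsub>B.B\<^esub> B.\<iota> y = [p] \<cdot>\<^bsub>B.B\<^esub> (x \<otimes>\<^bsub>B.B\<^esub> B.\<iota> w) \<oplus>\<^bsub>B.B\<^esub> (E.DD p x \<otimes>\<^bsub>B.B\<^esub> ?u \<oplus>\<^bsub>B.B\<^esub> [p] \<cdot>\<^bsub>B.B\<^esub> z)"
    using z(2) a f x y w by (simp add: DD \<iota>p B.B.add_pow_rdistr)
  also have "\<dots> = E.DD p x \<otimes>\<^bsub>B.B\<^esub> ?u \<oplus>\<^bsub>B.B\<^esub> [p] \<cdot>\<^bsub>B.B\<^esub> (x \<otimes>\<^bsub>B.B\<^esub> B.\<iota> w \<oplus>\<^bsub>B.B\<^esub> z)"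
    using cw cx z(1) by (simp add: B.B.nat_mult_distr B.B.a_ac)
  finally have "E.DD p x \<otimes>\<^bsub>B.B\<^esub> ?u = [p] \<cdot>\<^bsub>B.B\<^esub> B.\<iota> y \<ominus>\<^bsub>B.B\<^esub> [p] \<cdot>\<^bsub>B.B\<^esub> (x \<otimes>\<^bsub>B.B\<^esub> B.\<iota> w \<oplus>\<^bsub>B.B\<^esub> z)"
    using cw cx z(1) by (simp add: B.B.minus_eq B.B.a_assoc B.B.r_neg)
  also have "\<dots> = [p] \<cdot>\<^bsub>B.B\<^esub> (B.\<iota> y \<ominus>\<^bsub>B.B\<^esub> (x \<otimes>\<^bsub>B.B\<^esub> B.\<iota> w \<oplus>\<^bsub>B.B\<^esub> z))"
    by (rule B.B.nat_mult_minus[symmetric]) (use cy cw z(1) in simp_all)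
  finally show ?thesis
    by (rule B.nat_mult_unit_cancel[rotated 2]) (use x cy cw z(1) in simp_all)
qed

lemma pullback_closed:
  assumes S: "kaehler_base S K" and T: "kaehler_base T L"
    and h: "h \<in> ring_hom S T" and hK: "h ` K \<subseteq> L" and \<omega>: "\<omega> \<in> carrier (kaehler S K)"
  shows "pullback T L h \<omega> \<in> carrier (kaehler T L)"
proof -
  interpret S: kaehler_base S K by fact
  interpret T: kaehler_base T L by fact
  obtain c where c: "Poly_Mapping.keys c \<subseteq> carrier S \<times> carrier S" "\<omega> = kcls S K c" using \<omega> by (rule S.kclsE)
  show ?thesis
    unfolding c(2) pullback_kcls[OF S T h hK c(1)]
    by (intro T.kcls_closed keys_frag_map[OF c(1)]) (use ring_hom_closed[OF h] in auto)
qed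

text \<open>Level 2 is the first one at which the Frobenius pullback of a form, being divisible by
  p, carries information.\<close>

locale lifted_derivation = nilpotent_derivation R G N M d p
  for R :: "'r ring" (structure) and G :: "('r, 'a, 'm) hopf_scheme" and N M d p +
  fixes f D'
  assumes f: "f \<in> carrier G"
    and D': "derivation_along (piece G p f 2) (piece G p f 2) (\<lambda>x. x) D'"
    and D'_restrict: "a \<in> carrier G \<Longrightarrow> D' (to_piece G p f 2 a) = to_piece G p f 2 (D a)"
begin

sublocale B: piece_base G f p 2 by unfold_locales (rule f)
sublocale E: derivation_ring B.B D' by unfold_locales (rule D')

lemma algmap_closed_B: "r \<in> carrier R \<Longrightarrow> algmap B.B r \<in> carrier B.B"
  by (simp add: B.algmap_B)

sublocale BK: kaehler_base B.B "constants R B.B"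
  by unfold_locales (use algmap_closed_B in blast)

abbreviation "\<Omega>B \<equiv> differentials R B.B"

lemma D'_algmap: "r \<in> carrier R \<Longrightarrow> D' (algmap B.B r) = \<zero>\<^bsub>B.B\<^esub>"
  by (simp add: B.algmap_B D'_restrict D_algmap ring_hom_zero[OF B.\<iota>_hom G2.A.ring_axioms B.B.ring_axioms])

lemma id_hom_B: "(\<lambda>x. x) \<in> ring_hom B.B B.B"
  by (simp add: ring_hom_def)

sublocale PB: kaehler_pairing B.B "constants R B.B" B.B "\<lambda>x. x" D'
  by unfold_locales (use id_hom_B D' D'_algmap in auto)

lemma restrict_constants: "B.\<iota> ` constants R G \<subseteq> constants R B.B"
  by (auto simp: B.algmap_B)

lemma restrict_form_closed: "\<omega> \<in> carrier (differentials R G) \<Longrightarrow> restrict_form R p G \<omega> f 2 \<in> carrier \<Omega>B"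
  unfolding restrict_form_def
  by (rule pullback_closed[OF GK.kaehler_base_axioms BK.kaehler_base_axioms B.\<iota>_hom restrict_constants])

lemma pairing_restrict:
  assumes \<omega>: "\<omega> \<in> carrier (differentials R G)"
  shows "pairing B.B (\<lambda>x. x) D' (restrict_form R p G \<omega> f 2) = B.\<iota> (pairing G (\<lambda>x. x) D \<omega>)"
proof -
  obtain c where c: "Poly_Mapping.keys c \<subseteq> carrier G \<times> carrier G" "\<omega> = kcls G (constants R G) c"
    using \<omega> by (rule GK.kclsE)
  interpret q: kaehler_pairing G "constants R G" B.B "\<lambda>x. B.\<iota> x" "\<lambda>x. D' (B.\<iota> x)"
  proof unfold_locales
    show "\<forall>k\<in>constants R G. D' (B.\<iota> k) = \<zero>\<^bsub>B.B\<^esub>" using D'_algmap by (auto simp: B.algmap_B)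
  qed (rule B.\<iota>_hom, rule derivation_along_comp[OF D' B.\<iota>_hom])
  have g: "(\<lambda>(a, b). a \<otimes>\<^bsub>G\<^esub> D b) \<in> carrier G \<times> carrier G \<rightarrow> carrier G" by auto
  have "pairing B.B (\<lambda>x. x) D' (restrict_form R p G \<omega> f 2) = pairing B.B (\<lambda>x. B.\<iota> x) (\<lambda>x. D' (B.\<iota> x)) \<omega>"
    unfolding restrict_form_def
    by (rule pairing_pullback[OF GK.kaehler_base_axioms PB.kaehler_pairing_axioms B.\<iota>_hom restrict_constants \<omega>])
  also have "\<dots> = q.ev c" by (subst c(2)) (rule q.pairing_kcls[OF c(1)])
  also have "\<dots> = frag_eval B.B (\<lambda>z. B.\<iota> ((\<lambda>(a, b). a \<otimes>\<^bsub>G\<^esub> D b) z)) c"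
    by (rule B.B.frag_eval_cong) (use c in \<open>auto simp: D'_restrict ring_hom_mult[OF B.\<iota>_hom]\<close>)
  also have "\<dots> = B.\<iota> (P.ev c)"
    by (rule ring_hom_frag_eval[OF B.\<iota>_hom G2.A.ring_axioms B.B.ring_axioms g c(1), symmetric])
  also have "P.ev c = pairing G (\<lambda>x. x) D \<omega>"
    by (subst c(2)) (rule P.pairing_kcls[OF c(1), symmetric])
  finally show ?thesis .
qed

lemma p2_zero: "\<forall>x\<in>carrier B.B. [p] \<cdot>\<^bsub>B.B\<^esub> ([p] \<cdot>\<^bsub>B.B\<^esub> x) = \<zero>\<^bsub>B.B\<^esub>"
proof
  fix x assume x: "x \<in> carrier B.B"
  have "[p] \<cdot>\<^bsub>B.B\<^esub> ([p] \<cdot>\<^bsub>B.B\<^esub> x) = [(p ^ 2)] \<cdot>\<^bsub>B.B\<^esub> x"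
    unfolding power2_eq_square by (rule B.B.nat_mult_mult[OF x, symmetric])
  also have "\<dots> = [(p ^ 2)] \<cdot>\<^bsub>B.B\<^esub> \<one>\<^bsub>B.B\<^esub> \<otimes>\<^bsub>B.B\<^esub> x"
    using x by (simp add: B.B.add_pow_ldistr)
  also have "\<dots> = \<zero>\<^bsub>B.B\<^esub>" unfolding B.B_char using x by simp
  finally show "[p] \<cdot>\<^bsub>B.B\<^esub> ([p] \<cdot>\<^bsub>B.B\<^esub> x) = \<zero>\<^bsub>B.B\<^esub>" .
qed

lemma fact_p_zero:
  assumes x: "x \<in> carrier B.B"
  shows "[(fact p :: nat)] \<cdot>\<^bsub>B.B\<^esub> ([p] \<cdot>\<^bsub>B.B\<^esub> x) = \<zero>\<^bsub>B.B\<^esub>"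
proof -
  obtain q where q: "p = Suc q" using p by (metis not0_implies_Suc not_prime_0)
  have "(fact p :: nat) = fact q * p" by (simp add: q mult.commute)
  then show ?thesis using x p2_zero by (simp add: B.B.nat_mult_mult)
qed

text \<open>
  Modulo \<open>p\<^sup>2\<close> the map \<open>x \<mapsto> p! x\<^sup>p\<close> is additive, so it suffices to treat the forms \<open>a db\<close>.
\<close>

lemma pairing_frobenius_pullback:
  assumes F: "F \<in> ring_hom B.B B.B" and Fc: "F ` constants R B.B \<subseteq> constants R B.B"
    and Fp: "\<forall>x\<in>carrier B.B. \<exists>z\<in>carrier B.B. F x = x [^]\<^bsub>B.B\<^esub> p \<oplus>\<^bsub>B.B\<^esub> [p] \<cdot>\<^bsub>B.B\<^esub> z"
    and \<xi>: "\<xi> \<in> carrier \<Omega>B"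
  shows "E.DD (p - 1) (pairing B.B (\<lambda>x. x) D' (pullback B.B (constants R B.B) F \<xi>)) =
    [(fact p :: nat)] \<cdot>\<^bsub>B.B\<^esub> (pairing B.B (\<lambda>x. x) D' \<xi> [^]\<^bsub>B.B\<^esub> p)"
proof -
  obtain c where c: "Poly_Mapping.keys c \<subseteq> carrier B.B \<times> carrier B.B" "\<xi> = kcls B.B (constants R B.B) c"
    using \<xi> by (rule BK.kclsE)
  interpret q: kaehler_pairing B.B "constants R B.B" B.B "\<lambda>x. F x" "\<lambda>x. D' (F x)"
  proof unfold_locales
    show "\<forall>k\<in>constants R B.B. D' (F k) = \<zero>\<^bsub>B.B\<^esub>"
    proof
      fix k assume "k \<in> constants R B.B"
      then have "F k \<in> constants R B.B" using Fc by blast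
      then show "D' (F k) = \<zero>\<^bsub>B.B\<^esub>" using PB.dK by blast
    qed
  qed (rule F, rule derivation_along_comp[OF D' F])
  let ?P = "\<lambda>x. [(fact p :: nat)] \<cdot>\<^bsub>B.B\<^esub> (x [^]\<^bsub>B.B\<^esub> p)"
  have P_add: "?P (x \<oplus>\<^bsub>B.B\<^esub> y) = ?P x \<oplus>\<^bsub>B.B\<^esub> ?P y" if x: "x \<in> carrier B.B" and y: "y \<in> carrier B.B" for x y
    using B.B.frobenius_add[OF p x y] fact_p_zero[OF B.B.frob_poly_closed[OF x y]] B.B.frob_poly_closed[OF x y] x y
    by (simp add: B.B.nat_mult_distr)
  have gF: "(\<lambda>(a, b). F a \<otimes>\<^bsub>B.B\<^esub> D' (F b)) \<in> carrier B.B \<times> carrier B.B \<rightarrow> carrier B.B"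
    by (rule q.ev_fun)
  have "pairing B.B (\<lambda>x. x) D' (pullback B.B (constants R B.B) F \<xi>) = pairing B.B (\<lambda>x. F x) (\<lambda>x. D' (F x)) \<xi>"
    by (rule pairing_pullback[OF BK.kaehler_base_axioms PB.kaehler_pairing_axioms F Fc \<xi>])
  also have "\<dots> = q.ev c" by (subst c(2)) (rule q.pairing_kcls[OF c(1)])
  finally have "E.DD (p - 1) (pairing B.B (\<lambda>x. x) D' (pullback B.B (constants R B.B) F \<xi>)) = E.DD (p - 1) (q.ev c)" by simp
  also have "\<dots> = frag_eval B.B (\<lambda>z. E.DD (p - 1) ((\<lambda>(a, b). F a \<otimes>\<^bsub>B.B\<^esub> D' (F b)) z)) c"
    by (rule abelian_group_hom_frag_eval[OF B.B.abelian_group_axioms B.B.abelian_group_axioms _ E.DD_add gF c(1)]) simp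
  also have "\<dots> = frag_eval B.B (\<lambda>z. ?P ((\<lambda>(a, b). a \<otimes>\<^bsub>B.B\<^esub> D' b) z)) c"
  proof (rule B.B.frag_eval_cong)
    fix z assume "z \<in> Poly_Mapping.keys c"
    then obtain a b where z: "z = (a, b)" "a \<in> carrier B.B" "b \<in> carrier B.B" using c(1) by blast
    have Dp: "\<forall>x\<in>carrier B.B. \<exists>z\<in>carrier B.B. E.DD p x = [p] \<cdot>\<^bsub>B.B\<^esub> z"
      using piece_derivation_p_divisible[OF f D'] D'_restrict by blast
    show "E.DD (p - 1) ((\<lambda>(a, b). F a \<otimes>\<^bsub>B.B\<^esub> D' (F b)) z) = ?P ((\<lambda>(a, b). a \<otimes>\<^bsub>B.B\<^esub> D' b) z)"
      unfolding z(1) prod.case by (rule E.frobenius_pairing[OF p p2_zero Dp Fp z(2,3)])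
  next
    show "(\<lambda>z. ?P ((\<lambda>(a, b). a \<otimes>\<^bsub>B.B\<^esub> D' b) z)) \<in> Poly_Mapping.keys c \<rightarrow> carrier B.B"
    proof
      fix z assume "z \<in> Poly_Mapping.keys c"
      then obtain a b where z: "z = (a, b)" "a \<in> carrier B.B" "b \<in> carrier B.B" using c(1) by blast
      show "?P ((\<lambda>(a, b). a \<otimes>\<^bsub>B.B\<^esub> D' b) z) \<in> carrier B.B"
        unfolding z(1) prod.case using z(2,3) by simp
    qed
  qed
  also have "\<dots> = ?P (PB.ev c)"
    by (rule abelian_group_hom_frag_eval[OF B.B.abelian_group_axioms B.B.abelian_group_axioms _ P_add PB.ev_fun c(1), symmetric]) auto
  also have "PB.ev c = pairing B.B (\<lambda>x. x) D' \<xi>"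
    by (subst c(2)) (rule PB.pairing_kcls[OF c(1), symmetric])
  finally show ?thesis .
qed

text \<open>The two descriptions of \<eta> meet in the pairing of p \<eta> with D': the error term p
  \<theta> is multiplied by p once more and vanishes.\<close>

lemma lie_invariant_p_zero:
  assumes F: "F \<in> ring_hom B.B B.B" and Fc: "F ` constants R B.B \<subseteq> constants R B.B"
    and Fp: "\<forall>x\<in>carrier B.B. \<exists>z\<in>carrier B.B. F x = x [^]\<^bsub>B.B\<^esub> p \<oplus>\<^bsub>B.B\<^esub> [p] \<cdot>\<^bsub>B.B\<^esub> z"
    and \<omega>: "\<And>j. j < m \<Longrightarrow> \<omega> j \<in> left_invariant_forms R G" and \<Lambda>: "\<And>j. j < m \<Longrightarrow> \<Lambda> j \<in> carrier R"
    and i: "i < m" and \<theta>: "\<theta> \<in> carrier \<Omega>B"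
    and \<eta>: "[p] \<cdot>\<^bsub>\<Omega>B\<^esub> \<eta> = pullback B.B (constants R B.B) F (restrict_form R p G (\<omega> i) f 2)"
    and \<eta>_eq: "\<eta> = finsum \<Omega>B (\<lambda>j. algmap B.B (\<Lambda> j) \<odot>\<^bsub>\<Omega>B\<^esub> restrict_form R p G (\<omega> j) f 2) {..<m} \<oplus>\<^bsub>\<Omega>B\<^esub> [p] \<cdot>\<^bsub>\<Omega>B\<^esub> \<theta>"
    and c: "c \<in> Units R" "pairing G (\<lambda>x. x) D (\<omega> i) = \<iota> c"
  shows "[p] \<cdot>\<^bsub>B.B\<^esub> \<one>\<^bsub>B.B\<^esub> = \<zero>\<^bsub>B.B\<^esub>"
proof -
  have \<omega>c: "\<omega> j \<in> carrier (differentials R G)" if "j < m" for j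
    using \<omega>[OF that] by (simp add: left_invariant_forms_def)
  have "\<forall>j\<in>{..<m}. \<exists>e. e \<in> carrier R \<and> pairing G (\<lambda>x. x) D (\<omega> j) = \<iota> e"
  proof
    fix j assume "j \<in> {..<m}"
    then have "\<omega> j \<in> left_invariant_forms R G" using \<omega> by simp
    from invariant_pairing[OF this] show "\<exists>e. e \<in> carrier R \<and> pairing G (\<lambda>x. x) D (\<omega> j) = \<iota> e" by blast
  qed
  from bchoice[OF this] obtain e where e: "\<forall>j\<in>{..<m}. e j \<in> carrier R \<and> pairing G (\<lambda>x. x) D (\<omega> j) = \<iota> (e j)" by blast
  have am: "algmap B.B \<in> ring_hom R B.B"
    using ring_hom_trans[OF \<iota>_hom B.\<iota>_hom] by (simp add: B.algmap_B[abs_def] comp_def)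
  let ?s = "\<lambda>j. algmap B.B (\<Lambda> j) \<odot>\<^bsub>\<Omega>B\<^esub> restrict_form R p G (\<omega> j) f 2"
  have s: "?s \<in> {..<m} \<rightarrow> carrier \<Omega>B"
    using \<Lambda> \<omega>c restrict_form_closed by (auto intro!: BK.smult_closed algmap_closed_B)
  have fs: "finsum \<Omega>B ?s {..<m} \<in> carrier \<Omega>B" by (rule BK.\<Omega>.finsum_closed[OF s])
  have p\<theta>: "[p] \<cdot>\<^bsub>\<Omega>B\<^esub> \<theta> \<in> carrier \<Omega>B" using \<theta> by (rule BK.\<Omega>.nat_mult_closed)
  have \<eta>c: "\<eta> \<in> carrier \<Omega>B" unfolding \<eta>_eq by (rule BK.\<Omega>.a_closed[OF fs p\<theta>])
  let ?pr = "pairing B.B (\<lambda>x. x) D'"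
  define r where "r = finsum R (\<lambda>j. \<Lambda> j \<otimes> e j) {..<m}"
  have rc: "r \<in> carrier R" unfolding r_def using \<Lambda> e by (intro G2.R.finsum_closed) auto
  have "?pr (finsum \<Omega>B ?s {..<m}) = finsum B.B (\<lambda>j. ?pr (?s j)) {..<m}" by (rule PB.pairing_finsum[OF s])
  also have "\<dots> = finsum B.B (\<lambda>j. algmap B.B (\<Lambda> j \<otimes> e j)) {..<m}"
  proof (rule B.B.finsum_cong')
    fix j assume j: "j \<in> {..<m}"
    then have "?pr (?s j) = algmap B.B (\<Lambda> j) \<otimes>\<^bsub>B.B\<^esub> B.\<iota> (\<iota> (e j))"
      using \<Lambda> \<omega>c e restrict_form_closed by (simp add: PB.pairing_smult algmap_closed_B pairing_restrict)
    then show "?pr (?s j) = algmap B.B (\<Lambda> j \<otimes> e j)"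
      using j \<Lambda> e ring_hom_mult[OF am, of "\<Lambda> j" "e j"] by (simp add: B.algmap_B)
  qed (use \<Lambda> e in \<open>auto intro!: algmap_closed_B\<close>)
  also have "\<dots> = algmap B.B r"
    unfolding r_def by (rule ring_hom_finsum[OF am G2.R.ring_axioms B.B.ring_axioms, symmetric]) (use \<Lambda> e in auto)
  finally have 1: "?pr (finsum \<Omega>B ?s {..<m}) = algmap B.B r" .
  have "?pr ([p] \<cdot>\<^bsub>\<Omega>B\<^esub> \<eta>) = [p] \<cdot>\<^bsub>B.B\<^esub> (algmap B.B r \<oplus>\<^bsub>B.B\<^esub> [p] \<cdot>\<^bsub>B.B\<^esub> ?pr \<theta>)"
    unfolding PB.pairing_nat_mult[OF \<eta>c] unfolding \<eta>_eq PB.pairing_add[OF fs p\<theta>] PB.pairing_nat_mult[OF \<theta>] 1 ..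
  also have "\<dots> = [p] \<cdot>\<^bsub>B.B\<^esub> algmap B.B r"
    using PB.pairing_closed[OF \<theta>] algmap_closed_B[OF rc] p2_zero by (simp add: B.B.nat_mult_distr)
  finally have 2: "?pr ([p] \<cdot>\<^bsub>\<Omega>B\<^esub> \<eta>) = [p] \<cdot>\<^bsub>B.B\<^esub> algmap B.B r" .
  \<comment> \<open>As p - 1 is at least 1, there is a derivation left to kill the constant.\<close>
  obtain q where q: "p - 1 = Suc q" using prime_gt_1_nat[OF p] by (metis Suc_diff_Suc)
  have "E.DD (p - 1) ([p] \<cdot>\<^bsub>B.B\<^esub> algmap B.B r) = \<zero>\<^bsub>B.B\<^esub>"
    unfolding q funpow_Suc_right comp_def E.D_nat_mult[OF algmap_closed_B[OF rc]] D'_algmap[OF rc] by (simp add: E.DD_zero)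
  then have "E.DD (p - 1) (?pr ([p] \<cdot>\<^bsub>\<Omega>B\<^esub> \<eta>)) = \<zero>\<^bsub>B.B\<^esub>" unfolding 2 .
  then have 3: "[(fact p :: nat)] \<cdot>\<^bsub>B.B\<^esub> (algmap B.B c [^]\<^bsub>B.B\<^esub> p) = \<zero>\<^bsub>B.B\<^esub>"
    unfolding \<eta> pairing_frobenius_pullback[OF F Fc Fp restrict_form_closed[OF \<omega>c[OF i]]] pairing_restrict[OF \<omega>c[OF i]] c(2) B.algmap_B .
  have u: "algmap B.B c [^]\<^bsub>B.B\<^esub> p \<in> Units B.B"
    by (intro B.B.Units_pow_closed ring_hom_Units[OF am c(1)])
  let ?u = "algmap B.B c [^]\<^bsub>B.B\<^esub> p"
  have "[(fact p :: nat)] \<cdot>\<^bsub>B.B\<^esub> \<one>\<^bsub>B.B\<^esub> = [(fact p :: nat)] \<cdot>\<^bsub>B.B\<^esub> ?u \<otimes>\<^bsub>B.B\<^esub> inv\<^bsub>B.B\<^esub> ?u"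
    using u by (simp add: B.B.add_pow_ldistr B.B.Units_closed)
  then have 4: "[(fact p :: nat)] \<cdot>\<^bsub>B.B\<^esub> \<one>\<^bsub>B.B\<^esub> = \<zero>\<^bsub>B.B\<^esub>" unfolding 3 using u by simp
  \<comment> \<open>In p! = (p - 1)! * p the first factor is prime to p, and p itself is annihilated
    by p here, so (p - 1)! can be cancelled.\<close>
  have fp: "(fact p :: nat) = fact (p - 1) * p" using q by (metis Suc_diff_1 fact_Suc mult.commute of_nat_id prime_gt_0_nat[OF p])
  show ?thesis
  proof (rule B.B.coprime_nat_mult_zero)
    show "coprime (fact (p - 1)) p"
      using p prime_dvd_fact_iff[OF p, of "p - 1"] prime_gt_0_nat[OF p] by (simp add: prime_imp_coprime coprime_commute)
    show "[(fact (p - 1) :: nat)] \<cdot>\<^bsub>B.B\<^esub> ([p] \<cdot>\<^bsub>B.B\<^esub> \<one>\<^bsub>B.B\<^esub>) = \<zero>\<^bsub>B.B\<^esub>"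
      unfolding B.B.nat_mult_mult[OF B.B.one_closed, symmetric] fp[symmetric] by (rule 4)
    show "[p] \<cdot>\<^bsub>B.B\<^esub> ([p] \<cdot>\<^bsub>B.B\<^esub> \<one>\<^bsub>B.B\<^esub>) = \<zero>\<^bsub>B.B\<^esub>" using p2_zero by simp
  qed simp
qed

end

section \<open>Contradiction at a point of the special fibre\<close>

lemma (in primeideal) pow_mem:
  assumes "x \<in> carrier R" "x [^] (n::nat) \<in> I"
  shows "x \<in> I"
  using assms(2)
proof (induction n)
  case 0
  then show ?case using one_imp_carrier I_notcarr by simp
next
  case (Suc n)
  then show ?case using I_prime[of "x [^] n" x] assms(1) by auto
qed

lemma (in embedded_group) unipotent_order_mono:
  fixes n p :: nat
  assumes u: "u \<in> rational_points R G" and "n \<le> p"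
    and "(point_matrix R N M u \<ominus>\<^bsub>RM\<^esub> \<one>\<^bsub>RM\<^esub>) [^]\<^bsub>RM\<^esub> n = \<zero>\<^bsub>RM\<^esub>"
  shows "(point_matrix R N M u \<ominus>\<^bsub>RM\<^esub> \<one>\<^bsub>RM\<^esub>) [^]\<^bsub>RM\<^esub> p = \<zero>\<^bsub>RM\<^esub>"
proof -
  let ?X = "point_matrix R N M u \<ominus>\<^bsub>RM\<^esub> \<one>\<^bsub>RM\<^esub>"
  have uh: "u \<in> ring_hom G R" using u by (simp add: rational_points_def alg_hom_def)
  have "point_matrix R N M u \<in> carrier RM"
    by (rule MR.MR_closedI) (use ring_hom_closed[OF uh M_entry] in \<open>auto simp: point_matrix_def\<close>)
  then have X: "?X \<in> carrier RM" by simp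
  have "?X [^]\<^bsub>RM\<^esub> p = ?X [^]\<^bsub>RM\<^esub> n \<otimes>\<^bsub>RM\<^esub> ?X [^]\<^bsub>RM\<^esub> (p - n)"
    using MR.MR.nat_pow_mult[OF X, of n "p - n"] assms(2) by simp
  then show ?thesis using assms(3) X by simp
qed

theorem theorem3p2:
  fixes p :: nat
    and R :: "'r ring"
    and G :: "('r, 'a) hopf"
  assumes "Factorial_Ring.prime p"
    and "discrete_valuation_ring R"
    and "maximalideal (PIdl\<^bsub>R\<^esub> ([p] \<cdot>\<^bsub>R\<^esub> \<one>\<^bsub>R\<^esub>)) R"
    and "adically_complete R ([p] \<cdot>\<^bsub>R\<^esub> \<one>\<^bsub>R\<^esub>)"
    and "algebraically_closed (R Quot (PIdl\<^bsub>R\<^esub> ([p] \<cdot>\<^bsub>R\<^esub> \<one>\<^bsub>R\<^esub>)))"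
    and "affine_group_scheme R G"
    and "smooth_algebra R G"
    and "\<exists>\<phi> G0 \<Phi>.
           frobenius_lift_ring R p \<phi> \<and>
           zariski_open G G0 \<and>
           (\<exists>q\<in>G0. [p] \<cdot>\<^bsub>G\<^esub> \<one>\<^bsub>G\<^esub> \<in> q) \<and>
           frobenius_lift R p \<phi> G G0 \<Phi> \<and>
           lie_invariant_mod_p R p G G0 \<Phi>"
  shows "\<not> (\<exists>u \<in> rational_points R G.
              (\<exists>a\<in>carrier G. u a \<noteq> counit G a) \<and>
              unipotent R G u \<and>
              unipotent_index R G u \<le> p)"
proof (rule notI, erule bexE, elim conjE)
  fix u assume u: "u \<in> rational_points R G" and nt: "\<exists>a\<in>carrier G. u a \<noteq> counit G a"
    and uni: "unipotent R G u" and ind: "unipotent_index R G u \<le> p"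
  have "domain R" "\<not> field R"
    using assms(2) by (auto simp: discrete_valuation_ring_def principal_domain_def)
  then interpret unramified_ring R p
    using assms(1,3,4) by (simp add: unramified_ring_def unramified_ring_axioms_def)
  interpret group_scheme R G by unfold_locales (rule assms(6))
  \<comment> \<open>Unipotence makes the set of admissible orders non-empty, so its least element is
    attained.\<close>
  have "unipotent_index R G u \<ge> 1 \<and> unipotent_order R G u (unipotent_index R G u)"
    unfolding unipotent_index_def by (rule LeastI_ex) (use uni in \<open>auto simp: unipotent_def\<close>)
  then obtain N M where emb: "gl_embedding R G N M"
    and nil0: "(point_matrix R N M u \<ominus>\<^bsub>matrix_ring R N\<^esub> \<one>\<^bsub>matrix_ring R N\<^esub>) [^]\<^bsub>matrix_ring R N\<^esub> (unipotent_index R G u)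
      = \<zero>\<^bsub>matrix_ring R N\<^esub>"
    unfolding unipotent_order_def by blast
  interpret embedded_group R G N M by unfold_locales (rule emb)
  interpret unipotent_point R p G N M u
    by unfold_locales (rule u, rule unipotent_order_mono[OF u ind nil0])
  obtain d b where dc: "\<forall>a\<in>carrier G. d a \<in> carrier R"
    and da: "\<forall>a\<in>carrier G. \<forall>b\<in>carrier G. d (a \<oplus>\<^bsub>G\<^esub> b) = d a \<oplus>\<^bsub>R\<^esub> d b"
    and dm: "\<forall>a\<in>carrier G. \<forall>b\<in>carrier G. d (a \<otimes>\<^bsub>G\<^esub> b) = counit G a \<otimes>\<^bsub>R\<^esub> d b \<oplus>\<^bsub>R\<^esub> counit G b \<otimes>\<^bsub>R\<^esub> d a"
    and d0: "\<forall>r\<in>carrier R. d (algmap G r) = \<zero>\<^bsub>R\<^esub>"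
    and dn: "mat_map N R d M [^]\<^bsub>matrix_ring R N\<^esub> p = \<zero>\<^bsub>matrix_ring R N\<^esub>"
    and b: "b \<in> carrier G" "d b \<notin> PIdl\<^bsub>R\<^esub> ([p] \<cdot>\<^bsub>R\<^esub> \<one>\<^bsub>R\<^esub>)"
    using unipotent_derivation[OF nt] by (elim exE conjE bexE)
  interpret nd: nilpotent_derivation R G N M d p
    by unfold_locales (use dc da dm d0 dn assms(1) in auto)
  obtain \<phi> G0 \<Phi> q where \<phi>: "frobenius_lift_ring R p \<phi>" and G0: "zariski_open G G0"
    and q: "q \<in> G0" "[p] \<cdot>\<^bsub>G\<^esub> \<one>\<^bsub>G\<^esub> \<in> q"
    and \<Phi>: "frobenius_lift R p \<phi> G G0 \<Phi>" and lie: "lie_invariant_mod_p R p G G0 \<Phi>"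
    using assms(8) by (elim exE conjE bexE)
  obtain E where E: "E \<subseteq> carrier G" "G0 = {q \<in> spec G. \<not> E \<subseteq> q}" using G0 by (auto simp: zariski_open_def)
  \<comment> \<open>The basic open set of f lies in G0 and contains the point q of the special
    fibre. So p cannot become zero on this piece at level 2, which is what the end of the proof
    exploits.\<close>
  then obtain f where f: "f \<in> E" "f \<in> carrier G" "f \<notin> q" using q(1) by blast
  have fU: "f \<in> affine_pieces G G0" using E f by (auto simp: affine_pieces_def basic_open_def)
  interpret q: primeideal q G using q(1) E(2) by (simp add: spec_def)
  interpret P: piece_base G f p 2 by unfold_locales (rule f(2))
  obtain D' where D': "derivation_along P.B P.B (\<lambda>x. x) D'" "\<forall>a\<in>carrier G. D' (P.\<iota> a) = P.\<iota> (nd.D a)"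
    using P.piece_derivation[OF nd.D] by blast
  interpret ld: lifted_derivation R G N M d p f D'
    by unfold_locales (use f(2) D' in auto)
  obtain m \<omega> \<Lambda> where gen: "generates_invariant_forms R G m \<omega>" and \<Lambda>: "\<forall>i<m. \<forall>j<m. \<Lambda> i j \<in> carrier R"
    and lie': "\<forall>i<m. \<exists>\<eta> \<theta>. frobenius_pullback_over_p R p G G0 \<Phi> (restrict_form R p G (\<omega> i)) \<eta> \<and>
           \<theta> \<in> formal_forms R p G G0 \<and>
           (\<forall>f\<in>affine_pieces G G0. \<forall>n.
              let \<Omega> = differentials R (piece G p f n) in
              \<eta> f n =
                finsum \<Omega>
                  (\<lambda>j. algmap (piece G p f n) (\<Lambda> i j) \<odot>\<^bsub>\<Omega>\<^esub> restrict_form R p G (\<omega> j) f n)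
                  {..<m}
                \<oplus>\<^bsub>\<Omega>\<^esub> [p] \<cdot>\<^bsub>\<Omega>\<^esub> \<theta> f n)"
    using lie unfolding lie_invariant_mod_p_def by (elim exE conjE)
  \<comment> \<open>Outside pR means invertible, by \<open>unitI\<close>, so this form has a unit as
    its pairing with D.\<close>
  obtain i c where i: "i < m" and c: "c \<in> carrier R" "c \<notin> PIdl\<^bsub>R\<^esub> ([p] \<cdot>\<^bsub>R\<^esub> \<one>\<^bsub>R\<^esub>)"
    and pc: "pairing G (\<lambda>x. x) nd.D (\<omega> i) = algmap G c"
    using nd.nondegenerate_invariant_form[OF gen maximalideal.axioms(1)[OF assms(3)] b] by (elim exE conjE bexE)
  obtain \<eta> \<theta> where \<eta>: "frobenius_pullback_over_p R p G G0 \<Phi> (restrict_form R p G (\<omega> i)) \<eta>"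
    and \<theta>: "\<theta> \<in> formal_forms R p G G0"
    and all: "\<forall>f\<in>affine_pieces G G0. \<forall>n.
              let \<Omega> = differentials R (piece G p f n) in
              \<eta> f n =
                finsum \<Omega>
                  (\<lambda>j. algmap (piece G p f n) (\<Lambda> i j) \<odot>\<^bsub>\<Omega>\<^esub> restrict_form R p G (\<omega> j) f n)
                  {..<m}
                \<oplus>\<^bsub>\<Omega>\<^esub> [p] \<cdot>\<^bsub>\<Omega>\<^esub> \<theta> f n"
    using lie'[THEN spec, THEN mp, OF i] by (elim exE conjE)
  have \<eta>\<theta>: "\<eta> f 2 = finsum (differentials R P.B) (\<lambda>j. algmap P.B (\<Lambda> i j) \<odot>\<^bsub>differentials R P.B\<^esub> restrict_form R p G (\<omega> j) f 2) {..<m}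
      \<oplus>\<^bsub>differentials R P.B\<^esub> [p] \<cdot>\<^bsub>differentials R P.B\<^esub> \<theta> f 2"
    using all[THEN bspec, OF fU, THEN spec, of 2] unfolding Let_def .
  have F: "\<Phi> f 2 \<in> ring_hom P.B P.B" and Fc: "\<forall>r\<in>carrier R. \<Phi> f 2 (algmap P.B r) = algmap P.B (\<phi> r)"
    using \<Phi>[unfolded frobenius_lift_def, THEN conjunct1, THEN bspec, OF fU, THEN spec, of 2] by (rule conjunct1, rule conjunct2)
  have Fc': "\<Phi> f 2 ` constants R P.B \<subseteq> constants R P.B"
    using Fc ring_hom_closed[of \<phi> R R] \<phi> by (auto simp: frobenius_lift_ring_def)
  have Fp: "\<forall>x\<in>carrier P.B. \<exists>z\<in>carrier P.B. \<Phi> f 2 x = x [^]\<^bsub>P.B\<^esub> p \<oplus>\<^bsub>P.B\<^esub> [p] \<cdot>\<^bsub>P.B\<^esub> z"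
    by (intro ballI P.frobenius_lift_mod_p[OF \<Phi> fU])
  have \<eta>2: "[p] \<cdot>\<^bsub>differentials R P.B\<^esub> \<eta> f 2 = pullback P.B (constants R P.B) (\<Phi> f 2) (restrict_form R p G (\<omega> i) f 2)"
    by (rule \<eta>[unfolded frobenius_pullback_over_p_def, THEN conjunct2, THEN bspec, OF fU, THEN spec, of 2])
  have \<theta>2: "\<theta> f 2 \<in> carrier (differentials R P.B)"
    by (rule \<theta>[unfolded formal_forms_def mem_Collect_eq, THEN conjunct1, THEN bspec, OF fU, THEN spec, of 2])
  have inv: "\<omega> j \<in> left_invariant_forms R G" if "j < m" for j
    using gen that by (simp add: generates_invariant_forms_def)
  have \<Lambda>i: "\<Lambda> i j \<in> carrier R" if "j < m" for j using \<Lambda> i that by simp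
  have "[p] \<cdot>\<^bsub>P.B\<^esub> \<one>\<^bsub>P.B\<^esub> = \<zero>\<^bsub>P.B\<^esub>"
    by (rule ld.lie_invariant_p_zero[OF F Fc' Fp inv \<Lambda>i i \<theta>2 \<eta>2 \<eta>\<theta> unitI[OF c] pc])
  then have "P.\<iota> ([p] \<cdot>\<^bsub>G\<^esub> \<one>\<^bsub>G\<^esub>) = \<zero>\<^bsub>P.B\<^esub>"
    using ring_hom_nat_mult[OF P.\<iota>_hom G2.A.ring_axioms P.B.ring_axioms G2.A.one_closed] ring_hom_one[OF P.\<iota>_hom] by simp
  from P.\<iota>_zeroD[OF G2.A.nat_mult_closed[OF G2.A.one_closed] this] obtain k :: nat and a where a: "a \<in> carrier G"
    and fk: "f [^]\<^bsub>G\<^esub> k \<otimes>\<^bsub>G\<^esub> [p] \<cdot>\<^bsub>G\<^esub> \<one>\<^bsub>G\<^esub> = [(p ^ 2)] \<cdot>\<^bsub>G\<^esub> a"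
    by (elim exE conjE)
  \<comment> \<open>From f^k p = p^2 a the element e = f^k - p a is killed by p, so e^p is a
    multiple of p and e lies in q. Then f^k = e + p a lies in q as well, against the choice of
    f.\<close>
  define e where "e = f [^]\<^bsub>G\<^esub> k \<ominus>\<^bsub>G\<^esub> [p] \<cdot>\<^bsub>G\<^esub> a"
  have fkc: "f [^]\<^bsub>G\<^esub> k \<in> carrier G" and pa: "[p] \<cdot>\<^bsub>G\<^esub> a \<in> carrier G" using f(2) a by simp_all
  have e: "e \<in> carrier G" using fkc pa by (simp add: e_def)
  have "[p] \<cdot>\<^bsub>G\<^esub> (f [^]\<^bsub>G\<^esub> k) = [p] \<cdot>\<^bsub>G\<^esub> ([p] \<cdot>\<^bsub>G\<^esub> a)"
    using fk fkc a by (simp add: G2.A.add_pow_rdistr power2_eq_square G2.A.nat_mult_mult)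
  then have pe: "[p] \<cdot>\<^bsub>G\<^esub> e = \<zero>\<^bsub>G\<^esub>"
    unfolding e_def G2.A.nat_mult_minus[OF fkc pa] using pa by (simp add: G2.A.minus_eq G2.A.r_neg)
  have pq: "[p] \<cdot>\<^bsub>G\<^esub> x \<in> q" if "x \<in> carrier G" for x
  proof -
    have "[p] \<cdot>\<^bsub>G\<^esub> x = x \<otimes>\<^bsub>G\<^esub> [p] \<cdot>\<^bsub>G\<^esub> \<one>\<^bsub>G\<^esub>" using that by (simp add: G2.A.add_pow_rdistr)
    then show ?thesis using q.I_l_closed[OF q(2) that] by simp
  qed
  have "\<exists>b\<in>carrier G. e [^]\<^bsub>G\<^esub> p = [p] \<cdot>\<^bsub>G\<^esub> b"
    by (rule smooth_p_torsion[OF \<phi> assms(7) e pe])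
  then obtain b' where b': "b' \<in> carrier G" "e [^]\<^bsub>G\<^esub> p = [p] \<cdot>\<^bsub>G\<^esub> b'" ..
  have "e \<in> q" by (rule q.pow_mem[OF e, of p]) (simp add: b' pq)
  moreover have "f [^]\<^bsub>G\<^esub> k = e \<oplus>\<^bsub>G\<^esub> [p] \<cdot>\<^bsub>G\<^esub> a"
    using fkc pa by (simp add: e_def G2.A.minus_eq G2.A.a_assoc G2.A.l_neg)
  ultimately have "f [^]\<^bsub>G\<^esub> k \<in> q" using q.a_closed pq[OF a] by simp
  then show False using q.pow_mem[OF f(2)] f(3) by blast
qed

end
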